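(* Let $k$ be a field, $n\ge1$, $Q=(q_1,\dots,q_n)\in(k^\times)^n$ with $q_i\ne1$ for all $i$, and $\Gamma=(\gamma_{ij})\in M_n(k^\times)$ multiplicatively antisymmetric. Let $\Lambda$ be the multiplicatively antisymmetric $2n\times2n$ matrix over $k$ made of $2\times2$ blocks $B_{ij}$ ($1\le i,j\le n$) with $$B_{ii}=\begin{pmatrix} 1 & q_i^{-1} \\ {} q_i & 1 \end{pmatrix},\qquad B_{ij}=\begin{pmatrix} \gamma_{ij} & q_i^{-1}\gamma_{ji} \\ {} \gamma_{ji} & q_i\gamma_{ij} \end{pmatrix}\quad(i<j),$$ the blocks with $i>j$ being determined by multiplicative antisymmetry. Then $$\operatorname{Fract}A_n^{Q,\Gamma}(k)\cong\operatorname{Fract}\mathcal O_\Lambda(k^{2n}).$$ In the single parameter case $A_n^q(k)$, where $q_i=q$ for all $i$ and $\gamma_{ij}=1$ for all $i,j$, if $q\neq 1$ is a primitive $r$-th root of unity, then $\operatorname{PIdeg}A_n^q(k)=r^n$.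
   Context: $k$ has arbitrary characteristic. In $R[x;\tau,\delta]$ one has $xr=\tau(r)x+\delta(r)$, with $\tau$ a $k$-algebra automorphism and $\delta$ a $k$-linear $\tau$-derivation ($\delta(rs)=\tau(r)\delta(s)+\delta(r)s$). A matrix $(\lambda_{ij})$ over $k^\times$ is multiplicatively antisymmetric if $\lambda_{ii}=1$ and $\lambda_{ji}=\lambda_{ij}^{-1}$. The multiparameter quantized Weyl algebra $A_n^{Q,\Gamma}(k)$ is the iterated skew polynomial ring $k[y_1][x_1;\tau_1,\delta_1][y_2;\sigma_2][x_2;\tau_2,\delta_2]\cdots[y_n;\sigma_n][x_n;\tau_n,\delta_n]$ with, for $j<i$, $\sigma_i(y_j)=\gamma_{ij}y_j$, $\sigma_i(x_j)=\gamma_{ji}x_j$, $\tau_i(y_j)=q_j\gamma_{ji}y_j$, $\tau_i(x_j)=q_j^{-1}\gamma_{ij}x_j$, $\delta_i(x_j)=\delta_i(y_j)=0$, and, for all $i$, $\tau_i(y_i)=q_iy_i$, $\delta_i(y_i)=1+\sum_{\ell<i}(q_\ell-1)y_\ell x_\ell$. For multiplicatively antisymmetric $\boldsymbol\lambda\in M_N(k^\times)$, $\mathcal O_{\boldsymbol\lambda}(k^N)$ is the $k$-algebra with generators $z_1,\dots,z_N$ and relations $z_iz_j=\lambda_{ij}z_jz_i$. $\operatorname{Fract}$ is the division ring of fractions and $\operatorname{PIdeg}$ the PI degree of a prime PI ring. *)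

theory Defs
  imports "HOL-Algebra.Algebra"
begin

section \<open>Algebras over a field\<close>

text \<open>
  A (noncommutative) \<open>k\<close>-algebra is a record of type \<^typ>\<open>('k, 'a) module\<close>: its ring operations
  together with a scalar multiplication. Elements outside the carrier are irrelevant, so maps are
  constrained on carriers only.
\<close>

definition alg_hom_linear ::
    "('k, 'm) ring_scheme \<Rightarrow> ('k, 'a) module \<Rightarrow> ('k, 'b) module \<Rightarrow> ('a \<Rightarrow> 'b) \<Rightarrow> bool"
  where "alg_hom_linear K A B f \<longleftrightarrow>
    (\<forall>c\<in>carrier K. \<forall>a\<in>carrier A. f (c \<odot>\<^bsub>A\<^esub> a) = c \<odot>\<^bsub>B\<^esub> f a)"

definition alg_iso :: "('k, 'm) ring_scheme \<Rightarrow> ('k, 'a) module \<Rightarrow> ('k, 'b) module \<Rightarrow> ('a \<Rightarrow> 'b) set"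
  where "alg_iso K A B = {f \<in> ring_iso A B. alg_hom_linear K A B f}"

definition alg_isomorphic :: "('k, 'm) ring_scheme \<Rightarrow> ('k, 'a) module \<Rightarrow> ('k, 'b) module \<Rightarrow> bool"
  where "alg_isomorphic K A B \<longleftrightarrow> alg_iso K A B \<noteq> {}"

definition ground_algebra :: "('k, 'm) ring_scheme \<Rightarrow> ('k, 'k) module"
  where "ground_algebra K =
    \<lparr> carrier = carrier K, monoid.mult = monoid.mult K, one = \<one>\<^bsub>K\<^esub>, ring.zero = \<zero>\<^bsub>K\<^esub>,
      add = add K, smult = monoid.mult K \<rparr>"

definition image_algebra :: "('a \<Rightarrow> 'b) \<Rightarrow> ('k, 'a) module \<Rightarrow> ('k, 'b) module"
  where "image_algebra f A = ring.extend (image_ring f A)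
    (module.fields (\<lambda>c b. f (c \<odot>\<^bsub>A\<^esub> inv_into (carrier A) f b)))"

definition quotient_algebra :: "('k, 'a) module \<Rightarrow> 'a set \<Rightarrow> ('k, 'a set) module"
  where "quotient_algebra A I = ring.extend (A Quot I)
    (module.fields (\<lambda>c C. (\<Union>a\<in>C. I +>\<^bsub>A\<^esub> (c \<odot>\<^bsub>A\<^esub> a))))"


section \<open>Skew polynomial rings\<close>

definition skew_derivation ::
    "('k, 'm) ring_scheme \<Rightarrow> ('k, 'a) module \<Rightarrow> ('a \<Rightarrow> 'a) \<Rightarrow> ('a \<Rightarrow> 'a) \<Rightarrow> bool"
  where "skew_derivation K R \<tau> \<delta> \<longleftrightarrow>
    \<delta> \<in> carrier R \<rightarrow> carrier R \<and>
    (\<forall>r\<in>carrier R. \<forall>s\<in>carrier R. \<delta> (r \<oplus>\<^bsub>R\<^esub> s) = \<delta> r \<oplus>\<^bsub>R\<^esub> \<delta> s) \<and>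
    alg_hom_linear K R R \<delta> \<and>
    (\<forall>r\<in>carrier R. \<forall>s\<in>carrier R. \<delta> (r \<otimes>\<^bsub>R\<^esub> s) = (\<tau> r \<otimes>\<^bsub>R\<^esub> \<delta> s) \<oplus>\<^bsub>R\<^esub> (\<delta> r \<otimes>\<^bsub>R\<^esub> s))"

text \<open>
  A function \<open>f\<close> in \<^term>\<open>up R\<close> stands for the left polynomial \<open>f 0 + f 1 x + f 2 x\<^sup>2 + \<dots>\<close>.
  The following is left multiplication by \<open>x\<close>, forced by \<open>x r = \<tau>(r) x + \<delta>(r)\<close>.
\<close>

definition skew_shift ::
    "('k, 'a) module \<Rightarrow> ('a \<Rightarrow> 'a) \<Rightarrow> ('a \<Rightarrow> 'a) \<Rightarrow> (nat \<Rightarrow> 'a) \<Rightarrow> (nat \<Rightarrow> 'a)"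
  where "skew_shift R \<tau> \<delta> f =
    (\<lambda>n. (case n of 0 \<Rightarrow> \<zero>\<^bsub>R\<^esub> | Suc m \<Rightarrow> \<tau> (f m)) \<oplus>\<^bsub>R\<^esub> \<delta> (f n))"

definition skew_poly :: "('k, 'a) module \<Rightarrow> ('a \<Rightarrow> 'a) \<Rightarrow> ('a \<Rightarrow> 'a) \<Rightarrow> ('k, nat \<Rightarrow> 'a) module"
  where "skew_poly R \<tau> \<delta> =
    \<lparr> carrier = up R,
      monoid.mult = (\<lambda>f g n. \<Oplus>\<^bsub>R\<^esub>i\<in>{i. f i \<noteq> \<zero>\<^bsub>R\<^esub>}. f i \<otimes>\<^bsub>R\<^esub> ((skew_shift R \<tau> \<delta> ^^ i) g) n),
      one = (\<lambda>n. if n = 0 then \<one>\<^bsub>R\<^esub> else \<zero>\<^bsub>R\<^esub>),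
      ring.zero = (\<lambda>n. \<zero>\<^bsub>R\<^esub>),
      add = (\<lambda>f g n. f n \<oplus>\<^bsub>R\<^esub> g n),
      smult = (\<lambda>c f n. c \<odot>\<^bsub>R\<^esub> f n) \<rparr>"

text \<open>
  Each extension step turns elements of type \<open>'a\<close> into elements of type \<^typ>\<open>nat \<Rightarrow> 'a\<close>. To iterate
  the construction a variable number of times, all stages are transported along the constructors
  of one recursive datatype.
\<close>

datatype 'k tower = TScalar 'k | TPoly "nat \<Rightarrow> 'k tower"

definition tower_base :: "('k, 'm) ring_scheme \<Rightarrow> ('k, 'k tower) module"
  where "tower_base K = image_algebra TScalar (ground_algebra K)"

definition tower_step :: "('k, 'k tower) module \<Rightarrow> ('k tower \<Rightarrow> 'k tower) \<Rightarrow>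
    ('k tower \<Rightarrow> 'k tower) \<Rightarrow> ('k, 'k tower) module"
  where "tower_step R \<tau> \<delta> = image_algebra TPoly (skew_poly R \<tau> \<delta>)"

definition tower_const :: "('k, 'k tower) module \<Rightarrow> 'k tower \<Rightarrow> 'k tower"
  where "tower_const R r = TPoly (\<lambda>n. if n = 0 then r else \<zero>\<^bsub>R\<^esub>)"

definition tower_var :: "('k, 'k tower) module \<Rightarrow> 'k tower"
  where "tower_var R = TPoly (\<lambda>n. if n = 1 then \<one>\<^bsub>R\<^esub> else \<zero>\<^bsub>R\<^esub>)"


section \<open>Multiparameter quantized Weyl algebras\<close>

definition mult_antisymmetric :: "('k, 'm) ring_scheme \<Rightarrow> nat \<Rightarrow> (nat \<Rightarrow> nat \<Rightarrow> 'k) \<Rightarrow> bool"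
  where "mult_antisymmetric K N \<Lambda> \<longleftrightarrow>
    (\<forall>i\<in>{1..N}. \<forall>j\<in>{1..N}. \<Lambda> i j \<in> carrier K - {\<zero>\<^bsub>K\<^esub>} \<and> \<Lambda> j i = inv\<^bsub>K\<^esub> (\<Lambda> i j)) \<and>
    (\<forall>i\<in>{1..N}. \<Lambda> i i = \<one>\<^bsub>K\<^esub>)"

text \<open>
  The maps \<open>\<sigma>\<^sub>i\<close>, \<open>\<tau>\<^sub>i\<close>, \<open>\<delta>\<^sub>i\<close> are given by their values on generators, which determine them on the
  carrier.
\<close>

definition weyl_sigma :: "('k, 'm) ring_scheme \<Rightarrow> (nat \<Rightarrow> nat \<Rightarrow> 'k) \<Rightarrow> ('k, 'a) module \<Rightarrow>
    (nat \<Rightarrow> 'a) \<Rightarrow> (nat \<Rightarrow> 'a) \<Rightarrow> nat \<Rightarrow> ('a \<Rightarrow> 'a)"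
  where "weyl_sigma K \<gamma> R y x i = (SOME \<sigma>. \<sigma> \<in> alg_iso K R R \<and>
    (\<forall>j\<in>{1..<i}. \<sigma> (y j) = \<gamma> i j \<odot>\<^bsub>R\<^esub> y j \<and> \<sigma> (x j) = \<gamma> j i \<odot>\<^bsub>R\<^esub> x j))"

definition weyl_tau :: "('k, 'm) ring_scheme \<Rightarrow> (nat \<Rightarrow> 'k) \<Rightarrow> (nat \<Rightarrow> nat \<Rightarrow> 'k) \<Rightarrow>
    ('k, 'a) module \<Rightarrow> (nat \<Rightarrow> 'a) \<Rightarrow> (nat \<Rightarrow> 'a) \<Rightarrow> nat \<Rightarrow> ('a \<Rightarrow> 'a)"
  where "weyl_tau K q \<gamma> R y x i = (SOME \<tau>. \<tau> \<in> alg_iso K R R \<and>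
    (\<forall>j\<in>{1..<i}. \<tau> (y j) = (q j \<otimes>\<^bsub>K\<^esub> \<gamma> j i) \<odot>\<^bsub>R\<^esub> y j \<and>
                 \<tau> (x j) = (inv\<^bsub>K\<^esub> (q j) \<otimes>\<^bsub>K\<^esub> \<gamma> i j) \<odot>\<^bsub>R\<^esub> x j) \<and>
    \<tau> (y i) = q i \<odot>\<^bsub>R\<^esub> y i)"

definition weyl_delta :: "('k, 'm) ring_scheme \<Rightarrow> (nat \<Rightarrow> 'k) \<Rightarrow> ('a \<Rightarrow> 'a) \<Rightarrow>
    ('k, 'a) module \<Rightarrow> (nat \<Rightarrow> 'a) \<Rightarrow> (nat \<Rightarrow> 'a) \<Rightarrow> nat \<Rightarrow> ('a \<Rightarrow> 'a)"
  where "weyl_delta K q \<tau> R y x i = (SOME \<delta>. skew_derivation K R \<tau> \<delta> \<and>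
    (\<forall>j\<in>{1..<i}. \<delta> (x j) = \<zero>\<^bsub>R\<^esub> \<and> \<delta> (y j) = \<zero>\<^bsub>R\<^esub>) \<and>
    \<delta> (y i) = \<one>\<^bsub>R\<^esub> \<oplus>\<^bsub>R\<^esub> (\<Oplus>\<^bsub>R\<^esub>l\<in>{1..<i}. (q l \<ominus>\<^bsub>K\<^esub> \<one>\<^bsub>K\<^esub>) \<odot>\<^bsub>R\<^esub> (y l \<otimes>\<^bsub>R\<^esub> x l)))"

text \<open>
  Stage \<open>n\<close> consists of the algebra \<open>k[y\<^sub>1][x\<^sub>1;\<tau>\<^sub>1,\<delta>\<^sub>1]\<dots>[y\<^sub>n;\<sigma>\<^sub>n][x\<^sub>n;\<tau>\<^sub>n,\<delta>\<^sub>n]\<close> and of the families of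
  its generators \<open>y\<^sub>1,\<dots>,y\<^sub>n\<close> and \<open>x\<^sub>1,\<dots>,x\<^sub>n\<close>; only the indices \<open>1,\<dots>,n\<close> are meaningful.
\<close>

primrec qweyl_tower :: "('k, 'm) ring_scheme \<Rightarrow> (nat \<Rightarrow> 'k) \<Rightarrow> (nat \<Rightarrow> nat \<Rightarrow> 'k) \<Rightarrow> nat \<Rightarrow>
    ('k, 'k tower) module \<times> (nat \<Rightarrow> 'k tower) \<times> (nat \<Rightarrow> 'k tower)"
  where
    "qweyl_tower K q \<gamma> 0 = (tower_base K, \<lambda>_. undefined, \<lambda>_. undefined)"
  | "qweyl_tower K q \<gamma> (Suc m) =
      (let i = Suc m;
           (R, y, x) = qweyl_tower K q \<gamma> m;
           \<sigma> = weyl_sigma K \<gamma> R y x i;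
           R' = tower_step R \<sigma> (\<lambda>_. \<zero>\<^bsub>R\<^esub>);
           y' = (\<lambda>j. if j = i then tower_var R else tower_const R (y j));
           x' = (\<lambda>j. tower_const R (x j));
           \<tau> = weyl_tau K q \<gamma> R' y' x' i;
           \<delta> = weyl_delta K q \<tau> R' y' x' i;
           R'' = tower_step R' \<tau> \<delta>;
           y'' = (\<lambda>j. tower_const R' (y' j));
           x'' = (\<lambda>j. if j = i then tower_var R' else tower_const R' (x' j))
       in (R'', y'', x''))"

definition qweyl :: "('k, 'm) ring_scheme \<Rightarrow> nat \<Rightarrow> (nat \<Rightarrow> 'k) \<Rightarrow> (nat \<Rightarrow> nat \<Rightarrow> 'k) \<Rightarrow>
    ('k, 'k tower) module"
  where "qweyl K n q \<gamma> = fst (qweyl_tower K q \<gamma> n)"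

definition qweyl_single :: "('k, 'm) ring_scheme \<Rightarrow> nat \<Rightarrow> 'k \<Rightarrow> ('k, 'k tower) module"
  where "qweyl_single K n q = qweyl K n (\<lambda>_. q) (\<lambda>_ _. \<one>\<^bsub>K\<^esub>)"


section \<open>Quantum affine spaces\<close>

text \<open>The free algebra on \<open>z\<^sub>1,\<dots>,z\<^sub>N\<close>: finitely supported functions on words in \<open>1,\<dots>,N\<close>.\<close>

definition free_algebra :: "('k, 'm) ring_scheme \<Rightarrow> nat \<Rightarrow> ('k, nat list \<Rightarrow> 'k) module"
  where "free_algebra K N =
    \<lparr> carrier = {f. f \<in> UNIV \<rightarrow> carrier K \<and> finite {w. f w \<noteq> \<zero>\<^bsub>K\<^esub>} \<and>
                    (\<forall>w. f w \<noteq> \<zero>\<^bsub>K\<^esub> \<longrightarrow> set w \<subseteq> {1..N})},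
      monoid.mult = (\<lambda>f g w. \<Oplus>\<^bsub>K\<^esub>i\<in>{..length w}. f (take i w) \<otimes>\<^bsub>K\<^esub> g (drop i w)),
      one = (\<lambda>w. if w = [] then \<one>\<^bsub>K\<^esub> else \<zero>\<^bsub>K\<^esub>),
      ring.zero = (\<lambda>w. \<zero>\<^bsub>K\<^esub>),
      add = (\<lambda>f g w. f w \<oplus>\<^bsub>K\<^esub> g w),
      smult = (\<lambda>c f w. c \<otimes>\<^bsub>K\<^esub> f w) \<rparr>"

definition free_gen :: "('k, 'm) ring_scheme \<Rightarrow> nat \<Rightarrow> (nat list \<Rightarrow> 'k)"
  where "free_gen K i = (\<lambda>w. if w = [i] then \<one>\<^bsub>K\<^esub> else \<zero>\<^bsub>K\<^esub>)"

definition qaffine_relations ::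
    "('k, 'm) ring_scheme \<Rightarrow> nat \<Rightarrow> (nat \<Rightarrow> nat \<Rightarrow> 'k) \<Rightarrow> (nat list \<Rightarrow> 'k) set"
  where "qaffine_relations K N \<Lambda> =
    (let F = free_algebra K N; z = free_gen K in
      {(z i \<otimes>\<^bsub>F\<^esub> z j) \<ominus>\<^bsub>F\<^esub> (\<Lambda> i j \<odot>\<^bsub>F\<^esub> (z j \<otimes>\<^bsub>F\<^esub> z i)) | i j. i \<in> {1..N} \<and> j \<in> {1..N}})"

definition qaffine :: "('k, 'm) ring_scheme \<Rightarrow> nat \<Rightarrow> (nat \<Rightarrow> nat \<Rightarrow> 'k) \<Rightarrow>
    ('k, (nat list \<Rightarrow> 'k) set) module"
  where "qaffine K N \<Lambda> = quotient_algebra (free_algebra K N)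
    (Idl\<^bsub>free_algebra K N\<^esub> (qaffine_relations K N \<Lambda>))"


section \<open>The commutation matrix\<close>

text \<open>
  \<open>weyl_block K q \<gamma> i j a b\<close> is the entry of \<open>B\<^sub>i\<^sub>j\<close> (for \<open>i \<le> j\<close>) in row \<open>a\<close> and column \<open>b\<close>, with
  \<open>a, b \<in> {1, 2}\<close>. Index \<open>s\<close> of the big matrix lies in block \<open>(s + 1) div 2\<close>, at position \<open>1\<close> if
  \<open>s\<close> is odd and \<open>2\<close> if \<open>s\<close> is even.
\<close>

definition weyl_block :: "('k, 'm) ring_scheme \<Rightarrow> (nat \<Rightarrow> 'k) \<Rightarrow> (nat \<Rightarrow> nat \<Rightarrow> 'k) \<Rightarrow>
    nat \<Rightarrow> nat \<Rightarrow> nat \<Rightarrow> nat \<Rightarrow> 'k"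
  where "weyl_block K q \<gamma> i j a b =
    (if i = j then
       (if a = b then \<one>\<^bsub>K\<^esub> else if a = 1 then inv\<^bsub>K\<^esub> (q i) else q i)
     else
       (if a = 1 then (if b = 1 then \<gamma> i j else inv\<^bsub>K\<^esub> (q i) \<otimes>\<^bsub>K\<^esub> \<gamma> j i)
        else (if b = 1 then \<gamma> j i else q i \<otimes>\<^bsub>K\<^esub> \<gamma> i j)))"

definition weyl_matrix ::
    "('k, 'm) ring_scheme \<Rightarrow> (nat \<Rightarrow> 'k) \<Rightarrow> (nat \<Rightarrow> nat \<Rightarrow> 'k) \<Rightarrow> nat \<Rightarrow> nat \<Rightarrow> 'k"
  where "weyl_matrix K q \<gamma> s t =
    (let i = (s + 1) div 2; j = (t + 1) div 2;
         a = (if odd s then 1 else 2); b = (if odd t then 1 else 2)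
     in if i \<le> j then weyl_block K q \<gamma> i j a b else inv\<^bsub>K\<^esub> (weyl_block K q \<gamma> j i b a))"


section \<open>Rings of fractions and PI degree\<close>

definition regular_elements :: "('a, 'm) ring_scheme \<Rightarrow> 'a set"
  where "regular_elements R = {s \<in> carrier R. \<forall>a\<in>carrier R.
    (s \<otimes>\<^bsub>R\<^esub> a = \<zero>\<^bsub>R\<^esub> \<longrightarrow> a = \<zero>\<^bsub>R\<^esub>) \<and> (a \<otimes>\<^bsub>R\<^esub> s = \<zero>\<^bsub>R\<^esub> \<longrightarrow> a = \<zero>\<^bsub>R\<^esub>)}"

text \<open>
  Ore localization at the set \<open>S\<close> of regular elements: the pair \<open>(a, s)\<close> stands for the right
  fraction \<open>a s\<^sup>-\<^sup>1\<close>, and \<open>(a, s)\<close>, \<open>(b, t)\<close> are equivalent iff \<open>a u = b v\<close> and \<open>s u = t v \<in> S\<close> for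
  some \<open>u, v\<close>. For a right Ore domain this is the division ring of fractions; for a prime PI ring
  it is the simple Artinian quotient ring of Posner's theorem.
\<close>

definition frac_pairs :: "('a, 'm) ring_scheme \<Rightarrow> ('a \<times> 'a) set"
  where "frac_pairs R = carrier R \<times> regular_elements R"

definition frac_rel :: "('a, 'm) ring_scheme \<Rightarrow> (('a \<times> 'a) \<times> ('a \<times> 'a)) set"
  where "frac_rel R = {((a, s), (b, t)). (a, s) \<in> frac_pairs R \<and> (b, t) \<in> frac_pairs R \<and>
    (\<exists>u\<in>carrier R. \<exists>v\<in>carrier R. a \<otimes>\<^bsub>R\<^esub> u = b \<otimes>\<^bsub>R\<^esub> v \<and> s \<otimes>\<^bsub>R\<^esub> u = t \<otimes>\<^bsub>R\<^esub> v \<and>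
      s \<otimes>\<^bsub>R\<^esub> u \<in> regular_elements R)}"

definition fraction :: "('a, 'm) ring_scheme \<Rightarrow> 'a \<Rightarrow> 'a \<Rightarrow> ('a \<times> 'a) set"
  where "fraction R a s = frac_rel R `` {(a, s)}"

text \<open>
  The operations below are
  \<open>a s\<^sup>-\<^sup>1 + b t\<^sup>-\<^sup>1 = (a u + b v) (s u)\<^sup>-\<^sup>1\<close> whenever \<open>s u = t v \<in> S\<close>, and
  \<open>(a s\<^sup>-\<^sup>1) (b t\<^sup>-\<^sup>1) = (a u) (t v)\<^sup>-\<^sup>1\<close> whenever \<open>s u = b v\<close> with \<open>v \<in> S\<close>;
  the union over all choices is that of copies of a single class.
\<close>

definition ring_of_fractions :: "('k, 'a) module \<Rightarrow> ('k, ('a \<times> 'a) set) module"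
  where "ring_of_fractions R =
    \<lparr> carrier = frac_pairs R // frac_rel R,
      monoid.mult = (\<lambda>P Q. \<Union>{fraction R (a \<otimes>\<^bsub>R\<^esub> u) (t \<otimes>\<^bsub>R\<^esub> v) | a s b t u v.
        (a, s) \<in> P \<and> (b, t) \<in> Q \<and> u \<in> carrier R \<and> v \<in> regular_elements R \<and>
        s \<otimes>\<^bsub>R\<^esub> u = b \<otimes>\<^bsub>R\<^esub> v}),
      one = fraction R \<one>\<^bsub>R\<^esub> \<one>\<^bsub>R\<^esub>,
      ring.zero = fraction R \<zero>\<^bsub>R\<^esub> \<one>\<^bsub>R\<^esub>,
      add = (\<lambda>P Q. \<Union>{fraction R ((a \<otimes>\<^bsub>R\<^esub> u) \<oplus>\<^bsub>R\<^esub> (b \<otimes>\<^bsub>R\<^esub> v)) (s \<otimes>\<^bsub>R\<^esub> u) | a s b t u v.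
        (a, s) \<in> P \<and> (b, t) \<in> Q \<and> u \<in> carrier R \<and> v \<in> carrier R \<and>
        s \<otimes>\<^bsub>R\<^esub> u = t \<otimes>\<^bsub>R\<^esub> v \<and> s \<otimes>\<^bsub>R\<^esub> u \<in> regular_elements R}),
      smult = (\<lambda>c P. \<Union>{fraction R (c \<odot>\<^bsub>R\<^esub> a) s | a s. (a, s) \<in> P}) \<rparr>"

definition ring_center :: "('a, 'm) ring_scheme \<Rightarrow> 'a set"
  where "ring_center R = {z \<in> carrier R. \<forall>a\<in>carrier R. z \<otimes>\<^bsub>R\<^esub> a = a \<otimes>\<^bsub>R\<^esub> z}"

definition prime_ring :: "('a, 'm) ring_scheme \<Rightarrow> bool"
  where "prime_ring R \<longleftrightarrow> ring R \<and> \<one>\<^bsub>R\<^esub> \<noteq> \<zero>\<^bsub>R\<^esub> \<and>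
    (\<forall>a\<in>carrier R. \<forall>b\<in>carrier R. (\<forall>r\<in>carrier R. a \<otimes>\<^bsub>R\<^esub> r \<otimes>\<^bsub>R\<^esub> b = \<zero>\<^bsub>R\<^esub>) \<longrightarrow>
      a = \<zero>\<^bsub>R\<^esub> \<or> b = \<zero>\<^bsub>R\<^esub>)"

text \<open>
  A polynomial identity is a noncommutative polynomial over the integers (a finitely supported
  coefficient function on words) that vanishes under all substitutions; it is monic if some word of
  maximal length in its support has coefficient \<open>1\<close>.
\<close>

definition eval_word :: "('a, 'm) ring_scheme \<Rightarrow> (nat \<Rightarrow> 'a) \<Rightarrow> nat list \<Rightarrow> 'a"
  where "eval_word R \<rho> w = foldr (\<lambda>i a. \<rho> i \<otimes>\<^bsub>R\<^esub> a) w \<one>\<^bsub>R\<^esub>"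

definition PI_ring :: "('a, 'm) ring_scheme \<Rightarrow> bool"
  where "PI_ring R \<longleftrightarrow> ring R \<and>
    (\<exists>f :: nat list \<Rightarrow> int. finite {w. f w \<noteq> 0} \<and>
      (\<exists>w. f w = 1 \<and> (\<forall>v. f v \<noteq> 0 \<longrightarrow> length v \<le> length w)) \<and>
      (\<forall>\<rho> \<in> UNIV \<rightarrow> carrier R.
        (\<Oplus>\<^bsub>R\<^esub>w\<in>{w. f w \<noteq> 0}. [f w] \<cdot>\<^bsub>R\<^esub> eval_word R \<rho> w) = \<zero>\<^bsub>R\<^esub>))"

text \<open>
  By Posner's theorem, the quotient ring \<open>Q\<close> of a prime PI ring is a central simple algebra of
  dimension \<open>d\<^sup>2\<close> over its centre; the PI degree is \<open>d\<close>.
\<close>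

definition PIdeg :: "('k, 'a) module \<Rightarrow> nat"
  where "PIdeg R =
    (let Q = ring_of_fractions R in
      THE d. ring.dimension Q (d ^ 2) (ring_center Q) (carrier Q))"

definition primitive_root_of_unity :: "('k, 'm) ring_scheme \<Rightarrow> nat \<Rightarrow> 'k \<Rightarrow> bool"
  where "primitive_root_of_unity K r q \<longleftrightarrow> q \<in> carrier K \<and> r > 0 \<and>
    q [^]\<^bsub>K\<^esub> r = \<one>\<^bsub>K\<^esub> \<and> (\<forall>j. 0 < j \<and> j < r \<longrightarrow> q [^]\<^bsub>K\<^esub> j \<noteq> \<one>\<^bsub>K\<^esub>)"

end

theory Submission
  imports Defs "HOL-Library.Poly_Mapping" "HOL-Combinatorics.Permutations"
begin

text \<open>
  Let \<open>T\<close> be the quantum torus with commutation matrix \<open>\<Lambda>\<close> and generators \<open>y\<^sub>1, w\<^sub>1, \<dots>, y\<^sub>n, w\<^sub>n\<close>. Putting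
  \<open>u\<^sub>i = y\<^sub>i w\<^sub>i\<close>, \<open>u\<^sub>0 = 1\<close> and \<open>x\<^sub>i = (q\<^sub>i - 1)\<^sup>-\<^sup>1 (w\<^sub>i - y\<^sub>i\<^sup>-\<^sup>1 u\<^sub>i\<^sub>-\<^sub>1)\<close> embeds the quantized Weyl algebra in \<open>T\<close>:
  each \<open>\<sigma>\<^sub>i\<close>, \<open>\<tau>\<^sub>i\<close> becomes conjugation by \<open>y\<^sub>i\<close>, \<open>w\<^sub>i\<close>, each \<open>\<delta>\<^sub>i\<close> becomes inner, and the new variable is free over
  the previous stage because its leading term involves a new generator of \<open>T\<close>. The image contains the
  \<open>y\<^sub>i\<close> and \<open>u\<^sub>i\<close>, hence monomial denominators for all elements of \<open>T\<close>; so does the quantum affine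
  space. Thus both algebras have the same fractions as \<open>T\<close>, which is right Ore by a Folner-type
  dimension count.

  If all \<open>q\<^sub>i\<close> are the primitive \<open>r\<close>-th root of unity \<open>q\<close> and \<open>\<Gamma> = 1\<close>, the monomials with exponents divisible
  by \<open>r\<close> are central, and the monomials with exponents in \<open>{0, \<dots>, r - 1}\<close> are eigenvectors for
  conjugation by the generators with pairwise distinct systems of eigenvalues. Hence these \<open>r\<^sup>2\<^sup>n\<close>
  monomials form a basis of the division ring of fractions over its centre, and the standard polynomial
  of degree \<open>r\<^sup>2\<^sup>n + 1\<close> is an identity.
\<close>

section \<open>Noncommutative algebras\<close>

text \<open>In the quantized Weyl algebra the commutator
  \<open>x\<^sub>i y\<^sub>i - y\<^sub>i x\<^sub>i\<close> equals \<open>u\<^sub>i =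
  u\<^sub>i\<^sub>-\<^sub>1 + (q\<^sub>i - 1) y\<^sub>i x\<^sub>i\<close>, which commutes with all
  generators up to scalars. Once \<open>y\<^sub>i\<close> is inverted, this equation can be solved
  for \<open>x\<^sub>i\<close>, and \<open>w\<^sub>i = y\<^sub>i\<^sup>-\<^sup>1 u\<^sub>i\<close>
  commutes with the other variables up to scalars; this is the origin of the formula for
  \<open>x\<^sub>i\<close>. The obstacle is that the tower fixes its automorphisms and derivations
  only by their values on generators, through \<open>SOME\<close>, over rings whose axioms still
  have to be established. In the torus both problems have one answer: ring axioms are inherited
  along an injective map, conjugations and inner derivations give existence, and agreement on
  generators shows that any admissible choice is the expected one. The embedding is therefore
  carried along the induction over the stages. For the PI degree the centre is never determined:
  independence uses only that the eigenvalues are central, and spanning only that the monomials with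
  exponents divisible by \<open>r\<close> are.\<close>

locale nc_algebra = K: field K + ring A
  for K :: "('k, 'm) ring_scheme" and A :: "('k, 'a) module" (structure) +
  assumes smult_closed [simp, intro]:
      "\<lbrakk>c \<in> carrier K; x \<in> carrier A\<rbrakk> \<Longrightarrow> c \<odot> x \<in> carrier A"
    and smult_l_distr: "\<lbrakk>c \<in> carrier K; d \<in> carrier K; x \<in> carrier A\<rbrakk> \<Longrightarrow>
      (c \<oplus>\<^bsub>K\<^esub> d) \<odot> x = c \<odot> x \<oplus> d \<odot> x"
    and smult_r_distr: "\<lbrakk>c \<in> carrier K; x \<in> carrier A; y \<in> carrier A\<rbrakk> \<Longrightarrow>
      c \<odot> (x \<oplus> y) = c \<odot> x \<oplus> c \<odot> y"
    and smult_assoc: "\<lbrakk>c \<in> carrier K; d \<in> carrier K; x \<in> carrier A\<rbrakk> \<Longrightarrow>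
      (c \<otimes>\<^bsub>K\<^esub> d) \<odot> x = c \<odot> (d \<odot> x)"
    and smult_one [simp]: "x \<in> carrier A \<Longrightarrow> \<one>\<^bsub>K\<^esub> \<odot> x = x"
    and smult_mult_left: "\<lbrakk>c \<in> carrier K; x \<in> carrier A; y \<in> carrier A\<rbrakk> \<Longrightarrow>
      (c \<odot> x) \<otimes> y = c \<odot> (x \<otimes> y)"
    and smult_mult_right: "\<lbrakk>c \<in> carrier K; x \<in> carrier A; y \<in> carrier A\<rbrakk> \<Longrightarrow>
      x \<otimes> (c \<odot> y) = c \<odot> (x \<otimes> y)"
begin

lemma smult_zero_left [simp]:
  assumes "x \<in> carrier A" shows "\<zero>\<^bsub>K\<^esub> \<odot> x = \<zero>"
proof -
  have "\<zero>\<^bsub>K\<^esub> \<odot> x \<oplus> \<zero>\<^bsub>K\<^esub> \<odot> x = \<zero>\<^bsub>K\<^esub> \<odot> x"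
    using smult_l_distr[of "\<zero>\<^bsub>K\<^esub>" "\<zero>\<^bsub>K\<^esub>" x] assms by simp
  then show ?thesis using assms by (simp add: add.l_cancel_one)
qed

lemma smult_zero_right [simp]:
  assumes "c \<in> carrier K" shows "c \<odot> \<zero> = \<zero>"
proof -
  have "c \<odot> \<zero> \<oplus> c \<odot> \<zero> = c \<odot> \<zero>"
    using smult_r_distr[of c \<zero> \<zero>] assms by simp
  then show ?thesis using assms by (simp add: add.l_cancel_one)
qed

lemma smult_minus_one:
  assumes "x \<in> carrier A" shows "(\<ominus>\<^bsub>K\<^esub> \<one>\<^bsub>K\<^esub>) \<odot> x = \<ominus> x"
proof -
  have "(\<ominus>\<^bsub>K\<^esub> \<one>\<^bsub>K\<^esub>) \<odot> x \<oplus> x = \<zero>"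
    using smult_l_distr[of "\<ominus>\<^bsub>K\<^esub> \<one>\<^bsub>K\<^esub>" "\<one>\<^bsub>K\<^esub>" x] assms by (simp add: K.l_neg)
  then show ?thesis using assms by (intro minus_equality[symmetric]) auto
qed

lemma smult_minus:
  assumes "c \<in> carrier K" "x \<in> carrier A" shows "c \<odot> (\<ominus> x) = \<ominus> (c \<odot> x)"
proof -
  have "c \<odot> (\<ominus> x) \<oplus> c \<odot> x = \<zero>"
    using smult_r_distr[of c "\<ominus> x" x] assms by (simp add: l_neg)
  then show ?thesis using assms by (intro minus_equality[symmetric]) auto
qed

end

definition alg_hom :: "('k, 'm) ring_scheme \<Rightarrow> ('k, 'a) module \<Rightarrow> ('k, 'b) module \<Rightarrow> ('a \<Rightarrow> 'b) set"
  where "alg_hom K A B = {f \<in> ring_hom A B. alg_hom_linear K A B f}"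

lemma alg_homI:
  assumes "\<And>a. a \<in> carrier A \<Longrightarrow> f a \<in> carrier B"
    and "\<And>a b. \<lbrakk>a \<in> carrier A; b \<in> carrier A\<rbrakk> \<Longrightarrow> f (a \<oplus>\<^bsub>A\<^esub> b) = f a \<oplus>\<^bsub>B\<^esub> f b"
    and "\<And>a b. \<lbrakk>a \<in> carrier A; b \<in> carrier A\<rbrakk> \<Longrightarrow> f (a \<otimes>\<^bsub>A\<^esub> b) = f a \<otimes>\<^bsub>B\<^esub> f b"
    and "f \<one>\<^bsub>A\<^esub> = \<one>\<^bsub>B\<^esub>"
    and "\<And>c a. \<lbrakk>c \<in> carrier K; a \<in> carrier A\<rbrakk> \<Longrightarrow> f (c \<odot>\<^bsub>A\<^esub> a) = c \<odot>\<^bsub>B\<^esub> f a"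
  shows "f \<in> alg_hom K A B"
  unfolding alg_hom_def alg_hom_linear_def ring_hom_def using assms by auto

lemma alg_hom_closed: "\<lbrakk>f \<in> alg_hom K A B; a \<in> carrier A\<rbrakk> \<Longrightarrow> f a \<in> carrier B"
  and alg_hom_add: "\<lbrakk>f \<in> alg_hom K A B; a \<in> carrier A; b \<in> carrier A\<rbrakk> \<Longrightarrow> f (a \<oplus>\<^bsub>A\<^esub> b) = f a \<oplus>\<^bsub>B\<^esub> f b"
  and alg_hom_mult: "\<lbrakk>f \<in> alg_hom K A B; a \<in> carrier A; b \<in> carrier A\<rbrakk> \<Longrightarrow> f (a \<otimes>\<^bsub>A\<^esub> b) = f a \<otimes>\<^bsub>B\<^esub> f b"
  and alg_hom_one: "f \<in> alg_hom K A B \<Longrightarrow> f \<one>\<^bsub>A\<^esub> = \<one>\<^bsub>B\<^esub>"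
  and alg_hom_smult: "\<lbrakk>f \<in> alg_hom K A B; c \<in> carrier K; a \<in> carrier A\<rbrakk> \<Longrightarrow> f (c \<odot>\<^bsub>A\<^esub> a) = c \<odot>\<^bsub>B\<^esub> f a"
  unfolding alg_hom_def alg_hom_linear_def ring_hom_def by auto

lemma alg_iso_iff: "f \<in> alg_iso K A B \<longleftrightarrow> f \<in> alg_hom K A B \<and> bij_betw f (carrier A) (carrier B)"
  unfolding alg_iso_def alg_hom_def ring_iso_def by auto

lemma alg_hom_zero:
  assumes "nc_algebra K A" "nc_algebra K B" "f \<in> alg_hom K A B" shows "f \<zero>\<^bsub>A\<^esub> = \<zero>\<^bsub>B\<^esub>"
proof -
  interpret A: nc_algebra K A by fact
  interpret B: nc_algebra K B by fact
  have "f (\<zero>\<^bsub>K\<^esub> \<odot>\<^bsub>A\<^esub> \<one>\<^bsub>A\<^esub>) = \<zero>\<^bsub>K\<^esub> \<odot>\<^bsub>B\<^esub> f \<one>\<^bsub>A\<^esub>" by (rule alg_hom_smult[OF assms(3)]) auto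
  then show ?thesis by (simp add: alg_hom_one[OF assms(3)])
qed

lemma alg_hom_minus:
  assumes "nc_algebra K A" "nc_algebra K B" "f \<in> alg_hom K A B" "a \<in> carrier A" "b \<in> carrier A"
  shows "f (a \<ominus>\<^bsub>A\<^esub> b) = f a \<ominus>\<^bsub>B\<^esub> f b"
proof -
  interpret A: nc_algebra K A by fact
  interpret B: nc_algebra K B by fact
  have "f (\<ominus>\<^bsub>A\<^esub> b) = \<ominus>\<^bsub>B\<^esub> f b"
    using alg_hom_smult[OF assms(3), of "\<ominus>\<^bsub>K\<^esub> \<one>\<^bsub>K\<^esub>" b] assms(5) alg_hom_closed[OF assms(3,5)]
    by (simp add: A.smult_minus_one B.smult_minus_one)
  then show ?thesis using assms by (simp add: A.minus_eq B.minus_eq alg_hom_add)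
qed

lemma alg_hom_finsum:
  assumes "nc_algebra K A" "nc_algebra K B" "f \<in> alg_hom K A B" "finite I" "g \<in> I \<rightarrow> carrier A"
  shows "f (\<Oplus>\<^bsub>A\<^esub>i\<in>I. g i) = (\<Oplus>\<^bsub>B\<^esub>i\<in>I. f (g i))"
proof -
  interpret A: nc_algebra K A by fact
  interpret B: nc_algebra K B by fact
  show ?thesis using assms(4,5)
  proof (induction I)
    case empty
    then show ?case by (simp add: alg_hom_zero[OF assms(1-3)])
  next
    case (insert i I)
    then have "g \<in> I \<rightarrow> carrier A" "g i \<in> carrier A" by auto
    moreover from this have "(\<lambda>i. f (g i)) \<in> I \<rightarrow> carrier B" "f (g i) \<in> carrier B"
      using alg_hom_closed[OF assms(3)] by auto
    ultimately show ?case using insert by (simp add: alg_hom_add[OF assms(3)])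
  qed
qed

lemma alg_iso_inv:
  assumes "f \<in> alg_iso K A B" "nc_algebra K A"
  shows "inv_into (carrier A) f \<in> alg_iso K B A"
proof -
  interpret A: nc_algebra K A by fact
  let ?g = "inv_into (carrier A) f"
  have f: "f \<in> alg_hom K A B" and bij: "bij_betw f (carrier A) (carrier B)"
    using assms(1) by (auto simp: alg_iso_iff)
  have gB: "?g b \<in> carrier A" and fg: "f (?g b) = b" if "b \<in> carrier B" for b
    using that bij by (auto simp: bij_betw_def inv_into_into f_inv_into_f)
  have gf: "?g (f a) = a" if "a \<in> carrier A" for a
    using that bij by (auto simp: bij_betw_def)
  have "?g \<in> alg_hom K B A"
  proof (rule alg_homI)
    fix a b assume ab: "a \<in> carrier B" "b \<in> carrier B"
    show "?g (a \<oplus>\<^bsub>B\<^esub> b) = ?g a \<oplus>\<^bsub>A\<^esub> ?g b"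
      using gf[of "?g a \<oplus>\<^bsub>A\<^esub> ?g b"] alg_hom_add[OF f] ab gB fg by simp
    show "?g (a \<otimes>\<^bsub>B\<^esub> b) = ?g a \<otimes>\<^bsub>A\<^esub> ?g b"
      using gf[of "?g a \<otimes>\<^bsub>A\<^esub> ?g b"] alg_hom_mult[OF f] ab gB fg by simp
  next
    show "?g \<one>\<^bsub>B\<^esub> = \<one>\<^bsub>A\<^esub>" using gf[of "\<one>\<^bsub>A\<^esub>"] alg_hom_one[OF f] by simp
  next
    fix c b assume cb: "c \<in> carrier K" "b \<in> carrier B"
    show "?g (c \<odot>\<^bsub>B\<^esub> b) = c \<odot>\<^bsub>A\<^esub> ?g b"
      using gf[of "c \<odot>\<^bsub>A\<^esub> ?g b"] alg_hom_smult[OF f] cb gB fg by simp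
  qed (use gB in auto)
  then show ?thesis by (auto simp: alg_iso_iff bij bij_betw_inv_into)
qed

lemma alg_hom_compose:
  assumes "f \<in> alg_hom K A B" "g \<in> alg_hom K B C" shows "(\<lambda>a. g (f a)) \<in> alg_hom K A C"
  using assms by (intro alg_homI) (simp_all add: alg_hom_closed alg_hom_add alg_hom_mult alg_hom_one alg_hom_smult)

lemma alg_iso_compose:
  assumes "f \<in> alg_iso K A B" "g \<in> alg_iso K B C" shows "(\<lambda>a. g (f a)) \<in> alg_iso K A C"
  using assms bij_betw_trans[of f "carrier A" "carrier B" g "carrier C"]
  by (auto simp: alg_iso_iff alg_hom_compose comp_def)

text \<open>Algebra axioms are pulled back along an injection, so that for a concretely given structure
  embedded in an algebra only closure has to be checked.\<close>

lemma nc_algebra_pullback: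
  fixes A :: "('k, 'a) module" and T :: "('k, 't) module"
  assumes T: "nc_algebra K T"
    and f: "f \<in> alg_hom K A T" and f0: "f \<zero>\<^bsub>A\<^esub> = \<zero>\<^bsub>T\<^esub>" and inj: "inj_on f (carrier A)"
    and one: "\<one>\<^bsub>A\<^esub> \<in> carrier A" and zero: "\<zero>\<^bsub>A\<^esub> \<in> carrier A"
    and add: "\<And>a b. \<lbrakk>a \<in> carrier A; b \<in> carrier A\<rbrakk> \<Longrightarrow> a \<oplus>\<^bsub>A\<^esub> b \<in> carrier A"
    and mult: "\<And>a b. \<lbrakk>a \<in> carrier A; b \<in> carrier A\<rbrakk> \<Longrightarrow> a \<otimes>\<^bsub>A\<^esub> b \<in> carrier A"
    and smult: "\<And>c a. \<lbrakk>c \<in> carrier K; a \<in> carrier A\<rbrakk> \<Longrightarrow> c \<odot>\<^bsub>A\<^esub> a \<in> carrier A"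
  shows "nc_algebra K A"
proof -
  interpret T: nc_algebra K T by fact
  note h = alg_hom_closed[OF f] alg_hom_add[OF f] alg_hom_mult[OF f] alg_hom_one[OF f]
    alg_hom_smult[OF f] f0 one zero add mult smult
  have eq: "x = y" if "f x = f y" "x \<in> carrier A" "y \<in> carrier A" for x y
    using inj that by (auto dest: inj_onD)
  show ?thesis
  proof (intro nc_algebra.intro nc_algebra_axioms.intro ringI abelian_groupI monoidI)
    show "field K" by unfold_locales
  next
    fix x assume x: "x \<in> carrier A"
    show "\<exists>y\<in>carrier A. y \<oplus>\<^bsub>A\<^esub> x = \<zero>\<^bsub>A\<^esub>"
    \<comment> \<open>The negative is a scalar multiple, so closure under scalars already provides
      it.\<close>
    proof (rule bexI[of _ "(\<ominus>\<^bsub>K\<^esub> \<one>\<^bsub>K\<^esub>) \<odot>\<^bsub>A\<^esub> x"])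
      show "(\<ominus>\<^bsub>K\<^esub> \<one>\<^bsub>K\<^esub>) \<odot>\<^bsub>A\<^esub> x \<oplus>\<^bsub>A\<^esub> x = \<zero>\<^bsub>A\<^esub>"
        by (rule eq) (use x in \<open>simp_all add: h T.smult_minus_one T.l_neg\<close>)
    qed (use x in \<open>simp add: h\<close>)
  qed ((simp add: h; fail) | (rule eq, simp_all add: h T.m_assoc T.a_ac T.l_distr T.r_distr T.smult_l_distr
      T.smult_r_distr T.smult_assoc T.smult_mult_left T.smult_mult_right))+
qed


section \<open>Localization of right Ore domains\<close>

locale nc_domain = nc_algebra +
  assumes one_not_zero' [simp]: "\<one> \<noteq> \<zero>"
    and no_zero_div: "\<lbrakk>a \<otimes> b = \<zero>; a \<in> carrier A; b \<in> carrier A\<rbrakk> \<Longrightarrow> a = \<zero> \<or> b = \<zero>"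
begin

text \<open>Testing against one excludes zero; the absence of zero divisors does the rest.\<close>

lemma regular_iff: "s \<in> regular_elements A \<longleftrightarrow> s \<in> carrier A \<and> s \<noteq> \<zero>"
  unfolding regular_elements_def using no_zero_div one_not_zero' by (auto dest: bspec[of _ _ \<one>])

lemma mult_eq_zero_iff: "\<lbrakk>a \<in> carrier A; b \<in> carrier A\<rbrakk> \<Longrightarrow> a \<otimes> b = \<zero> \<longleftrightarrow> a = \<zero> \<or> b = \<zero>"
  using no_zero_div by auto

lemma cancel_left:
  assumes "a \<otimes> x = a \<otimes> y" "a \<noteq> \<zero>" "a \<in> carrier A" "x \<in> carrier A" "y \<in> carrier A"
  shows "x = y"
proof -
  have "a \<otimes> (x \<ominus> y) = \<zero>" using assms by (simp add: minus_eq r_distr r_minus r_neg)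
  then have "x \<ominus> y = \<zero>" using assms no_zero_div by blast
  then show ?thesis using assms by simp
qed

lemma cancel_right:
  assumes "x \<otimes> a = y \<otimes> a" "a \<noteq> \<zero>" "a \<in> carrier A" "x \<in> carrier A" "y \<in> carrier A"
  shows "x = y"
proof -
  have "(x \<ominus> y) \<otimes> a = \<zero>" using assms by (simp add: minus_eq l_distr l_minus r_neg)
  then have "x \<ominus> y = \<zero>" using assms no_zero_div by blast
  then show ?thesis using assms by simp
qed

end

section \<open>Equivalence of right fractions in an Ore domain\<close>

locale right_ore_domain = nc_domain +
  assumes ore: "\<lbrakk>a \<in> carrier A; b \<in> carrier A; a \<noteq> \<zero>; b \<noteq> \<zero>\<rbrakk> \<Longrightarrow>
    \<exists>u\<in>carrier A. \<exists>v\<in>carrier A. a \<otimes> u = b \<otimes> v \<and> a \<otimes> u \<noteq> \<zero>"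
begin

lemma oreE:
  assumes "a \<in> carrier A" "b \<in> carrier A" "a \<noteq> \<zero>" "b \<noteq> \<zero>"
  obtains u v where "u \<in> carrier A" "v \<in> carrier A" "a \<otimes> u = b \<otimes> v" "u \<noteq> \<zero>" "v \<noteq> \<zero>"
proof -
  obtain u v where uv: "u \<in> carrier A" "v \<in> carrier A" "a \<otimes> u = b \<otimes> v" "a \<otimes> u \<noteq> \<zero>"
    using ore[OF assms] by blast
  moreover have "u \<noteq> \<zero>" "v \<noteq> \<zero>" using uv assms by auto
  ultimately show ?thesis using that by blast
qed

text \<open>The form used for products of fractions, where the numerator \<open>b\<close> may
  vanish: what has to be nonzero is \<open>v\<close>, which becomes part of a denominator.\<close>

lemma oreE':
  assumes "s \<in> carrier A" "b \<in> carrier A" "s \<noteq> \<zero>"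
  obtains u v where "u \<in> carrier A" "v \<in> carrier A" "s \<otimes> u = b \<otimes> v" "v \<noteq> \<zero>"
proof (cases "b = \<zero>")
  case True
  show ?thesis by (rule that[of \<zero> \<one>]) (use assms True in auto)
next
  case False
  show ?thesis using oreE[OF assms(1,2) assms(3) False] that by metis
qed

abbreviation "frc \<equiv> fraction A"

abbreviation nz where "nz \<equiv> {a \<in> carrier A. a \<noteq> \<zero>}"

text \<open>In a domain \<open>s \<otimes> u\<close> is regular exactly when both factors are
  nonzero, so the condition on the common denominator becomes a symmetric one on \<open>u\<close>
  and \<open>v\<close>.\<close>

lemma frac_rel_iff: "((a, s), (b, t)) \<in> frac_rel A \<longleftrightarrow>
    a \<in> carrier A \<and> s \<in> nz \<and> b \<in> carrier A \<and> t \<in> nz \<and>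
    (\<exists>u\<in>nz. \<exists>v\<in>nz. a \<otimes> u = b \<otimes> v \<and> s \<otimes> u = t \<otimes> v)"
proof
  assume "((a, s), (b, t)) \<in> frac_rel A"
  then obtain u v where c: "a \<in> carrier A" "s \<in> nz" "b \<in> carrier A" "t \<in> nz"
    and uv: "u \<in> carrier A" "v \<in> carrier A" "a \<otimes> u = b \<otimes> v" "s \<otimes> u = t \<otimes> v" "s \<otimes> u \<noteq> \<zero>"
    unfolding frac_rel_def frac_pairs_def by (auto simp: regular_iff)
  have "u \<noteq> \<zero>" using uv(5) c by auto
  moreover have "v \<noteq> \<zero>" using uv(4,5) c by auto
  ultimately show "a \<in> carrier A \<and> s \<in> nz \<and> b \<in> carrier A \<and> t \<in> nz \<and>
    (\<exists>u\<in>nz. \<exists>v\<in>nz. a \<otimes> u = b \<otimes> v \<and> s \<otimes> u = t \<otimes> v)" using c uv by blast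
next
  assume "a \<in> carrier A \<and> s \<in> nz \<and> b \<in> carrier A \<and> t \<in> nz \<and>
    (\<exists>u\<in>nz. \<exists>v\<in>nz. a \<otimes> u = b \<otimes> v \<and> s \<otimes> u = t \<otimes> v)"
  then obtain u v where c: "a \<in> carrier A" "s \<in> nz" "b \<in> carrier A" "t \<in> nz"
    and uv: "u \<in> nz" "v \<in> nz" "a \<otimes> u = b \<otimes> v" "s \<otimes> u = t \<otimes> v" by blast
  then have "s \<otimes> u \<in> nz" by (simp add: mult_eq_zero_iff)
  then have "u \<in> carrier A" "v \<in> carrier A" "s \<otimes> u \<in> regular_elements A" using uv by (auto simp: regular_iff)
  then show "((a, s), (b, t)) \<in> frac_rel A"
    unfolding frac_rel_def frac_pairs_def using c uv(3,4)
    by (clarsimp simp: regular_iff simp del: uv(4)) (metis (no_types))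
qed

text \<open>Equivalence provides one pair of witnesses; here every common multiple of the
  denominators is shown to work. A common right multiple of \<open>u\<close> and \<open>x\<close>
  leads from the given witnesses to the arbitrary pair, and the auxiliary factor is cancelled at the
  end. All well-definedness arguments for fractions rest on this.\<close>

lemma frac_rel_apply:
  assumes "((a, s), (b, t)) \<in> frac_rel A" "s \<otimes> x = t \<otimes> y" "x \<in> carrier A" "y \<in> carrier A"
  shows "a \<otimes> x = b \<otimes> y"
proof (cases "x = \<zero>")
  case True
  have c: "a \<in> carrier A" "s \<in> nz" "b \<in> carrier A" "t \<in> nz"
    using assms(1) unfolding frac_rel_iff by blast+
  then have "t \<otimes> y = \<zero>" using assms(2) True by simp
  then have "y = \<zero>" using c assms(4) by (simp add: mult_eq_zero_iff)
  then show ?thesis using c True by simp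
next
  case False
  obtain u v where uv: "u \<in> nz" "v \<in> nz" "a \<otimes> u = b \<otimes> v" "s \<otimes> u = t \<otimes> v"
    and c: "a \<in> carrier A" "s \<in> nz" "b \<in> carrier A" "t \<in> nz"
    using assms(1) unfolding frac_rel_iff by blast
  obtain p p' where p: "p \<in> carrier A" "p' \<in> carrier A" "u \<otimes> p = x \<otimes> p'" "p \<noteq> \<zero>" "p' \<noteq> \<zero>"
    using oreE[of u x] uv assms False by blast
  \<comment> \<open>Both sides are the same multiple of \<open>s\<close>; cancelling
    \<open>t\<close> carries the relation \<open>u p = x p'\<close> over to \<open>v\<close> and
    \<open>y\<close>.\<close>
  have "t \<otimes> (v \<otimes> p) = t \<otimes> (y \<otimes> p')"
  proof -
    have "t \<otimes> (v \<otimes> p) = (s \<otimes> u) \<otimes> p" using uv c p by (simp add: m_assoc)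
    also have "\<dots> = s \<otimes> (x \<otimes> p')" using uv(1) c p assms(3) by (simp add: m_assoc)
    also have "\<dots> = t \<otimes> y \<otimes> p'" using c p(2) assms by (simp flip: m_assoc)
    finally show ?thesis using c p assms by (simp add: m_assoc)
  qed
  then have vy: "v \<otimes> p = y \<otimes> p'" by (rule cancel_left) (use c uv p assms in auto)
  have "(a \<otimes> x) \<otimes> p' = (b \<otimes> y) \<otimes> p'"
  proof -
    have "(a \<otimes> x) \<otimes> p' = (a \<otimes> u) \<otimes> p"
      using uv(1) c p assms(3) by (simp add: m_assoc)
    also have "\<dots> = b \<otimes> (v \<otimes> p)" unfolding uv(3) using uv(2) c p(1) by (simp add: m_assoc)
    also have "\<dots> = (b \<otimes> y) \<otimes> p'" using vy c p assms by (simp add: m_assoc)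
    finally show ?thesis .
  qed
  then show ?thesis by (rule cancel_right) (use c p assms in auto)
qed

text \<open>The Ore condition yields a common multiple with nonzero cofactors. Together with
  \<open>frac_rel_apply\<close> this allows equality of fractions to be tested on arbitrary common
  multiples of the denominators.\<close>

lemma frac_relI:
  assumes "a \<in> carrier A" "s \<in> nz" "b \<in> carrier A" "t \<in> nz"
    and "\<And>x y. \<lbrakk>s \<otimes> x = t \<otimes> y; x \<in> carrier A; y \<in> carrier A\<rbrakk> \<Longrightarrow> a \<otimes> x = b \<otimes> y"
  shows "((a, s), (b, t)) \<in> frac_rel A"
proof -
  obtain u v where "u \<in> carrier A" "v \<in> carrier A" "s \<otimes> u = t \<otimes> v" "u \<noteq> \<zero>" "v \<noteq> \<zero>"
    using oreE[of s t] assms by blast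
  then show ?thesis using assms unfolding frac_rel_iff by blast
qed

lemma equiv_frac_rel: "equiv (frac_pairs A) (frac_rel A)"
proof (rule equivI)
  show "frac_rel A \<subseteq> frac_pairs A \<times> frac_pairs A" unfolding frac_rel_def by auto
  show "refl_on (frac_pairs A) (frac_rel A)"
  proof (rule refl_onI)
    fix p assume p: "p \<in> frac_pairs A"
    obtain a s where e: "p = (a, s)" by (cases p) auto
    have c: "a \<in> carrier A" "s \<in> nz" using p by (auto simp: e frac_pairs_def regular_iff)
    have "\<one> \<in> nz" by simp
    then show "(p, p) \<in> frac_rel A" using c unfolding e frac_rel_iff by blast
  qed
  show "sym (frac_rel A)"
  proof (rule symI)
    fix p q assume pq: "(p, q) \<in> frac_rel A"
    obtain a s b t where e: "p = (a, s)" "q = (b, t)" by (cases p, cases q) auto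
    obtain u v where uv: "u \<in> nz" "v \<in> nz" "a \<otimes> u = b \<otimes> v" "s \<otimes> u = t \<otimes> v"
      and c: "a \<in> carrier A" "s \<in> nz" "b \<in> carrier A" "t \<in> nz"
      using pq unfolding e frac_rel_iff by blast
    show "(q, p) \<in> frac_rel A" unfolding e frac_rel_iff
      using uv(1,2) uv(3,4)[symmetric] c by blast
  qed
  show "trans (frac_rel A)"
  proof (rule transI)
    fix p q w assume pq: "(p, q) \<in> frac_rel A" and qw: "(q, w) \<in> frac_rel A"
    obtain a s b t c z where e: "p = (a, s)" "q = (b, t)" "w = (c, z)" by (cases p, cases q, cases w) auto
    note pq = pq[unfolded e] and qw = qw[unfolded e]
    obtain u v where uv: "u \<in> nz" "v \<in> nz" "a \<otimes> u = b \<otimes> v" "s \<otimes> u = t \<otimes> v"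
      and c: "a \<in> carrier A" "s \<in> nz" "b \<in> carrier A" "t \<in> nz"
      using pq unfolding frac_rel_iff by blast
    have c': "c \<in> carrier A" "z \<in> nz" using qw unfolding frac_rel_iff by blast+
    \<comment> \<open>Prolonging the common multiple \<open>t \<otimes> v\<close> to a multiple of
      \<open>z\<close> lets both equivalences be read on the same element.\<close>
    obtain x y where xy: "x \<in> carrier A" "y \<in> carrier A" "(t \<otimes> v) \<otimes> x = z \<otimes> y" "x \<noteq> \<zero>" "y \<noteq> \<zero>"
      using oreE[of "t \<otimes> v" z] c c' uv by (auto simp: mult_eq_zero_iff)
    have "b \<otimes> (v \<otimes> x) = c \<otimes> y"
      by (rule frac_rel_apply[OF qw]) (use xy c c' uv in \<open>auto simp: m_assoc\<close>)
    then have "a \<otimes> (u \<otimes> x) = c \<otimes> y" "s \<otimes> (u \<otimes> x) = z \<otimes> y" "u \<otimes> x \<noteq> \<zero>"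
      using c uv xy by (auto simp: m_assoc[symmetric] mult_eq_zero_iff)
    then show "(p, w) \<in> frac_rel A"
      unfolding e frac_rel_iff using c c' uv xy by (intro conjI bexI[of _ "u \<otimes> x"] bexI[of _ y]) auto
  qed
qed

lemma frac_eq_rel: "\<lbrakk>a \<in> carrier A; s \<in> nz; b \<in> carrier A; t \<in> nz\<rbrakk> \<Longrightarrow>
    frc a s = frc b t \<longleftrightarrow> ((a, s), (b, t)) \<in> frac_rel A"
  unfolding fraction_def using eq_equiv_class_iff[OF equiv_frac_rel]
  by (auto simp: frac_pairs_def regular_iff)

lemma frac_eqI:
  assumes "a \<otimes> u = b \<otimes> v" "s \<otimes> u = t \<otimes> v"
    "a \<in> carrier A" "s \<in> nz" "b \<in> carrier A" "t \<in> nz" "u \<in> nz" "v \<in> nz"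
  shows "frc a s = frc b t"
  using assms by (subst frac_eq_rel) (auto simp: frac_rel_iff)

lemma frac_eqE:
  assumes "frc a s = frc b t" "a \<in> carrier A" "s \<in> nz" "b \<in> carrier A" "t \<in> nz"
  obtains u v where "u \<in> nz" "v \<in> nz" "a \<otimes> u = b \<otimes> v" "s \<otimes> u = t \<otimes> v"
  using assms by (subst (asm) frac_eq_rel) (auto simp: frac_rel_iff)

lemma frac_eqD:
  assumes "frc a s = frc b t" "s \<otimes> x = t \<otimes> y"
    "a \<in> carrier A" "s \<in> nz" "b \<in> carrier A" "t \<in> nz" "x \<in> carrier A" "y \<in> carrier A"
  shows "a \<otimes> x = b \<otimes> y"
  using assms frac_rel_apply[of a s b t x y] by (subst (asm) frac_eq_rel) auto

lemma frac_eqI_all: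
  assumes "a \<in> carrier A" "s \<in> nz" "b \<in> carrier A" "t \<in> nz"
    and "\<And>x y. \<lbrakk>s \<otimes> x = t \<otimes> y; x \<in> carrier A; y \<in> carrier A\<rbrakk> \<Longrightarrow> a \<otimes> x = b \<otimes> y"
  shows "frc a s = frc b t"
  using assms frac_relI[of a s b t] by (subst frac_eq_rel) auto

lemma frac_scale: "\<lbrakk>a \<in> carrier A; s \<in> nz; u \<in> nz\<rbrakk> \<Longrightarrow> frc (a \<otimes> u) (s \<otimes> u) = frc a s"
  by (rule frac_eqI[of _ \<one> _ u]) (auto simp: mult_eq_zero_iff)

lemma frac_mem: "\<lbrakk>a \<in> carrier A; s \<in> nz\<rbrakk> \<Longrightarrow>
    (b, t) \<in> frc a s \<longleftrightarrow> b \<in> carrier A \<and> t \<in> nz \<and> frc b t = frc a s"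
  using frac_eq_rel[of a s b t] by (auto simp: fraction_def[of _ a s] frac_rel_iff)

section \<open>Ring operations on right fractions\<close>

abbreviation Q where "Q \<equiv> ring_of_fractions A"

lemma Q_carrier: "carrier Q = {frc a s | a s. a \<in> carrier A \<and> s \<in> nz}"
proof -
  have "carrier Q = (\<Union>p\<in>frac_pairs A. {frac_rel A `` {p}})" by (simp add: ring_of_fractions_def quotient_def)
  also have "\<dots> = {frc a s | a s. (a, s) \<in> frac_pairs A}" unfolding fraction_def by auto
  also have "\<dots> = {frc a s | a s. a \<in> carrier A \<and> s \<in> nz}" by (simp add: frac_pairs_def regular_iff)
  finally show ?thesis .
qed

lemma frac_in_Q [simp, intro]: "\<lbrakk>a \<in> carrier A; s \<in> nz\<rbrakk> \<Longrightarrow> frc a s \<in> carrier Q"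
  by (auto simp: Q_carrier)

lemma Q_E:
  assumes "P \<in> carrier Q" obtains a s where "P = frc a s" "a \<in> carrier A" "s \<in> nz"
  using assms unfolding Q_carrier by blast

text \<open>The definition takes a union over all representatives and cofactors; it has to be seen
  that all members coincide. Two choices are compared on an arbitrary common multiple of their
  denominators, where each summand is controlled separately by \<open>frac_eqD\<close>.\<close>

lemma Q_add_gen:
  assumes "a \<in> carrier A" "s \<in> nz" "b \<in> carrier A" "t \<in> nz" "u \<in> nz" "v \<in> nz"
    and e: "s \<otimes> u = t \<otimes> v"
  shows "frc a s \<oplus>\<^bsub>Q\<^esub> frc b t = frc (a \<otimes> u \<oplus> b \<otimes> v) (s \<otimes> u)"
proof -
  have *: "frc (a' \<otimes> u' \<oplus> b' \<otimes> v') (s' \<otimes> u') = frc (a \<otimes> u \<oplus> b \<otimes> v) (s \<otimes> u)"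
    if "(a', s') \<in> frc a s" "(b', t') \<in> frc b t" "u' \<in> carrier A" "v' \<in> carrier A"
      "s' \<otimes> u' = t' \<otimes> v'" "s' \<otimes> u' \<noteq> \<zero>" for a' s' b' t' u' v'
  proof -
    have c: "a' \<in> carrier A" "s' \<in> nz" "frc a' s' = frc a s" "b' \<in> carrier A" "t' \<in> nz" "frc b' t' = frc b t"
      using that assms by (auto simp: frac_mem)
    show ?thesis
    proof (rule frac_eqI_all)
      fix x y assume xy: "s' \<otimes> u' \<otimes> x = s \<otimes> u \<otimes> y" "x \<in> carrier A" "y \<in> carrier A"
      have "a' \<otimes> (u' \<otimes> x) = a \<otimes> (u \<otimes> y)"
        by (rule frac_eqD[OF c(3)]) (use c xy assms(1-6) that(1-4) in \<open>auto simp: m_assoc\<close>)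
      moreover have "t' \<otimes> v' \<otimes> x = t \<otimes> v \<otimes> y" using xy(1) that(5) e by simp
      then have "b' \<otimes> (v' \<otimes> x) = b \<otimes> (v \<otimes> y)"
        by (intro frac_eqD[OF c(6)]) (use c xy(2,3) assms(1-6) that(1-4) in \<open>auto simp: m_assoc\<close>)
      ultimately show "(a' \<otimes> u' \<oplus> b' \<otimes> v') \<otimes> x = (a \<otimes> u \<oplus> b \<otimes> v) \<otimes> y"
        using c xy assms that by (simp add: l_distr m_assoc)
    qed (use c that assms in \<open>auto simp: mult_eq_zero_iff\<close>)
  qed
  have "(a, s) \<in> frc a s" "(b, t) \<in> frc b t" using assms by (auto simp: frac_mem)
  \<comment> \<open>The given \<open>u\<close>, \<open>v\<close> show that the family is inhabited;
    the union of an empty family would be the empty set rather than a class.\<close>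
  then have "{frc (a' \<otimes> u' \<oplus> b' \<otimes> v') (s' \<otimes> u') |a' s' b' t' u' v'.
        (a', s') \<in> frc a s \<and> (b', t') \<in> frc b t \<and> u' \<in> carrier A \<and> v' \<in> carrier A \<and>
        s' \<otimes> u' = t' \<otimes> v' \<and> s' \<otimes> u' \<in> regular_elements A} = {frc (a \<otimes> u \<oplus> b \<otimes> v) (s \<otimes> u)}"
    (is "?S = _")
  proof (intro equalityI subsetI)
    fix p assume "p \<in> ?S"
    then obtain a' s' b' t' u' v' where "p = frc (a' \<otimes> u' \<oplus> b' \<otimes> v') (s' \<otimes> u')"
      and "(a', s') \<in> frc a s" "(b', t') \<in> frc b t" "u' \<in> carrier A" "v' \<in> carrier A"
        "s' \<otimes> u' = t' \<otimes> v'" "s' \<otimes> u' \<in> regular_elements A" by blast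
    then show "p \<in> {frc (a \<otimes> u \<oplus> b \<otimes> v) (s \<otimes> u)}" using *[of a' s' b' t' u' v'] by (simp only: regular_iff) simp
  next
    fix p assume "p \<in> {frc (a \<otimes> u \<oplus> b \<otimes> v) (s \<otimes> u)}"
    moreover have "s \<otimes> u \<in> regular_elements A" using assms by (simp add: regular_iff mult_eq_zero_iff)
    ultimately show "p \<in> ?S" using \<open>(a, s) \<in> frc a s\<close> \<open>(b, t) \<in> frc b t\<close> assms(5,6) e by blast
  qed
  then show ?thesis unfolding ring_of_fractions_def by simp
qed

text \<open>As for sums, but in two stages: comparing the right-hand fractions gives
  \<open>s' u' x = s u y\<close>, and this is the common multiple on which the left-hand fractions
  can be compared.\<close>

lemma Q_mult_gen:
  assumes "a \<in> carrier A" "s \<in> nz" "b \<in> carrier A" "t \<in> nz" "u \<in> carrier A" "v \<in> nz"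
    and e: "s \<otimes> u = b \<otimes> v"
  shows "frc a s \<otimes>\<^bsub>Q\<^esub> frc b t = frc (a \<otimes> u) (t \<otimes> v)"
proof -
  have *: "frc (a' \<otimes> u') (t' \<otimes> v') = frc (a \<otimes> u) (t \<otimes> v)"
    if "(a', s') \<in> frc a s" "(b', t') \<in> frc b t" "u' \<in> carrier A" "v' \<in> nz"
      "s' \<otimes> u' = b' \<otimes> v'" for a' s' b' t' u' v'
  proof -
    have c: "a' \<in> carrier A" "s' \<in> nz" "frc a' s' = frc a s" "b' \<in> carrier A" "t' \<in> nz" "frc b' t' = frc b t"
      using that assms by (auto simp: frac_mem)
    show ?thesis
    proof (rule frac_eqI_all)
      fix x y assume xy: "t' \<otimes> v' \<otimes> x = t \<otimes> v \<otimes> y" "x \<in> carrier A" "y \<in> carrier A"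
      have "b' \<otimes> (v' \<otimes> x) = b \<otimes> (v \<otimes> y)"
        by (rule frac_eqD[OF c(6)]) (use c xy assms that in \<open>auto simp: m_assoc\<close>)
      then have s: "s' \<otimes> (u' \<otimes> x) = s \<otimes> (u \<otimes> y)"
        using c xy assms that by (auto simp: m_assoc[symmetric])
      have "a' \<otimes> (u' \<otimes> x) = a \<otimes> (u \<otimes> y)"
        by (rule frac_eqD[OF c(3)]) (use c xy assms that s in auto)
      then show "a' \<otimes> u' \<otimes> x = a \<otimes> u \<otimes> y"
        using c xy assms that by (simp add: m_assoc)
    qed (use c that assms in \<open>auto simp: mult_eq_zero_iff\<close>)
  qed
  have "(a, s) \<in> frc a s" "(b, t) \<in> frc b t" using assms by (auto simp: frac_mem)
  then have "{frc (a' \<otimes> u') (t' \<otimes> v') |a' s' b' t' u' v'.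
        (a', s') \<in> frc a s \<and> (b', t') \<in> frc b t \<and> u' \<in> carrier A \<and> v' \<in> regular_elements A \<and>
        s' \<otimes> u' = b' \<otimes> v'} = {frc (a \<otimes> u) (t \<otimes> v)}"
    (is "?S = _")
  proof (intro equalityI subsetI)
    fix p assume "p \<in> ?S"
    then obtain a' s' b' t' u' v' where "p = frc (a' \<otimes> u') (t' \<otimes> v')"
      and "(a', s') \<in> frc a s" "(b', t') \<in> frc b t" "u' \<in> carrier A" "v' \<in> regular_elements A"
        "s' \<otimes> u' = b' \<otimes> v'" by blast
    then show "p \<in> {frc (a \<otimes> u) (t \<otimes> v)}" using *[of a' s' b' t' u' v'] by (simp only: regular_iff) simp
  next
    fix p assume "p \<in> {frc (a \<otimes> u) (t \<otimes> v)}"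
    moreover have "v \<in> regular_elements A" using assms by (simp add: regular_iff)
    ultimately show "p \<in> ?S" using \<open>(a, s) \<in> frc a s\<close> \<open>(b, t) \<in> frc b t\<close> assms(5) e by blast
  qed
  then show ?thesis unfolding ring_of_fractions_def by simp
qed

lemma Q_smult:
  assumes "c \<in> carrier K" "a \<in> carrier A" "s \<in> nz"
  shows "c \<odot>\<^bsub>Q\<^esub> frc a s = frc (c \<odot> a) s"
proof -
  have *: "frc (c \<odot> a') s' = frc (c \<odot> a) s" if "(a', s') \<in> frc a s" for a' s'
  proof -
    have c: "a' \<in> carrier A" "s' \<in> nz" "frc a' s' = frc a s"
      using that assms by (auto simp: frac_mem)
    show ?thesis
    proof (rule frac_eqI_all)
      fix x y assume xy: "s' \<otimes> x = s \<otimes> y" "x \<in> carrier A" "y \<in> carrier A"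
      have "a' \<otimes> x = a \<otimes> y" by (rule frac_eqD[OF c(3)]) (use c xy assms in auto)
      then show "c \<odot> a' \<otimes> x = c \<odot> a \<otimes> y" using c xy assms by (simp add: smult_mult_left)
    qed (use c assms in auto)
  qed
  have "(a, s) \<in> frc a s" using assms by (auto simp: frac_mem)
  then have "{frc (c \<odot> a') s' |a' s'. (a', s') \<in> frc a s} = {frc (c \<odot> a) s}"
    (is "?S = _")
  proof (intro equalityI subsetI)
    fix p assume "p \<in> ?S"
    then obtain a' s' where "p = frc (c \<odot> a') s'" "(a', s') \<in> frc a s" by blast
    then show "p \<in> {frc (c \<odot> a) s}" using *[of a' s'] by simp
  next
    fix p assume "p \<in> {frc (c \<odot> a) s}"
    then show "p \<in> ?S" using \<open>(a, s) \<in> frc a s\<close> by blast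
  qed
  then show ?thesis unfolding ring_of_fractions_def by simp
qed

lemma Q_one: "\<one>\<^bsub>Q\<^esub> = frc \<one> \<one>" and Q_zero: "\<zero>\<^bsub>Q\<^esub> = frc \<zero> \<one>"
  unfolding ring_of_fractions_def by simp_all

lemma Q_add: "\<lbrakk>a \<in> carrier A; b \<in> carrier A; s \<in> nz\<rbrakk> \<Longrightarrow> frc a s \<oplus>\<^bsub>Q\<^esub> frc b s = frc (a \<oplus> b) s"
  using Q_add_gen[of a s b s \<one> \<one>] by simp

text \<open>If the second numerator starts with the first denominator, the product telescopes.
  \<open>Q_numerator\<close> brings every fraction into this form, so that later computations do not
  mention Ore cofactors.\<close>

lemma Q_mult: "\<lbrakk>a \<in> carrier A; s \<in> nz; u \<in> carrier A; t \<in> nz\<rbrakk> \<Longrightarrow>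
    frc a s \<otimes>\<^bsub>Q\<^esub> frc (s \<otimes> u) t = frc (a \<otimes> u) t"
  using Q_mult_gen[of a s "s \<otimes> u" t u \<one>] by simp

lemma frac_zero_iff: "\<lbrakk>a \<in> carrier A; s \<in> nz\<rbrakk> \<Longrightarrow> frc a s = \<zero>\<^bsub>Q\<^esub> \<longleftrightarrow> a = \<zero>"
  unfolding Q_zero
proof
  assume a: "a \<in> carrier A" "s \<in> nz" "frc a s = frc \<zero> \<one>"
  have "a \<otimes> \<one> = \<zero> \<otimes> s" by (rule frac_eqD[OF a(3)]) (use a in auto)
  then show "a = \<zero>" using a by auto
next
  assume "a \<in> carrier A" "s \<in> nz" "a = \<zero>"
  then show "frc a s = frc \<zero> \<one>" by (intro frac_eqI[of _ \<one> _ s]) auto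
qed

lemma common_denominator:
  assumes "P \<in> carrier Q" "s \<in> nz"
  obtains b u where "b \<in> carrier A" "u \<in> nz" "P = frc b (s \<otimes> u)"
proof -
  obtain a t where at: "P = frc a t" "a \<in> carrier A" "t \<in> nz" using Q_E assms by blast
  obtain u v where uv: "u \<in> carrier A" "v \<in> carrier A" "s \<otimes> u = t \<otimes> v" "u \<noteq> \<zero>" "v \<noteq> \<zero>"
    using oreE[of s t] at assms by blast
  have "P = frc (a \<otimes> v) (s \<otimes> u)" using at uv by (simp add: frac_scale)
  then show ?thesis using at uv by (intro that[of "a \<otimes> v" u]) auto
qed

lemma Q_E2:
  assumes "P \<in> carrier Q" "P' \<in> carrier Q"
  obtains a b s where "P = frc a s" "P' = frc b s" "a \<in> carrier A" "b \<in> carrier A" "s \<in> nz"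
proof -
  obtain a t where at: "P = frc a t" "a \<in> carrier A" "t \<in> nz" using Q_E assms by blast
  obtain b u where bu: "b \<in> carrier A" "u \<in> nz" "P' = frc b (t \<otimes> u)"
    using common_denominator assms at by blast
  have "P = frc (a \<otimes> u) (t \<otimes> u)" using at bu by (simp add: frac_scale)
  then show ?thesis using that[of "a \<otimes> u" "t \<otimes> u" b] at bu by (auto simp: mult_eq_zero_iff)
qed

lemma Q_E3:
  assumes "P \<in> carrier Q" "P' \<in> carrier Q" "P'' \<in> carrier Q"
  obtains a b c s where "P = frc a s" "P' = frc b s" "P'' = frc c s"
    "a \<in> carrier A" "b \<in> carrier A" "c \<in> carrier A" "s \<in> nz"
proof -
  obtain a b t where at: "P = frc a t" "P' = frc b t" "a \<in> carrier A" "b \<in> carrier A" "t \<in> nz"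
    using Q_E2[OF assms(1,2)] by blast
  obtain c u where bu: "c \<in> carrier A" "u \<in> nz" "P'' = frc c (t \<otimes> u)"
    using common_denominator[OF assms(3)] at by blast
  have "P = frc (a \<otimes> u) (t \<otimes> u)" "P' = frc (b \<otimes> u) (t \<otimes> u)" using at bu by (simp_all add: frac_scale)
  then show ?thesis using that[of "a \<otimes> u" "t \<otimes> u" "b \<otimes> u" c] at bu by (auto simp: mult_eq_zero_iff)
qed

lemma Q_numerator:
  assumes "P \<in> carrier Q" "s \<in> nz"
  obtains u t where "u \<in> carrier A" "t \<in> nz" "P = frc (s \<otimes> u) t"
proof -
  obtain a t where at: "P = frc a t" "a \<in> carrier A" "t \<in> nz" using Q_E assms by blast
  obtain u v where uv: "u \<in> carrier A" "v \<in> carrier A" "s \<otimes> u = a \<otimes> v" "v \<noteq> \<zero>"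
    using oreE'[of s a] at assms by blast
  have "P = frc (s \<otimes> u) (t \<otimes> v)" using at uv by (simp add: frac_scale)
  then show ?thesis using that[of u "t \<otimes> v"] uv at by (auto simp: mult_eq_zero_iff)
qed

text \<open>Two fractions are prepared at once for multiplication from the left by a fraction with
  denominator \<open>s\<close> and for addition to each other; this is the shape that distributivity
  on that side requires.\<close>

lemma Q_numerator2:
  assumes "P \<in> carrier Q" "P' \<in> carrier Q" "s \<in> nz"
  obtains u v t where "u \<in> carrier A" "v \<in> carrier A" "t \<in> nz" "P = frc (s \<otimes> u) t" "P' = frc (s \<otimes> v) t"
proof -
  obtain b c t where t: "P = frc b t" "P' = frc c t" "b \<in> carrier A" "c \<in> carrier A" "t \<in> nz"
    using Q_E2[OF assms(1,2)] by blast
  obtain u v where uv: "u \<in> carrier A" "v \<in> carrier A" "s \<otimes> u = b \<otimes> v" "v \<noteq> \<zero>"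
    using oreE'[of s b] t assms by blast
  obtain u' v' where uv': "u' \<in> carrier A" "v' \<in> carrier A" "s \<otimes> u' = (c \<otimes> v) \<otimes> v'" "v' \<noteq> \<zero>"
    using oreE'[of s "c \<otimes> v"] t uv assms by auto
  have nz: "v \<otimes> v' \<in> nz" using uv uv' by (auto simp: mult_eq_zero_iff)
  have "P = frc (b \<otimes> (v \<otimes> v')) (t \<otimes> (v \<otimes> v'))" "P' = frc (c \<otimes> (v \<otimes> v')) (t \<otimes> (v \<otimes> v'))"
    using t nz by (simp_all add: frac_scale)
  moreover have "b \<otimes> (v \<otimes> v') = s \<otimes> (u \<otimes> v')" "c \<otimes> (v \<otimes> v') = s \<otimes> u'"
    using uv uv' t assms by (auto simp: m_assoc[symmetric])
  moreover have "t \<otimes> (v \<otimes> v') \<in> nz" using t nz uv uv' by (auto simp: mult_eq_zero_iff)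
  ultimately show ?thesis using that[of "u \<otimes> v'" u' "t \<otimes> (v \<otimes> v')"] uv uv' by auto
qed

text \<open>Each axiom is checked on representatives adapted to it: equal denominators for sums, and
  for products a chain in which each numerator starts with the preceding denominator.\<close>

lemma ring_Q: "ring Q"
proof (intro ringI abelian_groupI monoidI)
  have one: "\<one> \<in> nz" by simp
  show "\<zero>\<^bsub>Q\<^esub> \<in> carrier Q" "\<one>\<^bsub>Q\<^esub> \<in> carrier Q" by (auto simp: Q_zero Q_one)
  fix x assume x: "x \<in> carrier Q"
  obtain a s where as: "x = frc a s" "a \<in> carrier A" "s \<in> nz" using Q_E x by blast
  have z: "\<zero>\<^bsub>Q\<^esub> = frc \<zero> s" using frac_zero_iff[of \<zero> s] as by simp
  show "\<zero>\<^bsub>Q\<^esub> \<oplus>\<^bsub>Q\<^esub> x = x" using as by (simp add: z Q_add)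
  show "\<exists>y\<in>carrier Q. y \<oplus>\<^bsub>Q\<^esub> x = \<zero>\<^bsub>Q\<^esub>"
    by (rule bexI[of _ "frc (\<ominus> a) s"]) (use as in \<open>simp_all add: z Q_add l_neg\<close>)
  show "\<one>\<^bsub>Q\<^esub> \<otimes>\<^bsub>Q\<^esub> x = x" using as Q_mult[of \<one> \<one> a s] by (simp add: Q_one)
  show "x \<otimes>\<^bsub>Q\<^esub> \<one>\<^bsub>Q\<^esub> = x"
  proof -
    have "frc s s = frc \<one> \<one>" using frac_scale[of \<one> \<one> s] as by simp
    then show ?thesis using as Q_mult[of a s \<one> s] by (simp add: Q_one)
  qed
  fix y assume y: "y \<in> carrier Q"
  obtain c b t where cbt: "x = frc c t" "y = frc b t" "c \<in> carrier A" "b \<in> carrier A" "t \<in> nz"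
    using Q_E2[OF x y] by blast
  show "x \<oplus>\<^bsub>Q\<^esub> y \<in> carrier Q" using cbt by (simp add: Q_add frac_in_Q)
  show "x \<oplus>\<^bsub>Q\<^esub> y = y \<oplus>\<^bsub>Q\<^esub> x" using cbt by (simp add: Q_add a_comm)
  obtain u t' where ut: "u \<in> carrier A" "t' \<in> nz" "y = frc (s \<otimes> u) t'"
    using Q_numerator y as by blast
  have xy: "x \<otimes>\<^bsub>Q\<^esub> y = frc (a \<otimes> u) t'" using ut as by (simp add: Q_mult)
  then show "x \<otimes>\<^bsub>Q\<^esub> y \<in> carrier Q" using ut as by (simp add: frac_in_Q)
  fix z assume z: "z \<in> carrier Q"
  show "x \<oplus>\<^bsub>Q\<^esub> y \<oplus>\<^bsub>Q\<^esub> z = x \<oplus>\<^bsub>Q\<^esub> (y \<oplus>\<^bsub>Q\<^esub> z)"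
    by (rule Q_E3[OF x y z]) (simp add: Q_add a_assoc)
  obtain v w where vw: "v \<in> carrier A" "w \<in> nz" "z = frc (t' \<otimes> v) w"
    using Q_numerator z ut by blast
  have yz: "y \<otimes>\<^bsub>Q\<^esub> z = frc (s \<otimes> (u \<otimes> v)) w" using ut vw as by (simp add: Q_mult m_assoc)
  show "x \<otimes>\<^bsub>Q\<^esub> y \<otimes>\<^bsub>Q\<^esub> z = x \<otimes>\<^bsub>Q\<^esub> (y \<otimes>\<^bsub>Q\<^esub> z)"
  proof -
    have "x \<otimes>\<^bsub>Q\<^esub> (y \<otimes>\<^bsub>Q\<^esub> z) = frc (a \<otimes> (u \<otimes> v)) w" unfolding yz using as ut vw by (simp add: Q_mult)
    moreover have "x \<otimes>\<^bsub>Q\<^esub> y \<otimes>\<^bsub>Q\<^esub> z = frc (a \<otimes> u \<otimes> v) w" unfolding xy using as ut vw by (simp add: Q_mult)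
    ultimately show ?thesis using as ut vw by (simp add: m_assoc)
  qed
  obtain u' t'' where ut': "u' \<in> carrier A" "t'' \<in> nz" "z = frc (t \<otimes> u') t''"
    using Q_numerator z cbt by blast
  show "(x \<oplus>\<^bsub>Q\<^esub> y) \<otimes>\<^bsub>Q\<^esub> z = x \<otimes>\<^bsub>Q\<^esub> z \<oplus>\<^bsub>Q\<^esub> y \<otimes>\<^bsub>Q\<^esub> z"
    using cbt ut' by (simp add: Q_add Q_mult l_distr)
next
  fix x y z assume xyz: "x \<in> carrier Q" "y \<in> carrier Q" "z \<in> carrier Q"
  obtain a s where as: "z = frc a s" "a \<in> carrier A" "s \<in> nz" using Q_E xyz by blast
  obtain u v t where uvt: "u \<in> carrier A" "v \<in> carrier A" "t \<in> nz" "x = frc (s \<otimes> u) t" "y = frc (s \<otimes> v) t"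
    using Q_numerator2[OF xyz(1,2) as(3)] by blast
  have "z \<otimes>\<^bsub>Q\<^esub> (x \<oplus>\<^bsub>Q\<^esub> y) = frc a s \<otimes>\<^bsub>Q\<^esub> frc (s \<otimes> (u \<oplus> v)) t"
    using as uvt by (simp add: Q_add r_distr)
  also have "\<dots> = frc (a \<otimes> u \<oplus> a \<otimes> v) t" using as uvt Q_mult[of a s "u \<oplus> v" t] by (simp add: r_distr)
  also have "\<dots> = z \<otimes>\<^bsub>Q\<^esub> x \<oplus>\<^bsub>Q\<^esub> z \<otimes>\<^bsub>Q\<^esub> y" using as uvt by (simp add: Q_add Q_mult)
  finally show "z \<otimes>\<^bsub>Q\<^esub> (x \<oplus>\<^bsub>Q\<^esub> y) = z \<otimes>\<^bsub>Q\<^esub> x \<oplus>\<^bsub>Q\<^esub> z \<otimes>\<^bsub>Q\<^esub> y" .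
qed

lemma Q_inverse:
  assumes "a \<in> nz" "s \<in> nz"
  shows "frc a s \<otimes>\<^bsub>Q\<^esub> frc s a = \<one>\<^bsub>Q\<^esub>"
  using Q_mult[of a s \<one> a] frac_scale[of \<one> \<one> a] assms by (simp add: Q_one)

end

locale division_ring = ring +
  assumes one_neq_zero: "\<one> \<noteq> \<zero>"
    and nonzero_unit: "\<lbrakk>a \<in> carrier R; a \<noteq> \<zero>\<rbrakk> \<Longrightarrow> a \<in> Units R"

lemma (in right_ore_domain) division_ring_Q: "division_ring Q"
proof (intro division_ring.intro division_ring_axioms.intro ring_Q)
  show "\<one>\<^bsub>Q\<^esub> \<noteq> \<zero>\<^bsub>Q\<^esub>" using frac_zero_iff[of \<one> \<one>] by (simp add: Q_one)
  fix x assume x: "x \<in> carrier Q" "x \<noteq> \<zero>\<^bsub>Q\<^esub>"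
  obtain a s where as: "x = frc a s" "a \<in> carrier A" "s \<in> nz" using Q_E x by blast
  have a: "a \<in> nz" using x as by (auto simp: frac_zero_iff)
  then show "x \<in> Units Q" using Q_inverse[of a s] Q_inverse[of s a] as
    by (auto simp: Units_def intro!: bexI[of _ "frc s a"])
qed

section \<open>Transfer of fractions along an embedding with denominators\<close>

text \<open>If every element of \<open>T\<close> can be multiplied into the subalgebra \<open>f R\<close> by a nonzero element of
  \<open>f R\<close>, then \<open>R\<close> and \<open>T\<close> have the same fractions.\<close>

locale localizing_embedding = R: nc_algebra K R + T: right_ore_domain K T
  for K :: "('k, 'm) ring_scheme" and R :: "('k, 'a) module" and T :: "('k, 'b) module" +
  fixes f
  assumes hom: "f \<in> alg_hom K R T" and inj: "inj_on f (carrier R)"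
    and dense: "t \<in> carrier T \<Longrightarrow> \<exists>s\<in>carrier R. s \<noteq> \<zero>\<^bsub>R\<^esub> \<and> t \<otimes>\<^bsub>T\<^esub> f s \<in> f ` carrier R"
begin

lemmas h = alg_hom_closed[OF hom] alg_hom_add[OF hom] alg_hom_mult[OF hom] alg_hom_one[OF hom]
    alg_hom_smult[OF hom] alg_hom_zero[OF R.nc_algebra_axioms T.nc_algebra_axioms hom]

lemma f_eq: "\<lbrakk>x \<in> carrier R; y \<in> carrier R\<rbrakk> \<Longrightarrow> f x = f y \<longleftrightarrow> x = y"
  using inj by (auto dest: inj_onD)

lemma f_zero: "x \<in> carrier R \<Longrightarrow> f x = \<zero>\<^bsub>T\<^esub> \<longleftrightarrow> x = \<zero>\<^bsub>R\<^esub>"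
  using f_eq[of x "\<zero>\<^bsub>R\<^esub>"] by (simp add: h)

sublocale R: nc_domain K R
proof unfold_locales
  show "\<one>\<^bsub>R\<^esub> \<noteq> \<zero>\<^bsub>R\<^esub>" using f_eq[of "\<one>\<^bsub>R\<^esub>" "\<zero>\<^bsub>R\<^esub>"] by (simp add: h)
  fix a b assume "a \<otimes>\<^bsub>R\<^esub> b = \<zero>\<^bsub>R\<^esub>" "a \<in> carrier R" "b \<in> carrier R"
  then show "a = \<zero>\<^bsub>R\<^esub> \<or> b = \<zero>\<^bsub>R\<^esub>" using T.no_zero_div[of "f a" "f b"] f_zero
    by (metis h(1,3,6))
qed

text \<open>The denominators are cleared one after the other: after \<open>s\<close> has cleared
  \<open>t\<close>, a second factor clears what \<open>t'\<close> has become, and the product serves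
  both.\<close>

lemma dense2:
  assumes "t \<in> carrier T" "t' \<in> carrier T"
  obtains s a b where "s \<in> carrier R" "s \<noteq> \<zero>\<^bsub>R\<^esub>" "a \<in> carrier R" "b \<in> carrier R"
    "t \<otimes>\<^bsub>T\<^esub> f s = f a" "t' \<otimes>\<^bsub>T\<^esub> f s = f b"
proof -
  obtain s a where s: "s \<in> carrier R" "s \<noteq> \<zero>\<^bsub>R\<^esub>" "a \<in> carrier R" "t \<otimes>\<^bsub>T\<^esub> f s = f a"
    using dense[OF assms(1)] by auto
  have "t' \<otimes>\<^bsub>T\<^esub> f s \<in> carrier T" using assms s by (simp add: h)
  from dense[OF this] obtain s' b where s': "s' \<in> carrier R" "s' \<noteq> \<zero>\<^bsub>R\<^esub>" "b \<in> carrier R"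
      "t' \<otimes>\<^bsub>T\<^esub> f s \<otimes>\<^bsub>T\<^esub> f s' = f b"
    by auto
  show ?thesis
    by (rule that[of "s \<otimes>\<^bsub>R\<^esub> s'" "a \<otimes>\<^bsub>R\<^esub> s'" b])
       (use s s' assms in \<open>auto simp: h R.mult_eq_zero_iff simp flip: T.m_assoc\<close>)
qed

text \<open>The Ore cofactors found in \<open>T\<close> are multiplied by one common denominator,
  which moves both of them into the image of \<open>R\<close>.\<close>

sublocale R: right_ore_domain K R
proof unfold_locales
  fix a b assume ab: "a \<in> carrier R" "b \<in> carrier R" "a \<noteq> \<zero>\<^bsub>R\<^esub>" "b \<noteq> \<zero>\<^bsub>R\<^esub>"
  then have "f a \<in> carrier T" "f b \<in> carrier T" "f a \<noteq> \<zero>\<^bsub>T\<^esub>" "f b \<noteq> \<zero>\<^bsub>T\<^esub>" by (auto simp: h f_zero)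
  from T.oreE[OF this] obtain u v where uv: "u \<in> carrier T" "v \<in> carrier T"
    "f a \<otimes>\<^bsub>T\<^esub> u = f b \<otimes>\<^bsub>T\<^esub> v" "u \<noteq> \<zero>\<^bsub>T\<^esub>" by metis
  obtain s x y where s: "s \<in> carrier R" "s \<noteq> \<zero>\<^bsub>R\<^esub>" "x \<in> carrier R" "y \<in> carrier R"
    "u \<otimes>\<^bsub>T\<^esub> f s = f x" "v \<otimes>\<^bsub>T\<^esub> f s = f y" using dense2[OF uv(1,2)] by metis
  have "f (a \<otimes>\<^bsub>R\<^esub> x) = f (b \<otimes>\<^bsub>R\<^esub> y)"
    using uv s ab by (simp add: h flip: s(5,6) T.m_assoc)
  then have "a \<otimes>\<^bsub>R\<^esub> x = b \<otimes>\<^bsub>R\<^esub> y" using f_eq s ab by simp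
  moreover have "f x \<noteq> \<zero>\<^bsub>T\<^esub>" using s uv by (simp add: h T.mult_eq_zero_iff f_zero flip: s(5))
  then have "a \<otimes>\<^bsub>R\<^esub> x \<noteq> \<zero>\<^bsub>R\<^esub>" using s ab by (simp add: f_zero R.mult_eq_zero_iff)
  ultimately show "\<exists>u\<in>carrier R. \<exists>v\<in>carrier R. a \<otimes>\<^bsub>R\<^esub> u = b \<otimes>\<^bsub>R\<^esub> v \<and> a \<otimes>\<^bsub>R\<^esub> u \<noteq> \<zero>\<^bsub>R\<^esub>"
    using s by blast
qed

text \<open>The union over the members of a class avoids choosing a representative;
  \<open>frac_map_frac\<close> shows that all members contribute the same class.\<close>

definition frac_map :: "('a \<times> 'a) set \<Rightarrow> ('b \<times> 'b) set"
  where "frac_map P = (\<Union>(a, s)\<in>P. fraction T (f a) (f s))"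

lemma f_nz: "s \<in> R.nz \<Longrightarrow> f s \<in> T.nz"
  by (simp add: h f_zero)

lemma frac_map_frac:
  assumes "a \<in> carrier R" "s \<in> R.nz"
  shows "frac_map (R.frc a s) = T.frc (f a) (f s)"
proof -
  have "T.frc (f b) (f t) = T.frc (f a) (f s)" if bt: "(b, t) \<in> R.frc a s" for b t
  proof -
    have c: "b \<in> carrier R" "t \<in> R.nz" "R.frc b t = R.frc a s" using bt assms by (auto simp: R.frac_mem)
    obtain u v where uv: "u \<in> R.nz" "v \<in> R.nz" "b \<otimes>\<^bsub>R\<^esub> u = a \<otimes>\<^bsub>R\<^esub> v" "t \<otimes>\<^bsub>R\<^esub> u = s \<otimes>\<^bsub>R\<^esub> v"
      using R.frac_eqE[OF c(3)] c assms by blast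
    have "f b \<otimes>\<^bsub>T\<^esub> f u = f a \<otimes>\<^bsub>T\<^esub> f v" "f t \<otimes>\<^bsub>T\<^esub> f u = f s \<otimes>\<^bsub>T\<^esub> f v"
      using arg_cong[OF uv(3), of f] arg_cong[OF uv(4), of f] uv(1,2) c assms by (simp_all add: h)
    then show ?thesis using uv(1,2) c assms
      by (intro T.frac_eqI[of _ "f u" _ "f v"]) (auto simp: h f_zero)
  qed
  then have "(\<lambda>(a, s). T.frc (f a) (f s)) p = T.frc (f a) (f s)" if "p \<in> R.frc a s" for p
    using that by (cases p) simp
  moreover have "(a, s) \<in> R.frc a s" using assms by (simp add: R.frac_mem)
  ultimately show ?thesis unfolding frac_map_def by (metis (mono_tags, lifting) SUP_eq_const empty_iff)
qed

lemma frac_map_iso: "frac_map \<in> alg_iso K (ring_of_fractions R) (ring_of_fractions T)"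
proof -
  note fm = frac_map_frac
  have "frac_map \<in> alg_hom K R.Q T.Q"
  proof (rule alg_homI)
    fix x assume x: "x \<in> carrier R.Q"
    obtain a s where as: "x = R.frc a s" "a \<in> carrier R" "s \<in> R.nz" by (rule R.Q_E[OF x])
    then show "frac_map x \<in> carrier T.Q" using f_nz by (simp add: fm h)
    fix y assume y: "y \<in> carrier R.Q"
    obtain c b t where cbt: "x = R.frc c t" "y = R.frc b t" "c \<in> carrier R" "b \<in> carrier R" "t \<in> R.nz"
      by (rule R.Q_E2[OF x y])
    show "frac_map (x \<oplus>\<^bsub>R.Q\<^esub> y) = frac_map x \<oplus>\<^bsub>T.Q\<^esub> frac_map y"
      using cbt f_nz by (simp add: R.Q_add fm T.Q_add h)
    obtain u t' where ut: "u \<in> carrier R" "t' \<in> R.nz" "y = R.frc (s \<otimes>\<^bsub>R\<^esub> u) t'"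
      by (rule R.Q_numerator[OF y as(3)])
    show "frac_map (x \<otimes>\<^bsub>R.Q\<^esub> y) = frac_map x \<otimes>\<^bsub>T.Q\<^esub> frac_map y"
      using as ut f_nz by (simp add: R.Q_mult fm T.Q_mult h)
  next
    show "frac_map \<one>\<^bsub>R.Q\<^esub> = \<one>\<^bsub>T.Q\<^esub>" by (simp add: R.Q_one T.Q_one fm h)
  next
    fix c x assume c: "c \<in> carrier K" and x: "x \<in> carrier R.Q"
    obtain a s where as: "x = R.frc a s" "a \<in> carrier R" "s \<in> R.nz" by (rule R.Q_E[OF x])
    then show "frac_map (c \<odot>\<^bsub>R.Q\<^esub> x) = c \<odot>\<^bsub>T.Q\<^esub> frac_map x"
      using c f_nz by (simp add: R.Q_smult fm T.Q_smult h)
  qed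
  moreover have "bij_betw frac_map (carrier R.Q) (carrier T.Q)"
  proof (rule bij_betwI')
    fix x y assume xy: "x \<in> carrier R.Q" "y \<in> carrier R.Q"
    obtain a b s where as: "x = R.frc a s" "y = R.frc b s" "a \<in> carrier R" "b \<in> carrier R" "s \<in> R.nz"
      by (rule R.Q_E2[OF xy])
    show "frac_map x = frac_map y \<longleftrightarrow> x = y"
    proof
      assume eq: "frac_map x = frac_map y"
      have e: "T.frc (f a) (f s) = T.frc (f b) (f s)"
        using eq fm[OF as(3,5)] fm[OF as(4,5)] unfolding as(1,2) by simp
      have "f a \<otimes>\<^bsub>T\<^esub> \<one>\<^bsub>T\<^esub> = f b \<otimes>\<^bsub>T\<^esub> \<one>\<^bsub>T\<^esub>"
        by (rule T.frac_eqD[OF e]) (use as f_nz in \<open>auto simp: h f_zero\<close>)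
      then have "a = b" using as by (simp add: h f_eq)
      then show "x = y" using as by simp
    qed simp
  next
    fix x assume "x \<in> carrier R.Q" then show "frac_map x \<in> carrier T.Q"
      by (rule alg_hom_closed[OF calculation])
  next
    fix y assume "y \<in> carrier T.Q"
    then obtain t t' where t: "y = T.frc t t'" "t \<in> carrier T" "t' \<in> T.nz" by (rule T.Q_E)
    \<comment> \<open>Expanding numerator and denominator by the same \<open>f s\<close> moves both
      into the image and leaves the fraction unchanged.\<close>
    obtain s a b where s: "s \<in> carrier R" "s \<noteq> \<zero>\<^bsub>R\<^esub>" "a \<in> carrier R" "b \<in> carrier R"
      "t \<otimes>\<^bsub>T\<^esub> f s = f a" "t' \<otimes>\<^bsub>T\<^esub> f s = f b"
      by (rule dense2[of t t']) (use t in auto)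
    have "f b \<noteq> \<zero>\<^bsub>T\<^esub>" using s t by (simp add: T.mult_eq_zero_iff h f_zero flip: s(6))
    then have b: "b \<in> R.nz" using s by (auto simp: h)
    have "y = T.frc (f a) (f b)" using t s T.frac_scale[of t t' "f s"] by (simp add: h f_zero)
    then have "y = frac_map (R.frc a b)" using s b by (simp add: fm)
    then show "\<exists>x\<in>carrier R.Q. y = frac_map x" using R.frac_in_Q s b by blast
  qed
  ultimately show ?thesis by (simp add: alg_iso_iff)
qed

end

section \<open>Twisted monoid algebras\<close>

text \<open>Gaussian elimination by induction on the equations. An equation with zero coefficients
  is dropped; otherwise one of its nonzero coefficients serves as a pivot, which removes one
  equation and one unknown and so preserves the strict inequality of the cardinalities.\<close>

lemma (in field) homogeneous_system:
  assumes "finite E" "finite U" "card E < card U"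
    and "\<And>e u. \<lbrakk>e \<in> E; u \<in> U\<rbrakk> \<Longrightarrow> M e u \<in> carrier R"
  shows "\<exists>x. x \<in> U \<rightarrow> carrier R \<and> (\<exists>u\<in>U. x u \<noteq> \<zero>) \<and> (\<forall>e\<in>E. (\<Oplus>u\<in>U. M e u \<otimes> x u) = \<zero>)"
  using assms
proof (induction E arbitrary: U M)
  case empty
  then obtain u where "u \<in> U" by fastforce
  then show ?case by (intro exI[of _ "\<lambda>_. \<one>"]) auto
next
  case (insert e E)
  note Mc = insert.prems(3)
  show ?case
  proof (cases "\<forall>u\<in>U. M e u = \<zero>")
    case True
    have "card E < card U" using insert by simp
    with insert.IH[of U M] insert.prems obtain x where x: "x \<in> U \<rightarrow> carrier R" "\<exists>u\<in>U. x u \<noteq> \<zero>"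
      "\<forall>e\<in>E. (\<Oplus>u\<in>U. M e u \<otimes> x u) = \<zero>" by auto
    have "(\<Oplus>u\<in>U. M e u \<otimes> x u) = (\<Oplus>u\<in>U. \<zero>)"
      by (rule finsum_cong') (use True x(1) in \<open>auto dest: funcset_mem\<close>)
    then show ?thesis using x by (intro exI[of _ x]) auto
  next
    case False
    then obtain u0 where u0: "u0 \<in> U" "M e u0 \<noteq> \<zero>" by blast
    define p where "p = inv (M e u0)"
    have p: "p \<in> carrier R" "M e u0 \<otimes> p = \<one>" using u0 Mc[of e u0] field_Units by (auto simp: p_def)
    define U' where "U' = U - {u0}"
    have U': "finite U'" "u0 \<notin> U'" "U = insert u0 U'" using u0 insert.prems by (auto simp: U'_def)
    have Mc': "M e' u \<in> carrier R" if "e' \<in> insert e E" "u \<in> insert u0 U'" for e' u using Mc that U' by auto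
    \<comment> \<open>Row operation: the multiple of row \<open>e\<close> that is subtracted makes
      the coefficient of \<open>u0\<close> vanish.\<close>
    define M' where "M' e' u = M e' u \<ominus> M e' u0 \<otimes> p \<otimes> M e u" for e' u
    have "card E < card U'" using insert U' by simp
    moreover have M'c: "M' e' u \<in> carrier R" if "e' \<in> E" "u \<in> U'" for e' u
      using Mc' that p by (simp add: M'_def)
    ultimately obtain x where x: "x \<in> U' \<rightarrow> carrier R" "\<exists>u\<in>U'. x u \<noteq> \<zero>"
      "\<forall>e\<in>E. (\<Oplus>u\<in>U'. M' e u \<otimes> x u) = \<zero>" using insert.IH[of U' M'] U' by blast
    define S where "S e' = (\<Oplus>u\<in>U'. M e' u \<otimes> x u)" for e'
    have xc: "x u \<in> carrier R" if "u \<in> U'" for u using x that by auto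
    have Sc: "S e' \<in> carrier R" if "e' \<in> insert e E" for e'
      unfolding S_def using that Mc' xc by (intro finsum_closed) auto
    \<comment> \<open>The eliminated unknown receives the value that solves the pivot equation
      \<open>e\<close>.\<close>
    define y where "y = x(u0 := \<ominus> (p \<otimes> S e))"
    have sum: "(\<Oplus>u\<in>U. M e' u \<otimes> y u) = M e' u0 \<otimes> (\<ominus> (p \<otimes> S e)) \<oplus> S e'" if e': "e' \<in> insert e E" for e'
    proof -
      have "(\<Oplus>u\<in>U. M e' u \<otimes> y u) = M e' u0 \<otimes> y u0 \<oplus> (\<Oplus>u\<in>U'. M e' u \<otimes> y u)"
        unfolding U'(3) by (rule finsum_insert) (use U' Mc' xc e' p Sc in \<open>auto simp: y_def\<close>)
      also have "(\<Oplus>u\<in>U'. M e' u \<otimes> y u) = S e'"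
        unfolding S_def by (rule finsum_cong') (use U' Mc' xc e' in \<open>auto simp: y_def\<close>)
      finally show ?thesis by (simp add: y_def)
    qed
    have "(\<Oplus>u\<in>U. M e u \<otimes> y u) = \<zero>"
    proof -
      have "M e u0 \<otimes> (\<ominus> (p \<otimes> S e)) = \<ominus> (M e u0 \<otimes> p \<otimes> S e)"
        using p(1) Sc Mc' by (simp add: r_minus m_assoc)
      also have "\<dots> = \<ominus> S e" unfolding p(2) using Sc by simp
      finally show ?thesis using sum[of e] Sc by (simp add: l_neg)
    qed
    moreover have "(\<Oplus>u\<in>U. M e' u \<otimes> y u) = \<zero>" if e': "e' \<in> E" for e'
    proof -
      have "\<zero> = (\<Oplus>u\<in>U'. M' e' u \<otimes> x u)" using x e' by simp
      also have "\<dots> = (\<Oplus>u\<in>U'. M e' u \<otimes> x u \<oplus> (\<ominus> (M e' u0 \<otimes> p)) \<otimes> (M e u \<otimes> x u))"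
        by (rule finsum_cong')
           (use Mc' xc e' p in \<open>auto simp: M'_def minus_eq l_distr l_minus m_assoc\<close>)
      also have "\<dots> = S e' \<oplus> (\<Oplus>u\<in>U'. (\<ominus> (M e' u0 \<otimes> p)) \<otimes> (M e u \<otimes> x u))"
        unfolding S_def by (rule finsum_addf) (use Mc' xc e' p in auto)
      also have "(\<Oplus>u\<in>U'. (\<ominus> (M e' u0 \<otimes> p)) \<otimes> (M e u \<otimes> x u)) = (\<ominus> (M e' u0 \<otimes> p)) \<otimes> S e"
        unfolding S_def by (rule finsum_rdistr[symmetric]) (use U' Mc' xc e' p in auto)
      finally show ?thesis using sum[of e'] e' p Sc Mc'
        by (simp add: r_minus l_minus m_assoc a_comm)
    qed
    moreover have "y \<in> U \<rightarrow> carrier R" using xc p Sc U' by (auto simp: y_def)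
    moreover have "\<exists>u\<in>U. y u \<noteq> \<zero>" using x U' by (auto simp: y_def)
    ultimately show ?thesis by (intro exI[of _ y]) auto
  qed
qed

text \<open>The multiplication is an arbitrary biadditive operation with given values on monomials, since it is written in
  different ways for words and for exponent vectors.\<close>

definition kmono :: "('k, 'm) ring_scheme \<Rightarrow> 'k \<Rightarrow> 'g \<Rightarrow> 'g \<Rightarrow> 'k"
  where "kmono K s a = (\<lambda>x. if x = a then s else \<zero>\<^bsub>K\<^esub>)"

locale monoid_algebra = K: field K
  for K :: "('k, 'm) ring_scheme" and A :: "('k, 'g \<Rightarrow> 'k) module" (structure)
    and M :: "'g set" and star :: "'g \<Rightarrow> 'g \<Rightarrow> 'g" (infixl \<open>\<star>\<close> 70) and e :: 'g
    and c :: "'g \<Rightarrow> 'g \<Rightarrow> 'k" +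
  assumes carrier_iff: "f \<in> carrier A \<longleftrightarrow>
      (\<forall>x. f x \<in> carrier K) \<and> finite {x. f x \<noteq> \<zero>\<^bsub>K\<^esub>} \<and> (\<forall>x. f x \<noteq> \<zero>\<^bsub>K\<^esub> \<longrightarrow> x \<in> M)"
    and add_def: "f \<oplus> g = (\<lambda>x. f x \<oplus>\<^bsub>K\<^esub> g x)"
    and zero_def: "\<zero> = (\<lambda>x. \<zero>\<^bsub>K\<^esub>)"
    and one_def: "\<one> = kmono K \<one>\<^bsub>K\<^esub> e"
    and smult_def: "k \<odot> f = (\<lambda>x. k \<otimes>\<^bsub>K\<^esub> f x)"
    and mult_closed: "\<lbrakk>f \<in> carrier A; g \<in> carrier A\<rbrakk> \<Longrightarrow> f \<otimes> g \<in> carrier A"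
    and distr_left: "\<lbrakk>f \<in> carrier A; g \<in> carrier A; h \<in> carrier A\<rbrakk> \<Longrightarrow> (f \<oplus> g) \<otimes> h = f \<otimes> h \<oplus> g \<otimes> h"
    and distr_right: "\<lbrakk>f \<in> carrier A; g \<in> carrier A; h \<in> carrier A\<rbrakk> \<Longrightarrow> f \<otimes> (g \<oplus> h) = f \<otimes> g \<oplus> f \<otimes> h"
    and mono_mult: "\<lbrakk>s \<in> carrier K; t \<in> carrier K; a \<in> M; b \<in> M\<rbrakk> \<Longrightarrow>
      kmono K s a \<otimes> kmono K t b = kmono K (s \<otimes>\<^bsub>K\<^esub> t \<otimes>\<^bsub>K\<^esub> c a b) (a \<star> b)"
    and unit_mem: "e \<in> M" and star_closed: "\<lbrakk>a \<in> M; b \<in> M\<rbrakk> \<Longrightarrow> a \<star> b \<in> M"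
    and star_assoc: "\<lbrakk>a \<in> M; b \<in> M; d \<in> M\<rbrakk> \<Longrightarrow> a \<star> b \<star> d = a \<star> (b \<star> d)"
    and star_unit: "a \<in> M \<Longrightarrow> e \<star> a = a" "a \<in> M \<Longrightarrow> a \<star> e = a"
    and c_closed: "\<lbrakk>a \<in> M; b \<in> M\<rbrakk> \<Longrightarrow> c a b \<in> carrier K"
    and c_unit: "a \<in> M \<Longrightarrow> c e a = \<one>\<^bsub>K\<^esub>" "a \<in> M \<Longrightarrow> c a e = \<one>\<^bsub>K\<^esub>"
    and cocycle: "\<lbrakk>a \<in> M; b \<in> M; d \<in> M\<rbrakk> \<Longrightarrow>
      c a b \<otimes>\<^bsub>K\<^esub> c (a \<star> b) d = c b d \<otimes>\<^bsub>K\<^esub> c a (b \<star> d)"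
begin

lemma mono_closed: "\<lbrakk>s \<in> carrier K; a \<in> M\<rbrakk> \<Longrightarrow> kmono K s a \<in> carrier A"
  unfolding carrier_iff kmono_def by (auto intro: finite_subset[of _ "{a}"])

lemma add_closed': "\<lbrakk>f \<in> carrier A; g \<in> carrier A\<rbrakk> \<Longrightarrow> f \<oplus> g \<in> carrier A"
  unfolding carrier_iff add_def
  by (auto intro: finite_subset[of _ "{x. f x \<noteq> \<zero>\<^bsub>K\<^esub>} \<union> {x. g x \<noteq> \<zero>\<^bsub>K\<^esub>}"]) (metis K.l_zero K.zero_closed)

lemma smult_closed': "\<lbrakk>k \<in> carrier K; f \<in> carrier A\<rbrakk> \<Longrightarrow> k \<odot> f \<in> carrier A"
  unfolding carrier_iff smult_def
  by (auto intro: finite_subset[of _ "{x. f x \<noteq> \<zero>\<^bsub>K\<^esub>}"]) (metis K.r_null)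

lemma zero_closed': "\<zero> \<in> carrier A"
  unfolding carrier_iff zero_def by simp

text \<open>Induction on the support, splitting off one monomial at a time. It reduces additive
  statements to monomials and is used for almost all identities in these algebras.\<close>

lemma carrier_induct [consumes 1, case_names zero add]:
  assumes "f \<in> carrier A" "P \<zero>"
    and "\<And>g s a. \<lbrakk>g \<in> carrier A; s \<in> carrier K; a \<in> M; P g\<rbrakk> \<Longrightarrow> P (kmono K s a \<oplus> g)"
  shows "P f"
proof -
  have "finite S \<Longrightarrow> \<forall>f. f \<in> carrier A \<longrightarrow> {x. f x \<noteq> \<zero>\<^bsub>K\<^esub>} = S \<longrightarrow> P f" for S
  proof (induction S rule: finite_induct)
    case empty
    then show ?case using assms(2) by (auto simp: zero_def carrier_iff fun_eq_iff dest: ext)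
  next
    case (insert a S)
    show ?case
    proof (intro allI impI)
      fix f assume f: "f \<in> carrier A" "{x. f x \<noteq> \<zero>\<^bsub>K\<^esub>} = insert a S"
      let ?g = "f(a := \<zero>\<^bsub>K\<^esub>)"
      have fa: "f a \<in> carrier K" "a \<in> M" using f unfolding carrier_iff by auto
      have supp: "{x. ?g x \<noteq> \<zero>\<^bsub>K\<^esub>} = S" using f(2) insert.hyps by auto
      have g: "?g \<in> carrier A" using f(1) supp insert.hyps unfolding carrier_iff by auto
      have "f = kmono K (f a) a \<oplus> ?g" using f(1) unfolding add_def kmono_def carrier_iff by (auto simp: fun_eq_iff)
      then show "P f" using assms(3)[OF g fa] insert.IH supp g by metis
    qed
  qed
  then show ?thesis using assms(1) by (metis carrier_iff)
qed

lemma add_assoc': "\<lbrakk>f \<in> carrier A; g \<in> carrier A; h \<in> carrier A\<rbrakk> \<Longrightarrow> f \<oplus> g \<oplus> h = f \<oplus> (g \<oplus> h)"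
  unfolding carrier_iff add_def by (simp add: K.a_assoc)

lemma add_group: "abelian_group A"
proof (rule abelian_groupI)
  fix x assume x: "x \<in> carrier A"
  show "\<exists>y\<in>carrier A. y \<oplus> x = \<zero>"
    by (rule bexI[of _ "(\<ominus>\<^bsub>K\<^esub> \<one>\<^bsub>K\<^esub>) \<odot> x"])
      (use x in \<open>simp_all add: smult_closed'\<close>,
       simp add: carrier_iff zero_def add_def smult_def K.l_neg K.l_minus)
qed (simp_all add: add_closed' zero_closed' add_assoc',
     simp_all add: carrier_iff add_def zero_def K.a_comm)

interpretation add: abelian_group A by (rule add_group)

lemma zero_mult: "f \<in> carrier A \<Longrightarrow> \<zero> \<otimes> f = \<zero>" "f \<in> carrier A \<Longrightarrow> f \<otimes> \<zero> = \<zero>"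
  using distr_left[of \<zero> \<zero> f] distr_right[of f \<zero> \<zero>] mult_closed zero_closed' add.add.l_cancel_one
  by (metis add.l_zero)+

lemma smult_add: "\<lbrakk>k \<in> carrier K; f \<in> carrier A; g \<in> carrier A\<rbrakk> \<Longrightarrow> k \<odot> (f \<oplus> g) = k \<odot> f \<oplus> k \<odot> g"
  unfolding carrier_iff add_def smult_def by (simp add: K.r_distr)

lemma smult_mono: "k \<in> carrier K \<Longrightarrow> k \<odot> kmono K s a = kmono K (k \<otimes>\<^bsub>K\<^esub> s) a"
  unfolding kmono_def smult_def by auto

lemma smult_zero: "k \<in> carrier K \<Longrightarrow> k \<odot> \<zero> = \<zero>"
  by (simp add: zero_def smult_def)

text \<open>Biadditive identities need only be checked on monomials.\<close>

lemma nc_algebra: "nc_algebra K A"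
proof (intro nc_algebra.intro nc_algebra_axioms.intro ringI add_group monoidI)
  note cl = mult_closed add_closed' smult_closed' zero_closed' mono_closed distr_left distr_right
    zero_mult smult_add smult_zero
  note mc = mono_mult star_closed c_closed star_assoc
  show "field K" by unfold_locales
  \<comment> \<open>On monomials associativity is exactly the cocycle identity.\<close>
  have assoc_mono: "kmono K s a \<otimes> kmono K t b \<otimes> kmono K u d = kmono K s a \<otimes> (kmono K t b \<otimes> kmono K u d)"
    if "s \<in> carrier K" "t \<in> carrier K" "u \<in> carrier K" "a \<in> M" "b \<in> M" "d \<in> M" for s t u a b d
  proof -
    have "s \<otimes>\<^bsub>K\<^esub> t \<otimes>\<^bsub>K\<^esub> c a b \<otimes>\<^bsub>K\<^esub> u \<otimes>\<^bsub>K\<^esub> c (a \<star> b) d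
      = s \<otimes>\<^bsub>K\<^esub> t \<otimes>\<^bsub>K\<^esub> u \<otimes>\<^bsub>K\<^esub> (c a b \<otimes>\<^bsub>K\<^esub> c (a \<star> b) d)"
      using that by (simp add: c_closed star_closed K.m_ac)
    also have "\<dots> = s \<otimes>\<^bsub>K\<^esub> (t \<otimes>\<^bsub>K\<^esub> u \<otimes>\<^bsub>K\<^esub> c b d) \<otimes>\<^bsub>K\<^esub> c a (b \<star> d)"
      unfolding cocycle[OF that(4-6)] using that by (simp add: c_closed star_closed K.m_ac)
    finally show ?thesis using that by (simp add: mc)
  qed
  \<comment> \<open>Monomials are replaced by general elements one factor at a time, starting with
    the last.\<close>
  have assoc2: "kmono K s a \<otimes> kmono K t b \<otimes> h = kmono K s a \<otimes> (kmono K t b \<otimes> h)"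
    if "s \<in> carrier K" "t \<in> carrier K" "a \<in> M" "b \<in> M" "h \<in> carrier A" for s t a b h
    using that(5) by (induction rule: carrier_induct) (use that in \<open>simp_all add: cl assoc_mono\<close>)
  have assoc1: "kmono K s a \<otimes> g \<otimes> h = kmono K s a \<otimes> (g \<otimes> h)"
    if "s \<in> carrier K" "a \<in> M" "g \<in> carrier A" "h \<in> carrier A" for s a g h
    using that(3) by (induction rule: carrier_induct) (use that in \<open>simp_all add: cl assoc2\<close>)
  fix x y z assume xyz: "x \<in> carrier A" "y \<in> carrier A" "z \<in> carrier A"
  show "x \<otimes> y \<otimes> z = x \<otimes> (y \<otimes> z)"
    using xyz(1) by (induction rule: carrier_induct) (use xyz in \<open>simp_all add: cl assoc1\<close>)
  show "(x \<oplus> y) \<otimes> z = x \<otimes> z \<oplus> y \<otimes> z" "z \<otimes> (x \<oplus> y) = z \<otimes> x \<oplus> z \<otimes> y"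
    using xyz by (simp_all add: cl)
next
  show "\<one> \<in> carrier A" by (simp add: one_def mono_closed unit_mem)
  fix x assume "x \<in> carrier A"
  then show "\<one> \<otimes> x = x" "x \<otimes> \<one> = x"
    by (induction rule: carrier_induct)
       (simp_all add: one_def unit_mem mono_closed zero_mult distr_left distr_right mono_mult star_unit c_unit c_closed)
  show "\<one>\<^bsub>K\<^esub> \<odot> x = x" using \<open>x \<in> carrier A\<close> by (simp add: smult_def carrier_iff)
next
  fix k l x assume "k \<in> carrier K" "l \<in> carrier K" "x \<in> carrier A"
  then show "(k \<oplus>\<^bsub>K\<^esub> l) \<odot> x = k \<odot> x \<oplus> l \<odot> x" "(k \<otimes>\<^bsub>K\<^esub> l) \<odot> x = k \<odot> (l \<odot> x)"
    by (simp_all add: smult_def carrier_iff add_def K.l_distr K.m_assoc)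
next
  note cl = mult_closed add_closed' smult_closed' zero_closed' mono_closed distr_left distr_right
    zero_mult smult_add smult_zero
  fix k x y assume k: "k \<in> carrier K" and xy: "x \<in> carrier A" "y \<in> carrier A"
  have 1: "(k \<odot> kmono K s a) \<otimes> y = k \<odot> (kmono K s a \<otimes> y)" if "s \<in> carrier K" "a \<in> M" for s a
    using xy(2) by (induction rule: carrier_induct)
      (use that k in \<open>simp_all add: cl\<close>, simp add: smult_mono mono_mult c_closed K.m_ac)
  show "(k \<odot> x) \<otimes> y = k \<odot> (x \<otimes> y)"
    using xy(1) by (induction rule: carrier_induct) (use k xy in \<open>simp_all add: cl 1\<close>)
  have 2: "kmono K s a \<otimes> (k \<odot> y) = k \<odot> (kmono K s a \<otimes> y)" if "s \<in> carrier K" "a \<in> M" for s a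
    using xy(2) by (induction rule: carrier_induct)
      (use that k in \<open>simp_all add: cl\<close>, simp add: smult_mono mono_mult c_closed K.m_ac)
  show "x \<otimes> (k \<odot> y) = k \<odot> (x \<otimes> y)"
    using xy(1) by (induction rule: carrier_induct) (use k xy in \<open>simp_all add: cl 2\<close>)
  show "k \<odot> (x \<oplus> y) = k \<odot> x \<oplus> k \<odot> y" by (simp add: cl k xy)
qed (simp_all add: mult_closed smult_closed')

end

sublocale monoid_algebra \<subseteq> nc_algebra K A by (rule nc_algebra)

section \<open>The universal property of a twisted monoid algebra\<close>

definition linear_ext :: "('k, 'm) ring_scheme \<Rightarrow> ('k, 's) module \<Rightarrow> ('g \<Rightarrow> 's) \<Rightarrow> ('g \<Rightarrow> 'k) \<Rightarrow> 's"
  where "linear_ext K S \<phi> f = (\<Oplus>\<^bsub>S\<^esub>x\<in>{x. f x \<noteq> \<zero>\<^bsub>K\<^esub>}. f x \<odot>\<^bsub>S\<^esub> \<phi> x)"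

context monoid_algebra
begin

context
  fixes S :: "('k, 's) module" and \<phi>
  assumes S: "nc_algebra K S" and \<phi>: "\<And>a. a \<in> M \<Longrightarrow> \<phi> a \<in> carrier S"
begin

interpretation S: nc_algebra K S by (rule S)

lemma linear_ext_superset:
  assumes "f \<in> carrier A" "finite B" "B \<subseteq> M" "{x. f x \<noteq> \<zero>\<^bsub>K\<^esub>} \<subseteq> B"
  shows "linear_ext K S \<phi> f = (\<Oplus>\<^bsub>S\<^esub>x\<in>B. f x \<odot>\<^bsub>S\<^esub> \<phi> x)"
  unfolding linear_ext_def
  by (rule S.add.finprod_mono_neutral_cong_left) (use assms \<phi> in \<open>auto simp: carrier_iff\<close>)

lemma linear_ext_closed: "f \<in> carrier A \<Longrightarrow> linear_ext K S \<phi> f \<in> carrier S"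
  unfolding linear_ext_def by (rule S.finsum_closed) (auto simp: carrier_iff \<phi>)

lemma linear_ext_mono: "\<lbrakk>s \<in> carrier K; a \<in> M\<rbrakk> \<Longrightarrow> linear_ext K S \<phi> (kmono K s a) = s \<odot>\<^bsub>S\<^esub> \<phi> a"
  by (subst linear_ext_superset[of _ "{a}"]) (auto simp: mono_closed \<phi>, auto simp: kmono_def \<phi> split: if_splits)

lemma linear_ext_add:
  assumes "f \<in> carrier A" "g \<in> carrier A"
  shows "linear_ext K S \<phi> (f \<oplus> g) = linear_ext K S \<phi> f \<oplus>\<^bsub>S\<^esub> linear_ext K S \<phi> g"
proof -
  define B where "B = {x. f x \<noteq> \<zero>\<^bsub>K\<^esub>} \<union> {x. g x \<noteq> \<zero>\<^bsub>K\<^esub>}"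
  have B: "finite B" "B \<subseteq> M" using assms by (auto simp: B_def carrier_iff)
  have c: "f x \<in> carrier K" "g x \<in> carrier K" for x using assms by (auto simp: carrier_iff)
  have "{x. (f \<oplus> g) x \<noteq> \<zero>\<^bsub>K\<^esub>} \<subseteq> B" by (auto simp: B_def add_def)
  then have "linear_ext K S \<phi> (f \<oplus> g) = (\<Oplus>\<^bsub>S\<^esub>x\<in>B. (f \<oplus> g) x \<odot>\<^bsub>S\<^esub> \<phi> x)"
    using assms B by (intro linear_ext_superset) auto
  also have "\<dots> = (\<Oplus>\<^bsub>S\<^esub>x\<in>B. f x \<odot>\<^bsub>S\<^esub> \<phi> x \<oplus>\<^bsub>S\<^esub> g x \<odot>\<^bsub>S\<^esub> \<phi> x)"
    by (rule S.finsum_cong') (use B \<phi> c in \<open>auto simp: add_def S.smult_l_distr\<close>)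
  also have "\<dots> = (\<Oplus>\<^bsub>S\<^esub>x\<in>B. f x \<odot>\<^bsub>S\<^esub> \<phi> x) \<oplus>\<^bsub>S\<^esub> (\<Oplus>\<^bsub>S\<^esub>x\<in>B. g x \<odot>\<^bsub>S\<^esub> \<phi> x)"
    by (rule S.finsum_addf) (use B \<phi> c in auto)
  also have "(\<Oplus>\<^bsub>S\<^esub>x\<in>B. f x \<odot>\<^bsub>S\<^esub> \<phi> x) = linear_ext K S \<phi> f"
    by (rule linear_ext_superset[symmetric]) (use assms B in \<open>auto simp: B_def\<close>)
  also have "(\<Oplus>\<^bsub>S\<^esub>x\<in>B. g x \<odot>\<^bsub>S\<^esub> \<phi> x) = linear_ext K S \<phi> g"
    by (rule linear_ext_superset[symmetric]) (use assms B in \<open>auto simp: B_def\<close>)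
  finally show ?thesis .
qed

text \<open>Both sides of multiplicativity are biadditive, so the hypothesis on basis elements,
  twisted by \<open>c\<close>, is enough. It turns the free algebra into a source of maps to the
  torus.\<close>

lemma linear_ext_hom:
  assumes one: "\<phi> e = \<one>\<^bsub>S\<^esub>"
    and mult: "\<And>a b. \<lbrakk>a \<in> M; b \<in> M\<rbrakk> \<Longrightarrow> \<phi> a \<otimes>\<^bsub>S\<^esub> \<phi> b = c a b \<odot>\<^bsub>S\<^esub> \<phi> (a \<star> b)"
  shows "linear_ext K S \<phi> \<in> alg_hom K A S"
proof (rule alg_homI)
  let ?L = "linear_ext K S \<phi>"
  have L0: "?L \<zero> = \<zero>\<^bsub>S\<^esub>" by (simp add: linear_ext_def zero_def)
  note r = linear_ext_add linear_ext_closed linear_ext_mono L0 mono_closed S.l_distr S.r_distr \<phi>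
    S.smult_r_distr smult_add smult_zero distr_left distr_right
  fix f g assume f: "f \<in> carrier A" and g: "g \<in> carrier A"
  have mm: "?L (kmono K s a \<otimes> kmono K t b) = ?L (kmono K s a) \<otimes>\<^bsub>S\<^esub> ?L (kmono K t b)"
    if "s \<in> carrier K" "t \<in> carrier K" "a \<in> M" "b \<in> M" for s t a b
    using that by (simp add: mono_mult linear_ext_mono c_closed star_closed \<phi> S.smult_mult_left
        S.smult_mult_right mult)
      (simp add: c_closed star_closed \<phi> K.m_ac flip: S.smult_assoc)
  have mg: "?L (kmono K s a \<otimes> g) = ?L (kmono K s a) \<otimes>\<^bsub>S\<^esub> ?L g" if "s \<in> carrier K" "a \<in> M" for s a
    using g by (induction rule: carrier_induct) (use that mm in \<open>simp_all add: r\<close>)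
  show "?L (f \<otimes> g) = ?L f \<otimes>\<^bsub>S\<^esub> ?L g"
    using f by (induction rule: carrier_induct) (use g mg in \<open>simp_all add: r\<close>)
next
  show "linear_ext K S \<phi> \<one> = \<one>\<^bsub>S\<^esub>"
    by (simp add: one_def linear_ext_mono unit_mem one)
next
  let ?L = "linear_ext K S \<phi>"
  have L0: "?L \<zero> = \<zero>\<^bsub>S\<^esub>" by (simp add: linear_ext_def zero_def)
  fix k f assume k: "k \<in> carrier K" and f: "f \<in> carrier A"
  show "?L (k \<odot> f) = k \<odot>\<^bsub>S\<^esub> ?L f"
    using f by (induction rule: carrier_induct)
      (use k in \<open>simp_all add: linear_ext_add linear_ext_closed L0 mono_closed S.smult_r_distr smult_add smult_zero smult_mono linear_ext_mono \<phi> S.smult_assoc\<close>)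
qed (simp_all add: linear_ext_add linear_ext_closed)

end

end


section \<open>Twisted group algebras\<close>

text \<open>Convolution: the coefficient at \<open>x\<close> collects the products of the terms at
  \<open>a\<close> and \<open>x - a\<close>, each twisted by \<open>c a (x - a)\<close>. Summing
  over the support of \<open>f\<close> keeps the sum finite.\<close>

definition twisted_group_algebra ::
    "('k, 'm) ring_scheme \<Rightarrow> 'g::ab_group_add set \<Rightarrow> ('g \<Rightarrow> 'g \<Rightarrow> 'k) \<Rightarrow> ('k, 'g \<Rightarrow> 'k) module"
  where "twisted_group_algebra K H c =
    \<lparr> carrier = {f. (\<forall>x. f x \<in> carrier K) \<and> finite {x. f x \<noteq> \<zero>\<^bsub>K\<^esub>} \<and> (\<forall>x. f x \<noteq> \<zero>\<^bsub>K\<^esub> \<longrightarrow> x \<in> H)},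
      monoid.mult = (\<lambda>f g x. \<Oplus>\<^bsub>K\<^esub>a\<in>{a. f a \<noteq> \<zero>\<^bsub>K\<^esub>}. f a \<otimes>\<^bsub>K\<^esub> c a (x - a) \<otimes>\<^bsub>K\<^esub> g (x - a)),
      one = kmono K \<one>\<^bsub>K\<^esub> 0,
      ring.zero = (\<lambda>x. \<zero>\<^bsub>K\<^esub>),
      add = (\<lambda>f g x. f x \<oplus>\<^bsub>K\<^esub> g x),
      smult = (\<lambda>k f x. k \<otimes>\<^bsub>K\<^esub> f x) \<rparr>"

text \<open>A bicharacter is in particular a cocycle. The group order on exponents supplies the
  leading terms that rule out zero divisors; the subgroup \<open>H\<close> restricts the
  supports.\<close>

locale bicharacter = K: field K
  for K :: "('k, 'm) ring_scheme" +
  fixes H :: "'g::linordered_ab_group_add set" and c :: "'g \<Rightarrow> 'g \<Rightarrow> 'k"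
  assumes c_closed [simp]: "c a b \<in> carrier K" and c_nonzero [simp]: "c a b \<noteq> \<zero>\<^bsub>K\<^esub>"
    and c_add_left: "c (a + a') b = c a b \<otimes>\<^bsub>K\<^esub> c a' b"
    and c_add_right: "c a (b + b') = c a b \<otimes>\<^bsub>K\<^esub> c a b'"
    and H_zero: "0 \<in> H" and H_add: "\<lbrakk>a \<in> H; b \<in> H\<rbrakk> \<Longrightarrow> a + b \<in> H" and H_minus: "a \<in> H \<Longrightarrow> - a \<in> H"
begin

abbreviation T where "T \<equiv> twisted_group_algebra K H c"

lemma c_zero_left [simp]: "c 0 b = \<one>\<^bsub>K\<^esub>"
proof -
  have "c 0 b \<otimes>\<^bsub>K\<^esub> c 0 b = c 0 b \<otimes>\<^bsub>K\<^esub> \<one>\<^bsub>K\<^esub>" using c_add_left[of 0 0 b] by simp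
  then show ?thesis by (subst (asm) K.m_lcancel) simp_all
qed

lemma c_zero_right [simp]: "c a 0 = \<one>\<^bsub>K\<^esub>"
proof -
  have "c a 0 \<otimes>\<^bsub>K\<^esub> c a 0 = c a 0 \<otimes>\<^bsub>K\<^esub> \<one>\<^bsub>K\<^esub>" using c_add_right[of a 0 0] by simp
  then show ?thesis by (subst (asm) K.m_lcancel) simp_all
qed

abbreviation supp where "supp f \<equiv> {x. f x \<noteq> \<zero>\<^bsub>K\<^esub>}"

lemma T_carrier: "f \<in> carrier T \<longleftrightarrow>
    (\<forall>x. f x \<in> carrier K) \<and> finite (supp f) \<and> (\<forall>x. f x \<noteq> \<zero>\<^bsub>K\<^esub> \<longrightarrow> x \<in> H)"
  by (simp add: twisted_group_algebra_def)

lemma T_apply: "f \<in> carrier T \<Longrightarrow> f x \<in> carrier K"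
  by (simp add: T_carrier)

lemma mult_apply:
  assumes "f \<in> carrier T" "g \<in> carrier T" "finite B" "supp f \<subseteq> B"
  shows "(f \<otimes>\<^bsub>T\<^esub> g) x = (\<Oplus>\<^bsub>K\<^esub>a\<in>B. f a \<otimes>\<^bsub>K\<^esub> c a (x - a) \<otimes>\<^bsub>K\<^esub> g (x - a))"
proof -
  have "(\<Oplus>\<^bsub>K\<^esub>a\<in>supp f. f a \<otimes>\<^bsub>K\<^esub> c a (x - a) \<otimes>\<^bsub>K\<^esub> g (x - a))
      = (\<Oplus>\<^bsub>K\<^esub>a\<in>B. f a \<otimes>\<^bsub>K\<^esub> c a (x - a) \<otimes>\<^bsub>K\<^esub> g (x - a))"
    by (rule K.add.finprod_mono_neutral_cong_left)
       (use assms in \<open>auto simp: T_apply\<close>)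
  then show ?thesis by (simp add: twisted_group_algebra_def)
qed

text \<open>Substituting \<open>a = x - b\<close> turns the convolution into a sum over the second
  factor. In the Ore equation the unknown stands on the right, and this form is linear in its
  coefficients.\<close>

lemma mult_apply_right:
  assumes f: "f \<in> carrier T" and g: "g \<in> carrier T" and B: "finite B" "supp g \<subseteq> B"
  shows "(f \<otimes>\<^bsub>T\<^esub> g) x = (\<Oplus>\<^bsub>K\<^esub>b\<in>B. f (x - b) \<otimes>\<^bsub>K\<^esub> c (x - b) b \<otimes>\<^bsub>K\<^esub> g b)"
proof -
  define S where "S = supp f \<union> (\<lambda>b. x - b) ` B"
  have fin: "finite S" using B f by (auto simp: S_def T_carrier)
  have "(f \<otimes>\<^bsub>T\<^esub> g) x = (\<Oplus>\<^bsub>K\<^esub>a\<in>S. f a \<otimes>\<^bsub>K\<^esub> c a (x - a) \<otimes>\<^bsub>K\<^esub> g (x - a))"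
    by (rule mult_apply) (use f g fin in \<open>auto simp: S_def\<close>)
  also have "\<dots> = (\<Oplus>\<^bsub>K\<^esub>a\<in>(\<lambda>b. x - b) ` B. f a \<otimes>\<^bsub>K\<^esub> c a (x - a) \<otimes>\<^bsub>K\<^esub> g (x - a))"
  proof (rule K.add.finprod_mono_neutral_cong_right)
    fix a assume "a \<in> S - (\<lambda>b. x - b) ` B"
    then have "x - a \<notin> B" by (metis DiffD2 diff_diff_eq2 add_diff_cancel_left' image_eqI)
    then have "g (x - a) = \<zero>\<^bsub>K\<^esub>" using B by auto
    then show "f a \<otimes>\<^bsub>K\<^esub> c a (x - a) \<otimes>\<^bsub>K\<^esub> g (x - a) = \<zero>\<^bsub>K\<^esub>" using f by (simp add: T_apply)
  qed (use fin f g in \<open>auto simp: S_def T_apply\<close>)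
  also have "\<dots> = (\<Oplus>\<^bsub>K\<^esub>b\<in>B. f (x - b) \<otimes>\<^bsub>K\<^esub> c (x - b) (x - (x - b)) \<otimes>\<^bsub>K\<^esub> g (x - (x - b)))"
    by (rule K.finsum_reindex) (use f g in \<open>auto simp: T_apply inj_on_def\<close>)
  finally show ?thesis by simp
qed

lemma supp_mult:
  assumes "f \<in> carrier T" "g \<in> carrier T"
  shows "supp (f \<otimes>\<^bsub>T\<^esub> g) \<subseteq> (\<lambda>(a, b). a + b) ` (supp f \<times> supp g)"
proof
  fix x assume x: "x \<in> supp (f \<otimes>\<^bsub>T\<^esub> g)"
  have "\<exists>a\<in>supp f. g (x - a) \<noteq> \<zero>\<^bsub>K\<^esub>"
  proof (rule ccontr)
    assume *: "\<not> ?thesis"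
    have "(f \<otimes>\<^bsub>T\<^esub> g) x = (\<Oplus>\<^bsub>K\<^esub>a\<in>supp f. \<zero>\<^bsub>K\<^esub>)"
      by (subst mult_apply[OF assms _ subset_refl], use assms in \<open>simp add: T_carrier\<close>,
        rule K.finsum_cong') (use * assms in \<open>auto simp: T_apply\<close>)
    then show False using x by simp
  qed
  then obtain a where "a \<in> supp f" "x - a \<in> supp g" by blast
  then show "x \<in> (\<lambda>(a, b). a + b) ` (supp f \<times> supp g)" by (intro image_eqI[of _ _ "(a, x - a)"]) auto
qed

lemma mult_closed_T:
  assumes "f \<in> carrier T" "g \<in> carrier T" shows "f \<otimes>\<^bsub>T\<^esub> g \<in> carrier T"
  unfolding T_carrier[of "f \<otimes>\<^bsub>T\<^esub> g"]
proof (intro conjI allI impI)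
  fix x
  have "finite (supp f)" using assms by (simp add: T_carrier)
  then show "(f \<otimes>\<^bsub>T\<^esub> g) x \<in> carrier K"
    using assms by (simp add: mult_apply[OF assms _ subset_refl]) (auto intro!: K.finsum_closed simp: T_apply)
  show "finite (supp (f \<otimes>\<^bsub>T\<^esub> g))"
    by (rule finite_subset[OF supp_mult[OF assms]]) (use assms in \<open>auto simp: T_carrier\<close>)
  assume "(f \<otimes>\<^bsub>T\<^esub> g) x \<noteq> \<zero>\<^bsub>K\<^esub>"
  then show "x \<in> H" using supp_mult[OF assms] assms H_add by (auto simp: T_carrier)
qed

lemma T_add: "f \<oplus>\<^bsub>T\<^esub> g = (\<lambda>x. f x \<oplus>\<^bsub>K\<^esub> g x)" and T_zero: "\<zero>\<^bsub>T\<^esub> = (\<lambda>x. \<zero>\<^bsub>K\<^esub>)"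
  and T_one: "\<one>\<^bsub>T\<^esub> = kmono K \<one>\<^bsub>K\<^esub> 0" and T_smult: "k \<odot>\<^bsub>T\<^esub> f = (\<lambda>x. k \<otimes>\<^bsub>K\<^esub> f x)"
  by (simp_all add: twisted_group_algebra_def)

lemma T_add_closed: "\<lbrakk>f \<in> carrier T; g \<in> carrier T\<rbrakk> \<Longrightarrow> f \<oplus>\<^bsub>T\<^esub> g \<in> carrier T"
  unfolding T_carrier T_add
  by (auto intro: finite_subset[of _ "supp f \<union> supp g"]) (metis K.l_zero K.zero_closed)

lemma T_mono_closed: "\<lbrakk>s \<in> carrier K; a \<in> H\<rbrakk> \<Longrightarrow> kmono K s a \<in> carrier T"
  unfolding T_carrier kmono_def by (auto intro: finite_subset[of _ "{a}"])

lemma T_distr_left: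
  assumes "f \<in> carrier T" "g \<in> carrier T" "h \<in> carrier T"
  shows "(f \<oplus>\<^bsub>T\<^esub> g) \<otimes>\<^bsub>T\<^esub> h = f \<otimes>\<^bsub>T\<^esub> h \<oplus>\<^bsub>T\<^esub> g \<otimes>\<^bsub>T\<^esub> h"
proof
  fix x
  define B where "B = supp f \<union> supp g"
  have B: "finite B" "supp f \<subseteq> B" "supp g \<subseteq> B" "supp (f \<oplus>\<^bsub>T\<^esub> g) \<subseteq> B"
    using assms by (auto simp: B_def T_carrier T_add)
  have "((f \<oplus>\<^bsub>T\<^esub> g) \<otimes>\<^bsub>T\<^esub> h) x = (\<Oplus>\<^bsub>K\<^esub>a\<in>B. (f \<oplus>\<^bsub>T\<^esub> g) a \<otimes>\<^bsub>K\<^esub> c a (x - a) \<otimes>\<^bsub>K\<^esub> h (x - a))"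
    by (rule mult_apply) (use assms B T_add_closed in auto)
  also have "\<dots> = (\<Oplus>\<^bsub>K\<^esub>a\<in>B. f a \<otimes>\<^bsub>K\<^esub> c a (x - a) \<otimes>\<^bsub>K\<^esub> h (x - a) \<oplus>\<^bsub>K\<^esub> g a \<otimes>\<^bsub>K\<^esub> c a (x - a) \<otimes>\<^bsub>K\<^esub> h (x - a))"
    by (rule K.finsum_cong') (use assms in \<open>auto simp: T_apply T_add K.l_distr\<close>)
  also have "\<dots> = (\<Oplus>\<^bsub>K\<^esub>a\<in>B. f a \<otimes>\<^bsub>K\<^esub> c a (x - a) \<otimes>\<^bsub>K\<^esub> h (x - a)) \<oplus>\<^bsub>K\<^esub>
      (\<Oplus>\<^bsub>K\<^esub>a\<in>B. g a \<otimes>\<^bsub>K\<^esub> c a (x - a) \<otimes>\<^bsub>K\<^esub> h (x - a))"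
    by (rule K.finsum_addf) (use assms in \<open>auto simp: T_apply\<close>)
  also have "\<dots> = (f \<otimes>\<^bsub>T\<^esub> h \<oplus>\<^bsub>T\<^esub> g \<otimes>\<^bsub>T\<^esub> h) x"
    using assms B by (simp add: T_add mult_apply[of f h B] mult_apply[of g h B])
  finally show "((f \<oplus>\<^bsub>T\<^esub> g) \<otimes>\<^bsub>T\<^esub> h) x = (f \<otimes>\<^bsub>T\<^esub> h \<oplus>\<^bsub>T\<^esub> g \<otimes>\<^bsub>T\<^esub> h) x" .
qed

lemma T_distr_right:
  assumes "f \<in> carrier T" "g \<in> carrier T" "h \<in> carrier T"
  shows "f \<otimes>\<^bsub>T\<^esub> (g \<oplus>\<^bsub>T\<^esub> h) = f \<otimes>\<^bsub>T\<^esub> g \<oplus>\<^bsub>T\<^esub> f \<otimes>\<^bsub>T\<^esub> h"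
proof
  fix x
  define B where "B = supp f"
  have B: "finite B" "supp f \<subseteq> B" using assms by (auto simp: B_def T_carrier)
  have "(f \<otimes>\<^bsub>T\<^esub> (g \<oplus>\<^bsub>T\<^esub> h)) x = (\<Oplus>\<^bsub>K\<^esub>a\<in>B. f a \<otimes>\<^bsub>K\<^esub> c a (x - a) \<otimes>\<^bsub>K\<^esub> (g \<oplus>\<^bsub>T\<^esub> h) (x - a))"
    by (rule mult_apply) (use assms B T_add_closed in auto)
  also have "\<dots> = (\<Oplus>\<^bsub>K\<^esub>a\<in>B. f a \<otimes>\<^bsub>K\<^esub> c a (x - a) \<otimes>\<^bsub>K\<^esub> g (x - a) \<oplus>\<^bsub>K\<^esub> f a \<otimes>\<^bsub>K\<^esub> c a (x - a) \<otimes>\<^bsub>K\<^esub> h (x - a))"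
    by (rule K.finsum_cong') (use assms in \<open>auto simp: T_apply T_add K.r_distr\<close>)
  also have "\<dots> = (\<Oplus>\<^bsub>K\<^esub>a\<in>B. f a \<otimes>\<^bsub>K\<^esub> c a (x - a) \<otimes>\<^bsub>K\<^esub> g (x - a)) \<oplus>\<^bsub>K\<^esub>
      (\<Oplus>\<^bsub>K\<^esub>a\<in>B. f a \<otimes>\<^bsub>K\<^esub> c a (x - a) \<otimes>\<^bsub>K\<^esub> h (x - a))"
    by (rule K.finsum_addf) (use assms in \<open>auto simp: T_apply\<close>)
  also have "\<dots> = (f \<otimes>\<^bsub>T\<^esub> g \<oplus>\<^bsub>T\<^esub> f \<otimes>\<^bsub>T\<^esub> h) x"
    using assms B by (simp add: T_add mult_apply[of f _ B])
  finally show "(f \<otimes>\<^bsub>T\<^esub> (g \<oplus>\<^bsub>T\<^esub> h)) x = (f \<otimes>\<^bsub>T\<^esub> g \<oplus>\<^bsub>T\<^esub> f \<otimes>\<^bsub>T\<^esub> h) x" .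
qed

lemma T_mono_mult:
  assumes "s \<in> carrier K" "t \<in> carrier K" "a \<in> H" "b \<in> H"
  shows "kmono K s a \<otimes>\<^bsub>T\<^esub> kmono K t b = kmono K (s \<otimes>\<^bsub>K\<^esub> t \<otimes>\<^bsub>K\<^esub> c a b) (a + b)"
proof
  fix x
  have "(kmono K s a \<otimes>\<^bsub>T\<^esub> kmono K t b) x = kmono K s a a \<otimes>\<^bsub>K\<^esub> c a (x - a) \<otimes>\<^bsub>K\<^esub> kmono K t b (x - a)"
    by (subst mult_apply[of _ _ "{a}"]) (use assms T_mono_closed in \<open>auto simp: kmono_def\<close>)
  then show "(kmono K s a \<otimes>\<^bsub>T\<^esub> kmono K t b) x = kmono K (s \<otimes>\<^bsub>K\<^esub> t \<otimes>\<^bsub>K\<^esub> c a b) (a + b) x"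
    using assms by (cases "x = a + b") (auto simp: kmono_def K.m_ac)
qed

sublocale monoid_algebra K T H "(+)" 0 c
proof unfold_locales
  show "c a b \<otimes>\<^bsub>K\<^esub> c (a + b) d = c b d \<otimes>\<^bsub>K\<^esub> c a (b + d)" for a b d
    by (simp add: c_add_left c_add_right K.m_ac)
qed ((rule T_carrier T_add T_zero T_one T_smult T_distr_left T_distr_right T_mono_mult mult_closed_T; assumption)
    | simp add: H_zero H_add add.assoc)+

text \<open>In an ordered group the sum of the two largest exponents arises from only one pair, so
  its coefficient is a product of nonzero scalars.\<close>

lemma T_no_zero_div:
  assumes "f \<in> carrier T" "g \<in> carrier T" "f \<noteq> \<zero>\<^bsub>T\<^esub>" "g \<noteq> \<zero>\<^bsub>T\<^esub>"
  shows "f \<otimes>\<^bsub>T\<^esub> g \<noteq> \<zero>\<^bsub>T\<^esub>"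
proof -
  have fin: "finite (supp f)" "finite (supp g)" using assms by (auto simp: T_carrier)
  have ne: "supp f \<noteq> {}" "supp g \<noteq> {}" using assms by (auto simp: T_zero)
  define a where "a = Max (supp f)"
  define b where "b = Max (supp g)"
  have ab: "f a \<noteq> \<zero>\<^bsub>K\<^esub>" "g b \<noteq> \<zero>\<^bsub>K\<^esub>"
    using Max_in[OF fin(1) ne(1)] Max_in[OF fin(2) ne(2)] by (auto simp: a_def b_def)
  have "(f \<otimes>\<^bsub>T\<^esub> g) (a + b) = (\<Oplus>\<^bsub>K\<^esub>a'\<in>supp f. f a' \<otimes>\<^bsub>K\<^esub> c a' (a + b - a') \<otimes>\<^bsub>K\<^esub> g (a + b - a'))"
    by (rule mult_apply) (use assms fin in auto)
  also have "\<dots> = (\<Oplus>\<^bsub>K\<^esub>a'\<in>{a}. f a' \<otimes>\<^bsub>K\<^esub> c a' (a + b - a') \<otimes>\<^bsub>K\<^esub> g (a + b - a'))"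
  proof (rule K.add.finprod_mono_neutral_cong_right)
    fix a' assume a': "a' \<in> supp f - {a}"
    then have "a' < a" using Max_ge[OF fin(1), of a'] by (auto simp: a_def order_less_le)
    then have "b < a + b - a'" by (simp add: less_diff_eq add.commute)
    then have "g (a + b - a') = \<zero>\<^bsub>K\<^esub>" using Max_ge[OF fin(2), of "a + b - a'"] by (force simp: b_def)
    then show "f a' \<otimes>\<^bsub>K\<^esub> c a' (a + b - a') \<otimes>\<^bsub>K\<^esub> g (a + b - a') = \<zero>\<^bsub>K\<^esub>" using assms by (simp add: T_apply)
  qed (use fin ab assms in \<open>auto simp: T_apply\<close>)
  also have "\<dots> = f a \<otimes>\<^bsub>K\<^esub> c a b \<otimes>\<^bsub>K\<^esub> g b" using assms by (simp add: T_apply)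
  also have "\<dots> \<noteq> \<zero>\<^bsub>K\<^esub>" using ab assms by (simp add: T_apply K.integral_iff)
  finally show ?thesis by (auto simp: T_zero)
qed

lemma nc_domain_T: "nc_domain K T"
proof unfold_locales
  show "\<one>\<^bsub>T\<^esub> \<noteq> \<zero>\<^bsub>T\<^esub>" by (auto simp: T_one T_zero kmono_def fun_eq_iff)
qed (use T_no_zero_div in blast)

text \<open>A common right multiple of \<open>f\<close> and \<open>g\<close> is found by linear algebra: \<open>f u = g v\<close>, with \<open>u\<close> and
  \<open>v\<close> supported in \<open>E\<close>, is a homogeneous system with \<open>2 |E|\<close> unknowns and \<open>|F + E|\<close> equations.\<close>

lemma right_ore_domain_T:
  assumes Folner: "\<And>F. \<lbrakk>finite F; F \<subseteq> H\<rbrakk> \<Longrightarrow> \<exists>E. finite E \<and> E \<subseteq> H \<and>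
    card ((\<lambda>(a, b). a + b) ` (F \<times> E)) < 2 * card E"
  shows "right_ore_domain K T"
proof (intro right_ore_domain.intro right_ore_domain_axioms.intro nc_domain_T)
  interpret D: nc_domain K T by (rule nc_domain_T)
  fix f g assume fg: "f \<in> carrier T" "g \<in> carrier T" "f \<noteq> \<zero>\<^bsub>T\<^esub>" "g \<noteq> \<zero>\<^bsub>T\<^esub>"
  define F where "F = supp f \<union> supp g"
  have F: "finite F" "F \<subseteq> H" using fg by (auto simp: F_def T_carrier)
  obtain E where E: "finite E" "E \<subseteq> H" "card ((\<lambda>(a, b). a + b) ` (F \<times> E)) < 2 * card E"
    using Folner[OF F] by blast
  define FE where "FE = (\<lambda>(a, b). a + b) ` (F \<times> E)"
  define U where "U = E \<times> (UNIV :: bool set)"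
  \<comment> \<open>The Boolean tag separates the coefficients of \<open>u\<close>
    (\<open>True\<close>) from those of \<open>v\<close> (\<open>False\<close>); the sign turns
    \<open>f u = g v\<close> into a homogeneous equation at each exponent \<open>x\<close>.\<close>
  define M where "M x = (\<lambda>(e, p). if p then f (x - e) \<otimes>\<^bsub>K\<^esub> c (x - e) e
      else \<ominus>\<^bsub>K\<^esub> (g (x - e) \<otimes>\<^bsub>K\<^esub> c (x - e) e))" for x
  have Mc: "M x u \<in> carrier K" for x u using fg by (cases u) (auto simp: M_def T_apply)
  have "card FE < card U" using E by (simp add: FE_def U_def card_cartesian_product)
  moreover have "finite FE" "finite U" using F E by (auto simp: FE_def U_def)
  ultimately obtain z where z: "z \<in> U \<rightarrow> carrier K" "\<exists>u\<in>U. z u \<noteq> \<zero>\<^bsub>K\<^esub>"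
    "\<forall>x\<in>FE. (\<Oplus>\<^bsub>K\<^esub>u\<in>U. M x u \<otimes>\<^bsub>K\<^esub> z u) = \<zero>\<^bsub>K\<^esub>"
    using K.homogeneous_system[of FE U M] Mc by blast
  define w where "w p = (\<lambda>e. if e \<in> E then z (e, p) else \<zero>\<^bsub>K\<^esub>)" for p
  have zc: "z (e, p) \<in> carrier K" if "e \<in> E" for e p using z(1) that by (auto simp: U_def)
  have ws: "supp (w p) \<subseteq> E" for p by (auto simp: w_def)
  have wc: "w p \<in> carrier T" for p
    using finite_subset[OF ws E(1)] ws E(2) zc unfolding T_carrier by (auto simp: w_def)
  have "(f \<otimes>\<^bsub>T\<^esub> w True) x = (g \<otimes>\<^bsub>T\<^esub> w False) x" for x
  proof (cases "x \<in> FE")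
    case False
    have "(f \<otimes>\<^bsub>T\<^esub> w True) x = \<zero>\<^bsub>K\<^esub>" "(g \<otimes>\<^bsub>T\<^esub> w False) x = \<zero>\<^bsub>K\<^esub>"
      using False supp_mult[OF fg(1) wc[of True]] supp_mult[OF fg(2) wc[of False]] ws
      unfolding FE_def F_def by fastforce+
    then show ?thesis by simp
  next
    case True
    have U: "U = (\<lambda>e. (e, True)) ` E \<union> (\<lambda>e. (e, False)) ` E" by (auto simp: U_def)
    have f1: "(\<Oplus>\<^bsub>K\<^esub>u\<in>(\<lambda>e. (e, True)) ` E. M x u \<otimes>\<^bsub>K\<^esub> z u) = (f \<otimes>\<^bsub>T\<^esub> w True) x"
    proof -
      have "(\<Oplus>\<^bsub>K\<^esub>u\<in>(\<lambda>e. (e, True)) ` E. M x u \<otimes>\<^bsub>K\<^esub> z u) = (\<Oplus>\<^bsub>K\<^esub>e\<in>E. M x (e, True) \<otimes>\<^bsub>K\<^esub> z (e, True))"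
        by (rule K.finsum_reindex) (use Mc zc in \<open>auto simp: inj_on_def\<close>)
      also have "\<dots> = (\<Oplus>\<^bsub>K\<^esub>e\<in>E. f (x - e) \<otimes>\<^bsub>K\<^esub> c (x - e) e \<otimes>\<^bsub>K\<^esub> w True e)"
        by (rule K.finsum_cong') (use zc fg in \<open>auto simp: M_def w_def T_apply\<close>)
      also have "\<dots> = (f \<otimes>\<^bsub>T\<^esub> w True) x"
        by (rule mult_apply_right[symmetric]) (use fg wc E ws in auto)
      finally show ?thesis .
    qed
    have g1: "(\<Oplus>\<^bsub>K\<^esub>u\<in>(\<lambda>e. (e, False)) ` E. M x u \<otimes>\<^bsub>K\<^esub> z u) = \<ominus>\<^bsub>K\<^esub> (g \<otimes>\<^bsub>T\<^esub> w False) x"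
    proof -
      have "(\<Oplus>\<^bsub>K\<^esub>u\<in>(\<lambda>e. (e, False)) ` E. M x u \<otimes>\<^bsub>K\<^esub> z u) = (\<Oplus>\<^bsub>K\<^esub>e\<in>E. M x (e, False) \<otimes>\<^bsub>K\<^esub> z (e, False))"
        by (rule K.finsum_reindex) (use Mc zc in \<open>auto simp: inj_on_def\<close>)
      also have "\<dots> = (\<Oplus>\<^bsub>K\<^esub>e\<in>E. (\<ominus>\<^bsub>K\<^esub> \<one>\<^bsub>K\<^esub>) \<otimes>\<^bsub>K\<^esub> (g (x - e) \<otimes>\<^bsub>K\<^esub> c (x - e) e \<otimes>\<^bsub>K\<^esub> w False e))"
        by (rule K.finsum_cong') (use zc fg in \<open>auto simp: M_def w_def T_apply K.l_minus\<close>)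
      also have "\<dots> = (\<ominus>\<^bsub>K\<^esub> \<one>\<^bsub>K\<^esub>) \<otimes>\<^bsub>K\<^esub> (\<Oplus>\<^bsub>K\<^esub>e\<in>E. g (x - e) \<otimes>\<^bsub>K\<^esub> c (x - e) e \<otimes>\<^bsub>K\<^esub> w False e)"
        by (rule K.finsum_rdistr[symmetric]) (use E zc fg in \<open>auto simp: w_def T_apply\<close>)
      also have "(\<Oplus>\<^bsub>K\<^esub>e\<in>E. g (x - e) \<otimes>\<^bsub>K\<^esub> c (x - e) e \<otimes>\<^bsub>K\<^esub> w False e) = (g \<otimes>\<^bsub>T\<^esub> w False) x"
        by (rule mult_apply_right[symmetric]) (use fg wc E ws in auto)
      finally show ?thesis using mult_closed[OF fg(2) wc] by (simp add: K.l_minus T_apply)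
    qed
    have "(f \<otimes>\<^bsub>T\<^esub> w True) x \<oplus>\<^bsub>K\<^esub> (\<ominus>\<^bsub>K\<^esub> (g \<otimes>\<^bsub>T\<^esub> w False) x) = \<zero>\<^bsub>K\<^esub>"
    proof -
      have "(\<Oplus>\<^bsub>K\<^esub>u\<in>U. M x u \<otimes>\<^bsub>K\<^esub> z u) = \<zero>\<^bsub>K\<^esub>" using z True by blast
      also have "(\<Oplus>\<^bsub>K\<^esub>u\<in>U. M x u \<otimes>\<^bsub>K\<^esub> z u) = (\<Oplus>\<^bsub>K\<^esub>u\<in>(\<lambda>e. (e, True)) ` E. M x u \<otimes>\<^bsub>K\<^esub> z u) \<oplus>\<^bsub>K\<^esub>
          (\<Oplus>\<^bsub>K\<^esub>u\<in>(\<lambda>e. (e, False)) ` E. M x u \<otimes>\<^bsub>K\<^esub> z u)"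
        unfolding U by (rule K.finsum_Un_disjoint) (use E Mc zc in auto)
      finally show ?thesis unfolding f1 g1 .
    qed
    then show ?thesis using mult_closed[OF fg(2) wc] mult_closed[OF fg(1) wc]
      by (metis K.minus_eq K.r_right_minus_eq T_apply)
  qed
  then have eq: "f \<otimes>\<^bsub>T\<^esub> w True = g \<otimes>\<^bsub>T\<^esub> w False" by blast
  have "f \<otimes>\<^bsub>T\<^esub> w True \<noteq> \<zero>\<^bsub>T\<^esub>"
  proof
    assume "f \<otimes>\<^bsub>T\<^esub> w True = \<zero>\<^bsub>T\<^esub>"
    \<comment> \<open>In a domain a vanishing common multiple would annihilate both cofactors,
      against the nontriviality of the solution \<open>z\<close>.\<close>
    then have "w True = \<zero>\<^bsub>T\<^esub>" "w False = \<zero>\<^bsub>T\<^esub>" using eq fg wc T_no_zero_div by metis+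
    then have w0: "w p = \<zero>\<^bsub>T\<^esub>" for p by (cases p) auto
    obtain e p where ep: "e \<in> E" "z (e, p) \<noteq> \<zero>\<^bsub>K\<^esub>" using z(2) by (auto simp: U_def)
    then show False using fun_cong[OF w0[of p], of e] by (simp add: w_def T_zero)
  qed
  then show "\<exists>u\<in>carrier T. \<exists>v\<in>carrier T. f \<otimes>\<^bsub>T\<^esub> u = g \<otimes>\<^bsub>T\<^esub> v \<and> f \<otimes>\<^bsub>T\<^esub> u \<noteq> \<zero>\<^bsub>T\<^esub>"
    using eq wc by blast
qed

end

section \<open>Quantum tori\<close>

text \<open>Exponent vectors of monomials in \<open>z\<^sub>1\<^sup>\<plusminus>\<^sup>1, \<dots>, z\<^sub>N\<^sup>\<plusminus>\<^sup>1\<close>; the type of finitely supported functions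
  carries a lexicographic group order.\<close>

definition exponents :: "nat \<Rightarrow> (nat \<Rightarrow>\<^sub>0 int) set"
  where "exponents N = {a. Poly_Mapping.keys a \<subseteq> {1..N}}"

lemma exponents_iff: "a \<in> exponents N \<longleftrightarrow> (\<forall>i. i \<notin> {1..N} \<longrightarrow> Poly_Mapping.lookup a i = 0)"
  by (auto simp: exponents_def in_keys_iff)

definition exponent_box :: "nat \<Rightarrow> int \<Rightarrow> int \<Rightarrow> (nat \<Rightarrow>\<^sub>0 int) set"
  where "exponent_box N l u = {a \<in> exponents N. \<forall>i\<in>{1..N}. Poly_Mapping.lookup a i \<in> {l..<u}}"

lemma bij_exponent_box:
  "bij_betw (\<lambda>a. restrict (Poly_Mapping.lookup a) {1..N}) (exponent_box N l u) ({1..N} \<rightarrow>\<^sub>E {l..<u})"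
proof (rule bij_betw_imageI)
  show "inj_on (\<lambda>a. restrict (Poly_Mapping.lookup a) {1..N}) (exponent_box N l u)"
  proof (rule inj_onI)
    fix a b assume a: "a \<in> exponent_box N l u" and b: "b \<in> exponent_box N l u"
      and eq: "restrict (Poly_Mapping.lookup a) {1..N} = restrict (Poly_Mapping.lookup b) {1..N}"
    show "a = b"
    proof (rule poly_mapping_eqI)
      fix i
      show "Poly_Mapping.lookup a i = Poly_Mapping.lookup b i"
        using fun_cong[OF eq, of i] a b by (cases "i \<in> {1..N}") (auto simp: exponent_box_def exponents_iff)
    qed
  qed
  show "(\<lambda>a. restrict (Poly_Mapping.lookup a) {1..N}) ` exponent_box N l u = {1..N} \<rightarrow>\<^sub>E {l..<u}"
  proof (intro equalityI subsetI)
    fix f assume f: "f \<in> {1..N} \<rightarrow>\<^sub>E {l..<u}"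
    define a where "a = Abs_poly_mapping (\<lambda>i. if i \<in> {1..N} then f i else 0)"
    have "finite {i. (if i \<in> {1..N} then f i else 0) \<noteq> 0}"
      by (rule finite_subset[of _ "{1..N}"]) auto
    then have la: "Poly_Mapping.lookup a = (\<lambda>i. if i \<in> {1..N} then f i else 0)" by (simp add: a_def)
    have "a \<in> exponent_box N l u" using f by (auto simp: exponent_box_def exponents_iff la PiE_def)
    moreover have "f = restrict (Poly_Mapping.lookup a) {1..N}" using f by (auto simp: la PiE_def extensional_def fun_eq_iff)
    ultimately show "f \<in> (\<lambda>a. restrict (Poly_Mapping.lookup a) {1..N}) ` exponent_box N l u" by blast
  qed (auto simp: exponent_box_def)
qed

lemma finite_exponent_box: "finite (exponent_box N l u)"
  using bij_betw_finite[OF bij_exponent_box[of N l u]] by (simp add: finite_PiE)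

lemma card_exponent_box: "card (exponent_box N l u) = nat (u - l) ^ N"
  using bij_betw_same_card[OF bij_exponent_box[of N l u]] by (simp add: card_PiE)

text \<open>A long box works: adding \<open>F\<close> lengthens each side from
  \<open>k = 2 d m\<close> to at most \<open>2 d (m + 1)\<close>, so the volume grows by at most the
  factor \<open>((m + 1) / m) ^ N\<close>, which is below two when \<open>m\<close> is large
  compared with \<open>N\<close>.\<close>

lemma exponents_Folner:
  assumes F: "finite F" "F \<subseteq> exponents N"
  shows "\<exists>E. finite E \<and> E \<subseteq> exponents N \<and> card ((\<lambda>(a, b). a + b) ` (F \<times> E)) < 2 * card E"
proof -
  \<comment> \<open>A strict bound for all coordinates occurring in \<open>F\<close>; the summand
    one also keeps it positive when \<open>F\<close> is empty or trivial.\<close>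
  define d where "d = 1 + (\<Sum>a\<in>F. \<Sum>i=1..N. \<bar>Poly_Mapping.lookup a i\<bar>)"
  have d: "\<bar>Poly_Mapping.lookup a i\<bar> < d" if "a \<in> F" "i \<in> {1..N}" for a i
  proof -
    have "\<bar>Poly_Mapping.lookup a i\<bar> \<le> (\<Sum>i=1..N. \<bar>Poly_Mapping.lookup a i\<bar>)"
      by (rule member_le_sum) (use that in auto)
    also have "\<dots> \<le> (\<Sum>a\<in>F. \<Sum>i=1..N. \<bar>Poly_Mapping.lookup a i\<bar>)"
      by (rule member_le_sum[of a F "\<lambda>a. \<Sum>i=1..N. \<bar>Poly_Mapping.lookup a i\<bar>"])
         (use that F in \<open>auto intro: sum_nonneg\<close>)
    finally show ?thesis by (simp add: d_def)
  qed
  have d1: "d \<ge> 1" by (simp add: d_def sum_nonneg)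
  \<comment> \<open>With this value \<open>N / (m + 1)\<close> is below one half, so Bernoulli's
    inequality gives \<open>(m / (m + 1)) ^ N > 1 / 2\<close>.\<close>
  define m where "m = 2 * N + 1"
  define k where "k = 2 * d * int m"
  define E where "E = exponent_box N 0 k"
  have "(\<lambda>(a, b). a + b) ` (F \<times> E) \<subseteq> exponent_box N (- d) (k + d)"
  proof clarify
    fix a b assume ab: "a \<in> F" "b \<in> E"
    have "- d \<le> Poly_Mapping.lookup a i + Poly_Mapping.lookup b i \<and>
        Poly_Mapping.lookup a i + Poly_Mapping.lookup b i < k + d" if "i \<in> {1..N}" for i
    proof -
      have "0 \<le> Poly_Mapping.lookup b i \<and> Poly_Mapping.lookup b i < k"
        using ab(2) that by (auto simp: E_def exponent_box_def)
      then show ?thesis using d[OF ab(1) that] by linarith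
    qed
    then show "a + b \<in> exponent_box N (- d) (k + d)"
      using ab F by (auto simp: E_def exponent_box_def exponents_iff lookup_add)
  qed
  then have "card ((\<lambda>(a, b). a + b) ` (F \<times> E)) \<le> card (exponent_box N (- d) (k + d))"
    by (intro card_mono finite_exponent_box)
  also have "\<dots> = nat (2 * d * int (m + 1)) ^ N"
    by (simp add: card_exponent_box k_def algebra_simps)
  also have "nat (2 * d * int (m + 1)) = nat (2 * d) * (m + 1)"
    by (subst nat_mult_distrib) (use d1 in simp, simp only: nat_int)
  also have "(nat (2 * d) * (m + 1)) ^ N = nat (2 * d) ^ N * (m + 1) ^ N"
    by (rule power_mult_distrib)
  also have "\<dots> < nat (2 * d) ^ N * (2 * m ^ N)"
  proof -
    have "1 + real N * (- 1 / (real m + 1)) \<le> (1 + (- 1 / (real m + 1))) ^ N"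
      by (rule Bernoulli_inequality) (simp add: field_simps)
    also have "1 + (- 1 / (real m + 1)) = real m / (real m + 1)" by (simp add: field_simps)
    finally have "1 - real N / (real m + 1) \<le> (real m / (real m + 1)) ^ N" by simp
    moreover have "real N / (real m + 1) < 1 / 2" by (simp add: m_def field_simps)
    ultimately have "1 / 2 < (real m / (real m + 1)) ^ N" by linarith
    then have "(real m + 1) ^ N < 2 * real m ^ N" by (simp add: power_divide field_simps)
    then have "real ((m + 1) ^ N) < real (2 * m ^ N)" by (simp add: add.commute)
    then have "(m + 1) ^ N < 2 * m ^ N" by (simp only: of_nat_less_iff)
    then show ?thesis using d1 by simp
  qed
  also have "\<dots> = 2 * card E"
    using d1 by (simp add: E_def card_exponent_box k_def nat_mult_distrib power_mult_distrib)
  finally show ?thesis using finite_exponent_box[of N 0 k] by (intro exI[of _ E]) (auto simp: E_def exponent_box_def)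
qed

text \<open>An induction principle for the free abelian group: powers of one generator are reached
  by sums and negation, and a vector is the sum of its components.\<close>

lemma exponents_generated:
  assumes "a \<in> exponents N" "P 0"
    and add: "\<And>a b. \<lbrakk>P a; P b\<rbrakk> \<Longrightarrow> P (a + b)"
    and minus: "\<And>a. P a \<Longrightarrow> P (- a)"
    and gen: "\<And>i. i \<in> {1..N} \<Longrightarrow> P (Poly_Mapping.single i 1)"
  shows "P a"
proof -
  have nat: "P (Poly_Mapping.single i (int k))" if "i \<in> {1..N}" for i k
    using that by (induction k) (simp_all add: \<open>P 0\<close> single_add add gen)
  have int: "P (Poly_Mapping.single i z)" if "i \<in> {1..N}" for i z
    using nat[OF that, of "nat \<bar>z\<bar>"] minus[OF nat[OF that, of "nat \<bar>z\<bar>"]]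
    by (cases "z \<ge> 0") (simp_all add: single_uminus)
  have "P (\<Sum>i\<in>S. Poly_Mapping.single i (Poly_Mapping.lookup a i))" if "finite S" "S \<subseteq> {1..N}" for S
    using that by (induction S) (simp_all add: \<open>P 0\<close> add int)
  moreover have "a = (\<Sum>i\<in>{1..N}. Poly_Mapping.single i (Poly_Mapping.lookup a i))"
    using assms(1)
    by (intro poly_mapping_eqI) (auto simp: lookup_sum lookup_single when_def exponents_iff)
  ultimately show ?thesis by (metis finite_atLeastAtMost subset_refl)
qed

text \<open>Exponents may be negative, so powers are formed in the group of units.\<close>

abbreviation unit_pow :: "('k, 'm) ring_scheme \<Rightarrow> 'k \<Rightarrow> int \<Rightarrow> 'k"
  where "unit_pow K x z \<equiv> x [^]\<^bsub>units_of K\<^esub> z"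

context field
begin

lemma unit_pow_closed: "\<lbrakk>x \<in> carrier R; x \<noteq> \<zero>\<rbrakk> \<Longrightarrow> unit_pow R x z \<in> carrier R - {\<zero>}"
  using group.int_pow_closed[OF units_group, of x z] by (simp add: units_of_carrier field_Units)

lemma unit_pow_add: "\<lbrakk>x \<in> carrier R; x \<noteq> \<zero>\<rbrakk> \<Longrightarrow> unit_pow R x (y + z) = unit_pow R x y \<otimes> unit_pow R x z"
  using group.int_pow_mult[OF units_group, of x y z] by (simp add: units_of_carrier field_Units units_of_mult)

lemma unit_pow_0 [simp]: "unit_pow R x 0 = \<one>"
  by (simp add: units_of_one)

lemma unit_pow_1: "\<lbrakk>x \<in> carrier R; x \<noteq> \<zero>\<rbrakk> \<Longrightarrow> unit_pow R x 1 = x"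
  using group.int_pow_1[OF units_group, of x] by (simp add: units_of_carrier field_Units)

lemma unit_pow_mult: "\<lbrakk>x \<in> carrier R; x \<noteq> \<zero>\<rbrakk> \<Longrightarrow> unit_pow R x (y * z) = unit_pow R (unit_pow R x y) z"
  using group.int_pow_pow[OF units_group, of x y z] by (simp add: units_of_carrier field_Units)

lemma unit_pow_one [simp]: "unit_pow R \<one> z = \<one>"
  using group.int_pow_one[OF units_group, of z] by (simp add: units_of_one)

lemma unit_pow_minus: "\<lbrakk>x \<in> carrier R; x \<noteq> \<zero>\<rbrakk> \<Longrightarrow> unit_pow R x (- z) = inv (unit_pow R x z)"
  using group.int_pow_neg[OF units_group, of x z] unit_pow_closed[of x z]
  by (simp add: units_of_carrier field_Units units_of_inv)

lemma finprod_nonzero: "\<lbrakk>finite I; f \<in> I \<rightarrow> carrier R - {\<zero>}\<rbrakk> \<Longrightarrow> (\<Otimes>i\<in>I. f i) \<in> carrier R - {\<zero>}"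
  by (induction I rule: finite_induct) (auto simp: integral_iff Pi_iff)

end

text \<open>Moving \<open>z\<^sup>b\<close> to the left through \<open>z\<^sup>a\<close>, sorted products being the basis.\<close>

definition torus_cocycle ::
    "('k, 'm) ring_scheme \<Rightarrow> nat \<Rightarrow> (nat \<Rightarrow> nat \<Rightarrow> 'k) \<Rightarrow> (nat \<Rightarrow>\<^sub>0 int) \<Rightarrow> (nat \<Rightarrow>\<^sub>0 int) \<Rightarrow> 'k"
  where "torus_cocycle K N \<Lambda> a b = finprod K
    (\<lambda>(i, j). unit_pow K (\<Lambda> i j) (Poly_Mapping.lookup a i * Poly_Mapping.lookup b j))
    {(i, j). i \<in> {1..N} \<and> j \<in> {1..<i}}"

locale quantum_torus = K: field K for K :: "('k, 'm) ring_scheme" +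
  fixes N :: nat and \<Lambda> :: "nat \<Rightarrow> nat \<Rightarrow> 'k"
  assumes antisymmetric: "mult_antisymmetric K N \<Lambda>"
begin

lemma \<Lambda>_closed: "\<lbrakk>i \<in> {1..N}; j \<in> {1..N}\<rbrakk> \<Longrightarrow> \<Lambda> i j \<in> carrier K"
  and \<Lambda>_nonzero: "\<lbrakk>i \<in> {1..N}; j \<in> {1..N}\<rbrakk> \<Longrightarrow> \<Lambda> i j \<noteq> \<zero>\<^bsub>K\<^esub>"
  and \<Lambda>_inv: "\<lbrakk>i \<in> {1..N}; j \<in> {1..N}\<rbrakk> \<Longrightarrow> \<Lambda> j i = inv\<^bsub>K\<^esub> (\<Lambda> i j)"
  and \<Lambda>_diag: "i \<in> {1..N} \<Longrightarrow> \<Lambda> i i = \<one>\<^bsub>K\<^esub>"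
  using antisymmetric unfolding mult_antisymmetric_def by blast+

lemma \<Lambda>_inverse: "\<lbrakk>i \<in> {1..N}; j \<in> {1..N}\<rbrakk> \<Longrightarrow> \<Lambda> i j \<otimes>\<^bsub>K\<^esub> \<Lambda> j i = \<one>\<^bsub>K\<^esub>"
  unfolding \<Lambda>_inv[of i j] by (rule K.Units_r_inv) (simp add: K.field_Units \<Lambda>_closed \<Lambda>_nonzero)

abbreviation pairs where "pairs \<equiv> {(i, j). i \<in> {1..N} \<and> j \<in> {1..<i}}"

lemma finite_pairs: "finite pairs"
  by (rule finite_subset[of _ "{1..N} \<times> {1..N}"]) auto

lemma factor_closed:
  assumes "p \<in> pairs"
  shows "(case p of (i, j) \<Rightarrow> unit_pow K (\<Lambda> i j) (z i j)) \<in> carrier K - {\<zero>\<^bsub>K\<^esub>}"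
proof -
  obtain i j where p: "p = (i, j)" "i \<in> {1..N}" "j \<in> {1..N}" using assms by force
  show ?thesis unfolding p(1) prod.case by (rule K.unit_pow_closed[OF \<Lambda>_closed[OF p(2,3)] \<Lambda>_nonzero[OF p(2,3)]])
qed

text \<open>Each factor is a power with an exponent bilinear in \<open>a\<close> and
  \<open>b\<close>, so the product is multiplicative in each argument.\<close>

sublocale bicharacter K "exponents N" "torus_cocycle K N \<Lambda>"
proof unfold_locales
  fix a a' b b' :: "nat \<Rightarrow>\<^sub>0 int"
  have "torus_cocycle K N \<Lambda> a b \<in> carrier K - {\<zero>\<^bsub>K\<^esub>}"
    unfolding torus_cocycle_def by (rule K.finprod_nonzero[OF finite_pairs Pi_I]) (rule factor_closed)
  then show "torus_cocycle K N \<Lambda> a b \<in> carrier K" "torus_cocycle K N \<Lambda> a b \<noteq> \<zero>\<^bsub>K\<^esub>" by auto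
  have f: "(\<lambda>(i, j). unit_pow K (\<Lambda> i j) (z i j)) \<in> pairs \<rightarrow> carrier K" for z
    by (rule Pi_I) (rule DiffD1[OF factor_closed])
  have "torus_cocycle K N \<Lambda> (a + a') b =
    (\<Otimes>\<^bsub>K\<^esub>p\<in>pairs. (case p of (i, j) \<Rightarrow> unit_pow K (\<Lambda> i j) (Poly_Mapping.lookup a i * Poly_Mapping.lookup b j)) \<otimes>\<^bsub>K\<^esub>
      (case p of (i, j) \<Rightarrow> unit_pow K (\<Lambda> i j) (Poly_Mapping.lookup a' i * Poly_Mapping.lookup b j)))"
    unfolding torus_cocycle_def
  proof (rule K.finprod_cong')
    show "(\<lambda>p. (case p of (i, j) \<Rightarrow> unit_pow K (\<Lambda> i j) (Poly_Mapping.lookup a i * Poly_Mapping.lookup b j)) \<otimes>\<^bsub>K\<^esub>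
      (case p of (i, j) \<Rightarrow> unit_pow K (\<Lambda> i j) (Poly_Mapping.lookup a' i * Poly_Mapping.lookup b j))) \<in> pairs \<rightarrow> carrier K"
      by (intro Pi_I K.m_closed funcset_mem[OF f])
  qed (auto simp: lookup_add distrib_right K.unit_pow_add \<Lambda>_closed \<Lambda>_nonzero)
  also have "\<dots> = torus_cocycle K N \<Lambda> a b \<otimes>\<^bsub>K\<^esub> torus_cocycle K N \<Lambda> a' b"
    unfolding torus_cocycle_def by (rule K.finprod_multf[OF f f])
  finally show "torus_cocycle K N \<Lambda> (a + a') b = torus_cocycle K N \<Lambda> a b \<otimes>\<^bsub>K\<^esub> torus_cocycle K N \<Lambda> a' b" .
  have "torus_cocycle K N \<Lambda> a (b + b') =
    (\<Otimes>\<^bsub>K\<^esub>p\<in>pairs. (case p of (i, j) \<Rightarrow> unit_pow K (\<Lambda> i j) (Poly_Mapping.lookup a i * Poly_Mapping.lookup b j)) \<otimes>\<^bsub>K\<^esub>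
      (case p of (i, j) \<Rightarrow> unit_pow K (\<Lambda> i j) (Poly_Mapping.lookup a i * Poly_Mapping.lookup b' j)))"
    unfolding torus_cocycle_def
  proof (rule K.finprod_cong')
    show "(\<lambda>p. (case p of (i, j) \<Rightarrow> unit_pow K (\<Lambda> i j) (Poly_Mapping.lookup a i * Poly_Mapping.lookup b j)) \<otimes>\<^bsub>K\<^esub>
      (case p of (i, j) \<Rightarrow> unit_pow K (\<Lambda> i j) (Poly_Mapping.lookup a i * Poly_Mapping.lookup b' j))) \<in> pairs \<rightarrow> carrier K"
      by (intro Pi_I K.m_closed funcset_mem[OF f])
  qed (auto simp: lookup_add distrib_left K.unit_pow_add \<Lambda>_closed \<Lambda>_nonzero)
  also have "\<dots> = torus_cocycle K N \<Lambda> a b \<otimes>\<^bsub>K\<^esub> torus_cocycle K N \<Lambda> a b'"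
    unfolding torus_cocycle_def by (rule K.finprod_multf[OF f f])
  finally show "torus_cocycle K N \<Lambda> a (b + b') = torus_cocycle K N \<Lambda> a b \<otimes>\<^bsub>K\<^esub> torus_cocycle K N \<Lambda> a b'" .
qed (auto simp: exponents_iff lookup_add)

sublocale T: right_ore_domain K T
  by (rule right_ore_domain_T[OF exponents_Folner])

abbreviation cc where "cc \<equiv> torus_cocycle K N \<Lambda>"
abbreviation zmon where "zmon \<equiv> kmono K \<one>\<^bsub>K\<^esub>"
abbreviation ee :: "nat \<Rightarrow> nat \<Rightarrow>\<^sub>0 int" where "ee i \<equiv> Poly_Mapping.single i 1"
abbreviation Z where "Z i \<equiv> zmon (ee i)"

lemma ee_in: "i \<in> {1..N} \<Longrightarrow> ee i \<in> exponents N"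
  by (auto simp: exponents_def)

lemma cc_one:
  assumes "\<And>i j. \<lbrakk>i \<in> {1..N}; j \<in> {1..<i}\<rbrakk> \<Longrightarrow> Poly_Mapping.lookup a i = 0 \<or> Poly_Mapping.lookup b j = 0"
  shows "cc a b = \<one>\<^bsub>K\<^esub>"
  unfolding torus_cocycle_def
proof (rule K.finprod_one_eqI)
  fix p assume "p \<in> pairs"
  then obtain i j where p: "p = (i, j)" "i \<in> {1..N}" "j \<in> {1..<i}" by blast
  then show "(case p of (i, j) \<Rightarrow> unit_pow K (\<Lambda> i j) (Poly_Mapping.lookup a i * Poly_Mapping.lookup b j)) = \<one>\<^bsub>K\<^esub>"
    using assms[OF p(2,3)] by (auto simp: units_of_one)
qed

lemma cc_ee:
  assumes ij: "i \<in> {1..N}" "j \<in> {1..N}"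
  shows "cc (ee i) (ee j) = (if j < i then \<Lambda> i j else \<one>\<^bsub>K\<^esub>)"
proof (cases "j < i")
  case False
  then show ?thesis by (auto intro!: cc_one simp: lookup_single when_def)
next
  case True
  have "cc (ee i) (ee j) = (\<Otimes>\<^bsub>K\<^esub>p\<in>pairs. if (i, j) = p then (case p of (i, j) \<Rightarrow> \<Lambda> i j) else \<one>\<^bsub>K\<^esub>)"
    unfolding torus_cocycle_def
    by (rule K.finprod_cong')
       (auto simp: lookup_single when_def K.unit_pow_1 \<Lambda>_closed \<Lambda>_nonzero units_of_one split: if_splits)
  also have "\<dots> = \<Lambda> i j"
    by (subst K.finprod_singleton) (use True ij finite_pairs \<Lambda>_closed in auto)
  finally show ?thesis using True by simp
qed

lemma Z_closed: "i \<in> {1..N} \<Longrightarrow> Z i \<in> carrier T"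
  by (simp add: mono_closed ee_in)

text \<open>For distinct indices one of the two products is already sorted, so only the other one
  carries a scalar, and \<open>\<Lambda>_inverse\<close> covers the two possible orders.\<close>

lemma Z_commute:
  assumes ij: "i \<in> {1..N}" "j \<in> {1..N}"
  shows "Z i \<otimes>\<^bsub>T\<^esub> Z j = \<Lambda> i j \<odot>\<^bsub>T\<^esub> (Z j \<otimes>\<^bsub>T\<^esub> Z i)"
  using ij \<Lambda>_closed[OF ij] \<Lambda>_closed[OF ij(2,1)] \<Lambda>_inverse[OF ij] \<Lambda>_diag[OF ij(1)]
  by (cases "i = j"; cases "j < i") (auto simp: mono_mult ee_in cc_ee smult_mono add.commute)

lemma zmon_mult: "\<lbrakk>a \<in> exponents N; b \<in> exponents N\<rbrakk> \<Longrightarrow> zmon a \<otimes>\<^bsub>T\<^esub> zmon b = cc a b \<odot>\<^bsub>T\<^esub> zmon (a + b)"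
  by (simp add: mono_mult smult_mono)

lemma zmon_add: "\<lbrakk>a \<in> exponents N; b \<in> exponents N\<rbrakk> \<Longrightarrow>
    zmon (a + b) = inv\<^bsub>K\<^esub> (cc a b) \<odot>\<^bsub>T\<^esub> (zmon a \<otimes>\<^bsub>T\<^esub> zmon b)"
  by (simp add: zmon_mult smult_mono K.field_Units)

lemma zmon_nonzero: "zmon a \<noteq> \<zero>\<^bsub>T\<^esub>"
  by (auto simp: kmono_def T_zero fun_eq_iff)

text \<open>The cocycle gives a right inverse and a left inverse at the exponent \<open>- a\<close>,
  with scalars of different appearance; they agree because a left and a right inverse always
  coincide.\<close>

lemma zmon_Units: assumes "a \<in> exponents N" shows "zmon a \<in> Units T"
proof -
  have m: "- a \<in> exponents N" by (rule H_minus[OF assms])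
  define s where "s = inv\<^bsub>K\<^esub> (cc a (- a))"
  define t where "t = inv\<^bsub>K\<^esub> (cc (- a) a)"
  have st: "s \<in> carrier K" "t \<in> carrier K" by (auto simp: s_def t_def K.field_Units)
  have r: "zmon a \<otimes>\<^bsub>T\<^esub> kmono K s (- a) = \<one>\<^bsub>T\<^esub>"
    using assms m st by (simp add: mono_mult T_one s_def K.field_Units)
  moreover have l: "kmono K t (- a) \<otimes>\<^bsub>T\<^esub> zmon a = \<one>\<^bsub>T\<^esub>"
    using assms m st by (simp add: mono_mult T_one t_def K.field_Units)
  moreover have "kmono K t (- a) = kmono K s (- a)"
    by (rule inv_unique[OF l r]) (use assms m st in \<open>auto simp: mono_closed\<close>)
  ultimately show ?thesis
    unfolding Units_def using assms m st by (auto simp: mono_closed intro!: bexI[of _ "kmono K s (- a)"])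
qed

text \<open>The difference set of the monomials lying in a subalgebra \<open>B\<close> is a group; if it contains all
  generators, every element of the torus has a monomial denominator in \<open>B\<close>.\<close>

lemma dense_subalgebra:
  assumes B: "\<one>\<^bsub>T\<^esub> \<in> B" "\<And>x y. \<lbrakk>x \<in> B; y \<in> B\<rbrakk> \<Longrightarrow> x \<oplus>\<^bsub>T\<^esub> y \<in> B" "\<And>x y. \<lbrakk>x \<in> B; y \<in> B\<rbrakk> \<Longrightarrow> x \<otimes>\<^bsub>T\<^esub> y \<in> B"
    "\<And>k x. \<lbrakk>k \<in> carrier K; x \<in> B\<rbrakk> \<Longrightarrow> k \<odot>\<^bsub>T\<^esub> x \<in> B"
    and gen: "\<And>i. i \<in> {1..N} \<Longrightarrow> \<exists>b\<in>exponents N. zmon b \<in> B \<and> zmon (ee i + b) \<in> B"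
    and t: "t \<in> carrier T"
  shows "\<exists>b\<in>exponents N. zmon b \<in> B \<and> t \<otimes>\<^bsub>T\<^esub> zmon b \<in> B"
proof -
  define D where "D = {b \<in> exponents N. zmon b \<in> B}"
  have D_add: "a + b \<in> D" if "a \<in> D" "b \<in> D" for a b
    using that B(4)[of "inv\<^bsub>K\<^esub> (cc a b)"] B(3) by (auto simp: D_def H_add zmon_add K.field_Units)
  have D0: "0 \<in> D" using B(1) by (simp add: D_def H_zero T_one)
  have diff: "\<exists>b\<in>D. a + b \<in> D" if "a \<in> exponents N" for a
    using that
  proof (rule exponents_generated)
    fix a a' assume "\<exists>b\<in>D. a + b \<in> D" "\<exists>b\<in>D. a' + b \<in> D"
    then obtain b b' where "b \<in> D" "b' \<in> D" "a + b \<in> D" "a' + b' \<in> D" by blast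
    then show "\<exists>b\<in>D. a + a' + b \<in> D"
      using D_add[of b b'] D_add[of "a + b" "a' + b'"] by (intro bexI[of _ "b + b'"]) (simp_all add: ac_simps)
  next
    fix a assume "\<exists>b\<in>D. a + b \<in> D"
    then obtain b where "b \<in> D" "a + b \<in> D" by blast
    \<comment> \<open>The two monomials whose difference represents \<open>a\<close> exchange their
      roles.\<close>
    then show "\<exists>b\<in>D. - a + b \<in> D" by (intro bexI[of _ "a + b"]) (simp_all add: add.assoc[symmetric])
  next
    fix i assume "i \<in> {1..N}"
    then show "\<exists>b\<in>D. ee i + b \<in> D" using gen[of i] ee_in H_add by (auto simp: D_def)
  qed (use D0 in auto)
  have B0: "\<zero>\<^bsub>T\<^esub> \<in> B" using B(4)[of "\<zero>\<^bsub>K\<^esub>" "\<one>\<^bsub>T\<^esub>"] B(1) by simp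
  have "\<exists>b\<in>D. t \<otimes>\<^bsub>T\<^esub> zmon b \<in> B"
    using t
  proof (induction rule: carrier_induct)
    case zero
    then show ?case using D0 B0 by (intro bexI[of _ 0]) (auto simp: T_one[symmetric])
  next
    case (add g s a)
    obtain b where b: "b \<in> D" "g \<otimes>\<^bsub>T\<^esub> zmon b \<in> B" using add by blast
    \<comment> \<open>The denominator \<open>b\<close> treats the remaining part \<open>g\<close>
      and \<open>b'\<close> the new monomial; their sum treats both.\<close>
    obtain b' where b': "b' \<in> D" "a + b' \<in> D" using diff add by blast
    have m: "b \<in> exponents N" "b' \<in> exponents N" using b b' by (auto simp: D_def)
    have "g \<otimes>\<^bsub>T\<^esub> zmon (b + b') = inv\<^bsub>K\<^esub> (cc b b') \<odot>\<^bsub>T\<^esub> (g \<otimes>\<^bsub>T\<^esub> zmon b \<otimes>\<^bsub>T\<^esub> zmon b')"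
      using m add by (simp add: zmon_add smult_mult_right K.field_Units mono_closed m_assoc)
    then have 1: "g \<otimes>\<^bsub>T\<^esub> zmon (b + b') \<in> B" using b b' B(3,4) by (simp add: K.field_Units D_def)
    have "kmono K s a \<otimes>\<^bsub>T\<^esub> zmon (b + b') = (s \<otimes>\<^bsub>K\<^esub> cc a (b + b')) \<odot>\<^bsub>T\<^esub> zmon (a + b' + b)"
      using m add by (simp add: mono_mult smult_mono H_add ac_simps)
    moreover have "zmon (a + b' + b) \<in> B" using D_add[OF b'(2) b(1)] by (simp add: D_def)
    ultimately have 2: "kmono K s a \<otimes>\<^bsub>T\<^esub> zmon (b + b') \<in> B" using add B(4) by simp
    have "(kmono K s a \<oplus>\<^bsub>T\<^esub> g) \<otimes>\<^bsub>T\<^esub> zmon (b + b') \<in> B"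
      using 1 2 B(2) add m by (simp add: distr_left mono_closed H_add)
    then show ?case using D_add[OF b(1) b'(1)] by blast
  qed
  then show ?thesis by (auto simp: D_def)
qed

end

section \<open>Quantum affine spaces as subalgebras of quantum tori\<close>

text \<open>Words under concatenation with the trivial cocycle. A product of two monomials has only
  one contributing cut, at the length of the first word.\<close>

lemma (in field) free_algebra_monoid_algebra:
  "monoid_algebra R (free_algebra R N) {w. set w \<subseteq> {1..N}} (@) [] (\<lambda>_ _. \<one>)"
proof -
  let ?F = "free_algebra R N"
  have carr: "f \<in> carrier ?F \<longleftrightarrow> (\<forall>w. f w \<in> carrier R) \<and> finite {w. f w \<noteq> \<zero>} \<and> (\<forall>w. f w \<noteq> \<zero> \<longrightarrow> set w \<subseteq> {1..N})" for f
    by (auto simp: free_algebra_def)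
  have fc: "f w \<in> carrier R" if "f \<in> carrier ?F" for f w using that by (simp add: carr)
  have mult: "(f \<otimes>\<^bsub>?F\<^esub> g) = (\<lambda>w. \<Oplus>i\<in>{..length w}. f (take i w) \<otimes> g (drop i w))" for f g
    by (simp add: free_algebra_def)
  have add: "f \<oplus>\<^bsub>?F\<^esub> g = (\<lambda>w. f w \<oplus> g w)" for f g by (simp add: free_algebra_def)
  show ?thesis
  proof unfold_locales
    fix f g assume fg: "f \<in> carrier ?F" "g \<in> carrier ?F"
    have ex: "\<exists>u v. w = u @ v \<and> f u \<noteq> \<zero> \<and> g v \<noteq> \<zero>" if "(f \<otimes>\<^bsub>?F\<^esub> g) w \<noteq> \<zero>" for w
    proof (rule ccontr)
      assume *: "\<not> ?thesis"
      have "f (take i w) = \<zero> \<or> g (drop i w) = \<zero>" for i using * by (metis append_take_drop_id)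
      then have "f (take i w) \<otimes> g (drop i w) = \<zero>" for i using fc[OF fg(1)] fc[OF fg(2)] by (metis l_null r_null)
      then show False using that by (simp add: mult)
    qed
    have "{w. (f \<otimes>\<^bsub>?F\<^esub> g) w \<noteq> \<zero>} \<subseteq> (\<lambda>(u, v). u @ v) ` ({u. f u \<noteq> \<zero>} \<times> {v. g v \<noteq> \<zero>})"
      using ex by fastforce
    moreover have "finite ((\<lambda>(u, v). u @ v) ` ({u. f u \<noteq> \<zero>} \<times> {v. g v \<noteq> \<zero>}))"
      using fg by (auto simp: carr)
    ultimately have "finite {w. (f \<otimes>\<^bsub>?F\<^esub> g) w \<noteq> \<zero>}" by (rule finite_subset)
    moreover have "set w \<subseteq> {1..N}" if w: "(f \<otimes>\<^bsub>?F\<^esub> g) w \<noteq> \<zero>" for w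
    proof -
      obtain u v where "w = u @ v" "f u \<noteq> \<zero>" "g v \<noteq> \<zero>" using ex[OF w] by blast
      then show ?thesis using fg by (simp add: carr)
    qed
    moreover have "(f \<otimes>\<^bsub>?F\<^esub> g) w \<in> carrier R" for w
      unfolding mult by (rule finsum_closed) (use fc fg in auto)
    ultimately show "f \<otimes>\<^bsub>?F\<^esub> g \<in> carrier ?F" unfolding carr by blast
    fix h assume h: "h \<in> carrier ?F"
    have "(\<Oplus>i\<in>{..length w}. (f (take i w) \<oplus> g (take i w)) \<otimes> h (drop i w)) =
        (\<Oplus>i\<in>{..length w}. f (take i w) \<otimes> h (drop i w) \<oplus> g (take i w) \<otimes> h (drop i w))" for w
      by (rule finsum_cong') (use fc fg h in \<open>auto simp: l_distr\<close>)
    then show "(f \<oplus>\<^bsub>?F\<^esub> g) \<otimes>\<^bsub>?F\<^esub> h = f \<otimes>\<^bsub>?F\<^esub> h \<oplus>\<^bsub>?F\<^esub> g \<otimes>\<^bsub>?F\<^esub> h"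
      unfolding mult add using fc fg h by (auto intro!: ext simp: finsum_addf)
    have "(\<Oplus>i\<in>{..length w}. f (take i w) \<otimes> (g (drop i w) \<oplus> h (drop i w))) =
        (\<Oplus>i\<in>{..length w}. f (take i w) \<otimes> g (drop i w) \<oplus> f (take i w) \<otimes> h (drop i w))" for w
      by (rule finsum_cong') (use fc fg h in \<open>auto simp: r_distr\<close>)
    then show "f \<otimes>\<^bsub>?F\<^esub> (g \<oplus>\<^bsub>?F\<^esub> h) = f \<otimes>\<^bsub>?F\<^esub> g \<oplus>\<^bsub>?F\<^esub> f \<otimes>\<^bsub>?F\<^esub> h"
      unfolding mult add using fc fg h by (auto intro!: ext simp: finsum_addf)
  next
    fix s t and a b :: "nat list"
    assume st: "s \<in> carrier R" "t \<in> carrier R"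
    show "kmono R s a \<otimes>\<^bsub>?F\<^esub> kmono R t b = kmono R (s \<otimes> t \<otimes> \<one>) (a @ b)"
    proof
      fix w
      show "(kmono R s a \<otimes>\<^bsub>?F\<^esub> kmono R t b) w = kmono R (s \<otimes> t \<otimes> \<one>) (a @ b) w"
      proof (cases "w = a @ b")
        case False
        have "take i w \<noteq> a \<or> drop i w \<noteq> b" for i using False by (metis append_take_drop_id)
        then have "kmono R s a (take i w) \<otimes> kmono R t b (drop i w) = \<zero>" for i
          using st by (auto simp: kmono_def)
        then show ?thesis using False by (simp add: mult kmono_def)
      next
        case True
        have "(kmono R s a \<otimes>\<^bsub>?F\<^esub> kmono R t b) w = (\<Oplus>i\<in>{..length w}. if length a = i then s \<otimes> t else \<zero>)"
          unfolding mult
        proof (rule finsum_cong')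
          fix i assume "i \<in> {..length w}"
          then have i: "i \<le> length a + length b" using True by simp
          then have "length (take i (a @ b)) = i" by simp
          then have "take i (a @ b) = a \<longleftrightarrow> length a = i" by (metis append_eq_conv_conj)
          then show "kmono R s a (take i w) \<otimes> kmono R t b (drop i w) = (if length a = i then s \<otimes> t else \<zero>)"
            using True st by (auto simp: kmono_def)
        qed (use st in auto)
        also have "\<dots> = s \<otimes> t" by (rule finsum_singleton) (use True st in auto)
        finally show ?thesis using True st by (simp add: kmono_def)
      qed
    qed
  qed (auto simp: carr add, auto simp: free_algebra_def kmono_def)
qed

context quantum_torus
begin

abbreviation F where "F \<equiv> free_algebra K N"

interpretation F: monoid_algebra K F "{w. set w \<subseteq> {1..N}}" "(@)" "[]" "\<lambda>_ _. \<one>\<^bsub>K\<^esub>"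
  by (rule K.free_algebra_monoid_algebra)

abbreviation word_monomial where "word_monomial \<equiv> eval_word T Z"

lemma word_monomial_closed: "set w \<subseteq> {1..N} \<Longrightarrow> word_monomial w \<in> carrier T"
  by (induction w) (auto simp: eval_word_def Z_closed)

lemma word_monomial_append:
  "\<lbrakk>set u \<subseteq> {1..N}; set v \<subseteq> {1..N}\<rbrakk> \<Longrightarrow> word_monomial (u @ v) = word_monomial u \<otimes>\<^bsub>T\<^esub> word_monomial v"
  using word_monomial_closed by (induction u) (auto simp: eval_word_def Z_closed m_assoc)

definition to_torus :: "(nat list \<Rightarrow> 'k) \<Rightarrow> (nat \<Rightarrow>\<^sub>0 int) \<Rightarrow> 'k"
  where "to_torus = linear_ext K T word_monomial"

lemma to_torus_hom: "to_torus \<in> alg_hom K F T"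
  unfolding to_torus_def
  by (rule F.linear_ext_hom[OF nc_algebra])
     (auto simp: word_monomial_closed word_monomial_append[symmetric], simp add: eval_word_def)

lemma to_torus_kmono: "\<lbrakk>s \<in> carrier K; set w \<subseteq> {1..N}\<rbrakk> \<Longrightarrow> to_torus (kmono K s w) = s \<odot>\<^bsub>T\<^esub> word_monomial w"
  unfolding to_torus_def by (rule F.linear_ext_mono[OF nc_algebra]) (auto simp: word_monomial_closed)

definition exponent :: "nat list \<Rightarrow> nat \<Rightarrow>\<^sub>0 int"
  where "exponent w = (\<Sum>i\<leftarrow>w. ee i)"

lemma exponent_in: "set w \<subseteq> {1..N} \<Longrightarrow> exponent w \<in> exponents N"
  by (induction w) (auto simp: exponent_def H_zero H_add ee_in)

lemma lookup_exponent: "Poly_Mapping.lookup (exponent w) i = int (count (mset w) i)"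
  by (induction w) (auto simp: exponent_def lookup_add lookup_single when_def)

text \<open>In a sorted word a letter is never followed by a smaller one, so no commutation occurs
  and every cocycle value is one. Sorted words thus hit basis monomials with coefficient
  one.\<close>

lemma word_monomial_sorted:
  "\<lbrakk>sorted w; set w \<subseteq> {1..N}\<rbrakk> \<Longrightarrow> word_monomial w = zmon (exponent w)"
proof (induction w)
  case Nil
  then show ?case by (simp add: eval_word_def exponent_def T_one)
next
  case (Cons i w)
  have c: "cc (ee i) (exponent w) = \<one>\<^bsub>K\<^esub>"
  proof (rule cc_one)
    fix k j assume "k \<in> {1..N}" "j \<in> {1..<k}"
    then show "Poly_Mapping.lookup (ee i) k = 0 \<or> Poly_Mapping.lookup (exponent w) j = 0"
      using Cons.prems by (auto simp: lookup_single when_def lookup_exponent not_in_iff[symmetric])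
  qed
  have "word_monomial (i # w) = Z i \<otimes>\<^bsub>T\<^esub> zmon (exponent w)"
    using Cons by (simp add: eval_word_def)
  also have "\<dots> = zmon (exponent (i # w))"
    using Cons.prems c exponent_in[of w] by (simp add: mono_mult ee_in) (simp add: exponent_def)
  finally show ?case .
qed

lemma T_finsum_apply:
  "\<lbrakk>finite I; \<And>i. i \<in> I \<Longrightarrow> f i \<in> carrier T\<rbrakk> \<Longrightarrow> (\<Oplus>\<^bsub>T\<^esub>i\<in>I. f i) x = (\<Oplus>\<^bsub>K\<^esub>i\<in>I. f i x)"
proof (induction I rule: finite_induct)
  case (insert i I)
  then have "f \<in> I \<rightarrow> carrier T" "f i \<in> carrier T" "(\<lambda>i. f i x) \<in> I \<rightarrow> carrier K" "f i x \<in> carrier K"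
    by (auto simp: T_apply)
  then show ?case using insert by (simp add: T_add)
qed (simp add: T_zero)

text \<open>A sorted word is determined by its letter counts, so distinct sorted words go to
  distinct basis monomials, and the coefficient of \<open>w\<close> can be read off at
  \<open>exponent w\<close>.\<close>

lemma to_torus_sorted_inj:
  assumes g: "g \<in> carrier F" and sorted: "\<And>w. g w \<noteq> \<zero>\<^bsub>K\<^esub> \<Longrightarrow> sorted w" and 0: "to_torus g = \<zero>\<^bsub>T\<^esub>"
  shows "g = \<zero>\<^bsub>F\<^esub>"
proof -
  have fin: "finite {w. g w \<noteq> \<zero>\<^bsub>K\<^esub>}" and M: "g w \<noteq> \<zero>\<^bsub>K\<^esub> \<Longrightarrow> set w \<subseteq> {1..N}" and gc: "g w \<in> carrier K" for w
    using g by (auto simp: F.carrier_iff)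
  have "g w = \<zero>\<^bsub>K\<^esub>" for w
  proof (rule ccontr)
    assume w: "g w \<noteq> \<zero>\<^bsub>K\<^esub>"
    have "\<zero>\<^bsub>K\<^esub> = to_torus g (exponent w)" by (simp add: 0 T_zero)
    also have "\<dots> = (\<Oplus>\<^bsub>K\<^esub>v\<in>{w. g w \<noteq> \<zero>\<^bsub>K\<^esub>}. (g v \<odot>\<^bsub>T\<^esub> word_monomial v) (exponent w))"
      unfolding to_torus_def linear_ext_def
      by (rule T_finsum_apply) (use fin gc M word_monomial_closed in auto)
    also have "\<dots> = (\<Oplus>\<^bsub>K\<^esub>v\<in>{w. g w \<noteq> \<zero>\<^bsub>K\<^esub>}. if w = v then g v else \<zero>\<^bsub>K\<^esub>)"
    proof (rule K.finsum_cong')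
      fix v assume "v \<in> {w. g w \<noteq> \<zero>\<^bsub>K\<^esub>}"
      then have v: "g v \<noteq> \<zero>\<^bsub>K\<^esub>" by simp
      have "w = v" if "exponent w = exponent v"
      proof -
        have "mset w = mset v"
          by (rule multiset_eqI) (metis lookup_exponent of_nat_eq_iff that)
        then show ?thesis using sorted[OF w] sorted[OF v] by (metis properties_for_sort)
      qed
      then show "(g v \<odot>\<^bsub>T\<^esub> word_monomial v) (exponent w) = (if w = v then g v else \<zero>\<^bsub>K\<^esub>)"
        unfolding word_monomial_sorted[OF sorted[OF v] M[OF v]] T_smult
        using gc[of v] by (auto simp: kmono_def)
    qed (use gc in auto)
    also have "\<dots> = g w" by (rule K.finsum_singleton) (use w fin gc in auto)
    finally show False using w by simp
  qed
  then show ?thesis by (auto simp: F.zero_def)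
qed

section \<open>Normal forms modulo the commutation relations\<close>

abbreviation I where "I \<equiv> Idl\<^bsub>F\<^esub> (qaffine_relations K N \<Lambda>)"

lemma relations: "qaffine_relations K N \<Lambda> =
    {kmono K \<one>\<^bsub>K\<^esub> [i, j] \<ominus>\<^bsub>F\<^esub> kmono K (\<Lambda> i j) [j, i] | i j. i \<in> {1..N} \<and> j \<in> {1..N}}"
proof -
  have g: "free_gen K i = kmono K \<one>\<^bsub>K\<^esub> [i]" for i by (auto simp: free_gen_def kmono_def)
  have "(free_gen K i \<otimes>\<^bsub>F\<^esub> free_gen K j) \<ominus>\<^bsub>F\<^esub> (\<Lambda> i j \<odot>\<^bsub>F\<^esub> (free_gen K j \<otimes>\<^bsub>F\<^esub> free_gen K i)) =
      kmono K \<one>\<^bsub>K\<^esub> [i, j] \<ominus>\<^bsub>F\<^esub> kmono K (\<Lambda> i j) [j, i]" if "i \<in> {1..N}" "j \<in> {1..N}" for i j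
    using that by (simp add: g F.mono_mult F.smult_mono \<Lambda>_closed)
  then show ?thesis unfolding qaffine_relations_def Let_def by (metis (no_types, lifting))
qed

lemma relations_closed: "qaffine_relations K N \<Lambda> \<subseteq> carrier F"
  unfolding relations by (auto simp: F.mono_closed \<Lambda>_closed)

lemma ideal_I: "ideal I F"
  by (rule F.genideal_ideal[OF relations_closed])

interpretation I: ideal I F by (rule ideal_I)

lemma I_smult: "\<lbrakk>k \<in> carrier K; x \<in> I\<rbrakk> \<Longrightarrow> k \<odot>\<^bsub>F\<^esub> x \<in> I"
  using I.I_l_closed[of x "k \<odot>\<^bsub>F\<^esub> \<one>\<^bsub>F\<^esub>"] I.a_Hcarr[of x] by (simp add: F.smult_mult_left)

definition equiv_mod :: "(nat list \<Rightarrow> 'k) \<Rightarrow> (nat list \<Rightarrow> 'k) \<Rightarrow> bool" (infix \<open>\<cong>\<^sub>I\<close> 50)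
  where "f \<cong>\<^sub>I g \<longleftrightarrow> f \<in> carrier F \<and> g \<in> carrier F \<and> f \<ominus>\<^bsub>F\<^esub> g \<in> I"

lemma equiv_refl: "f \<in> carrier F \<Longrightarrow> f \<cong>\<^sub>I f"
  by (simp add: equiv_mod_def F.minus_eq F.r_neg)

lemma equiv_trans [trans]: "f \<cong>\<^sub>I g \<Longrightarrow> g \<cong>\<^sub>I h \<Longrightarrow> f \<cong>\<^sub>I h"
proof -
  assume a: "f \<cong>\<^sub>I g" "g \<cong>\<^sub>I h"
  then have "f \<ominus>\<^bsub>F\<^esub> h = (f \<ominus>\<^bsub>F\<^esub> g) \<oplus>\<^bsub>F\<^esub> (g \<ominus>\<^bsub>F\<^esub> h)"
    by (simp add: equiv_mod_def F.minus_eq F.a_assoc F.r_neg1)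
  then show ?thesis using a by (simp add: equiv_mod_def)
qed

lemma equiv_add: "\<lbrakk>f \<cong>\<^sub>I f'; g \<cong>\<^sub>I g'\<rbrakk> \<Longrightarrow> f \<oplus>\<^bsub>F\<^esub> g \<cong>\<^sub>I f' \<oplus>\<^bsub>F\<^esub> g'"
proof -
  assume a: "f \<cong>\<^sub>I f'" "g \<cong>\<^sub>I g'"
  then have "(f \<oplus>\<^bsub>F\<^esub> g) \<ominus>\<^bsub>F\<^esub> (f' \<oplus>\<^bsub>F\<^esub> g') = (f \<ominus>\<^bsub>F\<^esub> f') \<oplus>\<^bsub>F\<^esub> (g \<ominus>\<^bsub>F\<^esub> g')"
    by (simp add: equiv_mod_def F.minus_eq F.minus_add F.a_ac)
  then show ?thesis using a by (simp add: equiv_mod_def)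
qed

lemma equiv_mult_left: "\<lbrakk>f \<cong>\<^sub>I f'; g \<in> carrier F\<rbrakk> \<Longrightarrow> g \<otimes>\<^bsub>F\<^esub> f \<cong>\<^sub>I g \<otimes>\<^bsub>F\<^esub> f'"
proof -
  assume a: "f \<cong>\<^sub>I f'" "g \<in> carrier F"
  then have "g \<otimes>\<^bsub>F\<^esub> f \<ominus>\<^bsub>F\<^esub> g \<otimes>\<^bsub>F\<^esub> f' = g \<otimes>\<^bsub>F\<^esub> (f \<ominus>\<^bsub>F\<^esub> f')"
    by (simp add: equiv_mod_def F.minus_eq F.r_distr F.r_minus)
  then show ?thesis using a by (simp add: equiv_mod_def I.I_l_closed)
qed

lemma equiv_mult_right: "\<lbrakk>f \<cong>\<^sub>I f'; g \<in> carrier F\<rbrakk> \<Longrightarrow> f \<otimes>\<^bsub>F\<^esub> g \<cong>\<^sub>I f' \<otimes>\<^bsub>F\<^esub> g"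
proof -
  assume a: "f \<cong>\<^sub>I f'" "g \<in> carrier F"
  then have "f \<otimes>\<^bsub>F\<^esub> g \<ominus>\<^bsub>F\<^esub> f' \<otimes>\<^bsub>F\<^esub> g = (f \<ominus>\<^bsub>F\<^esub> f') \<otimes>\<^bsub>F\<^esub> g"
    by (simp add: equiv_mod_def F.minus_eq F.l_distr F.l_minus)
  then show ?thesis using a by (simp add: equiv_mod_def I.I_r_closed)
qed

lemma equiv_smult: "\<lbrakk>f \<cong>\<^sub>I f'; k \<in> carrier K\<rbrakk> \<Longrightarrow> k \<odot>\<^bsub>F\<^esub> f \<cong>\<^sub>I k \<odot>\<^bsub>F\<^esub> f'"
proof -
  assume a: "f \<cong>\<^sub>I f'" "k \<in> carrier K"
  then have "k \<odot>\<^bsub>F\<^esub> f \<ominus>\<^bsub>F\<^esub> k \<odot>\<^bsub>F\<^esub> f' = k \<odot>\<^bsub>F\<^esub> (f \<ominus>\<^bsub>F\<^esub> f')"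
    by (simp add: equiv_mod_def F.minus_eq F.smult_r_distr F.smult_minus)
  then show ?thesis using a by (simp add: equiv_mod_def I_smult)
qed

abbreviation wd where "wd \<equiv> kmono K \<one>\<^bsub>K\<^esub>"

text \<open>One step of insertion sort modulo the ideal: the first letter moves past a smaller one
  by a single relation. The scalar stays anonymous, since only the span of the sorted words is at
  stake.\<close>

lemma wd_insort:
  "\<lbrakk>i \<in> {1..N}; set w \<subseteq> {1..N}\<rbrakk> \<Longrightarrow> \<exists>k\<in>carrier K. wd (i # w) \<cong>\<^sub>I kmono K k (insort i w)"
proof (induction w)
  case Nil
  then show ?case by (intro bexI[of _ "\<one>\<^bsub>K\<^esub>"]) (auto intro!: equiv_refl F.mono_closed)
next
  case (Cons j w)
  have j: "j \<in> {1..N}" and w: "set w \<subseteq> {1..N}" using Cons.prems by auto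
  show ?case
  proof (cases "i \<le> j")
    case True
    then show ?thesis using Cons.prems equiv_refl[OF F.mono_closed[of "\<one>\<^bsub>K\<^esub>" "i # j # w"]]
      by (intro bexI[of _ "\<one>\<^bsub>K\<^esub>"]) simp_all
  next
    case False
    obtain k where k: "k \<in> carrier K" "wd (i # w) \<cong>\<^sub>I kmono K k (insort i w)" using Cons w by blast
    have L: "\<Lambda> i j \<in> carrier K" using \<Lambda>_closed Cons.prems(1) j by blast
    have "kmono K \<one>\<^bsub>K\<^esub> [i, j] \<ominus>\<^bsub>F\<^esub> kmono K (\<Lambda> i j) [j, i] \<in> qaffine_relations K N \<Lambda>"
      unfolding relations using Cons.prems(1) j by blast
    then have "wd [i, j] \<cong>\<^sub>I kmono K (\<Lambda> i j) [j, i]"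
      using F.genideal_self[OF relations_closed] Cons.prems(1) j L by (auto simp: equiv_mod_def F.mono_closed)
    then have "wd [i, j] \<otimes>\<^bsub>F\<^esub> wd w \<cong>\<^sub>I kmono K (\<Lambda> i j) [j, i] \<otimes>\<^bsub>F\<^esub> wd w"
      using w by (intro equiv_mult_right) (auto simp: F.mono_closed)
    then have "wd (i # j # w) \<cong>\<^sub>I \<Lambda> i j \<odot>\<^bsub>F\<^esub> (wd [j] \<otimes>\<^bsub>F\<^esub> wd (i # w))"
      using Cons.prems(1) j w L by (simp add: F.mono_mult F.smult_mono)
    also have "\<dots> \<cong>\<^sub>I \<Lambda> i j \<odot>\<^bsub>F\<^esub> (wd [j] \<otimes>\<^bsub>F\<^esub> kmono K k (insort i w))"
      using j L by (intro equiv_smult equiv_mult_left k) (auto simp: F.mono_closed)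
    also have "\<Lambda> i j \<odot>\<^bsub>F\<^esub> (wd [j] \<otimes>\<^bsub>F\<^esub> kmono K k (insort i w)) = kmono K (\<Lambda> i j \<otimes>\<^bsub>K\<^esub> k) (insort i (j # w))"
      using False Cons.prems(1) j w L k by (simp add: F.mono_mult F.smult_mono set_insort_key)
    finally show ?thesis using L k by blast
  qed
qed

lemma wd_sort: "set w \<subseteq> {1..N} \<Longrightarrow> \<exists>k\<in>carrier K. wd w \<cong>\<^sub>I kmono K k (sort w)"
proof (induction w)
  case Nil
  then show ?case by (intro bexI[of _ "\<one>\<^bsub>K\<^esub>"]) (auto intro!: equiv_refl F.mono_closed)
next
  case (Cons i w)
  then obtain k where k: "k \<in> carrier K" "wd w \<cong>\<^sub>I kmono K k (sort w)" by auto
  obtain l where l: "l \<in> carrier K" "wd (i # sort w) \<cong>\<^sub>I kmono K l (insort i (sort w))"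
    using wd_insort[of i "sort w"] Cons.prems by auto
  have "wd [i] \<otimes>\<^bsub>F\<^esub> wd w \<cong>\<^sub>I wd [i] \<otimes>\<^bsub>F\<^esub> kmono K k (sort w)"
    using Cons.prems by (intro equiv_mult_left k) (auto simp: F.mono_closed)
  then have "wd (i # w) \<cong>\<^sub>I k \<odot>\<^bsub>F\<^esub> wd (i # sort w)"
    using Cons.prems k by (simp add: F.mono_mult F.smult_mono)
  also have "\<dots> \<cong>\<^sub>I k \<odot>\<^bsub>F\<^esub> kmono K l (insort i (sort w))"
    by (intro equiv_smult l k)
  also have "\<dots> = kmono K (k \<otimes>\<^bsub>K\<^esub> l) (sort (i # w))" using k by (simp add: F.smult_mono)
  finally show ?case using k l by blast
qed

text \<open>The spanning half of the normal form theorem; \<open>to_torus_sorted_inj\<close> is the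
  independence half, with the torus as the faithful representation.\<close>

lemma sorted_representative:
  "f \<in> carrier F \<Longrightarrow> \<exists>g. f \<cong>\<^sub>I g \<and> (\<forall>w. g w \<noteq> \<zero>\<^bsub>K\<^esub> \<longrightarrow> sorted w)"
proof (induction rule: F.carrier_induct)
  case zero
  show ?case by (intro exI[of _ "\<zero>\<^bsub>F\<^esub>"]) (auto intro!: equiv_refl simp: F.zero_closed' F.zero_def[symmetric], simp add: F.zero_def)
next
  case (add f s w)
  obtain g where g: "f \<cong>\<^sub>I g" "\<forall>w. g w \<noteq> \<zero>\<^bsub>K\<^esub> \<longrightarrow> sorted w" using add by blast
  obtain k where k: "k \<in> carrier K" "wd w \<cong>\<^sub>I kmono K k (sort w)" using wd_sort add by blast
  have "s \<odot>\<^bsub>F\<^esub> wd w \<cong>\<^sub>I s \<odot>\<^bsub>F\<^esub> kmono K k (sort w)" using add k by (intro equiv_smult)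
  then have "kmono K s w \<cong>\<^sub>I kmono K (s \<otimes>\<^bsub>K\<^esub> k) (sort w)" using add k by (simp add: F.smult_mono)
  then have "kmono K s w \<oplus>\<^bsub>F\<^esub> f \<cong>\<^sub>I kmono K (s \<otimes>\<^bsub>K\<^esub> k) (sort w) \<oplus>\<^bsub>F\<^esub> g" using g by (intro equiv_add)
  moreover have "sorted v" if v: "(kmono K (s \<otimes>\<^bsub>K\<^esub> k) (sort w) \<oplus>\<^bsub>F\<^esub> g) v \<noteq> \<zero>\<^bsub>K\<^esub>" for v
  proof (cases "v = sort w")
    case False
    then have "g v \<noteq> \<zero>\<^bsub>K\<^esub>" using v g(1) by (auto simp: F.add_def kmono_def equiv_mod_def F.carrier_iff)
    then show ?thesis using g(2) by blast
  qed simp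
  ultimately show ?case by blast
qed

lemma to_torus_ring_hom: "ring_hom_ring F T to_torus"
  by (rule ring_hom_ringI2) (use to_torus_hom F.ring_axioms ring_axioms in \<open>auto simp: alg_hom_def\<close>)

lemma in_kernel: "f \<in> a_kernel F T to_torus \<longleftrightarrow> f \<in> carrier F \<and> to_torus f = \<zero>\<^bsub>T\<^esub>"
  unfolding a_kernel_def' by simp

text \<open>The torus generators satisfy the relations, which gives one inclusion. For the other, an
  element of the kernel is congruent to a combination of sorted words, which also lies in the kernel
  and hence vanishes.\<close>

lemma kernel_to_torus: "a_kernel F T to_torus = I"
proof
  note minus = alg_hom_minus[OF F.nc_algebra nc_algebra to_torus_hom]
  have "to_torus (kmono K \<one>\<^bsub>K\<^esub> [i, j] \<ominus>\<^bsub>F\<^esub> kmono K (\<Lambda> i j) [j, i]) = \<zero>\<^bsub>T\<^esub>"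
    if "i \<in> {1..N}" "j \<in> {1..N}" for i j
  proof -
    have L: "\<Lambda> i j \<in> carrier K" using that by (rule \<Lambda>_closed)
    have c: "kmono K \<one>\<^bsub>K\<^esub> [i, j] \<in> carrier F" "kmono K (\<Lambda> i j) [j, i] \<in> carrier F"
      using that L by (simp_all add: F.mono_closed)
    have "to_torus (kmono K \<one>\<^bsub>K\<^esub> [i, j]) = to_torus (kmono K (\<Lambda> i j) [j, i])"
      using that L Z_commute[OF that] Z_closed[OF that(1)] Z_closed[OF that(2)]
      by (simp add: to_torus_kmono eval_word_def)
    then show ?thesis using alg_hom_closed[OF to_torus_hom c(2)]
      by (simp add: minus[OF c] minus_eq r_neg)
  qed
  then have z: "to_torus f = \<zero>\<^bsub>T\<^esub>" if "f \<in> qaffine_relations K N \<Lambda>" for f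
    using that unfolding relations mem_Collect_eq by metis
  have "qaffine_relations K N \<Lambda> \<subseteq> a_kernel F T to_torus"
    using z relations_closed by (intro subsetI) (simp add: in_kernel subsetD)
  then show sub: "I \<subseteq> a_kernel F T to_torus"
    by (rule F.genideal_minimal[OF ring_hom_ring.kernel_is_ideal[OF to_torus_ring_hom]])
  show "a_kernel F T to_torus \<subseteq> I"
  proof
    fix f assume "f \<in> a_kernel F T to_torus"
    then have f: "f \<in> carrier F" "to_torus f = \<zero>\<^bsub>T\<^esub>" by (simp_all add: in_kernel)
    obtain g where "f \<cong>\<^sub>I g \<and> (\<forall>w. g w \<noteq> \<zero>\<^bsub>K\<^esub> \<longrightarrow> sorted w)" using sorted_representative[OF f(1)] ..
    then have g: "f \<cong>\<^sub>I g" "g w \<noteq> \<zero>\<^bsub>K\<^esub> \<Longrightarrow> sorted w" for w by simp_all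
    have gc: "g \<in> carrier F" "f \<ominus>\<^bsub>F\<^esub> g \<in> I" using g(1) by (simp_all add: equiv_mod_def)
    have "to_torus f \<ominus>\<^bsub>T\<^esub> to_torus g = \<zero>\<^bsub>T\<^esub>"
      using subsetD[OF sub gc(2)] minus[OF f(1) gc(1)] by (simp add: in_kernel)
    then have g0: "to_torus g = \<zero>\<^bsub>T\<^esub>" using f(2) alg_hom_closed[OF to_torus_hom gc(1)] by simp
    have "g = \<zero>\<^bsub>F\<^esub>" by (rule to_torus_sorted_inj[OF gc(1) g(2) g0])
    then show "f \<in> I" using gc f by (simp add: F.minus_eq)
  qed
qed

section \<open>The embedding of quantum affine space in the torus\<close>

definition qaffine_to_torus :: "(nat list \<Rightarrow> 'k) set \<Rightarrow> (nat \<Rightarrow>\<^sub>0 int) \<Rightarrow> 'k"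
  where "qaffine_to_torus P = the_elem (to_torus ` P)"

abbreviation O\<Lambda> where "O\<Lambda> \<equiv> qaffine K N \<Lambda>"

lemma O_simps: "carrier O\<Lambda> = carrier (F Quot I)" "add O\<Lambda> = add (F Quot I)" "monoid.mult O\<Lambda> = monoid.mult (F Quot I)"
  "\<one>\<^bsub>O\<Lambda>\<^esub> = \<one>\<^bsub>F Quot I\<^esub>" "\<zero>\<^bsub>O\<Lambda>\<^esub> = \<zero>\<^bsub>F Quot I\<^esub>"
  "k \<odot>\<^bsub>O\<Lambda>\<^esub> P = (\<Union>a\<in>P. I +>\<^bsub>F\<^esub> (k \<odot>\<^bsub>F\<^esub> a))"
  unfolding qaffine_def quotient_algebra_def by (simp_all add: ring.defs module.defs)

text \<open>All members of a coset remain congruent after scaling, so the union in the definition of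
  the quotient collapses to one coset.\<close>

lemma O_smult:
  assumes "k \<in> carrier K" "a \<in> carrier F"
  shows "k \<odot>\<^bsub>O\<Lambda>\<^esub> (I +>\<^bsub>F\<^esub> a) = I +>\<^bsub>F\<^esub> (k \<odot>\<^bsub>F\<^esub> a)"
proof -
  have "I +>\<^bsub>F\<^esub> (k \<odot>\<^bsub>F\<^esub> b) = I +>\<^bsub>F\<^esub> (k \<odot>\<^bsub>F\<^esub> a)" if b: "b \<in> I +>\<^bsub>F\<^esub> a" for b
  proof -
    obtain i where i: "i \<in> I" "b = i \<oplus>\<^bsub>F\<^esub> a" using b by (auto simp: a_r_coset_def')
    have ic: "i \<in> carrier F" using i I.a_Hcarr by blast
    then have bc: "b \<in> carrier F" using i assms by simp
    have "b \<ominus>\<^bsub>F\<^esub> a = i" using i ic assms by (simp add: F.minus_eq F.a_assoc F.r_neg)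
    then have "b \<cong>\<^sub>I a" using bc assms i by (simp add: equiv_mod_def)
    then have "k \<odot>\<^bsub>F\<^esub> b \<cong>\<^sub>I k \<odot>\<^bsub>F\<^esub> a" using assms equiv_smult by blast
    then show ?thesis using F.quotient_eq_iff_same_a_r_cos[OF ideal_I] by (auto simp: equiv_mod_def)
  qed
  moreover have "a \<in> I +>\<^bsub>F\<^esub> a" by (rule I.a_rcos_self[OF assms(2)])
  ultimately show ?thesis unfolding O_simps by blast
qed

lemma O_carrierE:
  assumes "P \<in> carrier O\<Lambda>" obtains a where "a \<in> carrier F" "P = I +>\<^bsub>F\<^esub> a"
  using assms ring_hom_ring.quot_mem[OF to_torus_ring_hom, unfolded kernel_to_torus] unfolding O_simps by blast

lemma coset_in_O: "a \<in> carrier F \<Longrightarrow> I +>\<^bsub>F\<^esub> a \<in> carrier O\<Lambda>"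
  unfolding O_simps FactRing_def A_RCOSETS_def' by auto

lemma qaffine_to_torus_coset: "a \<in> carrier F \<Longrightarrow> qaffine_to_torus (I +>\<^bsub>F\<^esub> a) = to_torus a"
  unfolding qaffine_to_torus_def
  using ring_hom_ring.the_elem_simp[OF to_torus_ring_hom, unfolded kernel_to_torus] .

lemma qaffine_to_torus_hom: "qaffine_to_torus \<in> alg_hom K O\<Lambda> T"
proof -
  have "qaffine_to_torus \<in> ring_hom (F Quot I) T"
    unfolding qaffine_to_torus_def
    by (rule ring_hom_ring.the_elem_hom[OF to_torus_ring_hom, unfolded kernel_to_torus])
  then have "qaffine_to_torus \<in> ring_hom O\<Lambda> T" by (simp add: ring_hom_def O_simps)
  moreover have "qaffine_to_torus (k \<odot>\<^bsub>O\<Lambda>\<^esub> P) = k \<odot>\<^bsub>T\<^esub> qaffine_to_torus P"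
    if k: "k \<in> carrier K" and P: "P \<in> carrier O\<Lambda>" for k P
  proof -
    obtain a where a: "a \<in> carrier F" "P = I +>\<^bsub>F\<^esub> a" by (rule O_carrierE[OF P])
    show ?thesis using k a by (simp add: O_smult qaffine_to_torus_coset alg_hom_smult[OF to_torus_hom])
  qed
  ultimately show ?thesis by (auto simp: alg_hom_def alg_hom_linear_def)
qed

lemma qaffine_to_torus_inj: "inj_on qaffine_to_torus (carrier O\<Lambda>)"
  unfolding qaffine_to_torus_def O_simps
  by (rule inj_onI) (rule ring_hom_ring.the_elem_inj[OF to_torus_ring_hom, unfolded kernel_to_torus])

lemma nc_algebra_qaffine: "nc_algebra K O\<Lambda>"
proof -
  have ring: "ring (F Quot I)" by (rule I.quotient_is_ring)
  interpret Q: ring "F Quot I" by (rule ring)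
  show ?thesis
  proof (rule nc_algebra_pullback[OF nc_algebra qaffine_to_torus_hom _ qaffine_to_torus_inj])
    show "qaffine_to_torus \<zero>\<^bsub>O\<Lambda>\<^esub> = \<zero>\<^bsub>T\<^esub>"
    proof -
      have "\<zero>\<^bsub>O\<Lambda>\<^esub> = I +>\<^bsub>F\<^esub> \<zero>\<^bsub>F\<^esub>" unfolding O_simps FactRing_def using I.a_rcos_const[of "\<zero>\<^bsub>F\<^esub>"] by simp
      then show ?thesis
        using qaffine_to_torus_coset[of "\<zero>\<^bsub>F\<^esub>"] alg_hom_zero[OF F.nc_algebra nc_algebra to_torus_hom] by simp
    qed
    fix k P assume k: "k \<in> carrier K" and P: "P \<in> carrier O\<Lambda>"
    obtain a where a: "a \<in> carrier F" "P = I +>\<^bsub>F\<^esub> a" by (rule O_carrierE[OF P])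
    then show "k \<odot>\<^bsub>O\<Lambda>\<^esub> P \<in> carrier O\<Lambda>" using k by (simp add: O_smult coset_in_O)
  qed (simp_all add: O_simps(1-5))
qed

lemma qaffine_localizing: "localizing_embedding K O\<Lambda> T qaffine_to_torus"
proof (intro localizing_embedding.intro localizing_embedding_axioms.intro nc_algebra_qaffine
    T.right_ore_domain_axioms qaffine_to_torus_hom qaffine_to_torus_inj)
  interpret O: nc_algebra K O\<Lambda> by (rule nc_algebra_qaffine)
  note h = alg_hom_add[OF qaffine_to_torus_hom] alg_hom_mult[OF qaffine_to_torus_hom]
    alg_hom_smult[OF qaffine_to_torus_hom] alg_hom_one[OF qaffine_to_torus_hom]
  let ?B = "qaffine_to_torus ` carrier O\<Lambda>"
  have Z: "Z i \<in> ?B" if "i \<in> {1..N}" for i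
  proof (rule image_eqI[OF _ coset_in_O])
    show "Z i = qaffine_to_torus (I +>\<^bsub>F\<^esub> wd [i])"
      using that Z_closed by (simp add: qaffine_to_torus_coset F.mono_closed to_torus_kmono eval_word_def)
  qed (use that in \<open>simp add: F.mono_closed\<close>)
  have one: "\<one>\<^bsub>T\<^esub> \<in> ?B" using h(4) by (metis O.one_closed image_eqI)
  fix t assume t: "t \<in> carrier T"
  have "\<exists>b\<in>exponents N. zmon b \<in> ?B \<and> t \<otimes>\<^bsub>T\<^esub> zmon b \<in> ?B"
  proof (rule dense_subalgebra[OF one _ _ _ _ t])
    fix x y assume "x \<in> ?B" "y \<in> ?B"
    then obtain a b where "a \<in> carrier O\<Lambda>" "b \<in> carrier O\<Lambda>" "x = qaffine_to_torus a" "y = qaffine_to_torus b" by blast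
    then show "x \<oplus>\<^bsub>T\<^esub> y \<in> ?B" "x \<otimes>\<^bsub>T\<^esub> y \<in> ?B" by (simp_all flip: h)
  next
    fix k x assume k: "k \<in> carrier K" and "x \<in> ?B"
    then obtain a where "a \<in> carrier O\<Lambda>" "x = qaffine_to_torus a" by blast
    then show "k \<odot>\<^bsub>T\<^esub> x \<in> ?B" using k by (simp flip: h)
  next
    fix i assume "i \<in> {1..N}"
    \<comment> \<open>The generators themselves come from the affine space, so the trivial monomial
      serves as the denominator.\<close>
    then show "\<exists>b\<in>exponents N. zmon b \<in> ?B \<and> zmon (ee i + b) \<in> ?B"
      using Z[of i] one H_zero by (intro bexI[of _ 0]) (auto simp: T_one)
  qed
  then obtain b s where bs: "s \<in> carrier O\<Lambda>" "zmon b = qaffine_to_torus s" "t \<otimes>\<^bsub>T\<^esub> zmon b \<in> ?B" by blast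
  then have "s \<noteq> \<zero>\<^bsub>O\<Lambda>\<^esub>" using zmon_nonzero[of b] alg_hom_zero[OF nc_algebra_qaffine nc_algebra qaffine_to_torus_hom] by auto
  then show "\<exists>s\<in>carrier O\<Lambda>. s \<noteq> \<zero>\<^bsub>O\<Lambda>\<^esub> \<and> t \<otimes>\<^bsub>T\<^esub> qaffine_to_torus s \<in> ?B" using bs by metis
qed

end

section \<open>Skew polynomial towers inside an algebra\<close>

inductive_set subalgebra_generated :: "('k, 'm) ring_scheme \<Rightarrow> ('k, 't) module \<Rightarrow> 't set \<Rightarrow> 't set"
  for K :: "('k, 'm) ring_scheme" and T :: "('k, 't) module" and G :: "'t set" where
    sg_one: "\<one>\<^bsub>T\<^esub> \<in> subalgebra_generated K T G"
  | sg_gen: "g \<in> G \<Longrightarrow> g \<in> subalgebra_generated K T G"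
  | sg_add: "\<lbrakk>x \<in> subalgebra_generated K T G; y \<in> subalgebra_generated K T G\<rbrakk> \<Longrightarrow>
      x \<oplus>\<^bsub>T\<^esub> y \<in> subalgebra_generated K T G"
  | sg_mult: "\<lbrakk>x \<in> subalgebra_generated K T G; y \<in> subalgebra_generated K T G\<rbrakk> \<Longrightarrow>
      x \<otimes>\<^bsub>T\<^esub> y \<in> subalgebra_generated K T G"
  | sg_smult: "\<lbrakk>k \<in> carrier K; x \<in> subalgebra_generated K T G\<rbrakk> \<Longrightarrow>
      k \<odot>\<^bsub>T\<^esub> x \<in> subalgebra_generated K T G"

lemma subalgebra_generated_mono:
  assumes "G \<subseteq> G'" shows "subalgebra_generated K T G \<subseteq> subalgebra_generated K T G'"
proof
  fix x assume "x \<in> subalgebra_generated K T G"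
  then show "x \<in> subalgebra_generated K T G'"
    by induction (use assms in \<open>auto intro: subalgebra_generated.intros\<close>)
qed

section \<open>Commutation up to scalars, and freeness of powers\<close>

context nc_algebra
begin

abbreviation sg where "sg \<equiv> subalgebra_generated K A"

lemma sg_closed: "\<lbrakk>x \<in> sg G; G \<subseteq> carrier A\<rbrakk> \<Longrightarrow> x \<in> carrier A"
  by (induction rule: subalgebra_generated.induct) auto

lemma sg_zero: "\<zero> \<in> sg G"
  using sg_smult[of "\<zero>\<^bsub>K\<^esub>" K "\<one>" A G] sg_one[of A K G] by simp

lemma sg_finsum: "\<lbrakk>finite I; \<And>i. i \<in> I \<Longrightarrow> f i \<in> sg G; G \<subseteq> carrier A\<rbrakk> \<Longrightarrow> (\<Oplus>i\<in>I. f i) \<in> sg G"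
proof (induction I rule: finite_induct)
  case (insert i I)
  then have "f i \<in> carrier A" "f \<in> I \<rightarrow> carrier A" using sg_closed by blast+
  then show ?case using insert by (simp add: sg_add)
qed (simp add: sg_zero)

lemma sg_pow: "x \<in> sg G \<Longrightarrow> x [^] (k::nat) \<in> sg G"
  by (induction k) (simp_all add: sg_one sg_mult)

text \<open>Quasi-commutation: \<open>a\<close> acts on \<open>b\<close> with eigenvalue
  \<open>s\<close>. The membership conditions are part of the notion so that the rules below can be
  chained like a calculus.\<close>

definition qc :: "'k \<Rightarrow> 'a \<Rightarrow> 'a \<Rightarrow> bool"
  where "qc s a b \<longleftrightarrow> s \<in> carrier K \<and> a \<in> carrier A \<and> b \<in> carrier A \<and> a \<otimes> b = s \<odot> (b \<otimes> a)"

lemma qc_mult_right: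
  assumes "qc s a b" "qc t a d" shows "qc (s \<otimes>\<^bsub>K\<^esub> t) a (b \<otimes> d)"
proof -
  have c: "s \<in> carrier K" "t \<in> carrier K" "a \<in> carrier A" "b \<in> carrier A" "d \<in> carrier A"
    and e1: "a \<otimes> b = s \<odot> (b \<otimes> a)" and e2: "a \<otimes> d = t \<odot> (d \<otimes> a)"
    using assms by (simp_all add: qc_def)
  have "a \<otimes> (b \<otimes> d) = (a \<otimes> b) \<otimes> d" using c by (simp add: m_assoc)
  also have "\<dots> = s \<odot> (b \<otimes> (a \<otimes> d))" unfolding e1 using c by (simp add: smult_mult_left m_assoc)
  also have "\<dots> = (s \<otimes>\<^bsub>K\<^esub> t) \<odot> (b \<otimes> d \<otimes> a)"
    unfolding e2 using c by (simp add: smult_mult_right smult_assoc m_assoc)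
  finally show ?thesis using c by (simp add: qc_def)
qed

lemma qc_mult_left:
  assumes "qc s a d" "qc t b d" shows "qc (s \<otimes>\<^bsub>K\<^esub> t) (a \<otimes> b) d"
proof -
  have c: "s \<in> carrier K" "t \<in> carrier K" "a \<in> carrier A" "b \<in> carrier A" "d \<in> carrier A"
    and e1: "a \<otimes> d = s \<odot> (d \<otimes> a)" and e2: "b \<otimes> d = t \<odot> (d \<otimes> b)"
    using assms by (simp_all add: qc_def)
  have "a \<otimes> b \<otimes> d = a \<otimes> (b \<otimes> d)" using c by (simp add: m_assoc)
  also have "\<dots> = t \<odot> ((a \<otimes> d) \<otimes> b)" unfolding e2 using c by (simp add: smult_mult_right m_assoc)
  also have "\<dots> = (t \<otimes>\<^bsub>K\<^esub> s) \<odot> (d \<otimes> (a \<otimes> b))"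
    unfolding e1 using c by (simp add: smult_mult_left smult_assoc m_assoc)
  finally show ?thesis using c by (simp add: qc_def K.m_comm)
qed

lemma qc_sym:
  assumes "qc s a b" "s \<noteq> \<zero>\<^bsub>K\<^esub>" shows "qc (inv\<^bsub>K\<^esub> s) b a"
proof -
  note c = assms(1)[unfolded qc_def]
  have u: "s \<in> Units K" using c assms(2) by (simp add: K.field_Units)
  have "inv\<^bsub>K\<^esub> s \<odot> (a \<otimes> b) = inv\<^bsub>K\<^esub> s \<odot> (s \<odot> (b \<otimes> a))" using c by simp
  also have "\<dots> = b \<otimes> a" using c u by (simp add: smult_assoc[symmetric])
  finally show ?thesis using c u by (simp add: qc_def)
qed

lemma qc_inv_right:
  assumes "qc s a b" "s \<noteq> \<zero>\<^bsub>K\<^esub>" "b \<in> Units A" shows "qc (inv\<^bsub>K\<^esub> s) a (inv b)"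
proof -
  have c: "s \<in> carrier K" "a \<in> carrier A" "b \<in> carrier A" using assms(1) by (simp_all add: qc_def)
  have u: "s \<in> Units K" using c assms(2) by (simp add: K.field_Units)
  have i: "inv b \<in> carrier A" using assms(3) by simp
  have e: "b \<otimes> a = inv\<^bsub>K\<^esub> s \<odot> (a \<otimes> b)" using qc_sym[OF assms(1,2)] by (simp add: qc_def)
  have "a \<otimes> inv b = (inv b \<otimes> b) \<otimes> (a \<otimes> inv b)" using c assms(3) by simp
  also have "\<dots> = inv b \<otimes> (b \<otimes> a) \<otimes> inv b" using c i by (simp add: m_assoc)
  also have "\<dots> = inv\<^bsub>K\<^esub> s \<odot> (inv b \<otimes> (a \<otimes> (b \<otimes> inv b)))"
    unfolding e using c i u by (simp add: smult_mult_left smult_mult_right m_assoc)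
  also have "\<dots> = inv\<^bsub>K\<^esub> s \<odot> (inv b \<otimes> a)" using c assms(3) by simp
  finally show ?thesis using c i u by (simp add: qc_def)
qed

lemma qc_inv_left:
  assumes "qc s a b" "s \<noteq> \<zero>\<^bsub>K\<^esub>" "a \<in> Units A" shows "qc (inv\<^bsub>K\<^esub> s) (inv a) b"
proof -
  have u: "s \<in> Units K" using assms by (simp add: K.field_Units qc_def)
  have "qc (inv\<^bsub>K\<^esub> (inv\<^bsub>K\<^esub> s)) b (inv a)"
    by (rule qc_inv_right[OF qc_sym[OF assms(1,2)] _ assms(3)]) (use u K.field_Units K.Units_inv_Units in blast)
  then have "qc s b (inv a)" using u by simp
  then show ?thesis using qc_sym assms(2) by blast
qed

lemma qc_minus: "\<lbrakk>qc s a b; qc s a d\<rbrakk> \<Longrightarrow> qc s a (b \<ominus> d)"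
  by (simp add: qc_def minus_eq l_distr r_distr r_minus l_minus smult_r_distr smult_minus)

lemma qc_smult: "\<lbrakk>qc s a b; k \<in> carrier K\<rbrakk> \<Longrightarrow> qc s a (k \<odot> b)"
  by (simp add: qc_def smult_mult_left smult_mult_right smult_assoc[symmetric] K.m_comm)

lemma qc_one: "a \<in> carrier A \<Longrightarrow> qc \<one>\<^bsub>K\<^esub> a \<one>" "a \<in> carrier A \<Longrightarrow> qc \<one>\<^bsub>K\<^esub> \<one> a"
  by (simp_all add: qc_def)

lemma qc_self: "a \<in> carrier A \<Longrightarrow> qc \<one>\<^bsub>K\<^esub> a a"
  by (simp add: qc_def)

text \<open>Left independence of the powers of \<open>t\<close> over \<open>S\<close>, equivalent
  for additive \<open>S\<close> to injectivity of the evaluation of left polynomials at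
  \<open>t\<close>. This is the condition for \<open>t\<close> to serve as a skew polynomial
  variable.\<close>

definition free_over :: "'a set \<Rightarrow> 'a \<Rightarrow> bool"
  where "free_over S t \<longleftrightarrow> (\<forall>(f :: nat \<Rightarrow> 'a) n. (\<forall>i. f i \<in> S) \<longrightarrow> (\<Oplus>i\<in>{..n}. f i \<otimes> t [^] i) = \<zero> \<longrightarrow>
    (\<forall>i\<le>n. f i = \<zero>))"

lemma free_overD:
  fixes f :: "nat \<Rightarrow> 'a"
  assumes "free_over S t" "\<And>i. f i \<in> S" "(\<Oplus>i\<in>{..n}. f i \<otimes> t [^] i) = \<zero>" "i \<le> n"
  shows "f i = \<zero>"
proof -
  have "(\<forall>i. f i \<in> S) \<longrightarrow> (\<Oplus>i\<in>{..n}. f i \<otimes> t [^] i) = \<zero> \<longrightarrow> (\<forall>i\<le>n. f i = \<zero>)"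
    using assms(1) unfolding free_over_def by (elim allE)
  then show ?thesis using assms(2-4) by simp
qed

lemma free_over_subset: "\<lbrakk>free_over S t; S' \<subseteq> S\<rbrakk> \<Longrightarrow> free_over S' t"
  unfolding free_over_def by blast

end

section \<open>Evaluation of skew polynomials in an ambient algebra\<close>

lemma (in ring) up_iff: "f \<in> up R \<longleftrightarrow> (\<forall>i. f i \<in> carrier R) \<and> (\<exists>n. \<forall>m>n. f m = \<zero>)"
  unfolding up_def bound_def by auto

lemma image_algebra_simps:
  assumes "inj f"
  shows "carrier (image_algebra f A) = f ` carrier A"
    and "\<lbrakk>a \<in> carrier A; b \<in> carrier A\<rbrakk> \<Longrightarrow> f a \<otimes>\<^bsub>image_algebra f A\<^esub> f b = f (a \<otimes>\<^bsub>A\<^esub> b)"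
    and "\<lbrakk>a \<in> carrier A; b \<in> carrier A\<rbrakk> \<Longrightarrow> f a \<oplus>\<^bsub>image_algebra f A\<^esub> f b = f (a \<oplus>\<^bsub>A\<^esub> b)"
    and "\<one>\<^bsub>image_algebra f A\<^esub> = f \<one>\<^bsub>A\<^esub>" and "\<zero>\<^bsub>image_algebra f A\<^esub> = f \<zero>\<^bsub>A\<^esub>"
    and "a \<in> carrier A \<Longrightarrow> c \<odot>\<^bsub>image_algebra f A\<^esub> f a = f (c \<odot>\<^bsub>A\<^esub> a)"
proof -
  have i: "inv_into (carrier A) f (f a) = a" if "a \<in> carrier A" for a
    using that assms by (intro inv_into_f_f) (auto intro: inj_on_subset)
  show "carrier (image_algebra f A) = f ` carrier A"
    by (simp add: image_algebra_def image_ring_def image_group_def ring.defs monoid.defs module.defs)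
  show "\<lbrakk>a \<in> carrier A; b \<in> carrier A\<rbrakk> \<Longrightarrow> f a \<otimes>\<^bsub>image_algebra f A\<^esub> f b = f (a \<otimes>\<^bsub>A\<^esub> b)"
    and "\<lbrakk>a \<in> carrier A; b \<in> carrier A\<rbrakk> \<Longrightarrow> f a \<oplus>\<^bsub>image_algebra f A\<^esub> f b = f (a \<oplus>\<^bsub>A\<^esub> b)"
    and "\<one>\<^bsub>image_algebra f A\<^esub> = f \<one>\<^bsub>A\<^esub>" and "\<zero>\<^bsub>image_algebra f A\<^esub> = f \<zero>\<^bsub>A\<^esub>"
    and "a \<in> carrier A \<Longrightarrow> c \<odot>\<^bsub>image_algebra f A\<^esub> f a = f (c \<odot>\<^bsub>A\<^esub> a)"
    by (simp_all add: image_algebra_def image_ring_def image_group_def ring.defs monoid.defs module.defs i)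
qed

lemma inj_TPoly: "inj TPoly" and inj_TScalar: "inj TScalar"
  by (auto intro: injI)

locale embedded_algebra_map = R: nc_algebra K R + T: nc_algebra K T
  for K :: "('k, 'm) ring_scheme" and R :: "('k, 'a) module" and T :: "('k, 't) module" +
  fixes \<psi>
  assumes hom: "\<psi> \<in> alg_hom K R T" and inj: "inj_on \<psi> (carrier R)"
begin

lemmas \<psi>_simps = alg_hom_closed[OF hom] alg_hom_add[OF hom] alg_hom_mult[OF hom] alg_hom_one[OF hom]
  alg_hom_smult[OF hom] alg_hom_zero[OF R.nc_algebra_axioms T.nc_algebra_axioms hom]

lemma \<psi>_eq: "\<lbrakk>x \<in> carrier R; y \<in> carrier R\<rbrakk> \<Longrightarrow> \<psi> x = \<psi> y \<longleftrightarrow> x = y"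
  using inj by (auto dest: inj_onD)

lemma image_generated:
  assumes "G \<subseteq> \<psi> ` carrier R" shows "T.sg G \<subseteq> \<psi> ` carrier R"
proof
  fix x assume "x \<in> T.sg G"
  then show "x \<in> \<psi> ` carrier R"
  proof induction
    case sg_one
    then show ?case by (intro image_eqI[of _ _ "\<one>\<^bsub>R\<^esub>"]) (simp_all add: \<psi>_simps)
  next
    case (sg_gen g)
    then show ?case using assms by blast
  next
    case (sg_add x y)
    then obtain a b where "a \<in> carrier R" "b \<in> carrier R" "x = \<psi> a" "y = \<psi> b" by blast
    then show ?case by (intro image_eqI[of _ _ "a \<oplus>\<^bsub>R\<^esub> b"]) (simp_all add: \<psi>_simps)
  next
    case (sg_mult x y)
    then obtain a b where "a \<in> carrier R" "b \<in> carrier R" "x = \<psi> a" "y = \<psi> b" by blast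
    then show ?case by (intro image_eqI[of _ _ "a \<otimes>\<^bsub>R\<^esub> b"]) (simp_all add: \<psi>_simps)
  next
    case (sg_smult k x)
    then obtain a where "a \<in> carrier R" "x = \<psi> a" by blast
    then show ?case using sg_smult(1) by (intro image_eqI[of _ _ "k \<odot>\<^bsub>R\<^esub> a"]) (simp_all add: \<psi>_simps)
  qed
qed

end

text \<open>A skew polynomial ring over \<open>R \<subseteq> T\<close> whose variable is realized by an element \<open>t\<close> of \<open>T\<close>.
  Its ring axioms, like those of \<open>R\<close>, are inherited from \<open>T\<close>.\<close>

locale skew_extension = embedded_algebra_map K R T \<psi>
  for K :: "('k, 'm) ring_scheme" and R :: "('k, 'k tower) module" and T :: "('k, 't) module" and \<psi> +
  fixes \<tau> \<delta> and t :: 't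
  assumes \<tau>_closed: "r \<in> carrier R \<Longrightarrow> \<tau> r \<in> carrier R" and \<delta>_closed: "r \<in> carrier R \<Longrightarrow> \<delta> r \<in> carrier R"
    and t: "t \<in> carrier T"
    and skew: "r \<in> carrier R \<Longrightarrow> t \<otimes>\<^bsub>T\<^esub> \<psi> r = \<psi> (\<tau> r) \<otimes>\<^bsub>T\<^esub> t \<oplus>\<^bsub>T\<^esub> \<psi> (\<delta> r)"
    and free: "T.free_over (\<psi> ` carrier R) t"
begin

definition ev :: "(nat \<Rightarrow> 'k tower) \<Rightarrow> 't"
  where "ev f = (\<Oplus>\<^bsub>T\<^esub>i\<in>{i. f i \<noteq> \<zero>\<^bsub>R\<^esub>}. \<psi> (f i) \<otimes>\<^bsub>T\<^esub> t [^]\<^bsub>T\<^esub> i)"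

abbreviation S where "S \<equiv> skew_poly R \<tau> \<delta>"
abbreviation shift where "shift \<equiv> skew_shift R \<tau> \<delta>"

lemma S_simps: "carrier S = up R" "\<zero>\<^bsub>S\<^esub> = (\<lambda>n. \<zero>\<^bsub>R\<^esub>)" "\<one>\<^bsub>S\<^esub> = (\<lambda>n. if n = 0 then \<one>\<^bsub>R\<^esub> else \<zero>\<^bsub>R\<^esub>)"
  "f \<oplus>\<^bsub>S\<^esub> g = (\<lambda>n. f n \<oplus>\<^bsub>R\<^esub> g n)" "k \<odot>\<^bsub>S\<^esub> f = (\<lambda>n. k \<odot>\<^bsub>R\<^esub> f n)"
  "f \<otimes>\<^bsub>S\<^esub> g = (\<lambda>n. \<Oplus>\<^bsub>R\<^esub>i\<in>{i. f i \<noteq> \<zero>\<^bsub>R\<^esub>}. f i \<otimes>\<^bsub>R\<^esub> (shift ^^ i) g n)"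
  unfolding skew_poly_def by simp_all

lemma up_closed: "f \<in> up R \<Longrightarrow> f i \<in> carrier R"
  by (simp add: R.up_iff)

lemma ev_eq:
  assumes "\<And>i. f i \<in> carrier R" "\<And>i. i > n \<Longrightarrow> f i = \<zero>\<^bsub>R\<^esub>"
  shows "ev f = (\<Oplus>\<^bsub>T\<^esub>i\<in>{..n}. \<psi> (f i) \<otimes>\<^bsub>T\<^esub> t [^]\<^bsub>T\<^esub> i)"
  unfolding ev_def
  by (rule T.add.finprod_mono_neutral_cong_left)
     (use assms t in \<open>auto simp: \<psi>_simps not_less[symmetric]\<close>)

lemma ev_closed: "f \<in> up R \<Longrightarrow> ev f \<in> carrier T"
  unfolding ev_def by (rule T.finsum_closed) (use t in \<open>auto simp: up_closed \<psi>_simps\<close>)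

lemma up_bound2:
  assumes "f \<in> up R" "g \<in> up R" obtains n where "\<And>m. m > n \<Longrightarrow> f m = \<zero>\<^bsub>R\<^esub>" "\<And>m. m > n \<Longrightarrow> g m = \<zero>\<^bsub>R\<^esub>"
proof -
  obtain n n' where "\<And>m. m > n \<Longrightarrow> f m = \<zero>\<^bsub>R\<^esub>" "\<And>m. m > n' \<Longrightarrow> g m = \<zero>\<^bsub>R\<^esub>"
    using assms unfolding R.up_iff by blast
  then show ?thesis using that[of "max n n'"] by simp
qed

lemma up_add: assumes "f \<in> up R" "g \<in> up R" shows "(\<lambda>n. f n \<oplus>\<^bsub>R\<^esub> g n) \<in> up R"
proof -
  obtain n where "\<And>m. m > n \<Longrightarrow> f m = \<zero>\<^bsub>R\<^esub>" "\<And>m. m > n \<Longrightarrow> g m = \<zero>\<^bsub>R\<^esub>" using up_bound2[OF assms] by blast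
  then show ?thesis using assms by (auto simp: R.up_iff intro!: exI[of _ n])
qed

lemma up_zero: "(\<lambda>n. \<zero>\<^bsub>R\<^esub>) \<in> up R"
  by (simp add: R.up_iff)

lemma ev_zero: "ev (\<lambda>n. \<zero>\<^bsub>R\<^esub>) = \<zero>\<^bsub>T\<^esub>"
  by (simp add: ev_def)

lemma ev_add:
  assumes "f \<in> up R" "g \<in> up R" shows "ev (\<lambda>n. f n \<oplus>\<^bsub>R\<^esub> g n) = ev f \<oplus>\<^bsub>T\<^esub> ev g"
proof -
  obtain n where n: "\<And>m. m > n \<Longrightarrow> f m = \<zero>\<^bsub>R\<^esub>" "\<And>m. m > n \<Longrightarrow> g m = \<zero>\<^bsub>R\<^esub>" using up_bound2[OF assms] by blast
  note c = up_closed[OF assms(1)] up_closed[OF assms(2)]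
  have "ev (\<lambda>n. f n \<oplus>\<^bsub>R\<^esub> g n) = (\<Oplus>\<^bsub>T\<^esub>i\<in>{..n}. \<psi> (f i \<oplus>\<^bsub>R\<^esub> g i) \<otimes>\<^bsub>T\<^esub> t [^]\<^bsub>T\<^esub> i)"
    by (rule ev_eq) (use c n in auto)
  also have "\<dots> = (\<Oplus>\<^bsub>T\<^esub>i\<in>{..n}. \<psi> (f i) \<otimes>\<^bsub>T\<^esub> t [^]\<^bsub>T\<^esub> i \<oplus>\<^bsub>T\<^esub> \<psi> (g i) \<otimes>\<^bsub>T\<^esub> t [^]\<^bsub>T\<^esub> i)"
    by (rule T.finsum_cong') (use c t in \<open>auto simp: \<psi>_simps T.l_distr\<close>)
  also have "\<dots> = (\<Oplus>\<^bsub>T\<^esub>i\<in>{..n}. \<psi> (f i) \<otimes>\<^bsub>T\<^esub> t [^]\<^bsub>T\<^esub> i) \<oplus>\<^bsub>T\<^esub> (\<Oplus>\<^bsub>T\<^esub>i\<in>{..n}. \<psi> (g i) \<otimes>\<^bsub>T\<^esub> t [^]\<^bsub>T\<^esub> i)"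
    by (rule T.finsum_addf) (use c t in \<open>auto simp: \<psi>_simps\<close>)
  finally show ?thesis using ev_eq[of f n] ev_eq[of g n] c n by simp
qed

lemma ev_left:
  assumes "f \<in> up R" "r \<in> carrier R"
  shows "(\<lambda>n. r \<otimes>\<^bsub>R\<^esub> f n) \<in> up R" "ev (\<lambda>n. r \<otimes>\<^bsub>R\<^esub> f n) = \<psi> r \<otimes>\<^bsub>T\<^esub> ev f"
proof -
  obtain n where n: "\<And>m. m > n \<Longrightarrow> f m = \<zero>\<^bsub>R\<^esub>" using assms unfolding R.up_iff by blast
  note c = up_closed[OF assms(1)]
  show "(\<lambda>n. r \<otimes>\<^bsub>R\<^esub> f n) \<in> up R" using assms(2) n c by (auto simp: R.up_iff intro!: exI[of _ n])
  have "ev (\<lambda>n. r \<otimes>\<^bsub>R\<^esub> f n) = (\<Oplus>\<^bsub>T\<^esub>i\<in>{..n}. \<psi> (r \<otimes>\<^bsub>R\<^esub> f i) \<otimes>\<^bsub>T\<^esub> t [^]\<^bsub>T\<^esub> i)"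
    by (rule ev_eq) (use c n assms in auto)
  also have "\<dots> = (\<Oplus>\<^bsub>T\<^esub>i\<in>{..n}. \<psi> r \<otimes>\<^bsub>T\<^esub> (\<psi> (f i) \<otimes>\<^bsub>T\<^esub> t [^]\<^bsub>T\<^esub> i))"
    by (rule T.finsum_cong') (use c t assms in \<open>auto simp: \<psi>_simps T.m_assoc\<close>)
  also have "\<dots> = \<psi> r \<otimes>\<^bsub>T\<^esub> (\<Oplus>\<^bsub>T\<^esub>i\<in>{..n}. \<psi> (f i) \<otimes>\<^bsub>T\<^esub> t [^]\<^bsub>T\<^esub> i)"
    by (rule T.finsum_rdistr[symmetric]) (use c t assms in \<open>auto simp: \<psi>_simps\<close>)
  finally show "ev (\<lambda>n. r \<otimes>\<^bsub>R\<^esub> f n) = \<psi> r \<otimes>\<^bsub>T\<^esub> ev f" using ev_eq[of f n] c n by simp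
qed

lemma \<psi>_zero_iff: "r \<in> carrier R \<Longrightarrow> \<psi> r = \<zero>\<^bsub>T\<^esub> \<longleftrightarrow> r = \<zero>\<^bsub>R\<^esub>"
  using \<psi>_eq[of r "\<zero>\<^bsub>R\<^esub>"] by (simp add: \<psi>_simps)

text \<open>The skew rule at zero is a relation of degree one in \<open>t\<close>; freeness makes
  its two coefficients vanish. This keeps shifted coefficient sequences finitely supported.\<close>

lemma \<tau>\<delta>_zero: "\<tau> \<zero>\<^bsub>R\<^esub> = \<zero>\<^bsub>R\<^esub>" "\<delta> \<zero>\<^bsub>R\<^esub> = \<zero>\<^bsub>R\<^esub>"
proof -
  define f where "f i = (if i = 0 then \<psi> (\<delta> \<zero>\<^bsub>R\<^esub>) else \<psi> (\<tau> \<zero>\<^bsub>R\<^esub>))" for i :: nat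
  have c: "\<psi> (\<delta> \<zero>\<^bsub>R\<^esub>) \<in> carrier T" "\<psi> (\<tau> \<zero>\<^bsub>R\<^esub>) \<in> carrier T" by (simp_all add: \<psi>_simps \<tau>_closed \<delta>_closed)
  have sk: "\<psi> (\<tau> \<zero>\<^bsub>R\<^esub>) \<otimes>\<^bsub>T\<^esub> t \<oplus>\<^bsub>T\<^esub> \<psi> (\<delta> \<zero>\<^bsub>R\<^esub>) = \<zero>\<^bsub>T\<^esub>"
    using skew[of "\<zero>\<^bsub>R\<^esub>"] t by (simp add: \<psi>_simps)
  have "f i \<in> \<psi> ` carrier R" for i by (auto simp: f_def \<tau>_closed \<delta>_closed)
  moreover have "(\<Oplus>\<^bsub>T\<^esub>i\<in>{..Suc 0}. f i \<otimes>\<^bsub>T\<^esub> t [^]\<^bsub>T\<^esub> i) = \<zero>\<^bsub>T\<^esub>"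
    using sk t c by (simp add: f_def)
  ultimately have "f i = \<zero>\<^bsub>T\<^esub>" if "i \<le> Suc 0" for i using that by (rule T.free_overD[OF free])
  from this[of 0] this[of 1] show "\<tau> \<zero>\<^bsub>R\<^esub> = \<zero>\<^bsub>R\<^esub>" "\<delta> \<zero>\<^bsub>R\<^esub> = \<zero>\<^bsub>R\<^esub>"
    by (simp_all add: f_def \<psi>_zero_iff \<tau>_closed \<delta>_closed)
qed

text \<open>\<open>skew_shift\<close> models left multiplication by the variable. In
  \<open>T\<close> the rule \<open>skew\<close> rewrites \<open>t \<psi>(f i) t^i\<close> as
  \<open>\<psi>(\<tau> (f i)) t^(i+1) + \<psi>(\<delta> (f i)) t^i\<close>, which is the same
  rearrangement of coefficients.\<close>

lemma ev_shift:
  assumes "f \<in> up R" shows "shift f \<in> up R" "ev (shift f) = t \<otimes>\<^bsub>T\<^esub> ev f"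
proof -
  obtain n where n: "\<And>m. m > n \<Longrightarrow> f m = \<zero>\<^bsub>R\<^esub>" using assms unfolding R.up_iff by blast
  note c = up_closed[OF assms(1)]
  define g where "g m = (case m of 0 \<Rightarrow> \<zero>\<^bsub>R\<^esub> | Suc m \<Rightarrow> \<tau> (f m))" for m
  have g: "g m \<in> carrier R" for m by (cases m) (auto simp: g_def c \<tau>_closed)
  have g0: "g m = \<zero>\<^bsub>R\<^esub>" if "m > Suc n" for m using that n by (cases m) (auto simp: g_def \<tau>\<delta>_zero)
  have gup: "g \<in> up R" using g g0 by (auto simp: R.up_iff)
  have dup: "(\<lambda>m. \<delta> (f m)) \<in> up R" using n c by (auto simp: R.up_iff \<delta>_closed \<tau>\<delta>_zero intro!: exI[of _ n])
  have sh: "shift f = (\<lambda>m. g m \<oplus>\<^bsub>R\<^esub> \<delta> (f m))" by (auto simp: skew_shift_def g_def)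
  show "shift f \<in> up R" unfolding sh by (rule up_add[OF gup dup])
  have "ev g = (\<Oplus>\<^bsub>T\<^esub>i\<in>{..Suc n}. \<psi> (g i) \<otimes>\<^bsub>T\<^esub> t [^]\<^bsub>T\<^esub> i)" by (rule ev_eq[OF g g0])
  \<comment> \<open>The shifted sequence has degree one more, and its constant term, split off here,
    is zero.\<close>
  also have "\<dots> = (\<Oplus>\<^bsub>T\<^esub>i\<in>{..n}. \<psi> (g (Suc i)) \<otimes>\<^bsub>T\<^esub> t [^]\<^bsub>T\<^esub> Suc i) \<oplus>\<^bsub>T\<^esub> \<psi> (g 0) \<otimes>\<^bsub>T\<^esub> t [^]\<^bsub>T\<^esub> (0::nat)"
    by (rule T.finsum_Suc2) (use g t in \<open>auto simp: \<psi>_simps\<close>)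
  also have "\<dots> = (\<Oplus>\<^bsub>T\<^esub>i\<in>{..n}. \<psi> (g (Suc i)) \<otimes>\<^bsub>T\<^esub> t [^]\<^bsub>T\<^esub> Suc i)"
    using g t by (subst (2) g_def) (simp add: \<psi>_simps)
  finally have evg: "ev g = (\<Oplus>\<^bsub>T\<^esub>i\<in>{..n}. \<psi> (\<tau> (f i)) \<otimes>\<^bsub>T\<^esub> t [^]\<^bsub>T\<^esub> Suc i)" by (simp add: g_def)
  have evd: "ev (\<lambda>m. \<delta> (f m)) = (\<Oplus>\<^bsub>T\<^esub>i\<in>{..n}. \<psi> (\<delta> (f i)) \<otimes>\<^bsub>T\<^esub> t [^]\<^bsub>T\<^esub> i)"
    by (rule ev_eq) (use c n in \<open>auto simp: \<delta>_closed \<tau>\<delta>_zero\<close>)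
  have "ev (shift f) = ev g \<oplus>\<^bsub>T\<^esub> ev (\<lambda>m. \<delta> (f m))" unfolding sh by (rule ev_add[OF gup dup])
  also have "\<dots> = (\<Oplus>\<^bsub>T\<^esub>i\<in>{..n}. \<psi> (\<tau> (f i)) \<otimes>\<^bsub>T\<^esub> t [^]\<^bsub>T\<^esub> Suc i \<oplus>\<^bsub>T\<^esub> \<psi> (\<delta> (f i)) \<otimes>\<^bsub>T\<^esub> t [^]\<^bsub>T\<^esub> i)"
    unfolding evg evd by (rule T.finsum_addf[symmetric]) (use c t in \<open>auto simp: \<psi>_simps \<tau>_closed \<delta>_closed\<close>)
  also have "\<dots> = (\<Oplus>\<^bsub>T\<^esub>i\<in>{..n}. t \<otimes>\<^bsub>T\<^esub> (\<psi> (f i) \<otimes>\<^bsub>T\<^esub> t [^]\<^bsub>T\<^esub> i))"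
  proof (rule T.finsum_cong')
    fix i assume "i \<in> {..n}"
    have p: "t [^]\<^bsub>T\<^esub> Suc i = t \<otimes>\<^bsub>T\<^esub> t [^]\<^bsub>T\<^esub> i" using t by (metis T.nat_pow_Suc2)
    have "t \<otimes>\<^bsub>T\<^esub> (\<psi> (f i) \<otimes>\<^bsub>T\<^esub> t [^]\<^bsub>T\<^esub> i) = (\<psi> (\<tau> (f i)) \<otimes>\<^bsub>T\<^esub> t \<oplus>\<^bsub>T\<^esub> \<psi> (\<delta> (f i))) \<otimes>\<^bsub>T\<^esub> t [^]\<^bsub>T\<^esub> i"
      using skew[OF c[of i]] c t by (simp add: \<psi>_simps T.m_assoc[symmetric])
    then show "\<psi> (\<tau> (f i)) \<otimes>\<^bsub>T\<^esub> t [^]\<^bsub>T\<^esub> Suc i \<oplus>\<^bsub>T\<^esub> \<psi> (\<delta> (f i)) \<otimes>\<^bsub>T\<^esub> t [^]\<^bsub>T\<^esub> i = t \<otimes>\<^bsub>T\<^esub> (\<psi> (f i) \<otimes>\<^bsub>T\<^esub> t [^]\<^bsub>T\<^esub> i)"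
      unfolding p using c t by (simp add: \<psi>_simps \<tau>_closed \<delta>_closed T.l_distr T.m_assoc)
  qed (use c t in \<open>auto simp: \<psi>_simps\<close>)
  also have "\<dots> = t \<otimes>\<^bsub>T\<^esub> (\<Oplus>\<^bsub>T\<^esub>i\<in>{..n}. \<psi> (f i) \<otimes>\<^bsub>T\<^esub> t [^]\<^bsub>T\<^esub> i)"
    by (rule T.finsum_rdistr[symmetric]) (use c t in \<open>auto simp: \<psi>_simps\<close>)
  finally show "ev (shift f) = t \<otimes>\<^bsub>T\<^esub> ev f" using ev_eq[of f n] c n by simp
qed

lemma ev_shift_pow:
  assumes "f \<in> up R" shows "(shift ^^ i) f \<in> up R \<and> ev ((shift ^^ i) f) = t [^]\<^bsub>T\<^esub> i \<otimes>\<^bsub>T\<^esub> ev f"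
proof (induction i)
  case (Suc i)
  have "t \<otimes>\<^bsub>T\<^esub> t [^]\<^bsub>T\<^esub> i = t [^]\<^bsub>T\<^esub> Suc i" using t by (metis T.nat_pow_Suc2)
  then show ?case using Suc ev_shift[of "(shift ^^ i) f"] t ev_closed[OF assms]
    by (simp add: T.m_assoc[symmetric])
qed (simp add: assms ev_closed)

lemma ev_sum:
  assumes "finite I" "\<And>i. i \<in> I \<Longrightarrow> h i \<in> up R"
  shows "(\<lambda>n. \<Oplus>\<^bsub>R\<^esub>i\<in>I. h i n) \<in> up R \<and> ev (\<lambda>n. \<Oplus>\<^bsub>R\<^esub>i\<in>I. h i n) = (\<Oplus>\<^bsub>T\<^esub>i\<in>I. ev (h i))"
  using assms
proof (induction I rule: finite_induct)
  case (insert i I)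
  have hi: "h i \<in> up R" and hI: "h j \<in> up R" if "j \<in> I" for j using insert that by auto
  have e: "(\<lambda>n. \<Oplus>\<^bsub>R\<^esub>j\<in>insert i I. h j n) = (\<lambda>n. h i n \<oplus>\<^bsub>R\<^esub> (\<Oplus>\<^bsub>R\<^esub>j\<in>I. h j n))"
    by (rule ext, rule R.finsum_insert) (use insert up_closed in auto)
  have "(\<Oplus>\<^bsub>T\<^esub>j\<in>insert i I. ev (h j)) = ev (h i) \<oplus>\<^bsub>T\<^esub> (\<Oplus>\<^bsub>T\<^esub>j\<in>I. ev (h j))"
    by (rule T.finsum_insert) (use insert ev_closed in auto)
  then show ?case unfolding e using insert ev_add up_add by auto
qed (simp add: up_zero ev_zero)

text \<open>The product in \<open>skew_poly\<close> is the sum of the coefficients of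
  \<open>f\<close> times iterated shifts of \<open>g\<close>; by \<open>ev_shift_pow\<close> every
  iterated shift evaluates to a power of \<open>t\<close> times the value of
  \<open>g\<close>.\<close>

lemma ev_mult:
  assumes "f \<in> up R" "g \<in> up R" shows "f \<otimes>\<^bsub>S\<^esub> g \<in> up R" "ev (f \<otimes>\<^bsub>S\<^esub> g) = ev f \<otimes>\<^bsub>T\<^esub> ev g"
proof -
  let ?I = "{i. f i \<noteq> \<zero>\<^bsub>R\<^esub>}"
  obtain n where n: "\<And>m. m > n \<Longrightarrow> f m = \<zero>\<^bsub>R\<^esub>" using assms unfolding R.up_iff by blast
  have "?I \<subseteq> {..n}" using n by (auto simp: not_less[symmetric])
  then have fin: "finite ?I" by (rule finite_subset) simp
  define h where "h i = (\<lambda>n. f i \<otimes>\<^bsub>R\<^esub> (shift ^^ i) g n)" for i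
  have h: "h i \<in> up R" "ev (h i) = \<psi> (f i) \<otimes>\<^bsub>T\<^esub> (t [^]\<^bsub>T\<^esub> i \<otimes>\<^bsub>T\<^esub> ev g)" for i
    using ev_left[of "(shift ^^ i) g" "f i"] ev_shift_pow[OF assms(2), of i] up_closed[OF assms(1)]
    by (auto simp: h_def)
  have e: "f \<otimes>\<^bsub>S\<^esub> g = (\<lambda>n. \<Oplus>\<^bsub>R\<^esub>i\<in>?I. h i n)" by (simp add: S_simps h_def)
  show "f \<otimes>\<^bsub>S\<^esub> g \<in> up R" unfolding e using ev_sum[of ?I h] fin h by blast
  have "ev (f \<otimes>\<^bsub>S\<^esub> g) = (\<Oplus>\<^bsub>T\<^esub>i\<in>?I. ev (h i))" unfolding e using ev_sum[of ?I h] fin h by blast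
  also have "\<dots> = (\<Oplus>\<^bsub>T\<^esub>i\<in>?I. (\<psi> (f i) \<otimes>\<^bsub>T\<^esub> t [^]\<^bsub>T\<^esub> i) \<otimes>\<^bsub>T\<^esub> ev g)"
    by (rule T.finsum_cong') (use h ev_closed[OF assms(2)] up_closed[OF assms(1)] t in \<open>auto simp: \<psi>_simps T.m_assoc\<close>)
  also have "\<dots> = (\<Oplus>\<^bsub>T\<^esub>i\<in>?I. \<psi> (f i) \<otimes>\<^bsub>T\<^esub> t [^]\<^bsub>T\<^esub> i) \<otimes>\<^bsub>T\<^esub> ev g"
    by (rule T.finsum_ldistr[symmetric]) (use fin ev_closed[OF assms(2)] up_closed[OF assms(1)] t in \<open>auto simp: \<psi>_simps\<close>)
  finally show "ev (f \<otimes>\<^bsub>S\<^esub> g) = ev f \<otimes>\<^bsub>T\<^esub> ev g" by (simp add: ev_def)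
qed

lemma ev_smult:
  assumes "f \<in> up R" "k \<in> carrier K"
  shows "(\<lambda>n. k \<odot>\<^bsub>R\<^esub> f n) \<in> up R" "ev (\<lambda>n. k \<odot>\<^bsub>R\<^esub> f n) = k \<odot>\<^bsub>T\<^esub> ev f"
proof -
  have e: "(\<lambda>n. k \<odot>\<^bsub>R\<^esub> f n) = (\<lambda>n. (k \<odot>\<^bsub>R\<^esub> \<one>\<^bsub>R\<^esub>) \<otimes>\<^bsub>R\<^esub> f n)"
    using assms up_closed[OF assms(1)] by (simp add: R.smult_mult_left)
  show "(\<lambda>n. k \<odot>\<^bsub>R\<^esub> f n) \<in> up R" unfolding e by (rule ev_left) (use assms in auto)
  have "ev (\<lambda>n. k \<odot>\<^bsub>R\<^esub> f n) = \<psi> (k \<odot>\<^bsub>R\<^esub> \<one>\<^bsub>R\<^esub>) \<otimes>\<^bsub>T\<^esub> ev f" unfolding e by (rule ev_left) (use assms in auto)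
  then show "ev (\<lambda>n. k \<odot>\<^bsub>R\<^esub> f n) = k \<odot>\<^bsub>T\<^esub> ev f"
    using assms ev_closed by (simp add: \<psi>_simps T.smult_mult_left)
qed

lemma up_const: "r \<in> carrier R \<Longrightarrow> (\<lambda>n. if n = 0 then r else \<zero>\<^bsub>R\<^esub>) \<in> up R"
  by (auto simp: R.up_iff)

lemma ev_const: "r \<in> carrier R \<Longrightarrow> ev (\<lambda>n. if n = 0 then r else \<zero>\<^bsub>R\<^esub>) = \<psi> r"
  by (subst ev_eq[of _ 0]) (auto simp: \<psi>_simps)

lemma up_var: "(\<lambda>n. if n = 1 then \<one>\<^bsub>R\<^esub> else \<zero>\<^bsub>R\<^esub>) \<in> up R"
  by (auto simp: R.up_iff intro!: exI[of _ 1])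

lemma ev_var: "ev (\<lambda>n. if n = 1 then \<one>\<^bsub>R\<^esub> else \<zero>\<^bsub>R\<^esub>) = t"
  by (subst ev_eq[of _ "Suc 0"]) (use t in \<open>auto simp: \<psi>_simps\<close>)

text \<open>The coefficientwise difference evaluates to a vanishing polynomial in \<open>t\<close>,
  whose coefficients are zero by freeness.\<close>

lemma ev_inj: assumes "f \<in> up R" "g \<in> up R" "ev f = ev g" shows "f = g"
proof -
  define h where "h = (\<lambda>n. f n \<oplus>\<^bsub>R\<^esub> (\<ominus>\<^bsub>K\<^esub> \<one>\<^bsub>K\<^esub>) \<odot>\<^bsub>R\<^esub> g n)"
  have m: "(\<lambda>n. (\<ominus>\<^bsub>K\<^esub> \<one>\<^bsub>K\<^esub>) \<odot>\<^bsub>R\<^esub> g n) \<in> up R" by (rule ev_smult) (use assms in auto)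
  have h: "h \<in> up R" unfolding h_def by (rule up_add[OF assms(1) m])
  have "ev h = ev f \<oplus>\<^bsub>T\<^esub> (\<ominus>\<^bsub>K\<^esub> \<one>\<^bsub>K\<^esub>) \<odot>\<^bsub>T\<^esub> ev g"
    unfolding h_def by (subst ev_add[OF assms(1) m]) (simp add: ev_smult assms)
  then have 0: "ev h = \<zero>\<^bsub>T\<^esub>" using assms ev_closed[OF assms(2)] by (simp add: T.smult_minus_one T.r_neg)
  obtain n where n: "\<And>m. m > n \<Longrightarrow> h m = \<zero>\<^bsub>R\<^esub>" using h unfolding R.up_iff by blast
  have "ev h = (\<Oplus>\<^bsub>T\<^esub>i\<in>{..n}. \<psi> (h i) \<otimes>\<^bsub>T\<^esub> t [^]\<^bsub>T\<^esub> i)" by (rule ev_eq) (use up_closed[OF h] n in auto)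
  then have s0: "(\<Oplus>\<^bsub>T\<^esub>i\<in>{..n}. \<psi> (h i) \<otimes>\<^bsub>T\<^esub> t [^]\<^bsub>T\<^esub> i) = \<zero>\<^bsub>T\<^esub>" using 0 by simp
  have "\<psi> (h i) = \<zero>\<^bsub>T\<^esub>" if "i \<le> n" for i
    by (rule T.free_overD[OF free _ s0 that]) (rule imageI[OF up_closed[OF h]])
  then have "h i = \<zero>\<^bsub>R\<^esub>" for i using n[of i] \<psi>_zero_iff[OF up_closed[OF h]] by (cases "i \<le> n") simp_all
  then have hi: "f i \<oplus>\<^bsub>R\<^esub> (\<ominus>\<^bsub>K\<^esub> \<one>\<^bsub>K\<^esub>) \<odot>\<^bsub>R\<^esub> g i = \<zero>\<^bsub>R\<^esub>" for i by (simp only: h_def)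
  show ?thesis
  proof
    fix i
    have "f i \<ominus>\<^bsub>R\<^esub> g i = \<zero>\<^bsub>R\<^esub>"
      using hi[of i] up_closed[OF assms(2), of i] by (simp only: R.smult_minus_one R.minus_eq)
    then show "f i = g i" using up_closed[OF assms(1), of i] up_closed[OF assms(2), of i] by simp
  qed
qed

definition \<psi>' :: "'k tower \<Rightarrow> 't"
  where "\<psi>' x = ev (case x of TPoly f \<Rightarrow> f)"

abbreviation R' where "R' \<equiv> tower_step R \<tau> \<delta>"

lemmas step_simps = image_algebra_simps[OF inj_TPoly, where A = S, folded tower_step_def]

lemma step_carrierE:
  assumes "x \<in> carrier R'" obtains f where "x = TPoly f" "f \<in> up R" "\<psi>' x = ev f"
  using assms unfolding step_simps S_simps by (auto simp: \<psi>'_def)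

lemma \<psi>'_TPoly [simp]: "\<psi>' (TPoly f) = ev f"
  by (simp add: \<psi>'_def)

lemma step_hom: "\<psi>' \<in> alg_hom K R' T"
proof (rule alg_homI)
  fix x assume "x \<in> carrier R'"
  then obtain f where f: "x = TPoly f" "f \<in> up R" by (rule step_carrierE)
  then show "\<psi>' x \<in> carrier T" by (simp add: ev_closed)
  fix y assume "y \<in> carrier R'"
  then obtain g where g: "y = TPoly g" "g \<in> up R" by (rule step_carrierE)
  show "\<psi>' (x \<oplus>\<^bsub>R'\<^esub> y) = \<psi>' x \<oplus>\<^bsub>T\<^esub> \<psi>' y" using f g by (simp add: step_simps S_simps ev_add)
  show "\<psi>' (x \<otimes>\<^bsub>R'\<^esub> y) = \<psi>' x \<otimes>\<^bsub>T\<^esub> \<psi>' y" using f g by (simp add: step_simps S_simps(1) ev_mult)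
next
  show "\<psi>' \<one>\<^bsub>R'\<^esub> = \<one>\<^bsub>T\<^esub>" by (simp add: step_simps S_simps ev_const \<psi>_simps)
next
  fix k x assume k: "k \<in> carrier K" and "x \<in> carrier R'"
  then obtain f where f: "x = TPoly f" "f \<in> up R" using step_carrierE by blast
  then show "\<psi>' (k \<odot>\<^bsub>R'\<^esub> x) = k \<odot>\<^bsub>T\<^esub> \<psi>' x" using k by (simp add: step_simps S_simps ev_smult)
qed

lemma step_inj: "inj_on \<psi>' (carrier R')"
proof (rule inj_onI)
  fix x y assume x: "x \<in> carrier R'" and y: "y \<in> carrier R'" and eq: "\<psi>' x = \<psi>' y"
  obtain f where f: "x = TPoly f" "f \<in> up R" using x by (rule step_carrierE)
  obtain g where g: "y = TPoly g" "g \<in> up R" using y by (rule step_carrierE)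
  show "x = y" using ev_inj[of f g] f g eq by simp
qed

lemma step_algebra: "nc_algebra K R'"
proof (rule nc_algebra_pullback[OF T.nc_algebra_axioms step_hom _ step_inj])
  show "\<psi>' \<zero>\<^bsub>R'\<^esub> = \<zero>\<^bsub>T\<^esub>" by (simp add: step_simps S_simps ev_zero)
  show "\<one>\<^bsub>R'\<^esub> \<in> carrier R'" "\<zero>\<^bsub>R'\<^esub> \<in> carrier R'" by (auto simp: step_simps S_simps up_const up_zero)
  fix x assume "x \<in> carrier R'"
  then obtain f where f: "x = TPoly f" "f \<in> up R" by (rule step_carrierE)
  show "k \<odot>\<^bsub>R'\<^esub> x \<in> carrier R'" if "k \<in> carrier K" for k
    using f that by (simp add: step_simps S_simps ev_smult)
  fix y assume "y \<in> carrier R'"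
  then obtain g where g: "y = TPoly g" "g \<in> up R" by (rule step_carrierE)
  show "x \<oplus>\<^bsub>R'\<^esub> y \<in> carrier R'" using f g by (simp add: step_simps S_simps up_add)
  show "x \<otimes>\<^bsub>R'\<^esub> y \<in> carrier R'" using f g by (simp add: step_simps S_simps(1) ev_mult)
qed

lemma step_const: "r \<in> carrier R \<Longrightarrow> tower_const R r \<in> carrier R' \<and> \<psi>' (tower_const R r) = \<psi> r"
  by (simp add: tower_const_def step_simps S_simps up_const ev_const)

lemma step_var: "tower_var R \<in> carrier R' \<and> \<psi>' (tower_var R) = t"
  using ev_var up_var by (simp add: tower_var_def step_simps S_simps)

lemma step_embedded: "embedded_algebra_map K R' T \<psi>'"
  by (intro embedded_algebra_map.intro embedded_algebra_map_axioms.intro step_algebra T.nc_algebra_axioms step_hom step_inj)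

lemma step_image:
  assumes G: "\<psi> ` carrier R = T.sg G" "G \<subseteq> carrier T" "G' = insert t G"
  shows "\<psi>' ` carrier R' = T.sg G'"
proof
  interpret R': embedded_algebra_map K R' T \<psi>' by (rule step_embedded)
  have G': "G' \<subseteq> carrier T" using G t by auto
  show "\<psi>' ` carrier R' \<subseteq> T.sg G'"
  proof
    fix z assume "z \<in> \<psi>' ` carrier R'"
    then obtain f where f: "f \<in> up R" "z = ev f" by (auto elim: step_carrierE)
    obtain n where n: "\<And>m. m > n \<Longrightarrow> f m = \<zero>\<^bsub>R\<^esub>" using f unfolding R.up_iff by blast
    have "ev f = (\<Oplus>\<^bsub>T\<^esub>i\<in>{..n}. \<psi> (f i) \<otimes>\<^bsub>T\<^esub> t [^]\<^bsub>T\<^esub> i)" by (rule ev_eq) (use up_closed[OF f(1)] n in auto)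
    also have "\<dots> \<in> T.sg G'"
    proof (rule T.sg_finsum)
      fix i
      have "\<psi> (f i) \<in> T.sg G" using up_closed[OF f(1)] G by blast
      then have "\<psi> (f i) \<in> T.sg G'" using subalgebra_generated_mono[of G G' K T] G by blast
      moreover have "t \<in> T.sg G'" using G by (auto intro: sg_gen)
      ultimately show "\<psi> (f i) \<otimes>\<^bsub>T\<^esub> t [^]\<^bsub>T\<^esub> i \<in> T.sg G'" by (intro sg_mult T.sg_pow)
    qed (use G' in auto)
    finally show "z \<in> T.sg G'" using f by simp
  qed
  have "G \<subseteq> \<psi>' ` carrier R'"
  proof
    fix g assume "g \<in> G"
    then have "g \<in> \<psi> ` carrier R" unfolding G(1) by (rule sg_gen)
    then obtain r where "r \<in> carrier R" "g = \<psi> r" by blast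
    then show "g \<in> \<psi>' ` carrier R'" using step_const[of r] by (metis image_eqI)
  qed
  moreover have "t \<in> \<psi>' ` carrier R'" using step_var by (metis image_eqI)
  ultimately show "T.sg G' \<subseteq> \<psi>' ` carrier R'" using G(3) by (intro R'.image_generated) auto
qed

end

section \<open>The quantized Weyl algebra inside a quantum torus\<close>

context nc_algebra
begin

text \<open>Generators that quasi-commute with \<open>u\<close> are eigenvectors of conjugation by
  \<open>u\<close>, and conjugation respects all operations of the algebra.\<close>

lemma conjugate_sg:
  assumes u: "u \<in> Units A" and G: "G \<subseteq> carrier A" and k: "\<And>g. g \<in> G \<Longrightarrow> \<exists>k. qc k u g"
  shows "x \<in> sg G \<Longrightarrow> u \<otimes> x \<otimes> inv u \<in> sg G"
proof (induction rule: subalgebra_generated.induct)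
  case sg_one
  have "u \<otimes> \<one> \<otimes> inv u = \<one>" using u Units_closed[OF u] by simp
  then show ?case using subalgebra_generated.sg_one[of A K G] by simp
next
  case (sg_gen g)
  obtain k where "qc k u g" using k sg_gen by blast
  then have "u \<otimes> g \<otimes> inv u = k \<odot> g" "k \<in> carrier K"
    using u Units_closed[OF u] Units_inv_closed[OF u] by (simp_all add: qc_def smult_mult_left m_assoc)
  then show ?case using subalgebra_generated.sg_gen[OF sg_gen] subalgebra_generated.sg_smult by metis
next
  case (sg_add x y)
  have "x \<in> carrier A" "y \<in> carrier A" using sg_add G sg_closed by blast+
  then have "u \<otimes> (x \<oplus> y) \<otimes> inv u = u \<otimes> x \<otimes> inv u \<oplus> u \<otimes> y \<otimes> inv u"
    using u Units_closed[OF u] Units_inv_closed[OF u] by (simp add: l_distr r_distr)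
  then show ?case using subalgebra_generated.sg_add[OF sg_add.IH] by simp
next
  case (sg_mult x y)
  have c: "x \<in> carrier A" "y \<in> carrier A" using sg_mult G sg_closed by blast+
  have "(u \<otimes> x \<otimes> inv u) \<otimes> (u \<otimes> y \<otimes> inv u) = u \<otimes> x \<otimes> ((inv u \<otimes> u) \<otimes> (y \<otimes> inv u))"
    using c u Units_closed[OF u] Units_inv_closed[OF u] by (simp add: m_assoc del: Units_l_inv)
  also have "\<dots> = u \<otimes> (x \<otimes> y) \<otimes> inv u"
    using c u Units_closed[OF u] Units_inv_closed[OF u] by (simp add: m_assoc)
  finally show ?case using subalgebra_generated.sg_mult[OF sg_mult.IH] by simp
next
  case (sg_smult s x)
  have "x \<in> carrier A" using sg_smult G sg_closed by blast
  then have "u \<otimes> (s \<odot> x) \<otimes> inv u = s \<odot> (u \<otimes> x \<otimes> inv u)"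
    using u sg_smult Units_closed[OF u] Units_inv_closed[OF u] by (simp add: smult_mult_left smult_mult_right)
  then show ?case using subalgebra_generated.sg_smult[OF sg_smult.hyps(1) sg_smult.IH] by simp
qed

end

section \<open>Automorphisms and skew derivations induced by the ambient algebra\<close>

locale generated_map = embedded_algebra_map K R T \<psi>
  for K :: "('k, 'm) ring_scheme" and R :: "('k, 'a) module" and T :: "('k, 't) module" and \<psi> +
  fixes G :: "'t set"
  assumes image: "\<psi> ` carrier R = T.sg G" and G: "G \<subseteq> carrier T"
begin

lemma preimage:
  assumes "x \<in> T.sg G" obtains r where "r \<in> carrier R" "\<psi> r = x"
proof -
  have "x \<in> \<psi> ` carrier R" using assms by (simp only: image)
  then show ?thesis by (elim imageE) (rule that, simp_all)
qed

lemma \<psi>_in: "r \<in> carrier R \<Longrightarrow> \<psi> r \<in> T.sg G"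
  unfolding image[symmetric] by (rule imageI)

lemma map_exists:
  assumes "\<And>r. r \<in> carrier R \<Longrightarrow> F r \<in> T.sg G"
  shows "\<exists>\<theta>. \<forall>r\<in>carrier R. \<theta> r \<in> carrier R \<and> \<psi> (\<theta> r) = F r"
proof -
  have "\<forall>r\<in>carrier R. \<exists>a. a \<in> carrier R \<and> \<psi> a = F r"
  proof
    fix r assume "r \<in> carrier R"
    then have "F r \<in> T.sg G" by (rule assms)
    then obtain a where "a \<in> carrier R" "\<psi> a = F r" by (rule preimage)
    then show "\<exists>a. a \<in> carrier R \<and> \<psi> a = F r" by (intro exI conjI)
  qed
  then show ?thesis by (rule bchoice)
qed

text \<open>Conjugation by \<open>u\<close> maps the image of \<open>R\<close> into itself because
  \<open>u\<close> scales the generators. The scalars are nonzero, so the inverse of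
  \<open>u\<close> does the same; this gives surjectivity. The result makes the descriptions of
  \<open>weyl_sigma\<close> and \<open>weyl_tau\<close> satisfiable.\<close>

lemma twist_exists:
  assumes u: "u \<in> Units T" and k: "\<And>g. g \<in> G \<Longrightarrow> \<exists>k. k \<noteq> \<zero>\<^bsub>K\<^esub> \<and> T.qc k u g"
  shows "\<exists>\<theta>. \<theta> \<in> alg_iso K R R \<and> (\<forall>r\<in>carrier R. u \<otimes>\<^bsub>T\<^esub> \<psi> r = \<psi> (\<theta> r) \<otimes>\<^bsub>T\<^esub> u)"
proof -
  let ?v = "inv\<^bsub>T\<^esub> u"
  have uc: "u \<in> carrier T" "?v \<in> carrier T" and v: "?v \<in> Units T" using u by (auto simp: T.Units_closed)
  have k1: "\<exists>k. T.qc k u g" if "g \<in> G" for g using k[OF that] by blast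
  have k2: "\<exists>k. T.qc k ?v g" if "g \<in> G" for g using k[OF that] T.qc_inv_left u by blast
  have F: "u \<otimes>\<^bsub>T\<^esub> \<psi> r \<otimes>\<^bsub>T\<^esub> ?v \<in> T.sg G" if "r \<in> carrier R" for r
    using T.conjugate_sg[OF u G k1 \<psi>_in[OF that]] .
  have "\<exists>\<theta>. \<forall>r\<in>carrier R. \<theta> r \<in> carrier R \<and> \<psi> (\<theta> r) = u \<otimes>\<^bsub>T\<^esub> \<psi> r \<otimes>\<^bsub>T\<^esub> ?v"
    by (rule map_exists) (rule F)
  then obtain \<theta> where \<theta>0: "\<forall>r\<in>carrier R. \<theta> r \<in> carrier R \<and> \<psi> (\<theta> r) = u \<otimes>\<^bsub>T\<^esub> \<psi> r \<otimes>\<^bsub>T\<^esub> ?v" by (elim exE)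
  note \<theta> = bspec[OF \<theta>0]
  have tw: "u \<otimes>\<^bsub>T\<^esub> \<psi> r = \<psi> (\<theta> r) \<otimes>\<^bsub>T\<^esub> u" if "r \<in> carrier R" for r
    using \<theta>[OF that] that u uc by (simp add: T.m_assoc \<psi>_simps)
  have eqI: "a = b" if "a \<in> carrier R" "b \<in> carrier R" "\<psi> a \<otimes>\<^bsub>T\<^esub> u = \<psi> b \<otimes>\<^bsub>T\<^esub> u" for a b
  proof -
    have "\<psi> a \<otimes>\<^bsub>T\<^esub> u \<otimes>\<^bsub>T\<^esub> ?v = \<psi> b \<otimes>\<^bsub>T\<^esub> u \<otimes>\<^bsub>T\<^esub> ?v" using that by simp
    then have "\<psi> a = \<psi> b" using that(1,2) u uc by (simp add: T.m_assoc \<psi>_simps)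
    then show ?thesis using \<psi>_eq that by blast
  qed
  have hom: "\<theta> \<in> alg_hom K R R"
  proof (rule alg_homI)
    fix a b assume ab: "a \<in> carrier R" "b \<in> carrier R"
    note c = ab \<theta>[OF ab(1), THEN conjunct1] \<theta>[OF ab(2), THEN conjunct1]
    show "\<theta> (a \<oplus>\<^bsub>R\<^esub> b) = \<theta> a \<oplus>\<^bsub>R\<^esub> \<theta> b"
      by (rule eqI) (use c \<theta> uc in \<open>simp_all add: \<psi>_simps T.l_distr T.r_distr tw[symmetric]\<close>)
    have "u \<otimes>\<^bsub>T\<^esub> (\<psi> a \<otimes>\<^bsub>T\<^esub> \<psi> b) = \<psi> (\<theta> a) \<otimes>\<^bsub>T\<^esub> (u \<otimes>\<^bsub>T\<^esub> \<psi> b)"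
      using c uc tw[OF ab(1)] by (simp add: \<psi>_simps T.m_assoc[symmetric])
    also have "\<dots> = \<psi> (\<theta> a \<otimes>\<^bsub>R\<^esub> \<theta> b) \<otimes>\<^bsub>T\<^esub> u"
      unfolding tw[OF ab(2)] using c uc by (simp add: \<psi>_simps T.m_assoc)
    finally show "\<theta> (a \<otimes>\<^bsub>R\<^esub> b) = \<theta> a \<otimes>\<^bsub>R\<^esub> \<theta> b"
      using tw[of "a \<otimes>\<^bsub>R\<^esub> b"] c \<theta> by (intro eqI) (simp_all add: \<psi>_simps)
  next
    show "\<theta> \<one>\<^bsub>R\<^esub> = \<one>\<^bsub>R\<^esub>"
      by (rule eqI) (use \<theta> u uc in \<open>simp_all add: tw[symmetric] \<psi>_simps\<close>)
  next
    fix c a assume ca: "c \<in> carrier K" "a \<in> carrier R"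
    show "\<theta> (c \<odot>\<^bsub>R\<^esub> a) = c \<odot>\<^bsub>R\<^esub> \<theta> a"
      by (rule eqI) (use ca \<theta> uc in \<open>simp_all add: \<psi>_simps T.smult_mult_left T.smult_mult_right tw[symmetric]\<close>)
  qed (use \<theta> in blast)
  have "bij_betw \<theta> (carrier R) (carrier R)"
  proof (rule bij_betwI')
    fix a b assume ab: "a \<in> carrier R" "b \<in> carrier R"
    show "\<theta> a = \<theta> b \<longleftrightarrow> a = b"
    proof
      assume "\<theta> a = \<theta> b"
      then have "u \<otimes>\<^bsub>T\<^esub> \<psi> a = u \<otimes>\<^bsub>T\<^esub> \<psi> b" using tw ab by simp
      then have "?v \<otimes>\<^bsub>T\<^esub> u \<otimes>\<^bsub>T\<^esub> \<psi> a = ?v \<otimes>\<^bsub>T\<^esub> u \<otimes>\<^bsub>T\<^esub> \<psi> b" using ab uc by (simp add: T.m_assoc \<psi>_simps del: T.Units_l_inv)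
      then have "\<psi> a = \<psi> b" using u ab by (simp add: \<psi>_simps)
      then show "a = b" using \<psi>_eq ab by blast
    qed simp
  next
    fix b assume b: "b \<in> carrier R"
    have "?v \<otimes>\<^bsub>T\<^esub> \<psi> b \<otimes>\<^bsub>T\<^esub> inv\<^bsub>T\<^esub> ?v \<in> T.sg G" using T.conjugate_sg[OF v G k2 \<psi>_in[OF b]] .
    then obtain a where a: "a \<in> carrier R" "\<psi> a = ?v \<otimes>\<^bsub>T\<^esub> \<psi> b \<otimes>\<^bsub>T\<^esub> u" using u by (auto elim: preimage)
    have "\<psi> (\<theta> a) \<otimes>\<^bsub>T\<^esub> u = u \<otimes>\<^bsub>T\<^esub> ?v \<otimes>\<^bsub>T\<^esub> (\<psi> b \<otimes>\<^bsub>T\<^esub> u)"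
      using tw[OF a(1)] a(2) b uc by (simp add: T.m_assoc \<psi>_simps del: T.Units_r_inv)
    then have "\<psi> (\<theta> a) \<otimes>\<^bsub>T\<^esub> u = \<psi> b \<otimes>\<^bsub>T\<^esub> u" using u uc b by (simp add: \<psi>_simps)
    then have "b = \<theta> a" using eqI[of "\<theta> a" b] \<theta>[OF a(1)] b by simp
    then show "\<exists>a\<in>carrier R. b = \<theta> a" using a by blast
  qed (use \<theta> in blast)
  then show ?thesis using hom tw by (auto simp: alg_iso_iff)
qed

text \<open>Elements on which \<theta> and \<open>u\<close> are compatible are closed under the
  algebra operations, so the generators decide. Hence an automorphism picked by \<open>SOME\<close>
  is recognized as conjugation from its prescribed values.\<close>

lemma twist_unique:
  assumes hom: "\<theta> \<in> alg_hom K R R" and u: "u \<in> carrier T"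
    and gen: "\<And>g. g \<in> G \<Longrightarrow> \<exists>r\<in>carrier R. \<psi> r = g \<and> u \<otimes>\<^bsub>T\<^esub> \<psi> r = \<psi> (\<theta> r) \<otimes>\<^bsub>T\<^esub> u"
    and r: "r \<in> carrier R"
  shows "u \<otimes>\<^bsub>T\<^esub> \<psi> r = \<psi> (\<theta> r) \<otimes>\<^bsub>T\<^esub> u"
proof -
  note h = alg_hom_closed[OF hom] alg_hom_add[OF hom] alg_hom_mult[OF hom] alg_hom_one[OF hom]
    alg_hom_smult[OF hom]
  have "\<exists>r\<in>carrier R. \<psi> r = x \<and> u \<otimes>\<^bsub>T\<^esub> \<psi> r = \<psi> (\<theta> r) \<otimes>\<^bsub>T\<^esub> u" if "x \<in> T.sg G" for x
    using that
  proof (induction rule: subalgebra_generated.induct)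
    case sg_one
    then show ?case using u by (intro bexI[of _ "\<one>\<^bsub>R\<^esub>"]) (simp_all add: \<psi>_simps h)
  next
    case (sg_gen g)
    then show ?case by (rule gen)
  next
    case (sg_add x y)
    then obtain a b where ab: "a \<in> carrier R" "b \<in> carrier R" "\<psi> a = x" "\<psi> b = y"
      and e: "u \<otimes>\<^bsub>T\<^esub> \<psi> a = \<psi> (\<theta> a) \<otimes>\<^bsub>T\<^esub> u" "u \<otimes>\<^bsub>T\<^esub> \<psi> b = \<psi> (\<theta> b) \<otimes>\<^bsub>T\<^esub> u" by blast
    from ab(1,2) e have "u \<otimes>\<^bsub>T\<^esub> \<psi> (a \<oplus>\<^bsub>R\<^esub> b) = \<psi> (\<theta> (a \<oplus>\<^bsub>R\<^esub> b)) \<otimes>\<^bsub>T\<^esub> u"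
      using u by (simp add: \<psi>_simps h T.l_distr T.r_distr)
    then show ?case using ab by (intro bexI[of _ "a \<oplus>\<^bsub>R\<^esub> b"]) (simp_all add: \<psi>_simps(2))
  next
    case (sg_mult x y)
    then obtain a b where ab: "a \<in> carrier R" "b \<in> carrier R" "\<psi> a = x" "\<psi> b = y"
      and e: "u \<otimes>\<^bsub>T\<^esub> \<psi> a = \<psi> (\<theta> a) \<otimes>\<^bsub>T\<^esub> u" "u \<otimes>\<^bsub>T\<^esub> \<psi> b = \<psi> (\<theta> b) \<otimes>\<^bsub>T\<^esub> u" by blast
    have "u \<otimes>\<^bsub>T\<^esub> (\<psi> a \<otimes>\<^bsub>T\<^esub> \<psi> b) = \<psi> (\<theta> a) \<otimes>\<^bsub>T\<^esub> (u \<otimes>\<^bsub>T\<^esub> \<psi> b)"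
      using ab(1,2) u e(1) by (simp add: \<psi>_simps h T.m_assoc[symmetric])
    also have "\<dots> = \<psi> (\<theta> (a \<otimes>\<^bsub>R\<^esub> b)) \<otimes>\<^bsub>T\<^esub> u"
      unfolding e(2) using ab(1,2) u by (simp add: \<psi>_simps h T.m_assoc)
    finally show ?case using ab by (intro bexI[of _ "a \<otimes>\<^bsub>R\<^esub> b"]) (simp_all add: \<psi>_simps(3))
  next
    case (sg_smult k x)
    then obtain a where ab: "a \<in> carrier R" "\<psi> a = x" and e: "u \<otimes>\<^bsub>T\<^esub> \<psi> a = \<psi> (\<theta> a) \<otimes>\<^bsub>T\<^esub> u" by blast
    from ab(1) e have "u \<otimes>\<^bsub>T\<^esub> \<psi> (k \<odot>\<^bsub>R\<^esub> a) = \<psi> (\<theta> (k \<odot>\<^bsub>R\<^esub> a)) \<otimes>\<^bsub>T\<^esub> u"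
      using u sg_smult(1) by (simp add: \<psi>_simps h T.smult_mult_left T.smult_mult_right)
    then show ?case using ab sg_smult(1) by (intro bexI[of _ "k \<odot>\<^bsub>R\<^esub> a"]) (simp_all add: \<psi>_simps(5))
  qed
  from this[OF \<psi>_in[OF r]] show ?thesis using \<psi>_eq r by metis
qed

text \<open>The skew commutator \<open>x r - \<theta>(r) x\<close> is automatically a skew
  derivation with values in \<open>T\<close>. Its twisted product rule propagates membership in the
  subalgebra from the generators to everything, so it restricts to \<open>R\<close>.\<close>

lemma derivation_exists:
  assumes hom: "\<theta> \<in> alg_hom K R R" and X: "x \<in> carrier T"
    and gen: "\<And>g. g \<in> G \<Longrightarrow> \<exists>r\<in>carrier R. \<psi> r = g \<and> x \<otimes>\<^bsub>T\<^esub> \<psi> r \<ominus>\<^bsub>T\<^esub> \<psi> (\<theta> r) \<otimes>\<^bsub>T\<^esub> x \<in> T.sg G"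
  shows "\<exists>\<delta>. skew_derivation K R \<theta> \<delta> \<and> (\<forall>r\<in>carrier R. \<delta> r \<in> carrier R \<and> \<psi> (\<delta> r) = x \<otimes>\<^bsub>T\<^esub> \<psi> r \<ominus>\<^bsub>T\<^esub> \<psi> (\<theta> r) \<otimes>\<^bsub>T\<^esub> x)"
proof -
  note h = alg_hom_closed[OF hom] alg_hom_add[OF hom] alg_hom_mult[OF hom] alg_hom_one[OF hom]
    alg_hom_smult[OF hom]
  define D where "D r = x \<otimes>\<^bsub>T\<^esub> \<psi> r \<ominus>\<^bsub>T\<^esub> \<psi> (\<theta> r) \<otimes>\<^bsub>T\<^esub> x" for r
  have Dc: "D r \<in> carrier T" if "r \<in> carrier R" for r using that X by (simp add: D_def \<psi>_simps h)
  have D_add: "D (a \<oplus>\<^bsub>R\<^esub> b) = D a \<oplus>\<^bsub>T\<^esub> D b" if "a \<in> carrier R" "b \<in> carrier R" for a b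
    using that X by (simp add: D_def \<psi>_simps h T.l_distr T.r_distr T.minus_eq T.minus_add T.a_ac)
  have D_smult: "D (k \<odot>\<^bsub>R\<^esub> a) = k \<odot>\<^bsub>T\<^esub> D a" if "a \<in> carrier R" "k \<in> carrier K" for a k
    using that X by (simp add: D_def \<psi>_simps h T.smult_mult_left T.smult_mult_right T.minus_eq T.smult_r_distr T.smult_minus)
  have D_mult: "D (a \<otimes>\<^bsub>R\<^esub> b) = \<psi> (\<theta> a) \<otimes>\<^bsub>T\<^esub> D b \<oplus>\<^bsub>T\<^esub> D a \<otimes>\<^bsub>T\<^esub> \<psi> b" if "a \<in> carrier R" "b \<in> carrier R" for a b
  proof -
    have "\<psi> (\<theta> a) \<otimes>\<^bsub>T\<^esub> D b \<oplus>\<^bsub>T\<^esub> D a \<otimes>\<^bsub>T\<^esub> \<psi> b =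
      (\<psi> (\<theta> a) \<otimes>\<^bsub>T\<^esub> x \<otimes>\<^bsub>T\<^esub> \<psi> b \<ominus>\<^bsub>T\<^esub> \<psi> (\<theta> a) \<otimes>\<^bsub>T\<^esub> \<psi> (\<theta> b) \<otimes>\<^bsub>T\<^esub> x) \<oplus>\<^bsub>T\<^esub>
      (x \<otimes>\<^bsub>T\<^esub> \<psi> a \<otimes>\<^bsub>T\<^esub> \<psi> b \<ominus>\<^bsub>T\<^esub> \<psi> (\<theta> a) \<otimes>\<^bsub>T\<^esub> x \<otimes>\<^bsub>T\<^esub> \<psi> b)"
      using that X by (simp add: D_def \<psi>_simps h T.minus_eq T.l_distr T.r_distr T.l_minus T.r_minus T.m_assoc)
    \<comment> \<open>The mixed term, with \<open>x\<close> between the images of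
      \<open>\<theta> a\<close> and \<open>b\<close>, occurs with both signs and cancels.\<close>
    also have "\<dots> = x \<otimes>\<^bsub>T\<^esub> \<psi> a \<otimes>\<^bsub>T\<^esub> \<psi> b \<ominus>\<^bsub>T\<^esub> \<psi> (\<theta> a) \<otimes>\<^bsub>T\<^esub> \<psi> (\<theta> b) \<otimes>\<^bsub>T\<^esub> x"
    proof -
      have "(p \<ominus>\<^bsub>T\<^esub> v) \<oplus>\<^bsub>T\<^esub> (w \<ominus>\<^bsub>T\<^esub> p) = w \<ominus>\<^bsub>T\<^esub> v" if "p \<in> carrier T" "v \<in> carrier T" "w \<in> carrier T" for p v w
      proof -
        have "(p \<ominus>\<^bsub>T\<^esub> v) \<oplus>\<^bsub>T\<^esub> (w \<ominus>\<^bsub>T\<^esub> p) = (p \<oplus>\<^bsub>T\<^esub> \<ominus>\<^bsub>T\<^esub> p) \<oplus>\<^bsub>T\<^esub> (w \<ominus>\<^bsub>T\<^esub> v)"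
          using that by (simp add: T.minus_eq T.a_ac)
        then show ?thesis using that by (simp add: T.r_neg)
      qed
      then show ?thesis using that X by (simp add: \<psi>_simps h)
    qed
    finally show ?thesis using that X by (simp add: D_def \<psi>_simps h T.m_assoc)
  qed
  have D_gen: "\<exists>r\<in>carrier R. \<psi> r = y \<and> D r \<in> T.sg G" if "y \<in> T.sg G" for y
    using that
  proof (induction rule: subalgebra_generated.induct)
    case sg_one
    have "D \<one>\<^bsub>R\<^esub> = \<zero>\<^bsub>T\<^esub>" using X by (simp add: D_def \<psi>_simps h T.minus_eq T.r_neg)
    then show ?case by (intro bexI[of _ "\<one>\<^bsub>R\<^esub>"]) (simp_all add: \<psi>_simps T.sg_zero)
  next
    case (sg_gen g)
    then show ?case using gen by (simp add: D_def)
  next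
    case (sg_add y z)
    then obtain a b where "a \<in> carrier R" "b \<in> carrier R" "\<psi> a = y" "\<psi> b = z" "D a \<in> T.sg G" "D b \<in> T.sg G" by blast
    then show ?case by (intro bexI[of _ "a \<oplus>\<^bsub>R\<^esub> b"]) (simp_all add: \<psi>_simps D_add subalgebra_generated.sg_add)
  next
    case (sg_mult y z)
    then obtain a b where "a \<in> carrier R" "b \<in> carrier R" "\<psi> a = y" "\<psi> b = z" "D a \<in> T.sg G" "D b \<in> T.sg G" by blast
    then show ?case using \<psi>_in
      by (intro bexI[of _ "a \<otimes>\<^bsub>R\<^esub> b"])
         (simp_all add: \<psi>_simps(3) D_mult subalgebra_generated.sg_add subalgebra_generated.sg_mult h sg_mult.hyps)
  next
    case (sg_smult k y)
    then obtain a where "a \<in> carrier R" "\<psi> a = y" "D a \<in> T.sg G" by blast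
    then show ?case using sg_smult(1)
      by (intro bexI[of _ "k \<odot>\<^bsub>R\<^esub> a"]) (simp_all add: \<psi>_simps(5) D_smult subalgebra_generated.sg_smult)
  qed
  have "D r \<in> T.sg G" if "r \<in> carrier R" for r using D_gen[OF \<psi>_in[OF that]] \<psi>_eq that by metis
  then have "\<exists>\<delta>. \<forall>r\<in>carrier R. \<delta> r \<in> carrier R \<and> \<psi> (\<delta> r) = D r" by (rule map_exists)
  then obtain \<delta> where \<delta>0: "\<forall>r\<in>carrier R. \<delta> r \<in> carrier R \<and> \<psi> (\<delta> r) = D r" by (elim exE)
  note \<delta> = bspec[OF \<delta>0]
  have \<delta>1: "\<delta> r \<in> carrier R" and \<delta>2: "\<psi> (\<delta> r) = D r" if "r \<in> carrier R" for r using \<delta>[OF that] by auto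
  have "skew_derivation K R \<theta> \<delta>"
    unfolding skew_derivation_def alg_hom_linear_def
  proof (intro conjI ballI)
    show "\<delta> \<in> carrier R \<rightarrow> carrier R" using \<delta>1 by blast
    fix r s assume rs: "r \<in> carrier R" "s \<in> carrier R"
    show "\<delta> (r \<oplus>\<^bsub>R\<^esub> s) = \<delta> r \<oplus>\<^bsub>R\<^esub> \<delta> s"
      using rs \<psi>_eq[of "\<delta> (r \<oplus>\<^bsub>R\<^esub> s)" "\<delta> r \<oplus>\<^bsub>R\<^esub> \<delta> s"] by (simp add: \<delta>1 \<delta>2 \<psi>_simps(2) D_add)
    show "\<delta> (r \<otimes>\<^bsub>R\<^esub> s) = \<theta> r \<otimes>\<^bsub>R\<^esub> \<delta> s \<oplus>\<^bsub>R\<^esub> \<delta> r \<otimes>\<^bsub>R\<^esub> s"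
      using rs \<psi>_eq[of "\<delta> (r \<otimes>\<^bsub>R\<^esub> s)" "\<theta> r \<otimes>\<^bsub>R\<^esub> \<delta> s \<oplus>\<^bsub>R\<^esub> \<delta> r \<otimes>\<^bsub>R\<^esub> s"]
      by (simp add: \<delta>1 \<delta>2 \<psi>_simps(2,3) D_mult h)
  next
    fix k r assume kr: "k \<in> carrier K" "r \<in> carrier R"
    show "\<delta> (k \<odot>\<^bsub>R\<^esub> r) = k \<odot>\<^bsub>R\<^esub> \<delta> r"
      using kr \<psi>_eq[of "\<delta> (k \<odot>\<^bsub>R\<^esub> r)" "k \<odot>\<^bsub>R\<^esub> \<delta> r"] by (simp add: \<delta>1 \<delta>2 \<psi>_simps(5) D_smult)
  qed
  then show ?thesis using \<delta>0 unfolding D_def by (intro exI conjI)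
qed

text \<open>The rule \<open>x r = \<theta>(r) x + \<delta>(r)\<close> passes to sums, scalar
  multiples and products, and holds at one since a skew derivation kills one. Thus the derivation
  picked by \<open>SOME\<close> is realized by \<open>x\<close> once its values on generators
  fit.\<close>

lemma derivation_unique:
  assumes hom: "\<theta> \<in> alg_hom K R R" and \<delta>: "skew_derivation K R \<theta> \<delta>" and X: "x \<in> carrier T"
    and gen: "\<And>g. g \<in> G \<Longrightarrow> \<exists>r\<in>carrier R. \<psi> r = g \<and> x \<otimes>\<^bsub>T\<^esub> \<psi> r = \<psi> (\<theta> r) \<otimes>\<^bsub>T\<^esub> x \<oplus>\<^bsub>T\<^esub> \<psi> (\<delta> r)"
    and r: "r \<in> carrier R"
  shows "x \<otimes>\<^bsub>T\<^esub> \<psi> r = \<psi> (\<theta> r) \<otimes>\<^bsub>T\<^esub> x \<oplus>\<^bsub>T\<^esub> \<psi> (\<delta> r)"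
proof -
  note h = alg_hom_closed[OF hom] alg_hom_add[OF hom] alg_hom_mult[OF hom] alg_hom_one[OF hom]
    alg_hom_smult[OF hom]
  have dc: "\<delta> r \<in> carrier R" if "r \<in> carrier R" for r using \<delta> that unfolding skew_derivation_def by blast
  have d: "\<delta> (r \<oplus>\<^bsub>R\<^esub> s) = \<delta> r \<oplus>\<^bsub>R\<^esub> \<delta> s" "\<delta> (r \<otimes>\<^bsub>R\<^esub> s) = \<theta> r \<otimes>\<^bsub>R\<^esub> \<delta> s \<oplus>\<^bsub>R\<^esub> \<delta> r \<otimes>\<^bsub>R\<^esub> s"
    if "r \<in> carrier R" "s \<in> carrier R" for r s
    using \<delta> that unfolding skew_derivation_def by blast+
  have ds: "\<delta> (k \<odot>\<^bsub>R\<^esub> r) = k \<odot>\<^bsub>R\<^esub> \<delta> r" if "k \<in> carrier K" "r \<in> carrier R" for k r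
    using \<delta> that unfolding skew_derivation_def alg_hom_linear_def by blast
  have d1: "\<delta> \<one>\<^bsub>R\<^esub> = \<zero>\<^bsub>R\<^esub>"
  proof -
    have "\<delta> \<one>\<^bsub>R\<^esub> \<oplus>\<^bsub>R\<^esub> \<delta> \<one>\<^bsub>R\<^esub> = \<delta> \<one>\<^bsub>R\<^esub>" using d(2)[of "\<one>\<^bsub>R\<^esub>" "\<one>\<^bsub>R\<^esub>"] dc[of "\<one>\<^bsub>R\<^esub>"] by (simp add: h)
    then show ?thesis using dc[of "\<one>\<^bsub>R\<^esub>"] by (simp add: R.add.l_cancel_one)
  qed
  have "\<exists>r\<in>carrier R. \<psi> r = y \<and> x \<otimes>\<^bsub>T\<^esub> \<psi> r = \<psi> (\<theta> r) \<otimes>\<^bsub>T\<^esub> x \<oplus>\<^bsub>T\<^esub> \<psi> (\<delta> r)" if "y \<in> T.sg G" for y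
    using that
  proof (induction rule: subalgebra_generated.induct)
    case sg_one
    then show ?case using X by (intro bexI[of _ "\<one>\<^bsub>R\<^esub>"]) (simp_all add: \<psi>_simps h d1)
  next
    case (sg_gen g)
    then show ?case by (rule gen)
  next
    case (sg_add y z)
    then obtain a b where ab: "a \<in> carrier R" "b \<in> carrier R" "\<psi> a = y" "\<psi> b = z"
      and e: "x \<otimes>\<^bsub>T\<^esub> \<psi> a = \<psi> (\<theta> a) \<otimes>\<^bsub>T\<^esub> x \<oplus>\<^bsub>T\<^esub> \<psi> (\<delta> a)" "x \<otimes>\<^bsub>T\<^esub> \<psi> b = \<psi> (\<theta> b) \<otimes>\<^bsub>T\<^esub> x \<oplus>\<^bsub>T\<^esub> \<psi> (\<delta> b)" by blast
    have "x \<otimes>\<^bsub>T\<^esub> \<psi> (a \<oplus>\<^bsub>R\<^esub> b) = \<psi> (\<theta> (a \<oplus>\<^bsub>R\<^esub> b)) \<otimes>\<^bsub>T\<^esub> x \<oplus>\<^bsub>T\<^esub> \<psi> (\<delta> (a \<oplus>\<^bsub>R\<^esub> b))"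
      using ab(1,2) X e by (simp add: \<psi>_simps h d dc T.l_distr T.r_distr T.a_ac)
    then show ?case using ab by (intro bexI[of _ "a \<oplus>\<^bsub>R\<^esub> b"]) (simp_all add: \<psi>_simps(2))
  next
    case (sg_mult y z)
    then obtain a b where ab: "a \<in> carrier R" "b \<in> carrier R" "\<psi> a = y" "\<psi> b = z"
      and e: "x \<otimes>\<^bsub>T\<^esub> \<psi> a = \<psi> (\<theta> a) \<otimes>\<^bsub>T\<^esub> x \<oplus>\<^bsub>T\<^esub> \<psi> (\<delta> a)" "x \<otimes>\<^bsub>T\<^esub> \<psi> b = \<psi> (\<theta> b) \<otimes>\<^bsub>T\<^esub> x \<oplus>\<^bsub>T\<^esub> \<psi> (\<delta> b)" by blast
    have "x \<otimes>\<^bsub>T\<^esub> \<psi> (a \<otimes>\<^bsub>R\<^esub> b) = (x \<otimes>\<^bsub>T\<^esub> \<psi> a) \<otimes>\<^bsub>T\<^esub> \<psi> b" using ab(1,2) X by (simp add: \<psi>_simps T.m_assoc)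
    also have "\<dots> = \<psi> (\<theta> a) \<otimes>\<^bsub>T\<^esub> (x \<otimes>\<^bsub>T\<^esub> \<psi> b) \<oplus>\<^bsub>T\<^esub> \<psi> (\<delta> a) \<otimes>\<^bsub>T\<^esub> \<psi> b"
      unfolding e(1) using ab(1,2) X by (simp add: \<psi>_simps h dc T.l_distr T.m_assoc)
    also have "\<dots> = \<psi> (\<theta> (a \<otimes>\<^bsub>R\<^esub> b)) \<otimes>\<^bsub>T\<^esub> x \<oplus>\<^bsub>T\<^esub> \<psi> (\<delta> (a \<otimes>\<^bsub>R\<^esub> b))"
      unfolding e(2) using ab(1,2) X by (simp add: \<psi>_simps h d dc T.r_distr T.m_assoc T.a_assoc)
    finally show ?case using ab by (intro bexI[of _ "a \<otimes>\<^bsub>R\<^esub> b"]) (simp_all add: \<psi>_simps(3))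
  next
    case (sg_smult k y)
    then obtain a where ab: "a \<in> carrier R" "\<psi> a = y" and e: "x \<otimes>\<^bsub>T\<^esub> \<psi> a = \<psi> (\<theta> a) \<otimes>\<^bsub>T\<^esub> x \<oplus>\<^bsub>T\<^esub> \<psi> (\<delta> a)" by blast
    from ab(1) e have "x \<otimes>\<^bsub>T\<^esub> \<psi> (k \<odot>\<^bsub>R\<^esub> a) = \<psi> (\<theta> (k \<odot>\<^bsub>R\<^esub> a)) \<otimes>\<^bsub>T\<^esub> x \<oplus>\<^bsub>T\<^esub> \<psi> (\<delta> (k \<odot>\<^bsub>R\<^esub> a))"
      using X sg_smult(1) by (simp add: \<psi>_simps h ds dc T.smult_mult_left T.smult_mult_right T.smult_r_distr)
    then show ?case using ab sg_smult(1) by (intro bexI[of _ "k \<odot>\<^bsub>R\<^esub> a"]) (simp_all add: \<psi>_simps(5))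
  qed
  from this[OF \<psi>_in[OF r]] show ?thesis using \<psi>_eq r by metis
qed

end

context nc_algebra
begin

lemma qc_minus_left: "\<lbrakk>qc s a d; qc s b d\<rbrakk> \<Longrightarrow> qc s (a \<ominus> b) d"
  by (simp add: qc_def minus_eq l_distr r_distr r_minus l_minus smult_r_distr smult_minus)

lemma qc_smult_left: "\<lbrakk>qc s a b; k \<in> carrier K\<rbrakk> \<Longrightarrow> qc s (k \<odot> a) b"
  by (simp add: qc_def smult_mult_left smult_mult_right smult_assoc[symmetric] K.m_comm)

end

section \<open>Commutation relations of the elements realizing the generators\<close>

locale weyl_relations = nc_algebra K T
  for K :: "('k, 'm) ring_scheme" and T :: "('k, 't) module" (structure) +
  fixes n :: nat and q :: "nat \<Rightarrow> 'k" and \<gamma> :: "nat \<Rightarrow> nat \<Rightarrow> 'k" and Y W :: "nat \<Rightarrow> 't"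
  assumes q: "i \<in> {1..n} \<Longrightarrow> q i \<in> carrier K - {\<zero>\<^bsub>K\<^esub>} \<and> q i \<noteq> \<one>\<^bsub>K\<^esub>"
    and \<gamma>: "mult_antisymmetric K n \<gamma>"
    and Y_Units: "i \<in> {1..n} \<Longrightarrow> Y i \<in> Units T" and W_Units: "i \<in> {1..n} \<Longrightarrow> W i \<in> Units T"
    and YY: "\<lbrakk>1 \<le> j; j < i; i \<le> n\<rbrakk> \<Longrightarrow> qc (\<gamma> i j) (Y i) (Y j)"
    and YW: "\<lbrakk>1 \<le> j; j < i; i \<le> n\<rbrakk> \<Longrightarrow> qc (\<gamma> j i) (Y i) (W j)"
    and WY: "\<lbrakk>1 \<le> j; j < i; i \<le> n\<rbrakk> \<Longrightarrow> qc (q j \<otimes>\<^bsub>K\<^esub> \<gamma> j i) (W i) (Y j)"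
    and WW: "\<lbrakk>1 \<le> j; j < i; i \<le> n\<rbrakk> \<Longrightarrow> qc (inv\<^bsub>K\<^esub> (q j) \<otimes>\<^bsub>K\<^esub> \<gamma> i j) (W i) (W j)"
    and WYi: "i \<in> {1..n} \<Longrightarrow> qc (q i) (W i) (Y i)"
begin

text \<open>Here \<open>U\<^sub>i = 1 + \<Sum>\<^sub>l\<^sub>\<le>\<^sub>i (q\<^sub>l - 1) Y\<^sub>l X\<^sub>l\<close>, so that \<open>\<tau>\<^sub>i\<close> is conjugation by \<open>W\<^sub>i = Y\<^sub>i\<^sup>-\<^sup>1 U\<^sub>i\<close> and \<open>\<delta>\<^sub>i\<close> is the
  inner \<open>\<tau>\<^sub>i\<close>-derivation given by \<open>V\<^sub>i = Y\<^sub>i\<^sup>-\<^sup>1 U\<^sub>i\<^sub>-\<^sub>1\<close>, up to the factor \<open>- (q\<^sub>i - 1)\<^sup>-\<^sup>1\<close>.\<close>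

definition U where "U i = (if i = 0 then \<one> else Y i \<otimes> W i)"
definition V where "V i = inv (Y i) \<otimes> U (i - 1)"
definition Xg where "Xg i = inv\<^bsub>K\<^esub> (q i \<ominus>\<^bsub>K\<^esub> \<one>\<^bsub>K\<^esub>) \<odot> (W i \<ominus> V i)"
definition gens where "gens m = Y ` {1..m} \<union> Xg ` {1..m}"

lemma q_Units: "\<lbrakk>1 \<le> i; i \<le> n\<rbrakk> \<Longrightarrow> q i \<in> Units K" and q_nz: "\<lbrakk>1 \<le> i; i \<le> n\<rbrakk> \<Longrightarrow> q i \<noteq> \<zero>\<^bsub>K\<^esub>"
  and q_closed: "\<lbrakk>1 \<le> i; i \<le> n\<rbrakk> \<Longrightarrow> q i \<in> carrier K"
  using q[of i] by (auto simp: K.field_Units)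

lemma qi: "\<lbrakk>1 \<le> i; i \<le> n\<rbrakk> \<Longrightarrow> inv\<^bsub>K\<^esub> (q i) \<in> carrier K \<and> inv\<^bsub>K\<^esub> (q i) \<noteq> \<zero>\<^bsub>K\<^esub> \<and> q i \<otimes>\<^bsub>K\<^esub> inv\<^bsub>K\<^esub> (q i) = \<one>\<^bsub>K\<^esub>"
  using q_Units[of i] K.Units_inv_Units[of "q i"] by (auto simp: K.field_Units K.Units_r_inv)

lemma q1: "\<lbrakk>1 \<le> i; i \<le> n\<rbrakk> \<Longrightarrow> q i \<ominus>\<^bsub>K\<^esub> \<one>\<^bsub>K\<^esub> \<in> Units K"
  using q[of i] by (auto simp: K.field_Units)

lemma \<gamma>_closed: "\<lbrakk>1 \<le> i; i \<le> n; 1 \<le> j; j \<le> n\<rbrakk> \<Longrightarrow> \<gamma> i j \<in> carrier K"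
  and \<gamma>_nz: "\<lbrakk>1 \<le> i; i \<le> n; 1 \<le> j; j \<le> n\<rbrakk> \<Longrightarrow> \<gamma> i j \<noteq> \<zero>\<^bsub>K\<^esub>"
  and \<gamma>_inv: "\<lbrakk>1 \<le> i; i \<le> n; 1 \<le> j; j \<le> n\<rbrakk> \<Longrightarrow> inv\<^bsub>K\<^esub> (\<gamma> i j) = \<gamma> j i"
proof -
  assume a: "1 \<le> i" "i \<le> n" "1 \<le> j" "j \<le> n"
  have "i \<in> {1..n}" "j \<in> {1..n}" using a by auto
  with \<gamma> have "\<gamma> i j \<in> carrier K - {\<zero>\<^bsub>K\<^esub>} \<and> \<gamma> j i = inv\<^bsub>K\<^esub> (\<gamma> i j)"
    unfolding mult_antisymmetric_def by blast
  then show "\<gamma> i j \<in> carrier K" "\<gamma> i j \<noteq> \<zero>\<^bsub>K\<^esub>" "inv\<^bsub>K\<^esub> (\<gamma> i j) = \<gamma> j i" by simp_all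
qed

lemma \<gamma>\<gamma>: assumes "1 \<le> i" "i \<le> n" "1 \<le> j" "j \<le> n" shows "\<gamma> i j \<otimes>\<^bsub>K\<^esub> \<gamma> j i = \<one>\<^bsub>K\<^esub>"
  unfolding \<gamma>_inv[OF assms, symmetric]
  by (rule K.Units_r_inv) (simp only: K.field_Units Diff_iff singleton_iff \<gamma>_closed[OF assms] \<gamma>_nz[OF assms] simp_thms)

lemma Y_closed: "\<lbrakk>1 \<le> i; i \<le> n\<rbrakk> \<Longrightarrow> Y i \<in> carrier T" and W_closed: "\<lbrakk>1 \<le> i; i \<le> n\<rbrakk> \<Longrightarrow> W i \<in> carrier T"
  using Y_Units[of i] W_Units[of i] by auto

lemma U_closed: "i \<le> n \<Longrightarrow> U i \<in> carrier T"
  by (cases "i = 0") (simp_all add: U_def Y_closed W_closed)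

lemma V_closed: "\<lbrakk>1 \<le> i; i \<le> n\<rbrakk> \<Longrightarrow> V i \<in> carrier T"
  using Y_Units[of i] by (simp add: V_def U_closed)

lemma Xg_closed: "\<lbrakk>1 \<le> i; i \<le> n\<rbrakk> \<Longrightarrow> Xg i \<in> carrier T"
  using q1[of i] by (simp add: Xg_def V_closed W_closed)

text \<open>The scalars contributed by \<open>Y l\<close> and \<open>W l\<close> are inverse to each
  other, so \<open>U l\<close> commutes with the later \<open>Y i\<close>; \<open>WU\<close> gives
  the same for \<open>W i\<close>. Consequently \<open>V j\<close> differs from the inverse of
  \<open>Y j\<close> by a factor invisible to later variables.\<close>

lemma YU: assumes "i \<le> n" "l < i" shows "qc \<one>\<^bsub>K\<^esub> (Y i) (U l)"
proof (cases "l = 0")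
  case False
  then show ?thesis using qc_mult_right[OF YY[of l i] YW[of l i]] assms \<gamma>\<gamma>[of i l] by (simp add: U_def)
qed (use assms in \<open>simp add: U_def qc_one Y_closed\<close>)

lemma WU: assumes "i \<le> n" "l < i" shows "qc \<one>\<^bsub>K\<^esub> (W i) (U l)"
proof (cases "l = 0")
  case False
  have l: "1 \<le> l" "l \<le> n" "1 \<le> i" using assms False by auto
  have "q l \<otimes>\<^bsub>K\<^esub> \<gamma> l i \<otimes>\<^bsub>K\<^esub> (inv\<^bsub>K\<^esub> (q l) \<otimes>\<^bsub>K\<^esub> \<gamma> i l) = (q l \<otimes>\<^bsub>K\<^esub> inv\<^bsub>K\<^esub> (q l)) \<otimes>\<^bsub>K\<^esub> (\<gamma> l i \<otimes>\<^bsub>K\<^esub> \<gamma> i l)"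
    using l assms by (simp add: K.m_ac qi[THEN conjunct1] q_closed \<gamma>_closed)
  also have "\<dots> = \<one>\<^bsub>K\<^esub>" using l assms by (simp add: qi \<gamma>\<gamma>)
  finally show ?thesis using qc_mult_right[OF WY[of l i] WW[of l i]] assms l by (simp add: U_def)
qed (use assms in \<open>simp add: U_def qc_one W_closed\<close>)

text \<open>Inverting \<open>Y j\<close> inverts its scalar, and the factor \<open>U (j - 1)\<close>
  commutes. The result agrees with the scalar of \<open>W j\<close> in \<open>YW\<close>, which is
  why the difference \<open>Xg j\<close> is again an eigenvector; \<open>WV\<close> is the analogue
  for \<open>W i\<close>.\<close>

lemma YV: assumes "1 \<le> j" "j < i" "i \<le> n" shows "qc (\<gamma> j i) (Y i) (V j)"
proof -
  have "qc (inv\<^bsub>K\<^esub> (\<gamma> i j) \<otimes>\<^bsub>K\<^esub> \<one>\<^bsub>K\<^esub>) (Y i) (V j)"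
    unfolding V_def by (intro qc_mult_right qc_inv_right YY YU Y_Units \<gamma>_nz) (use assms in auto)
  then show ?thesis using assms \<gamma>_closed[of j i] by (simp add: \<gamma>_inv)
qed

lemma YX: assumes "1 \<le> j" "j < i" "i \<le> n" shows "qc (\<gamma> j i) (Y i) (Xg j)"
  unfolding Xg_def by (intro qc_smult qc_minus YW YV) (use assms q1[of j] in auto)

lemma WV: assumes "1 \<le> j" "j < i" "i \<le> n" shows "qc (inv\<^bsub>K\<^esub> (q j) \<otimes>\<^bsub>K\<^esub> \<gamma> i j) (W i) (V j)"
proof -
  have nz: "q j \<otimes>\<^bsub>K\<^esub> \<gamma> j i \<noteq> \<zero>\<^bsub>K\<^esub>"
    using assms \<gamma>_nz[of j i] q_nz[of j] \<gamma>_closed[of j i] q_closed[of j] by (simp add: K.integral_iff)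
  have "qc (inv\<^bsub>K\<^esub> (q j \<otimes>\<^bsub>K\<^esub> \<gamma> j i) \<otimes>\<^bsub>K\<^esub> \<one>\<^bsub>K\<^esub>) (W i) (V j)"
    unfolding V_def by (intro qc_mult_right qc_inv_right WY WU Y_Units nz) (use assms in auto)
  moreover have "inv\<^bsub>K\<^esub> (q j \<otimes>\<^bsub>K\<^esub> \<gamma> j i) = inv\<^bsub>K\<^esub> (q j) \<otimes>\<^bsub>K\<^esub> \<gamma> i j"
  proof (rule K.comm_inv_char)
    have "q j \<otimes>\<^bsub>K\<^esub> \<gamma> j i \<otimes>\<^bsub>K\<^esub> (inv\<^bsub>K\<^esub> (q j) \<otimes>\<^bsub>K\<^esub> \<gamma> i j) = (q j \<otimes>\<^bsub>K\<^esub> inv\<^bsub>K\<^esub> (q j)) \<otimes>\<^bsub>K\<^esub> (\<gamma> j i \<otimes>\<^bsub>K\<^esub> \<gamma> i j)"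
      using assms by (simp add: K.m_ac qi[THEN conjunct1] q_closed \<gamma>_closed)
    also have "\<dots> = \<one>\<^bsub>K\<^esub>" using assms by (simp add: qi \<gamma>\<gamma>)
    finally show "q j \<otimes>\<^bsub>K\<^esub> \<gamma> j i \<otimes>\<^bsub>K\<^esub> (inv\<^bsub>K\<^esub> (q j) \<otimes>\<^bsub>K\<^esub> \<gamma> i j) = \<one>\<^bsub>K\<^esub>" .
  qed (use assms in \<open>simp_all add: qi q_closed \<gamma>_closed\<close>)
  ultimately show ?thesis using assms by (simp add: qi \<gamma>_closed)
qed

lemma WX: assumes "1 \<le> j" "j < i" "i \<le> n" shows "qc (inv\<^bsub>K\<^esub> (q j) \<otimes>\<^bsub>K\<^esub> \<gamma> i j) (W i) (Xg j)"
  unfolding Xg_def by (intro qc_smult qc_minus WW WV) (use assms q1[of j] in auto)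

text \<open>For \<open>j < l\<close> the entries of \<gamma> coming from \<open>Y l\<close> and
  \<open>W l\<close> cancel, so the eigenvalue of \<open>U l\<close> on \<open>Y j\<close> is
  \<open>q j\<close>, the same as for \<open>j = l\<close>.\<close>

lemma UY: assumes "1 \<le> j" "j \<le> l" "l \<le> n" shows "qc (q j) (U l) (Y j)"
proof (cases "j = l")
  case True
  have "qc (\<one>\<^bsub>K\<^esub> \<otimes>\<^bsub>K\<^esub> q l) (Y l \<otimes> W l) (Y l)"
    by (intro qc_mult_left qc_self WYi Y_closed) (use assms in auto)
  then show ?thesis using True assms by (simp add: U_def q_closed)
next
  case False
  have "qc (\<gamma> l j \<otimes>\<^bsub>K\<^esub> (q j \<otimes>\<^bsub>K\<^esub> \<gamma> j l)) (Y l \<otimes> W l) (Y j)"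
    by (intro qc_mult_left YY WY) (use assms False in auto)
  moreover have "\<gamma> l j \<otimes>\<^bsub>K\<^esub> (q j \<otimes>\<^bsub>K\<^esub> \<gamma> j l) = q j \<otimes>\<^bsub>K\<^esub> (\<gamma> l j \<otimes>\<^bsub>K\<^esub> \<gamma> j l)"
    using assms by (simp add: K.m_ac q_closed \<gamma>_closed)
  ultimately show ?thesis using assms by (simp add: U_def q_closed \<gamma>\<gamma>)
qed

lemma UW: assumes "1 \<le> j" "j \<le> l" "l \<le> n" shows "qc (inv\<^bsub>K\<^esub> (q j)) (U l) (W j)"
proof (cases "j = l")
  case True
  have "qc (inv\<^bsub>K\<^esub> (q l) \<otimes>\<^bsub>K\<^esub> \<one>\<^bsub>K\<^esub>) (Y l \<otimes> W l) (W l)"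
    by (intro qc_mult_left qc_self qc_sym WYi W_closed q_nz) (use assms in auto)
  then show ?thesis using True assms by (simp add: U_def qi)
next
  case False
  have "qc (\<gamma> j l \<otimes>\<^bsub>K\<^esub> (inv\<^bsub>K\<^esub> (q j) \<otimes>\<^bsub>K\<^esub> \<gamma> l j)) (Y l \<otimes> W l) (W j)"
    by (intro qc_mult_left YW WW) (use assms False in auto)
  moreover have "\<gamma> j l \<otimes>\<^bsub>K\<^esub> (inv\<^bsub>K\<^esub> (q j) \<otimes>\<^bsub>K\<^esub> \<gamma> l j) = inv\<^bsub>K\<^esub> (q j) \<otimes>\<^bsub>K\<^esub> (\<gamma> j l \<otimes>\<^bsub>K\<^esub> \<gamma> l j)"
    using assms by (simp add: K.m_ac qi[THEN conjunct1] \<gamma>_closed)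
  ultimately show ?thesis using assms by (simp add: U_def qi \<gamma>\<gamma>)
qed

lemma UU: assumes "j \<le> l" "l \<le> n" shows "qc \<one>\<^bsub>K\<^esub> (U l) (U j)"
proof (cases "j = 0")
  case True
  then show ?thesis using assms by (simp add: U_def[of 0] qc_one U_closed)
next
  case False
  have "qc (q j \<otimes>\<^bsub>K\<^esub> inv\<^bsub>K\<^esub> (q j)) (U l) (Y j \<otimes> W j)"
    by (intro qc_mult_right UY UW) (use assms False in auto)
  then show ?thesis using False assms by (simp add: U_def[of j] qi)
qed

lemma UX: assumes "1 \<le> j" "j \<le> l" "l \<le> n" shows "qc (inv\<^bsub>K\<^esub> (q j)) (U l) (Xg j)"
proof -
  have "qc (inv\<^bsub>K\<^esub> (q j) \<otimes>\<^bsub>K\<^esub> \<one>\<^bsub>K\<^esub>) (U l) (V j)"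
    unfolding V_def by (intro qc_mult_right qc_inv_right UY UU q_nz Y_Units) (use assms in auto)
  then have "qc (inv\<^bsub>K\<^esub> (q j)) (U l) (V j)" using assms by (simp add: qi)
  then show ?thesis unfolding Xg_def by (intro qc_smult qc_minus UW) (use assms q1[of j] in auto)
qed

text \<open>Now \<open>Xg i\<close> is the acting element. Its part \<open>V i\<close> has the
  inverse scalar of \<open>Y i\<close> together with \<open>q j\<close> from
  \<open>U (i - 1)\<close>, which is the scalar of \<open>W i\<close>. Equality of the two is the
  reason why the derivation vanishes on earlier variables.\<close>

lemma XY: assumes "1 \<le> j" "j < i" "i \<le> n" shows "qc (q j \<otimes>\<^bsub>K\<^esub> \<gamma> j i) (Xg i) (Y j)"
proof -
  have "qc (inv\<^bsub>K\<^esub> (\<gamma> i j) \<otimes>\<^bsub>K\<^esub> q j) (V i) (Y j)"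
    unfolding V_def by (intro qc_mult_left qc_inv_left YY UY \<gamma>_nz Y_Units) (use assms in auto)
  then have "qc (q j \<otimes>\<^bsub>K\<^esub> \<gamma> j i) (V i) (Y j)" using assms by (simp add: \<gamma>_inv \<gamma>_closed q_closed K.m_comm)
  then show ?thesis unfolding Xg_def[of i] by (intro qc_smult_left qc_minus_left WY) (use assms q1[of i] in auto)
qed

lemma XX: assumes "1 \<le> j" "j < i" "i \<le> n" shows "qc (inv\<^bsub>K\<^esub> (q j) \<otimes>\<^bsub>K\<^esub> \<gamma> i j) (Xg i) (Xg j)"
proof -
  have "qc (inv\<^bsub>K\<^esub> (\<gamma> j i) \<otimes>\<^bsub>K\<^esub> inv\<^bsub>K\<^esub> (q j)) (V i) (Xg j)"
    unfolding V_def by (intro qc_mult_left qc_inv_left YX UX \<gamma>_nz Y_Units) (use assms in auto)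
  then have "qc (inv\<^bsub>K\<^esub> (q j) \<otimes>\<^bsub>K\<^esub> \<gamma> i j) (V i) (Xg j)" using assms by (simp add: \<gamma>_inv \<gamma>_closed qi K.m_comm)
  then show ?thesis unfolding Xg_def[of i] by (intro qc_smult_left qc_minus_left WX) (use assms q1[of i] in auto)
qed

context
  fixes i assumes i: "1 \<le> i" "i \<le> n"
begin

lemma Y_V: "Y i \<otimes> V i = U (i - 1)"
  using Y_Units[of i] i by (simp add: V_def U_closed Y_closed m_assoc[symmetric])

lemma V_Y: "V i \<otimes> Y i = U (i - 1)"
proof -
  have c: "Y i \<in> carrier T" "U (i - 1) \<in> carrier T" "inv (Y i) \<in> carrier T" using i Y_Units[of i] by (auto simp: Y_closed U_closed)
  have "Y i \<otimes> U (i - 1) = U (i - 1) \<otimes> Y i" using YU[of i "i - 1"] i c by (simp add: qc_def)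
  then have "V i \<otimes> Y i = inv (Y i) \<otimes> (Y i \<otimes> U (i - 1))" using c by (simp add: V_def m_assoc)
  also have "\<dots> = U (i - 1)" using c Y_Units[of i] i by (simp add: m_assoc[symmetric])
  finally show ?thesis .
qed

lemma \<kappa>: "inv\<^bsub>K\<^esub> (q i \<ominus>\<^bsub>K\<^esub> \<one>\<^bsub>K\<^esub>) \<in> carrier K" "(q i \<ominus>\<^bsub>K\<^esub> \<one>\<^bsub>K\<^esub>) \<otimes>\<^bsub>K\<^esub> inv\<^bsub>K\<^esub> (q i \<ominus>\<^bsub>K\<^esub> \<one>\<^bsub>K\<^esub>) = \<one>\<^bsub>K\<^esub>"
  "inv\<^bsub>K\<^esub> (q i \<ominus>\<^bsub>K\<^esub> \<one>\<^bsub>K\<^esub>) \<otimes>\<^bsub>K\<^esub> (q i \<ominus>\<^bsub>K\<^esub> \<one>\<^bsub>K\<^esub>) = \<one>\<^bsub>K\<^esub>" "q i \<ominus>\<^bsub>K\<^esub> \<one>\<^bsub>K\<^esub> \<in> carrier K"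
  using q1[OF i] by (auto simp: K.Units_r_inv K.Units_l_inv)

text \<open>Substituting \<open>W i = (q i - 1) Xg i + V i\<close> in \<open>U i = Y i W i\<close>
  and using \<open>Y_V\<close>. So \<open>U\<close> satisfies the recursion of the commutators in
  the Weyl algebra.\<close>

lemma U_step: "U i = U (i - 1) \<oplus> (q i \<ominus>\<^bsub>K\<^esub> \<one>\<^bsub>K\<^esub>) \<odot> (Y i \<otimes> Xg i)"
proof -
  note c = Y_closed[OF i] W_closed[OF i] V_closed[OF i] U_closed[of "i - 1"] \<kappa>
  have "(q i \<ominus>\<^bsub>K\<^esub> \<one>\<^bsub>K\<^esub>) \<odot> (Y i \<otimes> Xg i) = Y i \<otimes> (W i \<ominus> V i)"
    using c by (simp add: Xg_def smult_mult_right smult_assoc[symmetric])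
  also have "\<dots> = Y i \<otimes> W i \<ominus> U (i - 1)" using c Y_V by (simp add: minus_eq r_distr r_minus)
  finally show ?thesis using c i by (simp add: U_def[of i] minus_eq a_ac r_neg1 r_neg)
qed

text \<open>The part \<open>W i\<close> satisfies the homogeneous relation
  \<open>W Y = q Y W\<close>, whereas both \<open>V i Y i\<close> and \<open>Y i V i\<close> equal
  \<open>U (i - 1)\<close>. The defect is therefore \<open>(q i - 1) U (i - 1)\<close>, and the
  normalizing factor in \<open>Xg i\<close> reduces it to \<open>U (i - 1)\<close>.\<close>

lemma X_Y: "Xg i \<otimes> Y i = q i \<odot> (Y i \<otimes> Xg i) \<oplus> U (i - 1)"
proof -
  let ?k = "inv\<^bsub>K\<^esub> (q i \<ominus>\<^bsub>K\<^esub> \<one>\<^bsub>K\<^esub>)"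
  note c = Y_closed[OF i] W_closed[OF i] V_closed[OF i] \<kappa> q_closed[OF i]
  have u: "U (i - 1) \<in> carrier T" using i by (simp add: U_closed)
  define A where "A = q i \<odot> (Y i \<otimes> W i)"
  have A: "A \<in> carrier T" "W i \<otimes> Y i = A" using c WYi[of i] i by (simp_all add: A_def qc_def)
  have 1: "Xg i \<otimes> Y i = ?k \<odot> (A \<ominus> U (i - 1))"
    using c u A V_Y by (simp add: Xg_def smult_mult_left minus_eq l_distr l_minus)
  have 2: "q i \<odot> (Y i \<otimes> Xg i) = ?k \<odot> (A \<ominus> q i \<odot> U (i - 1))"
  proof -
    have "q i \<odot> (Y i \<otimes> Xg i) = ?k \<odot> (q i \<odot> (Y i \<otimes> (W i \<ominus> V i)))"
      using c by (simp add: Xg_def smult_mult_right smult_assoc[symmetric] K.m_comm)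
    also have "q i \<odot> (Y i \<otimes> (W i \<ominus> V i)) = A \<ominus> q i \<odot> U (i - 1)"
      using c u Y_V by (simp add: A_def minus_eq r_distr r_minus smult_r_distr smult_minus)
    finally show ?thesis .
  qed
  have 3: "U (i - 1) = ?k \<odot> (q i \<odot> U (i - 1) \<ominus> U (i - 1))"
  proof -
    have "q i \<odot> U (i - 1) \<ominus> U (i - 1) = (q i \<ominus>\<^bsub>K\<^esub> \<one>\<^bsub>K\<^esub>) \<odot> U (i - 1)"
      using c u by (simp add: minus_eq K.minus_eq smult_l_distr smult_minus_one)
    then show ?thesis using c u by (simp add: smult_assoc[symmetric])
  qed
  have "q i \<odot> (Y i \<otimes> Xg i) \<oplus> U (i - 1) = ?k \<odot> ((A \<ominus> q i \<odot> U (i - 1)) \<oplus> (q i \<odot> U (i - 1) \<ominus> U (i - 1)))"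
    unfolding 2 by (subst (2) 3) (use c u A in \<open>simp add: smult_r_distr\<close>)
  also have "(A \<ominus> q i \<odot> U (i - 1)) \<oplus> (q i \<odot> U (i - 1) \<ominus> U (i - 1)) = A \<ominus> U (i - 1)"
    using c u A by (simp add: minus_eq a_assoc r_neg1 r_neg2)
  finally show ?thesis using 1 by simp
qed

end

text \<open>Telescoping \<open>U_step\<close>. The left side is the value prescribed for the
  derivation at the \<open>y\<close> with index \<open>Suc m\<close>.\<close>

lemma U_sum: "m \<le> n \<Longrightarrow> \<one> \<oplus> (\<Oplus>l\<in>{1..<Suc m}. (q l \<ominus>\<^bsub>K\<^esub> \<one>\<^bsub>K\<^esub>) \<odot> (Y l \<otimes> Xg l)) = U m"
proof (induction m)
  case (Suc m)
  have c: "(q l \<ominus>\<^bsub>K\<^esub> \<one>\<^bsub>K\<^esub>) \<odot> (Y l \<otimes> Xg l) \<in> carrier T" if "1 \<le> l" "l \<le> Suc m" for l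
    using that Suc.prems by (simp add: \<kappa> Y_closed Xg_closed)
  have e: "{1..<Suc (Suc m)} = insert (Suc m) {1..<Suc m}" by auto
  have s: "(\<Oplus>l\<in>{1..<Suc m}. (q l \<ominus>\<^bsub>K\<^esub> \<one>\<^bsub>K\<^esub>) \<odot> (Y l \<otimes> Xg l)) \<in> carrier T" using c by (intro finsum_closed) auto
  have "(\<Oplus>l\<in>{1..<Suc (Suc m)}. (q l \<ominus>\<^bsub>K\<^esub> \<one>\<^bsub>K\<^esub>) \<odot> (Y l \<otimes> Xg l)) =
    (q (Suc m) \<ominus>\<^bsub>K\<^esub> \<one>\<^bsub>K\<^esub>) \<odot> (Y (Suc m) \<otimes> Xg (Suc m)) \<oplus> (\<Oplus>l\<in>{1..<Suc m}. (q l \<ominus>\<^bsub>K\<^esub> \<one>\<^bsub>K\<^esub>) \<odot> (Y l \<otimes> Xg l))"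
    unfolding e by (rule finsum_insert) (use c in auto)
  then show ?case using Suc s c[of "Suc m"] U_step[of "Suc m"] U_closed[of m]
    by (simp add: a_ac flip: Suc.IH)
qed (simp add: U_def)

lemma gens_closed: "m \<le> n \<Longrightarrow> gens m \<subseteq> carrier T"
  by (auto simp: gens_def Xg_closed Y_closed)

lemma gens_Suc: "gens (Suc m) = insert (Xg (Suc m)) (insert (Y (Suc m)) (gens m))"
proof -
  have "{1..Suc m} = insert (Suc m) {1..m}" by auto
  then show ?thesis by (simp only: gens_def image_insert) blast
qed

text \<open>Ensures that the prescribed value of the next derivation lies in the algebra to which
  the next \<open>x\<close> is adjoined.\<close>

lemma U_in_sg: "m \<le> n \<Longrightarrow> U m \<in> sg (gens m)"
proof (induction m)
  case (Suc m)
  have "sg (gens m) \<subseteq> sg (gens (Suc m))" by (rule subalgebra_generated_mono) (auto simp: gens_Suc)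
  then have 1: "U m \<in> sg (gens (Suc m))" using Suc by auto
  have "(q (Suc m) \<ominus>\<^bsub>K\<^esub> \<one>\<^bsub>K\<^esub>) \<odot> (Y (Suc m) \<otimes> Xg (Suc m)) \<in> sg (gens (Suc m))"
    using Suc.prems \<kappa>(4)[of "Suc m"] by (intro sg_smult sg_mult sg_gen) (auto simp: gens_Suc)
  then show ?case using 1 U_step[of "Suc m"] Suc.prems by (simp add: sg_add)
qed (simp add: U_def sg_one)

end

context generated_map
begin

text \<open>Reads a quasi-commutation in \<open>T\<close> as the value of an automorphism of
  \<open>R\<close> on a generator; \<open>scalar_twist\<close> is the way back.\<close>

lemma scalar_action:
  assumes u: "u \<in> Units T" and r: "r \<in> carrier R" and s: "s \<in> carrier R"
    and tw: "u \<otimes>\<^bsub>T\<^esub> \<psi> r = \<psi> s \<otimes>\<^bsub>T\<^esub> u" and qc: "T.qc k u (\<psi> r)"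
  shows "s = k \<odot>\<^bsub>R\<^esub> r"
proof -
  have k: "k \<in> carrier K" and e: "u \<otimes>\<^bsub>T\<^esub> \<psi> r = k \<odot>\<^bsub>T\<^esub> (\<psi> r \<otimes>\<^bsub>T\<^esub> u)" using qc by (simp_all add: T.qc_def)
  note uc = T.Units_closed[OF u] T.Units_inv_closed[OF u]
  have "\<psi> s = \<psi> s \<otimes>\<^bsub>T\<^esub> u \<otimes>\<^bsub>T\<^esub> inv\<^bsub>T\<^esub> u" using s u uc by (simp add: T.m_assoc \<psi>_simps)
  also have "\<psi> s \<otimes>\<^bsub>T\<^esub> u = (k \<odot>\<^bsub>T\<^esub> \<psi> r) \<otimes>\<^bsub>T\<^esub> u" using tw e r k uc by (simp add: T.smult_mult_left \<psi>_simps)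
  also have "(k \<odot>\<^bsub>T\<^esub> \<psi> r) \<otimes>\<^bsub>T\<^esub> u \<otimes>\<^bsub>T\<^esub> inv\<^bsub>T\<^esub> u = \<psi> (k \<odot>\<^bsub>R\<^esub> r)" using r k u uc by (simp add: T.m_assoc \<psi>_simps)
  finally show ?thesis using \<psi>_eq s r k by simp
qed

lemma scalar_twist:
  assumes "s = k \<odot>\<^bsub>R\<^esub> r" "r \<in> carrier R" "T.qc k u (\<psi> r)"
  shows "u \<otimes>\<^bsub>T\<^esub> \<psi> r = \<psi> s \<otimes>\<^bsub>T\<^esub> u"
  using assms by (simp add: T.qc_def \<psi>_simps T.smult_mult_left)

end

section \<open>Realizing the tower stage by stage\<close>

text \<open>The freeness assumptions say that \<open>Y\<^sub>i\<close> and \<open>X\<^sub>i\<close> generate skew polynomial rings over the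
  algebras generated by the preceding variables.\<close>

locale weyl_model = weyl_relations K T n q \<gamma> Y W
  for K :: "('k, 'm) ring_scheme" and T :: "('k, 't) module" (structure) and n q \<gamma> Y W +
  assumes nontrivial: "\<one> \<noteq> \<zero>"
    and free_Y: "\<lbrakk>1 \<le> i; i \<le> n\<rbrakk> \<Longrightarrow> free_over (sg (gens (i - 1))) (Y i)"
    and free_X: "\<lbrakk>1 \<le> i; i \<le> n\<rbrakk> \<Longrightarrow> free_over (sg (insert (Y i) (gens (i - 1)))) (Xg i)"
begin

text \<open>The invariant of the induction: the current algebra is embedded with image generated by
  the variables adjoined so far, and the formal variables go to their models.\<close>

definition stage :: "nat \<Rightarrow> ('k, 'k tower) module \<Rightarrow> (nat \<Rightarrow> 'k tower) \<Rightarrow> (nat \<Rightarrow> 'k tower) \<Rightarrow>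
    ('k tower \<Rightarrow> 't) \<Rightarrow> bool"
  where "stage m R y x \<psi> \<longleftrightarrow> generated_map K R T \<psi> (gens m) \<and>
    (\<forall>j\<in>{1..m}. y j \<in> carrier R \<and> \<psi> (y j) = Y j \<and> x j \<in> carrier R \<and> \<psi> (x j) = Xg j)"

text \<open>Scalars embed through multiples of one: a nonzero scalar is invertible, so it cannot
  kill the unit of a nontrivial algebra.\<close>

lemma base_stage: "\<exists>\<psi>. stage 0 (tower_base K) y x \<psi>"
proof -
  let ?B = "tower_base K"
  note base = image_algebra_simps[OF inj_TScalar, where A = "ground_algebra K", folded tower_base_def]
  have g: "carrier (ground_algebra K) = carrier K" "\<one>\<^bsub>ground_algebra K\<^esub> = \<one>\<^bsub>K\<^esub>" "\<zero>\<^bsub>ground_algebra K\<^esub> = \<zero>\<^bsub>K\<^esub>"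
    "a \<oplus>\<^bsub>ground_algebra K\<^esub> b = a \<oplus>\<^bsub>K\<^esub> b" "a \<otimes>\<^bsub>ground_algebra K\<^esub> b = a \<otimes>\<^bsub>K\<^esub> b" "a \<odot>\<^bsub>ground_algebra K\<^esub> b = a \<otimes>\<^bsub>K\<^esub> b" for a b
    by (simp_all add: ground_algebra_def)
  define \<psi> where "\<psi> z = (case z of TScalar k \<Rightarrow> k \<odot> \<one>)" for z
  have cE: "\<exists>k\<in>carrier K. z = TScalar k" if "z \<in> carrier ?B" for z using that by (auto simp: base g)
  have hom: "\<psi> \<in> alg_hom K ?B T"
  proof (rule alg_homI)
    fix a assume "a \<in> carrier ?B"
    then obtain k where k: "k \<in> carrier K" "a = TScalar k" using cE by blast
    then show "\<psi> a \<in> carrier T" by (simp add: \<psi>_def)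
    fix b assume "b \<in> carrier ?B"
    then obtain l where l: "l \<in> carrier K" "b = TScalar l" using cE by blast
    show "\<psi> (a \<oplus>\<^bsub>?B\<^esub> b) = \<psi> a \<oplus> \<psi> b" using k l by (simp add: base g \<psi>_def smult_l_distr)
    show "\<psi> (a \<otimes>\<^bsub>?B\<^esub> b) = \<psi> a \<otimes> \<psi> b" using k l by (simp add: base g \<psi>_def smult_mult_left smult_assoc)
  next
    show "\<psi> \<one>\<^bsub>?B\<^esub> = \<one>" by (simp add: base g \<psi>_def)
  next
    fix c a assume c: "c \<in> carrier K" and "a \<in> carrier ?B"
    then obtain k where k: "k \<in> carrier K" "a = TScalar k" using cE by blast
    then show "\<psi> (c \<odot>\<^bsub>?B\<^esub> a) = c \<odot> \<psi> a" using c by (simp add: base g \<psi>_def smult_assoc)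
  qed
  have inj: "inj_on \<psi> (carrier ?B)"
  proof (rule inj_onI)
    fix a b assume "a \<in> carrier ?B" "b \<in> carrier ?B" and eq: "\<psi> a = \<psi> b"
    then obtain k l where kl: "k \<in> carrier K" "a = TScalar k" "l \<in> carrier K" "b = TScalar l" using cE by metis
    have "(k \<ominus>\<^bsub>K\<^esub> l) \<odot> \<one> = \<psi> a \<ominus> \<psi> b"
    proof -
      have "(k \<ominus>\<^bsub>K\<^esub> l) \<odot> \<one> \<oplus> l \<odot> \<one> = k \<odot> \<one>"
        using kl by (simp add: smult_l_distr[symmetric] K.minus_eq K.a_assoc K.l_neg)
      then have "k \<odot> \<one> \<ominus> l \<odot> \<one> = (k \<ominus>\<^bsub>K\<^esub> l) \<odot> \<one> \<oplus> (l \<odot> \<one> \<ominus> l \<odot> \<one>)"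
        using kl by (simp add: minus_eq a_assoc[symmetric])
      then show ?thesis using kl by (simp add: \<psi>_def minus_eq r_neg)
    qed
    then have z: "(k \<ominus>\<^bsub>K\<^esub> l) \<odot> \<one> = \<zero>" using eq kl by (simp add: \<psi>_def minus_eq r_neg)
    have "k \<ominus>\<^bsub>K\<^esub> l = \<zero>\<^bsub>K\<^esub>"
    proof (rule ccontr)
      assume nz: "k \<ominus>\<^bsub>K\<^esub> l \<noteq> \<zero>\<^bsub>K\<^esub>"
      then have u: "k \<ominus>\<^bsub>K\<^esub> l \<in> Units K" using kl by (simp add: K.field_Units)
      have "\<one> = inv\<^bsub>K\<^esub> (k \<ominus>\<^bsub>K\<^esub> l) \<odot> ((k \<ominus>\<^bsub>K\<^esub> l) \<odot> \<one>)"
        using u K.Units_closed[OF u] K.Units_inv_closed[OF u] by (simp only: smult_assoc[symmetric] K.Units_l_inv smult_one one_closed)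
      then show False using z nontrivial K.Units_inv_closed[OF u] by simp
    qed
    then show "a = b" using kl by simp
  qed
  have alg: "nc_algebra K ?B"
  proof (rule nc_algebra_pullback[OF nc_algebra_axioms hom _ inj])
    fix a assume "a \<in> carrier ?B"
    then obtain k where k: "k \<in> carrier K" "a = TScalar k" using cE by blast
    show "c \<odot>\<^bsub>?B\<^esub> a \<in> carrier ?B" if "c \<in> carrier K" for c using k that by (simp add: base g)
    fix b assume "b \<in> carrier ?B"
    then obtain l where l: "l \<in> carrier K" "b = TScalar l" using cE by blast
    show "a \<oplus>\<^bsub>?B\<^esub> b \<in> carrier ?B" "a \<otimes>\<^bsub>?B\<^esub> b \<in> carrier ?B" using k l by (simp_all add: base g)
  qed (simp_all add: base g \<psi>_def)
  interpret e: embedded_algebra_map K ?B T \<psi>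
    by (intro embedded_algebra_map.intro embedded_algebra_map_axioms.intro alg nc_algebra_axioms hom inj)
  have "\<psi> ` carrier ?B = sg (gens 0)"
  proof
    show "sg (gens 0) \<subseteq> \<psi> ` carrier ?B" by (rule e.image_generated) (simp add: gens_def)
    have "k \<odot> \<one> \<in> sg (gens 0)" if "k \<in> carrier K" for k by (intro sg_smult sg_one that)
    then show "\<psi> ` carrier ?B \<subseteq> sg (gens 0)" using cE by (force simp: \<psi>_def)
  qed
  then have "generated_map K ?B T \<psi> (gens 0)"
    by (intro generated_map.intro e.embedded_algebra_map_axioms generated_map_axioms.intro) (simp_all add: gens_def)
  then show ?thesis unfolding stage_def by auto
qed

text \<open>Each of the three maps is treated alike. The ambient algebra provides a map with the
  prescribed values, so the \<open>SOME\<close> description is satisfied by the map actually chosen,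
  and uniqueness on generators identifies the chosen map with conjugation or with the inner
  derivation. The local names follow the recursive clause of \<open>qweyl_tower\<close>.\<close>

lemma stage_step:
  fixes m :: nat
  defines "i \<equiv> Suc m"
  assumes st: "stage m R y x \<psi>" and n: "i \<le> n"
  defines "\<alpha> \<equiv> weyl_sigma K \<gamma> R y x i"
  defines "R1 \<equiv> tower_step R \<alpha> (\<lambda>_. \<zero>\<^bsub>R\<^esub>)"
  defines "y1 \<equiv> \<lambda>j. if j = i then tower_var R else tower_const R (y j)"
  defines "x1 \<equiv> \<lambda>j. tower_const R (x j)"
  defines "\<tau> \<equiv> weyl_tau K q \<gamma> R1 y1 x1 i"
  defines "\<delta> \<equiv> weyl_delta K q \<tau> R1 y1 x1 i"
  shows "\<exists>\<psi>2. stage i (tower_step R1 \<tau> \<delta>) (\<lambda>j. tower_const R1 (y1 j))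
    (\<lambda>j. if j = i then tower_var R1 else tower_const R1 (x1 j)) \<psi>2"
proof -
  have i: "1 \<le> i" "i \<le> n" "m \<le> n" "i - 1 = m" using n by (auto simp: i_def)
  interpret g: generated_map K R T \<psi> "gens m" using st by (simp add: stage_def)
  have vals: "y j \<in> carrier R" "\<psi> (y j) = Y j" "x j \<in> carrier R" "\<psi> (x j) = Xg j" if "1 \<le> j" "j < i" for j
    using st that by (auto simp: stage_def i_def)
  have gensE: "\<exists>j. 1 \<le> j \<and> j < i \<and> (z = Y j \<or> z = Xg j)" if "z \<in> gens m" for z
    using that by (auto simp: gens_def i_def)
  note Yu = Y_Units[of i] and Wu = W_Units[of i]
  have Yi: "Y i \<in> Units T" and Wi: "W i \<in> Units T" using Yu Wu i by auto
  have Yc: "Y i \<in> carrier T" and Wc: "W i \<in> carrier T" and Xc: "Xg i \<in> carrier T"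
    using i by (auto simp: Y_closed W_closed Xg_closed)
  have \<gamma>nz: "\<gamma> i j \<noteq> \<zero>\<^bsub>K\<^esub>" "\<gamma> j i \<noteq> \<zero>\<^bsub>K\<^esub>" "\<gamma> i j \<in> carrier K" "\<gamma> j i \<in> carrier K" if "1 \<le> j" "j < i" for j
    using that i \<gamma>_nz[of i j] \<gamma>_nz[of j i] \<gamma>_closed[of i j] \<gamma>_closed[of j i] by auto
  have ex\<alpha>: "\<exists>\<alpha>. \<alpha> \<in> alg_iso K R R \<and>
    (\<forall>j\<in>{1..<i}. \<alpha> (y j) = \<gamma> i j \<odot>\<^bsub>R\<^esub> y j \<and> \<alpha> (x j) = \<gamma> j i \<odot>\<^bsub>R\<^esub> x j)"
  proof -
    have "\<exists>k. k \<noteq> \<zero>\<^bsub>K\<^esub> \<and> qc k (Y i) z" if "z \<in> gens m" for z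
      using gensE[OF that] YY[of _ i] YX[of _ i] \<gamma>nz i(2) by metis
    from g.twist_exists[OF Yi this] obtain \<theta> where \<theta>: "\<theta> \<in> alg_iso K R R"
      and tw: "\<forall>r\<in>carrier R. Y i \<otimes> \<psi> r = \<psi> (\<theta> r) \<otimes> Y i" by metis
    have \<theta>c: "\<theta> r \<in> carrier R" if "r \<in> carrier R" for r using \<theta> that alg_hom_closed by (metis alg_iso_iff)
    have "\<theta> (y j) = \<gamma> i j \<odot>\<^bsub>R\<^esub> y j \<and> \<theta> (x j) = \<gamma> j i \<odot>\<^bsub>R\<^esub> x j" if j: "j \<in> {1..<i}" for j
    proof -
      have j: "1 \<le> j" "j < i" using j by auto
      note v = vals[OF j]
      have "\<theta> (y j) = \<gamma> i j \<odot>\<^bsub>R\<^esub> y j"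
        by (rule g.scalar_action[OF Yi v(1) \<theta>c[OF v(1)] bspec[OF tw v(1)]]) (use YY j i v in simp)
      moreover have "\<theta> (x j) = \<gamma> j i \<odot>\<^bsub>R\<^esub> x j"
        by (rule g.scalar_action[OF Yi v(3) \<theta>c[OF v(3)] bspec[OF tw v(3)]]) (use YX j i v in simp)
      ultimately show ?thesis by simp
    qed
    then show ?thesis using \<theta> by blast
  qed
  have \<alpha>: "\<alpha> \<in> alg_iso K R R \<and> (\<forall>j\<in>{1..<i}. \<alpha> (y j) = \<gamma> i j \<odot>\<^bsub>R\<^esub> y j \<and> \<alpha> (x j) = \<gamma> j i \<odot>\<^bsub>R\<^esub> x j)"
    unfolding \<alpha>_def weyl_sigma_def by (rule someI_ex[OF ex\<alpha>])
  then have \<alpha>hom: "\<alpha> \<in> alg_hom K R R" by (simp add: alg_iso_iff)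
  \<comment> \<open>Whatever automorphism was chosen, its values on generators force it to be
    conjugation by \<open>Y i\<close>.\<close>
  have \<alpha>tw: "Y i \<otimes> \<psi> r = \<psi> (\<alpha> r) \<otimes> Y i" if "r \<in> carrier R" for r
  proof (rule g.twist_unique[OF \<alpha>hom Yc _ that])
    fix z assume "z \<in> gens m"
    then obtain j where j: "1 \<le> j" "j < i" and z: "z = Y j \<or> z = Xg j" using gensE by blast
    note v = vals[OF j]
    have s: "\<alpha> (y j) = \<gamma> i j \<odot>\<^bsub>R\<^esub> y j" "\<alpha> (x j) = \<gamma> j i \<odot>\<^bsub>R\<^esub> x j" using \<alpha> j by auto
    have "Y i \<otimes> \<psi> (y j) = \<psi> (\<alpha> (y j)) \<otimes> Y i" by (rule g.scalar_twist[OF s(1) v(1)]) (use YY j i v in simp)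
    moreover have "Y i \<otimes> \<psi> (x j) = \<psi> (\<alpha> (x j)) \<otimes> Y i" by (rule g.scalar_twist[OF s(2) v(3)]) (use YX j i v in simp)
    ultimately show "\<exists>r\<in>carrier R. \<psi> r = z \<and> Y i \<otimes> \<psi> r = \<psi> (\<alpha> r) \<otimes> Y i" using z v by metis
  qed
  have \<alpha>c: "\<alpha> r \<in> carrier R" if "r \<in> carrier R" for r using alg_hom_closed[OF \<alpha>hom that] .
  interpret s: skew_extension K R T \<psi> \<alpha> "\<lambda>_. \<zero>\<^bsub>R\<^esub>" "Y i"
  proof unfold_locales
    fix r assume r: "r \<in> carrier R"
    show "Y i \<otimes> \<psi> r = \<psi> (\<alpha> r) \<otimes> Y i \<oplus> \<psi> \<zero>\<^bsub>R\<^esub>" using \<alpha>tw[OF r] Yc \<alpha>c[OF r] by (simp add: g.\<psi>_simps)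
  qed (use \<alpha>c Yc free_Y[of i] i g.image in simp_all)
  define \<phi> where "\<phi> = s.\<psi>'"
  define G1 where "G1 = insert (Y i) (gens m)"
  have G1c: "G1 \<subseteq> carrier T" using g.G Yc by (simp add: G1_def)
  interpret h: generated_map K R1 T \<phi> G1
    unfolding R1_def \<phi>_def
    by (intro generated_map.intro s.step_embedded generated_map_axioms.intro s.step_image[OF g.image g.G] G1c) (simp add: G1_def)
  have v1: "y1 j \<in> carrier R1" "\<phi> (y1 j) = Y j" "x1 j \<in> carrier R1" "\<phi> (x1 j) = Xg j" if "1 \<le> j" "j < i" for j
    using that vals[OF that] s.step_const[of "y j"] s.step_const[of "x j"] by (auto simp: y1_def x1_def R1_def \<phi>_def)
  have v1i: "y1 i \<in> carrier R1" "\<phi> (y1 i) = Y i"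
    using s.step_var by (auto simp: y1_def R1_def \<phi>_def)
  have G1E: "z = Y i \<or> (\<exists>j. 1 \<le> j \<and> j < i \<and> (z = Y j \<or> z = Xg j))" if "z \<in> G1" for z
    using that gensE[of z] by (auto simp: G1_def)
  have nz: "q j \<otimes>\<^bsub>K\<^esub> \<gamma> j i \<noteq> \<zero>\<^bsub>K\<^esub>" "inv\<^bsub>K\<^esub> (q j) \<otimes>\<^bsub>K\<^esub> \<gamma> i j \<noteq> \<zero>\<^bsub>K\<^esub>" if "1 \<le> j" "j < i" for j
    using that \<gamma>nz[OF that] i q_nz[of j] q_closed[of j] qi[of j] by (simp_all add: K.integral_iff)
  have WYi': "qc (q i) (W i) (Y i)" using WYi[of i] i by simp
  have ex\<tau>: "\<exists>\<tau>. \<tau> \<in> alg_iso K R1 R1 \<and>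
    (\<forall>j\<in>{1..<i}. \<tau> (y1 j) = (q j \<otimes>\<^bsub>K\<^esub> \<gamma> j i) \<odot>\<^bsub>R1\<^esub> y1 j \<and>
                 \<tau> (x1 j) = (inv\<^bsub>K\<^esub> (q j) \<otimes>\<^bsub>K\<^esub> \<gamma> i j) \<odot>\<^bsub>R1\<^esub> x1 j) \<and>
    \<tau> (y1 i) = q i \<odot>\<^bsub>R1\<^esub> y1 i"
  proof -
    have "\<exists>k. k \<noteq> \<zero>\<^bsub>K\<^esub> \<and> qc k (W i) z" if "z \<in> G1" for z
      using G1E[OF that] WY[of _ i] WX[of _ i] nz i(1,2) WYi' q_nz by metis
    from h.twist_exists[OF Wi this] obtain \<theta> where \<theta>: "\<theta> \<in> alg_iso K R1 R1"
      and tw: "\<forall>r\<in>carrier R1. W i \<otimes> \<phi> r = \<phi> (\<theta> r) \<otimes> W i" by metis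
    have \<theta>c: "\<theta> r \<in> carrier R1" if "r \<in> carrier R1" for r using \<theta> that alg_hom_closed by (metis alg_iso_iff)
    have "\<theta> (y1 j) = (q j \<otimes>\<^bsub>K\<^esub> \<gamma> j i) \<odot>\<^bsub>R1\<^esub> y1 j \<and> \<theta> (x1 j) = (inv\<^bsub>K\<^esub> (q j) \<otimes>\<^bsub>K\<^esub> \<gamma> i j) \<odot>\<^bsub>R1\<^esub> x1 j"
      if j: "j \<in> {1..<i}" for j
    proof -
      have j: "1 \<le> j" "j < i" using j by auto
      note v = v1[OF j]
      have "\<theta> (y1 j) = (q j \<otimes>\<^bsub>K\<^esub> \<gamma> j i) \<odot>\<^bsub>R1\<^esub> y1 j"
        by (rule h.scalar_action[OF Wi v(1) \<theta>c[OF v(1)] bspec[OF tw v(1)]]) (use WY j i v in simp)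
      moreover have "\<theta> (x1 j) = (inv\<^bsub>K\<^esub> (q j) \<otimes>\<^bsub>K\<^esub> \<gamma> i j) \<odot>\<^bsub>R1\<^esub> x1 j"
        by (rule h.scalar_action[OF Wi v(3) \<theta>c[OF v(3)] bspec[OF tw v(3)]]) (use WX j i v in simp)
      ultimately show ?thesis by simp
    qed
    moreover have "\<theta> (y1 i) = q i \<odot>\<^bsub>R1\<^esub> y1 i"
      by (rule h.scalar_action[OF Wi v1i(1) \<theta>c[OF v1i(1)] bspec[OF tw v1i(1)]]) (use WYi' v1i in simp)
    ultimately show ?thesis using \<theta> by blast
  qed
  have \<tau>: "\<tau> \<in> alg_iso K R1 R1 \<and>
    (\<forall>j\<in>{1..<i}. \<tau> (y1 j) = (q j \<otimes>\<^bsub>K\<^esub> \<gamma> j i) \<odot>\<^bsub>R1\<^esub> y1 j \<and>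
                 \<tau> (x1 j) = (inv\<^bsub>K\<^esub> (q j) \<otimes>\<^bsub>K\<^esub> \<gamma> i j) \<odot>\<^bsub>R1\<^esub> x1 j) \<and>
    \<tau> (y1 i) = q i \<odot>\<^bsub>R1\<^esub> y1 i"
    unfolding \<tau>_def weyl_tau_def by (rule someI_ex[OF ex\<tau>])
  then have \<tau>hom: "\<tau> \<in> alg_hom K R1 R1" by (simp add: alg_iso_iff)
  have \<tau>c: "\<tau> r \<in> carrier R1" if "r \<in> carrier R1" for r using alg_hom_closed[OF \<tau>hom that] .
  have Xtw: "Xg i \<otimes> \<phi> (y1 j) = \<phi> (\<tau> (y1 j)) \<otimes> Xg i" "Xg i \<otimes> \<phi> (x1 j) = \<phi> (\<tau> (x1 j)) \<otimes> Xg i"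
    if j: "1 \<le> j" "j < i" for j
  proof -
    note v = v1[OF j]
    have s: "\<tau> (y1 j) = (q j \<otimes>\<^bsub>K\<^esub> \<gamma> j i) \<odot>\<^bsub>R1\<^esub> y1 j" "\<tau> (x1 j) = (inv\<^bsub>K\<^esub> (q j) \<otimes>\<^bsub>K\<^esub> \<gamma> i j) \<odot>\<^bsub>R1\<^esub> x1 j"
      using \<tau> j by auto
    show "Xg i \<otimes> \<phi> (y1 j) = \<phi> (\<tau> (y1 j)) \<otimes> Xg i" by (rule h.scalar_twist[OF s(1) v(1)]) (use XY j i v in simp)
    show "Xg i \<otimes> \<phi> (x1 j) = \<phi> (\<tau> (x1 j)) \<otimes> Xg i" by (rule h.scalar_twist[OF s(2) v(3)]) (use XX j i v in simp)
  qed
  \<comment> \<open>On the newest \<open>y\<close> the relation is inhomogeneous; its constant term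
    \<open>U m\<close> is what the derivation has to produce.\<close>
  have Xtwi: "Xg i \<otimes> \<phi> (y1 i) = \<phi> (\<tau> (y1 i)) \<otimes> Xg i \<oplus> U m"
    using \<tau> X_Y[of i] i v1i Yc Xc q_closed[of i] by (simp add: h.\<psi>_simps smult_mult_left)
  have Uc: "U m \<in> carrier T" using i by (simp add: U_closed)
  have Usg: "U m \<in> sg G1"
    using U_in_sg[of m] i subalgebra_generated_mono[of "gens m" G1 K T] by (auto simp: G1_def)
  \<comment> \<open>The prescribed value of the derivation, written in the abstract algebra; below
    its image is seen to be \<open>U m\<close>.\<close>
  define D where "D = \<one>\<^bsub>R1\<^esub> \<oplus>\<^bsub>R1\<^esub> (\<Oplus>\<^bsub>R1\<^esub>l\<in>{1..<i}. (q l \<ominus>\<^bsub>K\<^esub> \<one>\<^bsub>K\<^esub>) \<odot>\<^bsub>R1\<^esub> (y1 l \<otimes>\<^bsub>R1\<^esub> x1 l))"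
  have Dl: "(q l \<ominus>\<^bsub>K\<^esub> \<one>\<^bsub>K\<^esub>) \<odot>\<^bsub>R1\<^esub> (y1 l \<otimes>\<^bsub>R1\<^esub> x1 l) \<in> carrier R1" if "l \<in> {1..<i}" for l
    using that v1[of l] q_closed[of l] i by simp
  have Dc: "D \<in> carrier R1" unfolding D_def using Dl by (intro h.R.a_closed h.R.one_closed h.R.finsum_closed) auto
  have \<phi>D: "\<phi> D = U m"
  proof -
    have "\<phi> (\<Oplus>\<^bsub>R1\<^esub>l\<in>{1..<i}. (q l \<ominus>\<^bsub>K\<^esub> \<one>\<^bsub>K\<^esub>) \<odot>\<^bsub>R1\<^esub> (y1 l \<otimes>\<^bsub>R1\<^esub> x1 l)) =
      (\<Oplus>l\<in>{1..<i}. \<phi> ((q l \<ominus>\<^bsub>K\<^esub> \<one>\<^bsub>K\<^esub>) \<odot>\<^bsub>R1\<^esub> (y1 l \<otimes>\<^bsub>R1\<^esub> x1 l)))"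
      by (rule alg_hom_finsum[OF h.R.nc_algebra_axioms nc_algebra_axioms h.hom]) (use Dl in auto)
    also have "\<dots> = (\<Oplus>l\<in>{1..<i}. (q l \<ominus>\<^bsub>K\<^esub> \<one>\<^bsub>K\<^esub>) \<odot> (Y l \<otimes> Xg l))"
      by (rule finsum_cong') (use v1 q_closed i Y_closed Xg_closed in \<open>auto simp: h.\<psi>_simps\<close>)
    finally have "\<phi> D = \<one> \<oplus> (\<Oplus>l\<in>{1..<Suc m}. (q l \<ominus>\<^bsub>K\<^esub> \<one>\<^bsub>K\<^esub>) \<odot> (Y l \<otimes> Xg l))"
      unfolding D_def using Dl by (subst h.\<psi>_simps(2)) (auto intro!: h.R.finsum_closed simp: h.\<psi>_simps(4) i_def)
    then show ?thesis using U_sum[of m] i by simp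
  qed
  have ex\<delta>: "\<exists>\<delta>. skew_derivation K R1 \<tau> \<delta> \<and>
    (\<forall>j\<in>{1..<i}. \<delta> (x1 j) = \<zero>\<^bsub>R1\<^esub> \<and> \<delta> (y1 j) = \<zero>\<^bsub>R1\<^esub>) \<and> \<delta> (y1 i) = D"
  proof -
    have minus0: "a \<ominus> a = \<zero>" if "a \<in> carrier T" for a using that by (simp add: minus_eq r_neg)
    have d0: "Xg i \<otimes> \<phi> (y1 j) \<ominus> \<phi> (\<tau> (y1 j)) \<otimes> Xg i = \<zero>" "Xg i \<otimes> \<phi> (x1 j) \<ominus> \<phi> (\<tau> (x1 j)) \<otimes> Xg i = \<zero>"
      if j: "1 \<le> j" "j < i" for j
      unfolding Xtw[OF j] by (intro minus0 m_closed Xc h.\<psi>_simps(1) \<tau>c v1 j)+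
    have di: "Xg i \<otimes> \<phi> (y1 i) \<ominus> \<phi> (\<tau> (y1 i)) \<otimes> Xg i = U m"
    proof -
      have "\<phi> (\<tau> (y1 i)) \<otimes> Xg i \<in> carrier T" by (intro m_closed Xc h.\<psi>_simps(1) \<tau>c v1i)
      then show ?thesis unfolding Xtwi using Uc by (simp add: minus_eq a_ac r_neg1 r_neg2 r_neg)
    qed
    have "\<exists>r\<in>carrier R1. \<phi> r = z \<and> Xg i \<otimes> \<phi> r \<ominus> \<phi> (\<tau> r) \<otimes> Xg i \<in> sg G1" if "z \<in> G1" for z
      using G1E[OF that]
    proof (elim disjE exE conjE)
      assume "z = Y i"
      then show ?thesis using v1i di Usg by (intro bexI[of _ "y1 i"]) simp_all
    next
      fix j assume j: "1 \<le> j" "j < i" "z = Y j"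
      then show ?thesis using v1[OF j(1,2)] d0[OF j(1,2)] sg_zero by (intro bexI[of _ "y1 j"]) simp_all
    next
      fix j assume j: "1 \<le> j" "j < i" "z = Xg j"
      then show ?thesis using v1[OF j(1,2)] d0[OF j(1,2)] sg_zero by (intro bexI[of _ "x1 j"]) simp_all
    qed
    from h.derivation_exists[OF \<tau>hom Xc this] obtain d where d: "skew_derivation K R1 \<tau> d"
      and d2: "\<forall>r\<in>carrier R1. d r \<in> carrier R1 \<and> \<phi> (d r) = Xg i \<otimes> \<phi> r \<ominus> \<phi> (\<tau> r) \<otimes> Xg i" by metis
    have eq0: "d r = \<zero>\<^bsub>R1\<^esub>" if "r \<in> carrier R1" "Xg i \<otimes> \<phi> r \<ominus> \<phi> (\<tau> r) \<otimes> Xg i = \<zero>" for r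
      using bspec[OF d2 that(1)] that(2) h.\<psi>_eq[of "d r" "\<zero>\<^bsub>R1\<^esub>"] by (simp add: h.\<psi>_simps(6))
    have "d (y1 i) = D" using bspec[OF d2 v1i(1)] di \<phi>D Dc h.\<psi>_eq[of "d (y1 i)" D] by simp
    then show ?thesis using d eq0 v1 d0 by (intro exI[of _ d]) simp
  qed
  have \<delta>: "skew_derivation K R1 \<tau> \<delta> \<and>
    (\<forall>j\<in>{1..<i}. \<delta> (x1 j) = \<zero>\<^bsub>R1\<^esub> \<and> \<delta> (y1 j) = \<zero>\<^bsub>R1\<^esub>) \<and> \<delta> (y1 i) = D"
    unfolding \<delta>_def weyl_delta_def D_def by (rule someI_ex[OF ex\<delta>[unfolded D_def]])
  have \<delta>c: "\<delta> r \<in> carrier R1" if "r \<in> carrier R1" for r using \<delta> that unfolding skew_derivation_def by blast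
  \<comment> \<open>The chosen derivation agrees with the skew commutator on all generators, so
    \<open>Xg i\<close> can represent the variable of the second extension.\<close>
  have \<delta>tw: "Xg i \<otimes> \<phi> r = \<phi> (\<tau> r) \<otimes> Xg i \<oplus> \<phi> (\<delta> r)" if "r \<in> carrier R1" for r
  proof (rule h.derivation_unique[OF \<tau>hom _ Xc _ that])
    show "skew_derivation K R1 \<tau> \<delta>" using \<delta> by blast
    fix z assume z: "z \<in> G1"
    show "\<exists>r\<in>carrier R1. \<phi> r = z \<and> Xg i \<otimes> \<phi> r = \<phi> (\<tau> r) \<otimes> Xg i \<oplus> \<phi> (\<delta> r)"
      using G1E[OF z]
    proof (elim disjE exE conjE)
      assume "z = Y i"
      then show ?thesis using v1i Xtwi \<delta> \<phi>D by (intro bexI[of _ "y1 i"]) simp_all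
    next
      fix j assume j: "1 \<le> j" "j < i" "z = Y j"
      have "\<phi> (\<tau> (y1 j)) \<otimes> Xg i \<in> carrier T" by (intro m_closed Xc h.\<psi>_simps(1) \<tau>c v1 j)
      then show ?thesis using v1[OF j(1,2)] Xtw(1)[OF j(1,2)] j \<delta>
        by (intro bexI[of _ "y1 j"]) (simp_all add: h.\<psi>_simps(6))
    next
      fix j assume j: "1 \<le> j" "j < i" "z = Xg j"
      have "\<phi> (\<tau> (x1 j)) \<otimes> Xg i \<in> carrier T" by (intro m_closed Xc h.\<psi>_simps(1) \<tau>c v1 j)
      then show ?thesis using v1[OF j(1,2)] Xtw(2)[OF j(1,2)] j \<delta>
        by (intro bexI[of _ "x1 j"]) (simp_all add: h.\<psi>_simps(6))
    qed
  qed
  interpret s2: skew_extension K R1 T \<phi> \<tau> \<delta> "Xg i"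
    by unfold_locales (use \<tau>c \<delta>c Xc \<delta>tw free_X[of i] i h.image G1_def in simp_all)
  have gm: "generated_map K (tower_step R1 \<tau> \<delta>) T s2.\<psi>' (gens i)"
  proof (intro generated_map.intro s2.step_embedded generated_map_axioms.intro s2.step_image[OF h.image h.G])
    show "gens i = insert (Xg i) G1" by (simp add: i_def gens_Suc G1_def)
    show "gens i \<subseteq> carrier T" using i by (intro gens_closed)
  qed
  moreover have "tower_const R1 (y1 j) \<in> carrier (tower_step R1 \<tau> \<delta>) \<and> s2.\<psi>' (tower_const R1 (y1 j)) = Y j"
    if "j \<in> {1..i}" for j
    using that v1[of j] v1i s2.step_const[of "y1 j"] by (cases "j = i") auto
  moreover have "(if j = i then tower_var R1 else tower_const R1 (x1 j)) \<in> carrier (tower_step R1 \<tau> \<delta>) \<and>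
      s2.\<psi>' (if j = i then tower_var R1 else tower_const R1 (x1 j)) = Xg j"
    if "j \<in> {1..i}" for j
    using that v1[of j] s2.step_const[of "x1 j"] s2.step_var by (cases "j = i") auto
  ultimately have "stage i (tower_step R1 \<tau> \<delta>) (\<lambda>j. tower_const R1 (y1 j))
      (\<lambda>j. if j = i then tower_var R1 else tower_const R1 (x1 j)) s2.\<psi>'"
    unfolding stage_def by blast
  then show ?thesis by blast
qed

lemma tower_stage:
  "m \<le> n \<Longrightarrow> \<exists>\<psi>. stage m (fst (qweyl_tower K q \<gamma> m)) (fst (snd (qweyl_tower K q \<gamma> m))) (snd (snd (qweyl_tower K q \<gamma> m))) \<psi>"
proof (induction m)
  case 0
  then show ?case using base_stage by simp
next
  case (Suc m)
  then obtain \<psi> where "stage m (fst (qweyl_tower K q \<gamma> m)) (fst (snd (qweyl_tower K q \<gamma> m))) (snd (snd (qweyl_tower K q \<gamma> m))) \<psi>"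
    by auto
  from stage_step[OF this Suc.prems] show ?case
    by (simp add: Let_def split_def del: One_nat_def)
qed

theorem qweyl_embedding:
  "\<exists>\<psi>. generated_map K (qweyl K n q \<gamma>) T \<psi> (gens n)"
  using tower_stage[of n] unfolding stage_def qweyl_def by auto

end

lemma (in right_ore_domain) nc_algebra_Q: "nc_algebra K Q"
proof (intro nc_algebra.intro nc_algebra_axioms.intro ring_Q)
  show "field K" by (rule K.field_axioms)
next
  fix c x assume c: "c \<in> carrier K" and x: "x \<in> carrier Q"
  obtain a s where x: "x = frc a s" "a \<in> carrier A" "s \<in> nz" by (rule Q_E[OF x])
  show "c \<odot>\<^bsub>Q\<^esub> x \<in> carrier Q" using c x by (simp add: Q_smult)
  fix d assume d: "d \<in> carrier K"
  show "(c \<oplus>\<^bsub>K\<^esub> d) \<odot>\<^bsub>Q\<^esub> x = c \<odot>\<^bsub>Q\<^esub> x \<oplus>\<^bsub>Q\<^esub> d \<odot>\<^bsub>Q\<^esub> x"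
    using c d x by (simp add: Q_smult Q_add smult_l_distr)
  show "(c \<otimes>\<^bsub>K\<^esub> d) \<odot>\<^bsub>Q\<^esub> x = c \<odot>\<^bsub>Q\<^esub> (d \<odot>\<^bsub>Q\<^esub> x)"
    using c d x by (simp add: Q_smult smult_assoc)
next
  fix x assume x: "x \<in> carrier Q"
  obtain a s where x: "x = frc a s" "a \<in> carrier A" "s \<in> nz" by (rule Q_E[OF x])
  show "\<one>\<^bsub>K\<^esub> \<odot>\<^bsub>Q\<^esub> x = x" using x by (simp add: Q_smult)
next
  fix c x y assume c: "c \<in> carrier K" and xy: "x \<in> carrier Q" "y \<in> carrier Q"
  obtain a b s where s: "x = frc a s" "y = frc b s" "a \<in> carrier A" "b \<in> carrier A" "s \<in> nz" by (rule Q_E2[OF xy])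
  show "c \<odot>\<^bsub>Q\<^esub> (x \<oplus>\<^bsub>Q\<^esub> y) = c \<odot>\<^bsub>Q\<^esub> x \<oplus>\<^bsub>Q\<^esub> c \<odot>\<^bsub>Q\<^esub> y"
    using c s by (simp add: Q_smult Q_add smult_r_distr)
  obtain u t where ut: "u \<in> carrier A" "t \<in> nz" "y = frc (s \<otimes> u) t" by (rule Q_numerator[OF xy(2) s(5)])
  show "(c \<odot>\<^bsub>Q\<^esub> x) \<otimes>\<^bsub>Q\<^esub> y = c \<odot>\<^bsub>Q\<^esub> (x \<otimes>\<^bsub>Q\<^esub> y)"
    unfolding s(1) ut(3) using c s(3-5) ut(1,2) by (simp add: Q_smult Q_mult smult_mult_left)
  have e: "c \<odot> (s \<otimes> u) = s \<otimes> (c \<odot> u)" "c \<odot> (a \<otimes> u) = a \<otimes> (c \<odot> u)"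
    by (rule smult_mult_right[symmetric], use c s(3-5) ut(1,2) in simp_all)+
  have "c \<odot>\<^bsub>Q\<^esub> y = frc (s \<otimes> (c \<odot> u)) t" unfolding ut(3) e(1)[symmetric] by (rule Q_smult) (use c s(3-5) ut(1,2) in simp_all)
  moreover have "frc a s \<otimes>\<^bsub>Q\<^esub> frc (s \<otimes> (c \<odot> u)) t = frc (a \<otimes> (c \<odot> u)) t" by (rule Q_mult) (use c s(3-5) ut(1,2) in simp_all)
  moreover have "x \<otimes>\<^bsub>Q\<^esub> y = frc (a \<otimes> u) t" unfolding s(1) ut(3) by (rule Q_mult) (use s(3-5) ut(1,2) in simp_all)
  moreover have "c \<odot>\<^bsub>Q\<^esub> frc (a \<otimes> u) t = frc (a \<otimes> (c \<odot> u)) t" unfolding e(2)[symmetric] by (rule Q_smult) (use c s(3-5) ut(1,2) in simp_all)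
  ultimately show "x \<otimes>\<^bsub>Q\<^esub> (c \<odot>\<^bsub>Q\<^esub> y) = c \<odot>\<^bsub>Q\<^esub> (x \<otimes>\<^bsub>Q\<^esub> y)" by (simp add: s(1))
qed

section \<open>Leading terms and freeness in a quantum torus\<close>

context quantum_torus
begin

text \<open>The subtorus in the first \<open>m\<close> generators; it receives the stages adjoined
  before a new generator of the torus appears.\<close>

definition Tsub :: "nat \<Rightarrow> ((nat \<Rightarrow>\<^sub>0 int) \<Rightarrow> 'k) set"
  where "Tsub m = {f \<in> carrier T. \<forall>a. f a \<noteq> \<zero>\<^bsub>K\<^esub> \<longrightarrow> a \<in> exponents m}"

lemma exponents_add: "\<lbrakk>a \<in> exponents m; b \<in> exponents m\<rbrakk> \<Longrightarrow> a + b \<in> exponents m"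
  by (simp add: exponents_iff lookup_add)

lemma kmono_apply: "kmono K s a x = (if x = a then s else \<zero>\<^bsub>K\<^esub>)"
  by (simp add: kmono_def)

lemma Tsub_kmono: "\<lbrakk>s \<in> carrier K; a \<in> exponents m; m \<le> N\<rbrakk> \<Longrightarrow> kmono K s a \<in> Tsub m"
  by (auto simp: Tsub_def kmono_apply exponents_iff intro!: mono_closed split: if_splits)

lemma supp_multE:
  assumes "f \<in> carrier T" "g \<in> carrier T" "(f \<otimes>\<^bsub>T\<^esub> g) x \<noteq> \<zero>\<^bsub>K\<^esub>"
  obtains a b where "x = a + b" "f a \<noteq> \<zero>\<^bsub>K\<^esub>" "g b \<noteq> \<zero>\<^bsub>K\<^esub>"
proof -
  have "x \<in> (\<lambda>(a, b). a + b) ` (supp f \<times> supp g)" by (rule subsetD[OF supp_mult[OF assms(1,2)]]) (use assms(3) in simp)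
  then show ?thesis by (auto intro: that)
qed

lemma sg_Tsub:
  assumes "G \<subseteq> Tsub m" "m \<le> N" shows "sg G \<subseteq> Tsub m"
proof
  fix x assume "x \<in> sg G"
  then show "x \<in> Tsub m"
  proof induction
    case sg_one
    then show ?case unfolding T_one using assms(2) by (intro Tsub_kmono) (auto simp: exponents_iff)
  next
    case (sg_add x y)
    then have "x \<oplus>\<^bsub>T\<^esub> y \<in> carrier T" by (simp add: Tsub_def)
    moreover have "x a \<noteq> \<zero>\<^bsub>K\<^esub> \<or> y a \<noteq> \<zero>\<^bsub>K\<^esub>" if "(x \<oplus>\<^bsub>T\<^esub> y) a \<noteq> \<zero>\<^bsub>K\<^esub>" for a
      using that by (auto simp: T_add)
    ultimately show ?case using sg_add unfolding Tsub_def by blast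
  next
    case (sg_mult x y)
    then have c: "x \<in> carrier T" "y \<in> carrier T" by (auto simp: Tsub_def)
    have "a \<in> exponents m" if a: "(x \<otimes>\<^bsub>T\<^esub> y) a \<noteq> \<zero>\<^bsub>K\<^esub>" for a
    proof -
      obtain b d where "a = b + d" "x b \<noteq> \<zero>\<^bsub>K\<^esub>" "y d \<noteq> \<zero>\<^bsub>K\<^esub>" by (rule supp_multE[OF c a])
      then show ?thesis using sg_mult by (auto simp: Tsub_def exponents_add)
    qed
    then show ?case using c by (simp add: Tsub_def)
  next
    case (sg_smult k x)
    then have "k \<odot>\<^bsub>T\<^esub> x \<in> carrier T" by (auto simp: Tsub_def)
    moreover have "x a \<noteq> \<zero>\<^bsub>K\<^esub>" if "(k \<odot>\<^bsub>T\<^esub> x) a \<noteq> \<zero>\<^bsub>K\<^esub>" for a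
      using that sg_smult(1) by (auto simp: T_smult)
    ultimately show ?case using sg_smult by (auto simp: Tsub_def)
  qed (use assms in auto)
qed

context
  fixes m :: nat assumes m: "Suc m \<le> N"
begin

text \<open>A filtration by the exponent of the first generator outside \<open>Tsub m\<close>; the
  degree may be negative, as for Laurent polynomials.\<close>

definition deg_le :: "int \<Rightarrow> ((nat \<Rightarrow>\<^sub>0 int) \<Rightarrow> 'k) set"
  where "deg_le k = {f \<in> carrier T. \<forall>a. f a \<noteq> \<zero>\<^bsub>K\<^esub> \<longrightarrow> Poly_Mapping.lookup a (Suc m) \<le> k}"

lemma deg_le_mult: "\<lbrakk>f \<in> deg_le k; g \<in> deg_le l\<rbrakk> \<Longrightarrow> f \<otimes>\<^bsub>T\<^esub> g \<in> deg_le (k + l)"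
proof -
  assume fg: "f \<in> deg_le k" "g \<in> deg_le l"
  then have c: "f \<in> carrier T" "g \<in> carrier T" by (auto simp: deg_le_def)
  have "Poly_Mapping.lookup a (Suc m) \<le> k + l" if a: "(f \<otimes>\<^bsub>T\<^esub> g) a \<noteq> \<zero>\<^bsub>K\<^esub>" for a
  proof -
    obtain b d where "a = b + d" "f b \<noteq> \<zero>\<^bsub>K\<^esub>" "g d \<noteq> \<zero>\<^bsub>K\<^esub>" by (rule supp_multE[OF c a])
    then show ?thesis using fg by (auto simp: deg_le_def lookup_add intro: add_mono)
  qed
  then show ?thesis using c by (simp add: deg_le_def)
qed

lemma deg_le_add: "\<lbrakk>f \<in> deg_le k; g \<in> deg_le k\<rbrakk> \<Longrightarrow> f \<oplus>\<^bsub>T\<^esub> g \<in> deg_le k"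
proof -
  assume fg: "f \<in> deg_le k" "g \<in> deg_le k"
  have "f a \<noteq> \<zero>\<^bsub>K\<^esub> \<or> g a \<noteq> \<zero>\<^bsub>K\<^esub>" if "(f \<oplus>\<^bsub>T\<^esub> g) a \<noteq> \<zero>\<^bsub>K\<^esub>" for a
    using that by (auto simp: T_add)
  moreover have "f \<oplus>\<^bsub>T\<^esub> g \<in> carrier T" using fg by (simp add: deg_le_def)
  ultimately show ?thesis using fg unfolding deg_le_def by blast
qed

lemma deg_le_mono: "\<lbrakk>f \<in> deg_le k; k \<le> l\<rbrakk> \<Longrightarrow> f \<in> deg_le l"
  unfolding deg_le_def using order_trans by blast

lemma deg_le_kmono: "\<lbrakk>s \<in> carrier K; a \<in> exponents N; Poly_Mapping.lookup a (Suc m) \<le> k\<rbrakk> \<Longrightarrow> kmono K s a \<in> deg_le k"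
  by (auto simp: deg_le_def kmono_apply intro!: mono_closed split: if_splits)

lemma deg_le_Tsub: "f \<in> Tsub m \<Longrightarrow> f \<in> deg_le 0"
  by (auto simp: deg_le_def Tsub_def exponents_iff)

lemma deg_le_carrier: "f \<in> deg_le k \<Longrightarrow> f \<in> carrier T"
  by (simp add: deg_le_def)

lemma deg_le_apply: "\<lbrakk>f \<in> deg_le k; k < Poly_Mapping.lookup a (Suc m)\<rbrakk> \<Longrightarrow> f a = \<zero>\<^bsub>K\<^esub>"
  unfolding deg_le_def by (metis (mono_tags, lifting) mem_Collect_eq not_less)

abbreviation ex :: "int \<Rightarrow> nat \<Rightarrow>\<^sub>0 int" where "ex j \<equiv> Poly_Mapping.single (Suc m) j"

lemma ex_in: "ex j \<in> exponents N"
  using m by (auto simp: exponents_iff lookup_single when_def)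

context
  fixes s p assumes s: "s \<in> carrier K" "s \<noteq> \<zero>\<^bsub>K\<^esub>" and p: "p \<in> Tsub m"
begin

text \<open>The common shape of \<open>Yt i\<close> (with \<open>p\<close> zero) and of
  \<open>w.Xg i\<close>: a nonzero multiple of the new torus generator plus an element of the
  earlier subtorus.\<close>

abbreviation v where "v \<equiv> kmono K s (ee (Suc m)) \<oplus>\<^bsub>T\<^esub> p"

lemma v_deg: "v \<in> deg_le 1"
  by (intro deg_le_add deg_le_kmono deg_le_mono[OF deg_le_Tsub[OF p]] s) (use ex_in[of 1] in auto)

text \<open>Each multiplication by \<open>v\<close> raises the leading exponent by one and
  multiplies the leading coefficient by \<open>s\<close> and a cocycle value, both nonzero;
  everything else has smaller degree.\<close>

lemma v_pow: "\<exists>u l. u \<in> carrier K \<and> u \<noteq> \<zero>\<^bsub>K\<^esub> \<and> l \<in> deg_le (int j - 1) \<and> v [^]\<^bsub>T\<^esub> j = kmono K u (ex (int j)) \<oplus>\<^bsub>T\<^esub> l"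
proof (induction j)
  case 0
  have "\<zero>\<^bsub>T\<^esub> \<in> deg_le (- 1)" by (simp add: deg_le_def, simp add: T_zero)
  moreover have "kmono K \<one>\<^bsub>K\<^esub> 0 \<oplus>\<^bsub>T\<^esub> \<zero>\<^bsub>T\<^esub> = \<one>\<^bsub>T\<^esub>" using one_closed by (simp flip: T_one)
  ultimately show ?case by (intro exI[of _ "\<one>\<^bsub>K\<^esub>"] exI[of _ "\<zero>\<^bsub>T\<^esub>"]) simp
next
  case (Suc j)
  then obtain u l where u: "u \<in> carrier K" "u \<noteq> \<zero>\<^bsub>K\<^esub>" and l: "l \<in> deg_le (int j - 1)"
    and e: "v [^]\<^bsub>T\<^esub> j = kmono K u (ex (int j)) \<oplus>\<^bsub>T\<^esub> l" by blast
  let ?a = "kmono K u (ex (int j))" and ?b = "kmono K s (ee (Suc m))"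
  have c: "?a \<in> carrier T" "?b \<in> carrier T" "p \<in> carrier T" "l \<in> carrier T" "v \<in> carrier T"
    using u s p l ex_in[of 1] ex_in[of "int j"] deg_le_carrier[OF v_deg]
    by (auto simp: Tsub_def deg_le_def intro!: mono_closed)
  have "v [^]\<^bsub>T\<^esub> Suc j = (?a \<oplus>\<^bsub>T\<^esub> l) \<otimes>\<^bsub>T\<^esub> v" by (simp add: e)
  also have "\<dots> = ?a \<otimes>\<^bsub>T\<^esub> ?b \<oplus>\<^bsub>T\<^esub> (?a \<otimes>\<^bsub>T\<^esub> p \<oplus>\<^bsub>T\<^esub> l \<otimes>\<^bsub>T\<^esub> v)"
  proof -
    have "(?a \<oplus>\<^bsub>T\<^esub> l) \<otimes>\<^bsub>T\<^esub> v = ?a \<otimes>\<^bsub>T\<^esub> v \<oplus>\<^bsub>T\<^esub> l \<otimes>\<^bsub>T\<^esub> v" by (rule l_distr[OF c(1,4,5)])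
    also have "?a \<otimes>\<^bsub>T\<^esub> v = ?a \<otimes>\<^bsub>T\<^esub> ?b \<oplus>\<^bsub>T\<^esub> ?a \<otimes>\<^bsub>T\<^esub> p" by (rule r_distr[OF c(2,3,1)])
    finally show ?thesis using c by (simp only: a_assoc m_closed)
  qed
  also have "?a \<otimes>\<^bsub>T\<^esub> ?b = kmono K (u \<otimes>\<^bsub>K\<^esub> s \<otimes>\<^bsub>K\<^esub> cc (ex (int j)) (ex 1)) (ex (int (Suc j)))"
    using u s ex_in by (simp add: mono_mult single_add[symmetric] add.commute)
  finally have e': "v [^]\<^bsub>T\<^esub> Suc j = kmono K (u \<otimes>\<^bsub>K\<^esub> s \<otimes>\<^bsub>K\<^esub> cc (ex (int j)) (ex 1)) (ex (int (Suc j))) \<oplus>\<^bsub>T\<^esub> (?a \<otimes>\<^bsub>T\<^esub> p \<oplus>\<^bsub>T\<^esub> l \<otimes>\<^bsub>T\<^esub> v)" .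
  have "?a \<in> deg_le (int j)" using u ex_in by (intro deg_le_kmono) auto
  from deg_le_mult[OF this deg_le_Tsub[OF p]] have d1: "?a \<otimes>\<^bsub>T\<^esub> p \<in> deg_le (int j)" by simp
  have d2: "l \<otimes>\<^bsub>T\<^esub> v \<in> deg_le (int j)" using deg_le_mult[OF l v_deg] by simp
  have "?a \<otimes>\<^bsub>T\<^esub> p \<oplus>\<^bsub>T\<^esub> l \<otimes>\<^bsub>T\<^esub> v \<in> deg_le (int (Suc j) - 1)" using deg_le_add[OF d1 d2] by simp
  moreover have "u \<otimes>\<^bsub>K\<^esub> s \<otimes>\<^bsub>K\<^esub> cc (ex (int j)) (ex 1) \<noteq> \<zero>\<^bsub>K\<^esub>" using u s by (simp add: K.integral_iff)
  ultimately show ?case using e' u s by (metis K.m_closed c_closed)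
qed

text \<open>As \<open>r\<close> does not involve the new generator, the part of degree
  \<open>j\<close> in \<open>r v^j\<close> is \<open>r\<close> times the leading monomial. Its
  coefficients are those of \<open>r\<close> up to nonzero scalars. The last alternative sets aside
  the exponents at which an element of the subtorus vanishes.\<close>

lemma coefficient_extraction:
  assumes r: "r \<in> Tsub m"
  shows "r \<otimes>\<^bsub>T\<^esub> v [^]\<^bsub>T\<^esub> j \<in> deg_le (int j)"
    and "\<exists>k\<in>carrier K - {\<zero>\<^bsub>K\<^esub>}. (r \<otimes>\<^bsub>T\<^esub> v [^]\<^bsub>T\<^esub> j) (a + ex (int j)) = r a \<otimes>\<^bsub>K\<^esub> k \<or> a \<notin> exponents m"
proof -
  obtain u l where u: "u \<in> carrier K" "u \<noteq> \<zero>\<^bsub>K\<^esub>" and l: "l \<in> deg_le (int j - 1)"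
    and e: "v [^]\<^bsub>T\<^esub> j = kmono K u (ex (int j)) \<oplus>\<^bsub>T\<^esub> l" using v_pow by blast
  let ?a = "kmono K u (ex (int j))"
  have c: "?a \<in> carrier T" "l \<in> carrier T" "r \<in> carrier T"
    using u l r ex_in by (auto simp: deg_le_def Tsub_def intro!: mono_closed)
  have "?a \<in> deg_le (int j)" using u ex_in by (intro deg_le_kmono) auto
  moreover have "l \<in> deg_le (int j)" by (rule deg_le_mono[OF l]) simp
  ultimately have "v [^]\<^bsub>T\<^esub> j \<in> deg_le (int j)" unfolding e by (rule deg_le_add)
  from deg_le_mult[OF deg_le_Tsub[OF r] this] show "r \<otimes>\<^bsub>T\<^esub> v [^]\<^bsub>T\<^esub> j \<in> deg_le (int j)" by simp
  show "\<exists>k\<in>carrier K - {\<zero>\<^bsub>K\<^esub>}. (r \<otimes>\<^bsub>T\<^esub> v [^]\<^bsub>T\<^esub> j) (a + ex (int j)) = r a \<otimes>\<^bsub>K\<^esub> k \<or> a \<notin> exponents m"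
  proof (cases "a \<in> exponents m")
    case True
    have a0: "Poly_Mapping.lookup a (Suc m) = 0" using True by (simp add: exponents_iff)
    have "r \<otimes>\<^bsub>T\<^esub> l \<in> deg_le (int j - 1)" using deg_le_mult[OF deg_le_Tsub[OF r] l] by simp
    then have 0: "(r \<otimes>\<^bsub>T\<^esub> l) (a + ex (int j)) = \<zero>\<^bsub>K\<^esub>" by (rule deg_le_apply) (simp add: lookup_add a0)
    have 1: "(r \<otimes>\<^bsub>T\<^esub> ?a) (a + ex (int j)) = r a \<otimes>\<^bsub>K\<^esub> (cc a (ex (int j)) \<otimes>\<^bsub>K\<^esub> u)"
      by (subst mult_apply_right[of _ _ "{ex (int j)}"]) (use c u in \<open>auto simp: kmono_apply T_apply K.m_assoc\<close>)
    have "r \<otimes>\<^bsub>T\<^esub> v [^]\<^bsub>T\<^esub> j = r \<otimes>\<^bsub>T\<^esub> ?a \<oplus>\<^bsub>T\<^esub> r \<otimes>\<^bsub>T\<^esub> l" unfolding e using c by (simp add: r_distr)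
    then have "(r \<otimes>\<^bsub>T\<^esub> v [^]\<^bsub>T\<^esub> j) (a + ex (int j)) = r a \<otimes>\<^bsub>K\<^esub> (cc a (ex (int j)) \<otimes>\<^bsub>K\<^esub> u)"
      using 0 1 c u by (simp add: T_add T_apply)
    then show ?thesis using u by (intro bexI[of _ "cc a (ex (int j)) \<otimes>\<^bsub>K\<^esub> u"]) (auto simp: K.integral_iff)
  qed (auto intro!: bexI[of _ "\<one>\<^bsub>K\<^esub>"])
qed

text \<open>In a vanishing polynomial in \<open>v\<close> only the summand with the highest power
  reaches degree \<open>n\<close>, so its coefficient is zero; descending induction removes the
  others.\<close>

lemma free_over_Tsub: "free_over (Tsub m) v"
  unfolding free_over_def
proof (intro allI impI)
  fix f :: "nat \<Rightarrow> (nat \<Rightarrow>\<^sub>0 int) \<Rightarrow> 'k" and n i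
  assume f: "\<forall>i. f i \<in> Tsub m"
  have fd: "f i \<otimes>\<^bsub>T\<^esub> v [^]\<^bsub>T\<^esub> i \<in> deg_le (int i)" for i using coefficient_extraction(1) f by blast
  have fc: "f i \<otimes>\<^bsub>T\<^esub> v [^]\<^bsub>T\<^esub> i \<in> carrier T" for i using deg_le_carrier[OF fd] .
  have sum_deg: "(\<Oplus>\<^bsub>T\<^esub>i\<in>{..n}. f i \<otimes>\<^bsub>T\<^esub> v [^]\<^bsub>T\<^esub> i) \<in> deg_le (int n)" for n
  proof (induction n)
    case 0
    then show ?case using fd[of 0] fc[of 0] by simp
  next
    case (Suc n)
    have "(\<Oplus>\<^bsub>T\<^esub>i\<in>{..Suc n}. f i \<otimes>\<^bsub>T\<^esub> v [^]\<^bsub>T\<^esub> i) = f (Suc n) \<otimes>\<^bsub>T\<^esub> v [^]\<^bsub>T\<^esub> Suc n \<oplus>\<^bsub>T\<^esub> (\<Oplus>\<^bsub>T\<^esub>i\<in>{..n}. f i \<otimes>\<^bsub>T\<^esub> v [^]\<^bsub>T\<^esub> i)"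
      by (rule finsum_Suc) (use fc in blast)
    then show ?case using deg_le_add[OF fd[of "Suc n"] deg_le_mono[OF Suc]] by (simp del: nat_pow_Suc)
  qed
  have top: "f n = \<zero>\<^bsub>T\<^esub>" if eq: "(f n \<otimes>\<^bsub>T\<^esub> v [^]\<^bsub>T\<^esub> n) \<oplus>\<^bsub>T\<^esub> g = \<zero>\<^bsub>T\<^esub>" and g: "g \<in> deg_le (int n - 1)" for n g
  proof
    fix a
    show "f n a = \<zero>\<^bsub>T\<^esub> a"
    proof (cases "a \<in> exponents m")
      case True
      have "g (a + ex (int n)) = \<zero>\<^bsub>K\<^esub>"
        by (rule deg_le_apply[OF g]) (use True in \<open>simp add: exponents_iff lookup_add\<close>)
      then have "(f n \<otimes>\<^bsub>T\<^esub> v [^]\<^bsub>T\<^esub> n) (a + ex (int n)) = \<zero>\<^bsub>K\<^esub>"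
        using fun_cong[OF eq, of "a + ex (int n)"] fc[of n] by (simp add: T_add T_zero T_apply)
      moreover obtain k where k: "k \<in> carrier K - {\<zero>\<^bsub>K\<^esub>}" "(f n \<otimes>\<^bsub>T\<^esub> v [^]\<^bsub>T\<^esub> n) (a + ex (int n)) = f n a \<otimes>\<^bsub>K\<^esub> k"
        using coefficient_extraction(2)[of "f n" n a] f True by blast
      ultimately have "f n a \<otimes>\<^bsub>K\<^esub> k = \<zero>\<^bsub>K\<^esub>" by simp
      moreover have "f n a \<in> carrier K" using f by (auto simp: Tsub_def T_apply)
      ultimately show ?thesis using k(1) K.integral_iff[of "f n a" k] by (simp add: T_zero)
    next
      case False
      then show ?thesis using f by (auto simp: Tsub_def T_zero)
    qed
  qed
  assume 0: "(\<Oplus>\<^bsub>T\<^esub>i\<in>{..n}. f i \<otimes>\<^bsub>T\<^esub> v [^]\<^bsub>T\<^esub> i) = \<zero>\<^bsub>T\<^esub>" and i: "i \<le> n"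
  from 0 i show "f i = \<zero>\<^bsub>T\<^esub>"
  proof (induction n)
    case 0
    have "\<zero>\<^bsub>T\<^esub> \<in> deg_le (int 0 - 1)" by (simp add: deg_le_def, simp add: T_zero)
    then have "f 0 = \<zero>\<^bsub>T\<^esub>" using top[of 0 "\<zero>\<^bsub>T\<^esub>"] 0 fc[of 0] by simp
    then show ?case using 0 by simp
  next
    case (Suc n)
    have e: "(\<Oplus>\<^bsub>T\<^esub>i\<in>{..Suc n}. f i \<otimes>\<^bsub>T\<^esub> v [^]\<^bsub>T\<^esub> i) = f (Suc n) \<otimes>\<^bsub>T\<^esub> v [^]\<^bsub>T\<^esub> Suc n \<oplus>\<^bsub>T\<^esub> (\<Oplus>\<^bsub>T\<^esub>i\<in>{..n}. f i \<otimes>\<^bsub>T\<^esub> v [^]\<^bsub>T\<^esub> i)"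
      by (rule finsum_Suc) (use fc in blast)
    have t: "f (Suc n) = \<zero>\<^bsub>T\<^esub>"
      by (rule top[of "Suc n" "(\<Oplus>\<^bsub>T\<^esub>i\<in>{..n}. f i \<otimes>\<^bsub>T\<^esub> v [^]\<^bsub>T\<^esub> i)"]) (use Suc.prems(1) e sum_deg[of n] in simp_all)
    have "(\<Oplus>\<^bsub>T\<^esub>i\<in>{..n}. f i \<otimes>\<^bsub>T\<^esub> v [^]\<^bsub>T\<^esub> i) = \<zero>\<^bsub>T\<^esub>"
      using Suc.prems(1) e t deg_le_carrier[OF sum_deg[of n]] deg_le_carrier[OF v_deg] by simp
    then show ?case using Suc t by (cases "i = Suc n") simp_all
  qed
qed

end

end

lemma inv_zmon:
  assumes "a \<in> exponents N" shows "\<exists>k\<in>carrier K. inv\<^bsub>T\<^esub> (zmon a) = kmono K k (- a)"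
proof -
  have m: "- a \<in> exponents N" by (rule H_minus[OF assms])
  define k where "k = inv\<^bsub>K\<^esub> (cc a (- a))"
  have k: "k \<in> carrier K" by (simp add: k_def K.field_Units)
  have c: "zmon a \<in> carrier T" "kmono K k (- a) \<in> carrier T" using assms m k by (simp_all add: mono_closed)
  have "zmon a \<otimes>\<^bsub>T\<^esub> kmono K k (- a) = \<one>\<^bsub>T\<^esub>"
    using assms m k by (simp add: mono_mult T_one k_def K.field_Units)
  then have "inv\<^bsub>T\<^esub> (zmon a) \<otimes>\<^bsub>T\<^esub> (zmon a \<otimes>\<^bsub>T\<^esub> kmono K k (- a)) = inv\<^bsub>T\<^esub> (zmon a)"
    using zmon_Units[OF assms] by simp
  then have "kmono K k (- a) = inv\<^bsub>T\<^esub> (zmon a)" using zmon_Units[OF assms] c by (simp flip: m_assoc)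
  then show ?thesis using k by metis
qed

end

section \<open>The torus belonging to the block matrix of the theorem\<close>

text \<open>Blocks below the diagonal are inverses by definition, so only the diagonal blocks
  require a computation; the remaining work is that all entries are units.\<close>

lemma (in field) weyl_matrix_antisymmetric:
  assumes q: "\<And>i. i \<in> {1..n} \<Longrightarrow> q i \<in> carrier R - {\<zero>}" and \<gamma>: "mult_antisymmetric R n \<gamma>"
  shows "mult_antisymmetric R (2 * n) (weyl_matrix R q \<gamma>)"
proof -
  have qc: "q i \<in> carrier R" "q i \<noteq> \<zero>" "q i \<in> Units R" "inv (q i) \<in> carrier R" "inv (q i) \<noteq> \<zero>" "inv (inv (q i)) = q i" if "i \<in> {1..n}" for i
    using q[OF that] Units_inv_Units[of "q i"] by (auto simp: field_Units)
  have gc: "\<gamma> i j \<in> carrier R - {\<zero>}" if "i \<in> {1..n}" "j \<in> {1..n}" for i j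
    using \<gamma> that unfolding mult_antisymmetric_def by blast
  have B: "weyl_block R q \<gamma> i j a b \<in> Units R" if "i \<in> {1..n}" "j \<in> {1..n}" for i j a b
    using that qc[OF that(1)] gc[OF that] gc[OF that(2,1)] by (auto simp: weyl_block_def field_Units integral_iff)
  have blk: "(s + 1) div 2 \<in> {1..n}" if "s \<in> {1..2 * n}" for s using that by auto
  have MU: "weyl_matrix R q \<gamma> s t \<in> Units R" if "s \<in> {1..2 * n}" "t \<in> {1..2 * n}" for s t
    unfolding weyl_matrix_def Let_def using B[OF blk[OF that(1)] blk[OF that(2)]] B[OF blk[OF that(2)] blk[OF that(1)]]
    by (simp add: Units_inv_Units)
  have Mi: "weyl_matrix R q \<gamma> t s = inv (weyl_matrix R q \<gamma> s t)" if st: "s \<in> {1..2 * n}" "t \<in> {1..2 * n}" for s t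
  proof -
    consider "(s + 1) div 2 < (t + 1) div 2" | "(t + 1) div 2 < (s + 1) div 2" | "(s + 1) div 2 = (t + 1) div 2" by linarith
    then show ?thesis
    proof cases
      case 1
      then show ?thesis by (simp add: weyl_matrix_def)
    next
      case 2
      then show ?thesis using B[OF blk[OF st(2)] blk[OF st(1)]] by (simp add: weyl_matrix_def)
    next
      case 3
      have blk_inv: "weyl_block R q \<gamma> i i b a = inv (weyl_block R q \<gamma> i i a b)"
        if "i \<in> {1..n}" "a \<in> {1, 2}" "b \<in> {1, 2}" for i a b
        using that(2,3) qc[OF that(1)] by (auto simp: weyl_block_def)
      have m: "(if odd s then 1 else (2 :: nat)) \<in> {1, 2}" "(if odd t then 1 else (2 :: nat)) \<in> {1, 2}" by simp_all
      show ?thesis unfolding weyl_matrix_def Let_def 3 if_P[OF le_refl] by (rule blk_inv[OF blk[OF st(2)] m])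
    qed
  qed
  have "weyl_matrix R q \<gamma> s s = \<one>" for s by (simp add: weyl_matrix_def weyl_block_def)
  then show ?thesis unfolding mult_antisymmetric_def using MU[unfolded field_Units] Mi by blast
qed

locale weyl_torus = K: field K for K :: "('k, 'm) ring_scheme" +
  fixes n :: nat and q :: "nat \<Rightarrow> 'k" and \<gamma> :: "nat \<Rightarrow> nat \<Rightarrow> 'k"
  assumes q: "i \<in> {1..n} \<Longrightarrow> q i \<in> carrier K - {\<zero>\<^bsub>K\<^esub>} \<and> q i \<noteq> \<one>\<^bsub>K\<^esub>"
    and \<gamma>: "mult_antisymmetric K n \<gamma>"
begin

sublocale quantum_torus K "2 * n" "weyl_matrix K q \<gamma>"
  by unfold_locales (rule K.weyl_matrix_antisymmetric[OF _ \<gamma>], use q in blast)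

lemma Z_qc: "\<lbrakk>s \<in> {1..2 * n}; t \<in> {1..2 * n}; weyl_matrix K q \<gamma> s t = k\<rbrakk> \<Longrightarrow> qc k (Z s) (Z t)"
  using Z_commute[of s t] \<Lambda>_closed[of s t] Z_closed by (simp add: qc_def)

text \<open>The two rows of block \<open>i\<close> belong to \<open>y\<^sub>i\<close> and
  \<open>w\<^sub>i\<close>, in this order; the filtration by generators follows the order in which
  the tower adjoins its variables.\<close>

definition Yt where "Yt i = Z (2 * i - 1)"
definition Wt where "Wt i = Z (2 * i)"

sublocale w: weyl_relations K T n q \<gamma> Yt Wt
proof unfold_locales
  fix i assume "i \<in> {1..n}"
  then show "q i \<in> carrier K - {\<zero>\<^bsub>K\<^esub>} \<and> q i \<noteq> \<one>\<^bsub>K\<^esub>" by (rule q)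
  show "Yt i \<in> Units T" "Wt i \<in> Units T" using \<open>i \<in> {1..n}\<close> by (auto simp: Yt_def Wt_def intro!: zmon_Units ee_in)
  show "qc (q i) (Wt i) (Yt i)" using \<open>i \<in> {1..n}\<close>
    unfolding Yt_def Wt_def by (intro Z_qc) (auto simp: weyl_matrix_def weyl_block_def)
next
  show "mult_antisymmetric K n \<gamma>" by (rule \<gamma>)
next
  fix i j assume ij: "1 \<le> j" "j < i" "i \<le> n"
  then have r: "i \<in> {1..n}" "j \<in> {1..n}" by auto
  have div: "(2 * i - 1 + 1) div 2 = i" "(2 * i + 1) div 2 = i" "(2 * j - 1 + 1) div 2 = j" "(2 * j + 1) div 2 = j"
    "odd (2 * i - 1)" "odd (2 * j - 1)" "\<not> i \<le> j" "j \<noteq> i" using ij by auto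
  have g: "\<gamma> i j \<in> Units K" "\<gamma> j i \<in> Units K" "inv\<^bsub>K\<^esub> (\<gamma> i j) = \<gamma> j i" "inv\<^bsub>K\<^esub> (\<gamma> j i) = \<gamma> i j"
  proof -
    have a: "\<gamma> i j \<in> carrier K - {\<zero>\<^bsub>K\<^esub>} \<and> \<gamma> j i = inv\<^bsub>K\<^esub> (\<gamma> i j)" "\<gamma> j i \<in> carrier K - {\<zero>\<^bsub>K\<^esub>} \<and> \<gamma> i j = inv\<^bsub>K\<^esub> (\<gamma> j i)"
      using \<gamma> r unfolding mult_antisymmetric_def by blast+
    show "\<gamma> i j \<in> Units K" "\<gamma> j i \<in> Units K" unfolding K.field_Units by (rule conjunct1[OF a(1)], rule conjunct1[OF a(2)])
    show "inv\<^bsub>K\<^esub> (\<gamma> i j) = \<gamma> j i" using conjunct2[OF a(1)] by (rule sym)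
    show "inv\<^bsub>K\<^esub> (\<gamma> j i) = \<gamma> i j" using conjunct2[OF a(2)] by (rule sym)
  qed
  have qj: "q j \<in> Units K" using q[OF r(2)] by (simp add: K.field_Units)
  have inv: "inv\<^bsub>K\<^esub> (x \<otimes>\<^bsub>K\<^esub> y) = inv\<^bsub>K\<^esub> x \<otimes>\<^bsub>K\<^esub> inv\<^bsub>K\<^esub> y" if "x \<in> Units K" "y \<in> Units K" for x y
  proof (rule K.comm_inv_char)
    have "x \<otimes>\<^bsub>K\<^esub> y \<otimes>\<^bsub>K\<^esub> (inv\<^bsub>K\<^esub> x \<otimes>\<^bsub>K\<^esub> inv\<^bsub>K\<^esub> y) = (x \<otimes>\<^bsub>K\<^esub> inv\<^bsub>K\<^esub> x) \<otimes>\<^bsub>K\<^esub> (y \<otimes>\<^bsub>K\<^esub> inv\<^bsub>K\<^esub> y)"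
      using that by (simp only: K.m_ac K.Units_closed K.Units_inv_closed K.m_closed)
    then show "x \<otimes>\<^bsub>K\<^esub> y \<otimes>\<^bsub>K\<^esub> (inv\<^bsub>K\<^esub> x \<otimes>\<^bsub>K\<^esub> inv\<^bsub>K\<^esub> y) = \<one>\<^bsub>K\<^esub>" using that by simp
  qed (use that in auto)
  have m: "2 * i - 1 \<in> {1..2 * n}" "2 * i \<in> {1..2 * n}" "2 * j - 1 \<in> {1..2 * n}" "2 * j \<in> {1..2 * n}" using ij by auto
  show "qc (\<gamma> i j) (Yt i) (Yt j)"
    unfolding Yt_def Wt_def by (rule Z_qc[OF m(1,3)]) (simp only: weyl_matrix_def weyl_block_def Let_def div, simp add: g)
  show "qc (\<gamma> j i) (Yt i) (Wt j)"
    unfolding Yt_def Wt_def by (rule Z_qc[OF m(1,4)]) (simp only: weyl_matrix_def weyl_block_def Let_def div, simp add: g)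
  show "qc (q j \<otimes>\<^bsub>K\<^esub> \<gamma> j i) (Wt i) (Yt j)"
    unfolding Yt_def Wt_def by (rule Z_qc[OF m(2,3)]) (simp only: weyl_matrix_def weyl_block_def Let_def div, simp add: inv g qj)
  show "qc (inv\<^bsub>K\<^esub> (q j) \<otimes>\<^bsub>K\<^esub> \<gamma> i j) (Wt i) (Wt j)"
    unfolding Yt_def Wt_def by (rule Z_qc[OF m(2,4)]) (simp only: weyl_matrix_def weyl_block_def Let_def div, simp add: inv g qj)
qed

lemma exponents_mono: "m \<le> m' \<Longrightarrow> exponents m \<subseteq> exponents m'"
  by (auto simp: exponents_def)

lemma Tsub_mono: "m \<le> m' \<Longrightarrow> Tsub m \<subseteq> Tsub m'"
  using exponents_mono by (force simp: Tsub_def)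

lemma Z_Tsub: "\<lbrakk>1 \<le> s; s \<le> m; m \<le> 2 * n\<rbrakk> \<Longrightarrow> Z s \<in> Tsub m"
  by (rule Tsub_kmono) (auto simp: exponents_iff lookup_single when_def)

lemma Yt_Tsub: "\<lbrakk>1 \<le> i; 2 * i - 1 \<le> m; m \<le> 2 * n\<rbrakk> \<Longrightarrow> Yt i \<in> Tsub m"
  and Wt_Tsub: "\<lbrakk>1 \<le> i; 2 * i \<le> m; m \<le> 2 * n\<rbrakk> \<Longrightarrow> Wt i \<in> Tsub m"
  unfolding Yt_def Wt_def by (rule Z_Tsub; simp)+

lemma U_Tsub: assumes "i \<le> n" shows "w.U i \<in> Tsub (2 * i)"
proof -
  let ?G = "if i = 0 then {} else {Yt i, Wt i}"
  have "w.U i \<in> sg ?G" by (auto simp: w.U_def intro: sg_one sg_gen sg_mult)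
  moreover have "?G \<subseteq> Tsub (2 * i)" using Yt_Tsub[of i "2 * i"] Wt_Tsub[of i "2 * i"] assms by auto
  ultimately show ?thesis using sg_Tsub[of ?G "2 * i"] assms by auto
qed

text \<open>The inverse of \<open>Yt i\<close> and the previous \<open>U\<close> avoid the generator
  \<open>Wt i\<close>. Hence the latter supplies the leading term of \<open>w.Xg i\<close>.\<close>

lemma V_Tsub: assumes "1 \<le> i" "i \<le> n" shows "w.V i \<in> Tsub (2 * i - 1)"
proof -
  have e: "ee (2 * i - 1) \<in> exponents (2 * n)" using assms by (intro ee_in) auto
  obtain k where k: "k \<in> carrier K" "inv\<^bsub>T\<^esub> (Yt i) = kmono K k (- ee (2 * i - 1))" using inv_zmon[OF e] unfolding Yt_def by blast
  have 1: "inv\<^bsub>T\<^esub> (Yt i) \<in> Tsub (2 * i - 1)"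
    unfolding k(2) using assms by (intro Tsub_kmono k) (auto simp: exponents_iff lookup_single when_def)
  have 2: "w.U (i - 1) \<in> Tsub (2 * i - 1)" by (rule subsetD[OF Tsub_mono U_Tsub]) (use assms in auto)
  let ?G = "{inv\<^bsub>T\<^esub> (Yt i), w.U (i - 1)}"
  have "w.V i \<in> sg ?G" unfolding w.V_def by (intro sg_mult sg_gen) auto
  moreover have "sg ?G \<subseteq> Tsub (2 * i - 1)" using 1 2 assms by (intro sg_Tsub) auto
  ultimately show ?thesis by blast
qed

lemma X_split:
  assumes "1 \<le> i" "i \<le> n"
  obtains k p where "k \<in> carrier K" "k \<noteq> \<zero>\<^bsub>K\<^esub>" "p \<in> Tsub (2 * i - 1)" "w.Xg i = kmono K k (ee (2 * i)) \<oplus>\<^bsub>T\<^esub> p"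
proof -
  define k where "k = inv\<^bsub>K\<^esub> (q i \<ominus>\<^bsub>K\<^esub> \<one>\<^bsub>K\<^esub>)"
  have k: "k \<in> Units K" unfolding k_def by (rule K.Units_inv_Units[OF w.q1[OF assms]])
  define p where "p = (\<ominus>\<^bsub>K\<^esub> k) \<odot>\<^bsub>T\<^esub> w.V i"
  have kc: "k \<in> carrier K" "k \<noteq> \<zero>\<^bsub>K\<^esub>" using k by (auto simp: K.field_Units)
  have "p \<in> sg {w.V i}" unfolding p_def using kc by (intro sg_smult sg_gen) auto
  moreover have "sg {w.V i} \<subseteq> Tsub (2 * i - 1)" using V_Tsub[OF assms] assms by (intro sg_Tsub) auto
  ultimately have p: "p \<in> Tsub (2 * i - 1)" by blast
  have "p = \<ominus>\<^bsub>T\<^esub> (k \<odot>\<^bsub>T\<^esub> w.V i)"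
  proof -
    have "p = ((\<ominus>\<^bsub>K\<^esub> \<one>\<^bsub>K\<^esub>) \<otimes>\<^bsub>K\<^esub> k) \<odot>\<^bsub>T\<^esub> w.V i" using kc by (simp add: p_def K.l_minus)
    then show ?thesis using kc w.V_closed[OF assms] by (simp add: smult_assoc smult_minus_one)
  qed
  then have "w.Xg i = k \<odot>\<^bsub>T\<^esub> Wt i \<oplus>\<^bsub>T\<^esub> p"
    using kc w.V_closed[OF assms] w.W_closed[OF assms] by (simp add: w.Xg_def k_def[symmetric] minus_eq smult_r_distr smult_minus)
  moreover have "k \<odot>\<^bsub>T\<^esub> Wt i = kmono K k (ee (2 * i))" using kc by (simp add: smult_mono Wt_def)
  ultimately show ?thesis using that[OF kc p] by simp
qed

lemma gens_Tsub: "m \<le> n \<Longrightarrow> w.gens m \<subseteq> Tsub (2 * m)"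
proof
  fix z assume m: "m \<le> n" and "z \<in> w.gens m"
  then obtain j where j: "1 \<le> j" "j \<le> m" and z: "z = Yt j \<or> z = w.Xg j" by (auto simp: w.gens_def)
  have "Yt j \<in> Tsub (2 * m)" using j m by (intro Yt_Tsub) auto
  moreover have "w.Xg j \<in> Tsub (2 * m)"
  proof -
    have jn: "j \<le> n" using j m by simp
    obtain k p where kp: "k \<in> carrier K" "k \<noteq> \<zero>\<^bsub>K\<^esub>" "p \<in> Tsub (2 * j - 1)" "w.Xg j = kmono K k (ee (2 * j)) \<oplus>\<^bsub>T\<^esub> p"
      by (rule X_split[OF j(1) jn])
    have "kmono K k (ee (2 * j)) \<in> Tsub (2 * m)"
      using j m kp by (intro Tsub_kmono) (auto simp: exponents_iff lookup_single when_def)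
    moreover have "p \<in> Tsub (2 * m)" by (rule subsetD[OF Tsub_mono kp(3)]) (use j in auto)
    ultimately have "{kmono K k (ee (2 * j)), p} \<subseteq> Tsub (2 * m)" by simp
    from sg_Tsub[OF this] have "sg {kmono K k (ee (2 * j)), p} \<subseteq> Tsub (2 * m)" using m by simp
    then show ?thesis unfolding kp(4) by (rule subsetD) (intro sg_add sg_gen; simp)
  qed
  ultimately show "z \<in> Tsub (2 * m)" using z by auto
qed

sublocale w: weyl_model K T n q \<gamma> Yt Wt
proof unfold_locales
  show "\<one>\<^bsub>T\<^esub> \<noteq> \<zero>\<^bsub>T\<^esub>" by (rule T.one_not_zero')
  fix i assume i: "1 \<le> i" "i \<le> n"
  show "free_over (sg (w.gens (i - 1))) (Yt i)"
  proof (rule free_over_subset)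
    \<comment> \<open>\<open>Yt i\<close> is itself a new generator of the torus, the case of
      \<open>free_over_Tsub\<close> with zero remainder.\<close>
    have z: "\<zero>\<^bsub>T\<^esub> \<in> Tsub (2 * i - 2)" by (simp add: Tsub_def, simp add: T_zero)
    have "free_over (Tsub (2 * i - 2)) (kmono K \<one>\<^bsub>K\<^esub> (ee (Suc (2 * i - 2))) \<oplus>\<^bsub>T\<^esub> \<zero>\<^bsub>T\<^esub>)"
      by (rule free_over_Tsub) (use i z in auto)
    moreover have "Suc (2 * i - 2) = 2 * i - 1" using i by auto
    ultimately show "free_over (Tsub (2 * i - 2)) (Yt i)" using w.Y_closed[OF i] by (simp add: Yt_def)
    show "sg (w.gens (i - 1)) \<subseteq> Tsub (2 * i - 2)"
      using sg_Tsub[of "w.gens (i - 1)" "2 * i - 2"] gens_Tsub[of "i - 1"] i by (simp add: right_diff_distrib')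
  qed
  show "free_over (sg (insert (Yt i) (w.gens (i - 1)))) (w.Xg i)"
  proof (rule free_over_subset)
    obtain k p where kp: "k \<in> carrier K" "k \<noteq> \<zero>\<^bsub>K\<^esub>" "p \<in> Tsub (2 * i - 1)" "w.Xg i = kmono K k (ee (2 * i)) \<oplus>\<^bsub>T\<^esub> p"
      by (rule X_split[OF i])
    have "free_over (Tsub (2 * i - 1)) (kmono K k (ee (Suc (2 * i - 1))) \<oplus>\<^bsub>T\<^esub> p)"
      by (rule free_over_Tsub) (use i kp in auto)
    then show "free_over (Tsub (2 * i - 1)) (w.Xg i)" using kp(4) i by simp
    have "w.gens (i - 1) \<subseteq> Tsub (2 * i - 1)" by (rule subset_trans[OF gens_Tsub Tsub_mono]) (use i in auto)
    moreover have "Yt i \<in> Tsub (2 * i - 1)" using i by (intro Yt_Tsub) auto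
    ultimately show "sg (insert (Yt i) (w.gens (i - 1))) \<subseteq> Tsub (2 * i - 1)" using i by (intro sg_Tsub) auto
  qed
qed

lemma qweyl_localizing: "\<exists>\<psi>. localizing_embedding K (qweyl K n q \<gamma>) T \<psi>"
proof -
  let ?A = "qweyl K n q \<gamma>"
  obtain \<psi> where "generated_map K ?A T \<psi> (w.gens n)" using w.qweyl_embedding by blast
  then interpret g: generated_map K ?A T \<psi> "w.gens n" .
  let ?B = "sg (w.gens n)"
  have YB: "Yt i \<in> ?B" if "1 \<le> i" "i \<le> n" for i using that by (intro sg_gen) (auto simp: w.gens_def)
  have UB: "w.U i \<in> ?B" if "i \<le> n" for i
  proof -
    have "w.gens i \<subseteq> w.gens n" using that by (auto simp: w.gens_def)
    from subalgebra_generated_mono[OF this] show ?thesis by (rule subsetD) (rule w.U_in_sg[OF that])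
  qed
  have dense: "\<exists>b\<in>exponents (2 * n). zmon b \<in> ?B \<and> t \<otimes>\<^bsub>T\<^esub> zmon b \<in> ?B" if t: "t \<in> carrier T" for t
  proof (rule dense_subalgebra[OF _ _ _ _ _ t])
    fix s assume s: "s \<in> {1..2 * n}"
    show "\<exists>b\<in>exponents (2 * n). zmon b \<in> ?B \<and> zmon (ee s + b) \<in> ?B"
    proof (cases "odd s")
      case True
      then obtain j where "s = 2 * j + 1" by (elim oddE)
      then have "Z s \<in> ?B" using YB[of "Suc j"] s by (simp add: Yt_def)
      then show ?thesis using H_zero sg_one[of T K "w.gens n"] by (intro bexI[of _ 0]) (simp_all add: T_one)
    next
      case False
      then obtain j where j: "s = 2 * j" by (auto elim: evenE)
      then have j1: "1 \<le> j" "j \<le> n" using s by auto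
      have e: "ee (2 * j - 1) \<in> exponents (2 * n)" "ee (2 * j) \<in> exponents (2 * n)" using j1 by (auto intro!: ee_in)
      \<comment> \<open>For \<open>Wt j\<close> the denominator is \<open>Yt j\<close>: both
        \<open>Yt j\<close> and the monomial \<open>w.U j\<close>, the product of
        \<open>Yt j\<close> and \<open>Wt j\<close>, are in the image.\<close>
      have "zmon (ee (2 * j - 1) + ee (2 * j)) = inv\<^bsub>K\<^esub> (cc (ee (2 * j - 1)) (ee (2 * j))) \<odot>\<^bsub>T\<^esub> w.U j"
        using j1 zmon_add[OF e] by (simp add: w.U_def Yt_def Wt_def)
      also have "\<dots> \<in> ?B" by (intro sg_smult UB j1) (simp add: K.field_Units)
      finally show ?thesis using e YB[OF j1] j by (intro bexI[of _ "ee (2 * j - 1)"]) (simp_all add: add.commute Yt_def)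
    qed
  qed (auto intro: sg_one sg_add sg_mult sg_smult)
  have "localizing_embedding K ?A T \<psi>"
  proof (intro localizing_embedding.intro localizing_embedding_axioms.intro g.R.nc_algebra_axioms
      T.right_ore_domain_axioms g.hom g.inj)
    fix t assume "t \<in> carrier T"
    then obtain b where b: "zmon b \<in> ?B" "t \<otimes>\<^bsub>T\<^esub> zmon b \<in> ?B" using dense by blast
    obtain s where s: "s \<in> carrier ?A" "\<psi> s = zmon b" by (rule g.preimage[OF b(1)])
    have "s \<noteq> \<zero>\<^bsub>?A\<^esub>" using s zmon_nonzero[of b] by (auto simp: g.\<psi>_simps(6))
    then show "\<exists>s\<in>carrier ?A. s \<noteq> \<zero>\<^bsub>?A\<^esub> \<and> t \<otimes>\<^bsub>T\<^esub> \<psi> s \<in> \<psi> ` carrier ?A"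
      using s b(2) unfolding g.image by (intro bexI[of _ s]) simp_all
  qed
  then show ?thesis by blast
qed

theorem fractions_isomorphic:
  "alg_isomorphic K (ring_of_fractions (qweyl K n q \<gamma>))
    (ring_of_fractions (qaffine K (2 * n) (weyl_matrix K q \<gamma>)))"
proof -
  obtain \<psi> where "localizing_embedding K (qweyl K n q \<gamma>) T \<psi>" using qweyl_localizing by blast
  then interpret A: localizing_embedding K "qweyl K n q \<gamma>" T \<psi> .
  interpret B: localizing_embedding K "qaffine K (2 * n) (weyl_matrix K q \<gamma>)" T qaffine_to_torus
    by (rule qaffine_localizing)
  have "inv_into (carrier B.R.Q) B.frac_map \<in> alg_iso K T.Q B.R.Q"
    by (rule alg_iso_inv[OF B.frac_map_iso B.R.nc_algebra_Q])
  from alg_iso_compose[OF A.frac_map_iso this] show ?thesis unfolding alg_isomorphic_def by blast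
qed

end

section \<open>Division rings of finite dimension over the centre\<close>

lemma (in ring) center_subring: "subring (ring_center R) R"
proof (rule subringI)
  fix x y assume xy: "x \<in> ring_center R" "y \<in> ring_center R"
  then have c: "x \<in> carrier R" "y \<in> carrier R" and
    e: "\<And>a. a \<in> carrier R \<Longrightarrow> x \<otimes> a = a \<otimes> x" "\<And>a. a \<in> carrier R \<Longrightarrow> y \<otimes> a = a \<otimes> y"
    by (auto simp: ring_center_def)
  show "x \<oplus> y \<in> ring_center R" unfolding ring_center_def using c e by (auto simp: l_distr r_distr)
  show "\<ominus> x \<in> ring_center R" unfolding ring_center_def using c(1) e(1) by (auto simp: l_minus r_minus)
  have "x \<otimes> y \<otimes> a = a \<otimes> (x \<otimes> y)" if a: "a \<in> carrier R" for a
  proof -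
    have "x \<otimes> y \<otimes> a = x \<otimes> a \<otimes> y" using c a e(2)[OF a] by (simp add: m_assoc)
    also have "\<dots> = a \<otimes> (x \<otimes> y)" using c a by (simp add: e(1)[OF a] m_assoc)
    finally show ?thesis .
  qed
  then show "x \<otimes> y \<in> ring_center R" unfolding ring_center_def using c by simp
qed (auto simp: ring_center_def)

section \<open>Linear algebra over the centre of a division ring\<close>

context division_ring
begin

abbreviation C where "C \<equiv> ring_center R"

lemma C_closed: "z \<in> C \<Longrightarrow> z \<in> carrier R"
  and C_comm: "\<lbrakk>z \<in> C; a \<in> carrier R\<rbrakk> \<Longrightarrow> z \<otimes> a = a \<otimes> z"
  by (simp_all add: ring_center_def)

lemma center_subfield: "subfield C R"
proof (rule subfieldI)
  show "subcring C R" by (rule subcringI[OF center_subring]) (rule C_comm[OF _ C_closed])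
  show "Units (R\<lparr>carrier := C\<rparr>) = C - {\<zero>}"
  proof (intro equalityI subsetI)
    fix x assume "x \<in> Units (R\<lparr>carrier := C\<rparr>)"
    then obtain y where xy: "x \<in> C" "y \<in> C" "x \<otimes> y = \<one>" by (auto simp: Units_def)
    then have "x \<noteq> \<zero>" using one_neq_zero C_closed[of y] by auto
    then show "x \<in> C - {\<zero>}" using xy by simp
  next
    fix x assume x: "x \<in> C - {\<zero>}"
    then have xc: "x \<in> carrier R" using C_closed by blast
    have u: "x \<in> Units R" by (rule nonzero_unit[OF xc]) (use x in simp)
    have "inv x \<otimes> a = a \<otimes> inv x" if a: "a \<in> carrier R" for a
    proof -
      have e: "a \<otimes> x = x \<otimes> a" using C_comm[of x a] x a by simp
      have "inv x \<otimes> a = inv x \<otimes> (a \<otimes> x) \<otimes> inv x" using u a xc by (simp add: m_assoc)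
      also have "\<dots> = inv x \<otimes> x \<otimes> (a \<otimes> inv x)" unfolding e using u a xc by (simp only: m_assoc Units_inv_closed m_closed)
      finally show ?thesis using u a by simp
    qed
    then have "inv x \<in> C" using u by (simp add: ring_center_def)
    then show "x \<in> Units (R\<lparr>carrier := C\<rparr>)"
      using Units_l_inv[OF u] Units_r_inv[OF u] x unfolding Units_def[of "R\<lparr>carrier := C\<rparr>"] by auto
  qed
qed

lemma no_zero_div: "\<lbrakk>a \<otimes> b = \<zero>; a \<in> carrier R; b \<in> carrier R; a \<noteq> \<zero>\<rbrakk> \<Longrightarrow> b = \<zero>"
  by (metis Units_l_cancel nonzero_unit r_null zero_closed)

lemma mult_right_cancel: "\<lbrakk>a \<otimes> b = a' \<otimes> b; a \<in> carrier R; a' \<in> carrier R; b \<in> carrier R; b \<noteq> \<zero>\<rbrakk> \<Longrightarrow> a = a'"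
proof -
  assume a: "a \<otimes> b = a' \<otimes> b" "a \<in> carrier R" "a' \<in> carrier R" "b \<in> carrier R" "b \<noteq> \<zero>"
  have u: "b \<in> Units R" using a nonzero_unit by blast
  have "a \<otimes> b \<otimes> inv b = a' \<otimes> b \<otimes> inv b" using a by simp
  then have "a \<otimes> (b \<otimes> inv b) = a' \<otimes> (b \<otimes> inv b)" using a(2-4) u by (simp only: m_assoc Units_inv_closed)
  then show "a = a'" using a(2,3) u by simp
qed

text \<open>Central coefficients let \<open>y\<close> pass, so moving it through a combination of
  eigenvectors only multiplies each coefficient by the eigenvalue of its vector.\<close>

lemma combine_commute:
  assumes "length Ks = length Us" "set Ks \<subseteq> C" "set Us \<subseteq> carrier R" "y \<in> carrier R"
    and "\<And>w. w \<in> set Us \<Longrightarrow> \<chi> w \<in> C \<and> y \<otimes> w = \<chi> w \<otimes> (w \<otimes> y)"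
  shows "y \<otimes> combine Ks Us = combine (map2 (\<lambda>k w. k \<otimes> \<chi> w) Ks Us) Us \<otimes> y"
  using assms(1-3,5)
proof (induction Ks Us rule: list_induct2)
  case Nil
  then show ?case using assms(4) by simp
next
  case (Cons k Ks u Us)
  have c: "k \<in> carrier R" "u \<in> carrier R" "\<chi> u \<in> carrier R" "set Ks \<subseteq> carrier R" "set Us \<subseteq> carrier R"
    using Cons.prems C_closed by auto
  have "set (map2 (\<lambda>k w. k \<otimes> \<chi> w) Ks Us) \<subseteq> carrier R"
  proof
    fix x assume "x \<in> set (map2 (\<lambda>k w. k \<otimes> \<chi> w) Ks Us)"
    then obtain l w where lw: "x = l \<otimes> \<chi> w" "(l, w) \<in> set (zip Ks Us)" by auto
    have "l \<in> carrier R" "\<chi> w \<in> carrier R"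
      using set_zip_leftD[OF lw(2)] set_zip_rightD[OF lw(2)] c Cons.prems C_closed by auto
    then show "x \<in> carrier R" using lw by simp
  qed
  then have cl: "combine (map2 (\<lambda>k w. k \<otimes> \<chi> w) Ks Us) Us \<in> carrier R" "combine Ks Us \<in> carrier R"
    using c by (auto intro: combine_in_carrier)
  have "y \<otimes> (k \<otimes> u) = k \<otimes> (y \<otimes> u)"
  proof -
    have "y \<otimes> k = k \<otimes> y" using C_comm[of k y] Cons.prems(1) assms(4) by simp
    then show ?thesis using assms(4) c by (simp add: m_assoc[symmetric])
  qed
  also have "y \<otimes> u = \<chi> u \<otimes> (u \<otimes> y)" using Cons.prems(3)[of u] by simp
  finally have "y \<otimes> (k \<otimes> u) = k \<otimes> \<chi> u \<otimes> u \<otimes> y" using c assms(4) by (simp add: m_assoc)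
  moreover have "y \<otimes> combine Ks Us = combine (map2 (\<lambda>k w. k \<otimes> \<chi> w) Ks Us) Us \<otimes> y"
    using Cons.IH Cons.prems by simp
  ultimately show ?case using c cl assms(4) by (simp add: r_distr l_distr)
qed

text \<open>Conjugation by a \<open>y\<close> whose eigenvalues tell \<open>u\<close> and \<open>v\<close> apart turns a relation that expresses \<open>u\<close>
  into one with a different coefficient at \<open>v\<close>.\<close>

lemma eigenvectors_independent:
  assumes "set Us \<subseteq> carrier R - {\<zero>}" "distinct Us"
    and "\<And>u v. \<lbrakk>u \<in> set Us; v \<in> set Us; u \<noteq> v\<rbrakk> \<Longrightarrow> \<exists>y \<chi>. y \<in> carrier R \<and> y \<noteq> \<zero> \<and>
      (\<forall>w\<in>set Us. \<chi> w \<in> C \<and> y \<otimes> w = \<chi> w \<otimes> (w \<otimes> y)) \<and> \<chi> u \<noteq> \<chi> v"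
  shows "independent C Us"
  using assms
proof (induction Us)
  case (Cons u Us)
  have ind: "independent C Us"
  proof (rule Cons.IH)
    fix v w assume "v \<in> set Us" "w \<in> set Us" "v \<noteq> w"
    then show "\<exists>y \<chi>. y \<in> carrier R \<and> y \<noteq> \<zero> \<and> (\<forall>w\<in>set Us. \<chi> w \<in> C \<and> y \<otimes> w = \<chi> w \<otimes> (w \<otimes> y)) \<and> \<chi> v \<noteq> \<chi> w"
      using Cons.prems(3)[of v w] by (metis list.set_intros(2))
  qed (use Cons.prems in auto)
  have Us: "set Us \<subseteq> carrier R" and u: "u \<in> carrier R" "u \<noteq> \<zero>" using Cons.prems by auto
  have "u \<notin> Span C Us"
  proof
    assume uS: "u \<in> Span C Us"
    then obtain Ks where Ks: "set Ks \<subseteq> C" "length Ks = length Us" "u = combine Ks Us"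
      using Span_mem_iff_length_version[OF center_subfield Us] by auto
    have "Ks ! i = \<zero>" if i: "i < length Us" for i
    proof (rule ccontr)
      assume k: "Ks ! i \<noteq> \<zero>"
      define v where "v = Us ! i"
      have v: "v \<in> set Us" "u \<noteq> v" using i Cons.prems(2) by (auto simp: v_def)
      then obtain y \<chi> where y: "y \<in> carrier R" "y \<noteq> \<zero>" "\<And>w. w \<in> set (u # Us) \<Longrightarrow> \<chi> w \<in> C \<and> y \<otimes> w = \<chi> w \<otimes> (w \<otimes> y)" "\<chi> u \<noteq> \<chi> v"
        using Cons.prems(3)[of u v] by auto
      let ?Ks' = "map2 (\<lambda>k w. k \<otimes> \<chi> w) Ks Us" and ?Ks'' = "map ((\<otimes>) (\<chi> u)) Ks"
      have \<chi>: "\<chi> w \<in> C" "\<chi> w \<in> carrier R" if "w \<in> set (u # Us)" for w using y(3)[OF that] C_closed by auto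
      have Kc: "set Ks \<subseteq> carrier R" using Ks C_closed by auto
      have sub: "set ?Ks' \<subseteq> C" "set ?Ks'' \<subseteq> C"
      proof -
        show "set ?Ks'' \<subseteq> C" using Ks(1) \<chi>(1) subringE(6)[OF center_subring] by auto
        have "a \<otimes> \<chi> w \<in> C" if "(a, w) \<in> set (zip Ks Us)" for a w
          using set_zip_leftD[OF that] set_zip_rightD[OF that] Ks(1) \<chi>(1)[of w] subringE(6)[OF center_subring] by auto
        then show "set ?Ks' \<subseteq> C" by auto
      qed
      then have subc: "set ?Ks' \<subseteq> carrier R" using C_closed by blast
      \<comment> \<open>The eigenvector equation for \<open>u\<close> is compared with the one
        obtained by expanding \<open>u\<close> in \<open>Us\<close>.\<close>
      have "combine ?Ks' Us \<otimes> y = y \<otimes> u" unfolding Ks(3)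
        by (rule combine_commute[symmetric]) (use Ks Us y in auto)
      also have "\<dots> = \<chi> u \<otimes> u \<otimes> y" using y(1) y(3)[of u] u \<chi>(2)[of u] by (simp add: m_assoc)
      finally have "combine ?Ks' Us = \<chi> u \<otimes> u"
        by (rule mult_right_cancel) (use y u \<chi>(2)[of u] subc Us in \<open>auto intro: combine_in_carrier\<close>)
      also have "\<dots> = \<chi> u \<otimes> combine Ks Us" by (rule arg_cong[OF Ks(3)])
      also have "\<dots> = combine ?Ks'' Us"
        by (rule combine_r_distr[OF Kc Us]) (use \<chi>(2)[of u] in simp)
      finally have e: "combine ?Ks' Us = combine ?Ks'' Us" .
      have "combine ?Ks' Us \<in> Span C Us"
        using Span_mem_iff_length_version[OF center_subfield Us] sub(1) Ks(2)
        by (metis (no_types, lifting) length_map length_zip min.idem)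
      \<comment> \<open>Independence of \<open>Us\<close> equates coefficients: at \<open>v\<close>
        this says that the eigenvalues of \<open>u\<close> and \<open>v\<close> agree after
        multiplication by a nonzero coefficient, against the choice of \<open>y\<close>.\<close>
      from unique_decomposition[OF center_subfield ind this] have "?Ks' = ?Ks''"
        using sub e Ks(2) by (metis (no_types, lifting) length_map length_zip min.idem)
      then have "?Ks' ! i = ?Ks'' ! i" by simp
      then have "Ks ! i \<otimes> \<chi> v = \<chi> u \<otimes> Ks ! i" using i Ks(2) by (simp add: v_def)
      moreover have Ki: "Ks ! i \<in> C" using i Ks by (metis nth_mem subsetD)
      ultimately have "\<chi> v \<otimes> Ks ! i = \<chi> u \<otimes> Ks ! i" using C_comm[OF Ki] \<chi>(2)[of v] v by simp
      from mult_right_cancel[OF this _ _ C_closed[OF Ki] k] y(4) \<chi>(2) v show False by auto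
    qed
    then have "Ks = replicate (length Us) \<zero>" using Ks(2) by (intro nth_equalityI) auto
    then show False using Ks(3) u(2) combine_replicate[OF Us] by simp
  qed
  then show ?case using ind u(1) by (intro li_Cons)
qed auto

lemma combine_mult_left:
  "\<lbrakk>set Ks \<subseteq> C; set Us \<subseteq> carrier R; s \<in> carrier R\<rbrakk> \<Longrightarrow> combine Ks (map ((\<otimes>) s) Us) = s \<otimes> combine Ks Us"
proof (induction Ks Us rule: combine.induct)
  case (1 k Ks u Us)
  have c: "k \<in> carrier R" "u \<in> carrier R" "combine Ks Us \<in> carrier R"
    using 1 C_closed by (auto intro!: combine_in_carrier)
  have "k \<otimes> (s \<otimes> u) = s \<otimes> (k \<otimes> u)" using C_comm[of k s] 1 c by (simp add: m_assoc[symmetric])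
  then show ?case using 1 c by (simp add: r_distr)
qed auto

context
  fixes Us assumes Us: "independent C Us"
begin

lemma span_carrier: "set Us \<subseteq> carrier R"
  by (rule independent_in_carrier[OF Us])

text \<open>Left multiplication by \<open>s\<close> is an injective endomorphism of a finite
  dimensional space over the centre, hence surjective; the preimage of one is the inverse.\<close>

lemma span_inverse:
  assumes s: "s \<in> Span C Us" "s \<noteq> \<zero>" and one: "\<one> \<in> Span C Us"
    and closed: "\<And>u. u \<in> set Us \<Longrightarrow> s \<otimes> u \<in> Span C Us"
  shows "inv s \<in> Span C Us"
proof -
  have sc: "s \<in> carrier R" using s(1) Span_in_carrier[OF _ span_carrier] C_closed by blast
  let ?Vs = "map ((\<otimes>) s) Us"
  have V: "set ?Vs \<subseteq> Span C Us" "set ?Vs \<subseteq> carrier R" using closed sc span_carrier by auto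
  have ind: "independent C ?Vs"
  proof (rule trivial_combine_imp_independent[OF center_subfield V(2)])
    fix Ks assume Ks: "set Ks \<subseteq> C" "combine Ks ?Vs = \<zero>"
    have "combine Ks Us \<in> carrier R" using Ks span_carrier C_closed by (intro combine_in_carrier) auto
    then have "combine Ks Us = \<zero>" using no_zero_div[of s] combine_mult_left[OF Ks(1) span_carrier sc] Ks(2) s(2) sc by simp
    then show "set (take (length ?Vs) Ks) \<subseteq> {\<zero>}"
      using independent_imp_trivial_combine[OF center_subfield Us Ks(1)] by simp
  qed
  have "Span C ?Vs = Span C Us"
    using independent_length_eq_dimension[OF center_subfield dimension_independent[OF Us] ind V(1)] by simp
  then obtain Ks where Ks: "set Ks \<subseteq> C" "\<one> = combine Ks ?Vs" and l: "length Ks = length Us"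
    using one Span_mem_iff_length_version[OF center_subfield V(2), of \<one>] by auto
  have c: "combine Ks Us \<in> carrier R" using Ks span_carrier C_closed by (intro combine_in_carrier) auto
  have e: "s \<otimes> combine Ks Us = \<one>" using Ks(2) combine_mult_left[OF Ks(1) span_carrier sc] by simp
  have u: "s \<in> Units R" by (rule nonzero_unit[OF sc s(2)])
  have "inv s \<otimes> (s \<otimes> combine Ks Us) = combine Ks Us" using u sc c by (simp add: m_assoc[symmetric])
  then have "inv s = combine Ks Us" using e u by simp
  then show ?thesis using Span_mem_iff_length_version[OF center_subfield span_carrier] Ks l by blast
qed

lemma span_mult:
  assumes closed: "\<And>u v. \<lbrakk>u \<in> set Us; v \<in> set Us\<rbrakk> \<Longrightarrow> u \<otimes> v \<in> Span C Us"
    and xy: "x \<in> Span C Us" "y \<in> Span C Us"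
  shows "x \<otimes> y \<in> Span C Us"
proof -
  note S = Span_subgroup_props[OF center_subfield span_carrier] Span_smult_closed[OF center_subfield span_carrier]
  have Sc: "a \<in> carrier R" if "a \<in> Span C Us" for a using S(1) that by blast
  have left: "combine Ks Vs \<otimes> w \<in> Span C Us"
    if "set Ks \<subseteq> C" "set Vs \<subseteq> carrier R" "w \<in> carrier R" "\<And>v. v \<in> set Vs \<Longrightarrow> v \<otimes> w \<in> Span C Us" for Ks Vs w
    using that
  proof (induction Ks Vs rule: combine.induct)
    case (1 k Ks u Vs)
    have c: "k \<in> carrier R" "u \<in> carrier R" "combine Ks Vs \<in> carrier R"
      using 1 C_closed by (auto intro!: combine_in_carrier)
    have "k \<otimes> (u \<otimes> w) \<in> Span C Us" using 1 S by simp
    then show ?case using 1 c S by (simp add: l_distr m_assoc)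
  qed (use S in auto)
  have uy: "u \<otimes> y \<in> Span C Us" if u: "u \<in> set Us" for u
  proof -
    obtain Ks where Ks: "set Ks \<subseteq> C" "y = combine Ks Us"
      using xy(2) Span_mem_iff_length_version[OF center_subfield span_carrier] by auto
    have uc: "u \<in> carrier R" using u span_carrier by blast
    have "combine Ks (map ((\<otimes>) u) Us) \<otimes> \<one> \<in> Span C Us"
      by (rule left[OF Ks(1)]) (use uc span_carrier closed[OF u] Sc in auto)
    moreover have "combine Ks (map ((\<otimes>) u) Us) \<in> carrier R"
      using Ks(1) uc span_carrier C_closed by (intro combine_in_carrier) auto
    ultimately show ?thesis using combine_mult_left[OF Ks(1) span_carrier uc] Ks(2) by simp
  qed
  obtain Ks where Ks: "set Ks \<subseteq> C" "x = combine Ks Us"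
    using xy(1) Span_mem_iff_length_version[OF center_subfield span_carrier] by auto
  show ?thesis unfolding Ks(2) by (rule left[OF Ks(1) span_carrier Sc[OF xy(2)] uy])
qed

end

end

subsection \<open>The standard identity\<close>

context ring
begin

lemma eval_word_closed: "\<rho> \<in> UNIV \<rightarrow> carrier R \<Longrightarrow> eval_word R \<rho> w \<in> carrier R"
  unfolding eval_word_def by (induction w) auto

lemma eval_word_append:
  "\<rho> \<in> UNIV \<rightarrow> carrier R \<Longrightarrow> eval_word R \<rho> (v @ w) = eval_word R \<rho> v \<otimes> eval_word R \<rho> w"
proof (induction v)
  case Nil
  then show ?case using eval_word_closed[of \<rho> w] by (simp add: eval_word_def)
next
  case (Cons i v)
  then show ?case using eval_word_closed[of \<rho> v] eval_word_closed[of \<rho> w]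
    by (simp add: eval_word_def m_assoc Pi_iff)
qed

lemma eval_word_cong: "(\<And>i. i \<in> set w \<Longrightarrow> \<rho> i = \<rho>' i) \<Longrightarrow> eval_word R \<rho> w = eval_word R \<rho>' w"
  unfolding eval_word_def by (induction w) auto

lemma eval_word_map: "eval_word R \<rho> (map p w) = eval_word R (\<rho> \<circ> p) w"
  unfolding eval_word_def by (induction w) auto

text \<open>A variable occurring once enters the value of a word linearly between two fixed factors.
  This gives additivity and central homogeneity of the standard polynomial in each argument.\<close>

lemma eval_word_slot:
  assumes "\<rho> \<in> UNIV \<rightarrow> carrier R" "distinct w" "i \<in> set w"
  obtains u v where "u \<in> carrier R" "v \<in> carrier R"
    "\<And>x. x \<in> carrier R \<Longrightarrow> eval_word R (\<rho>(i := x)) w = u \<otimes> x \<otimes> v"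
proof -
  obtain w1 w2 where w: "w = w1 @ i # w2" using split_list[OF assms(3)] by blast
  have "eval_word R (\<rho>(i := x)) w = eval_word R \<rho> w1 \<otimes> x \<otimes> eval_word R \<rho> w2" if x: "x \<in> carrier R" for x
  proof -
    have r: "\<rho>(i := x) \<in> UNIV \<rightarrow> carrier R" using assms(1) x by (auto simp: Pi_iff)
    have "eval_word R (\<rho>(i := x)) w = eval_word R (\<rho>(i := x)) w1 \<otimes> eval_word R (\<rho>(i := x)) (i # w2)"
      unfolding w by (rule eval_word_append[OF r])
    also have "eval_word R (\<rho>(i := x)) w1 = eval_word R \<rho> w1" by (rule eval_word_cong) (use assms(2) w in auto)
    also have "eval_word R (\<rho>(i := x)) (i # w2) = x \<otimes> eval_word R (\<rho>(i := x)) w2" by (simp add: eval_word_def)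
    also have "eval_word R (\<rho>(i := x)) w2 = eval_word R \<rho> w2" by (rule eval_word_cong) (use assms(2) w in auto)
    finally show ?thesis using x eval_word_closed[OF assms(1)] by (simp add: m_assoc del: fun_upd_apply)
  qed
  from that[OF eval_word_closed[OF assms(1)] eval_word_closed[OF assms(1)] this] show ?thesis .
qed

definition standard_polynomial :: "nat \<Rightarrow> (nat \<Rightarrow> 'a) \<Rightarrow> 'a"
  where "standard_polynomial m \<rho> =
    (\<Oplus>p\<in>{p. p permutes {..<m}}. [sign p] \<cdot> eval_word R (\<rho> \<circ> p) [0..<m])"

lemma standard_term_closed: "\<rho> \<in> UNIV \<rightarrow> carrier R \<Longrightarrow> [sign p] \<cdot> eval_word R (\<rho> \<circ> p) w \<in> carrier R"
  by (intro add.int_pow_closed eval_word_closed) (auto simp: Pi_iff)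

lemma standard_polynomial_closed: "\<rho> \<in> UNIV \<rightarrow> carrier R \<Longrightarrow> standard_polynomial m \<rho> \<in> carrier R"
  unfolding standard_polynomial_def by (intro finsum_closed Pi_I[of "{p. p permutes {..<m}}"] standard_term_closed)

lemma standard_term_slot:
  assumes "\<rho> \<in> UNIV \<rightarrow> carrier R" "k < m" "p permutes {..<m}"
  shows "\<exists>u\<in>carrier R. \<exists>v\<in>carrier R. \<forall>x\<in>carrier R.
    [sign p] \<cdot> eval_word R (\<rho>(k := x) \<circ> p) [0..<m] = u \<otimes> x \<otimes> v"
proof -
  define i where "i = inv_into UNIV p k"
  have i: "p i = k" unfolding i_def by (rule permutes_inverses(1)[OF assms(3)])
  have im: "i \<in> set [0..<m]" using i assms(2) permutes_in_image[OF assms(3), of i] by simp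
  have up: "\<rho>(k := x) \<circ> p = (\<rho> \<circ> p)(i := x)" for x
    using i permutes_inj[OF assms(3)] by (auto simp: fun_eq_iff inj_eq)
  obtain u v where uv: "u \<in> carrier R" "v \<in> carrier R"
    "\<And>x. x \<in> carrier R \<Longrightarrow> eval_word R ((\<rho> \<circ> p)(i := x)) [0..<m] = u \<otimes> x \<otimes> v"
    by (rule eval_word_slot[OF _ distinct_upt im, of "\<rho> \<circ> p"]) (use assms(1) in auto)
  have "[sign p] \<cdot> eval_word R (\<rho>(k := x) \<circ> p) [0..<m] = ([sign p] \<cdot> u) \<otimes> x \<otimes> v" if "x \<in> carrier R" for x
    unfolding up using uv that by (simp add: add_pow_ldistr_int)
  then show ?thesis using uv by (intro bexI[of _ "[sign p] \<cdot> u"] bexI[of _ v]) simp_all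
qed

lemma standard_polynomial_add:
  assumes r: "\<rho> \<in> UNIV \<rightarrow> carrier R" and k: "k < m" and xy: "x \<in> carrier R" "y \<in> carrier R"
  shows "standard_polynomial m (\<rho>(k := x \<oplus> y)) = standard_polynomial m (\<rho>(k := x)) \<oplus> standard_polynomial m (\<rho>(k := y))"
proof -
  have rx: "\<rho>(k := x) \<in> UNIV \<rightarrow> carrier R" if "x \<in> carrier R" for x using r that by (auto simp: Pi_iff)
  have "[sign p] \<cdot> eval_word R (\<rho>(k := x \<oplus> y) \<circ> p) [0..<m] =
    [sign p] \<cdot> eval_word R (\<rho>(k := x) \<circ> p) [0..<m] \<oplus> [sign p] \<cdot> eval_word R (\<rho>(k := y) \<circ> p) [0..<m]"
    if p: "p permutes {..<m}" for p
  proof -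
    obtain u v where uv: "u \<in> carrier R" "v \<in> carrier R"
      "\<And>x. x \<in> carrier R \<Longrightarrow> [sign p] \<cdot> eval_word R (\<rho>(k := x) \<circ> p) [0..<m] = u \<otimes> x \<otimes> v"
      using standard_term_slot[OF r k p] by blast
    show ?thesis using uv(1,2) xy by (simp add: uv(3) l_distr r_distr)
  qed
  then have "standard_polynomial m (\<rho>(k := x \<oplus> y)) = (\<Oplus>p\<in>{p. p permutes {..<m}}.
    [sign p] \<cdot> eval_word R (\<rho>(k := x) \<circ> p) [0..<m] \<oplus> [sign p] \<cdot> eval_word R (\<rho>(k := y) \<circ> p) [0..<m])"
    unfolding standard_polynomial_def
    by (intro finsum_cong') (auto intro!: a_closed standard_term_closed rx xy)
  also have "\<dots> = standard_polynomial m (\<rho>(k := x)) \<oplus> standard_polynomial m (\<rho>(k := y))"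
    unfolding standard_polynomial_def by (intro finsum_addf Pi_I standard_term_closed rx xy)
  finally show ?thesis .
qed

lemma standard_polynomial_mult:
  assumes r: "\<rho> \<in> UNIV \<rightarrow> carrier R" and k: "k < m" and z: "z \<in> ring_center R" and x: "x \<in> carrier R"
  shows "standard_polynomial m (\<rho>(k := z \<otimes> x)) = z \<otimes> standard_polynomial m (\<rho>(k := x))"
proof -
  have zc: "z \<in> carrier R" using z by (simp add: ring_center_def)
  have rx: "\<rho>(k := x) \<in> UNIV \<rightarrow> carrier R" using r x by (auto simp: Pi_iff)
  have "[sign p] \<cdot> eval_word R (\<rho>(k := z \<otimes> x) \<circ> p) [0..<m] = z \<otimes> [sign p] \<cdot> eval_word R (\<rho>(k := x) \<circ> p) [0..<m]"
    if p: "p permutes {..<m}" for p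
  proof -
    obtain u v where uv: "u \<in> carrier R" "v \<in> carrier R"
      "\<And>x. x \<in> carrier R \<Longrightarrow> [sign p] \<cdot> eval_word R (\<rho>(k := x) \<circ> p) [0..<m] = u \<otimes> x \<otimes> v"
      using standard_term_slot[OF r k p] by blast
    have "u \<otimes> (z \<otimes> x) = z \<otimes> (u \<otimes> x)"
    proof -
      have "z \<otimes> u = u \<otimes> z" using z uv(1) by (simp add: ring_center_def)
      then show ?thesis using zc uv(1) x by (simp add: m_assoc[symmetric])
    qed
    then show ?thesis using uv(1,2) x zc by (simp add: uv(3) m_assoc)
  qed
  then have "standard_polynomial m (\<rho>(k := z \<otimes> x)) =
    (\<Oplus>p\<in>{p. p permutes {..<m}}. z \<otimes> [sign p] \<cdot> eval_word R (\<rho>(k := x) \<circ> p) [0..<m])"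
    unfolding standard_polynomial_def by (intro finsum_cong') (auto intro!: m_closed standard_term_closed rx zc)
  also have "\<dots> = z \<otimes> standard_polynomial m (\<rho>(k := x))"
    unfolding standard_polynomial_def
    by (rule finsum_rdistr[symmetric]) (auto simp: finite_permutations zc intro!: standard_term_closed rx)
  finally show ?thesis .
qed

text \<open>Composition with the transposition of \<open>k\<close> and \<open>l\<close> pairs even
  with odd permutations whose words have equal values and opposite signs. Cancellation in pairs is
  valid in every characteristic, including two.\<close>

lemma standard_polynomial_alternating:
  assumes r: "\<rho> \<in> UNIV \<rightarrow> carrier R" and kl: "k < m" "l < m" "k \<noteq> l" "\<rho> k = \<rho> l"
  shows "standard_polynomial m \<rho> = \<zero>"
proof -
  define t where "t = transpose k l"
  define g where "g p = [sign p] \<cdot> eval_word R (\<rho> \<circ> p) [0..<m]" for p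
  let ?P = "{p. p permutes {..<m}}" and ?E = "{p. p permutes {..<m} \<and> evenperm p}"
    and ?O = "{p. p permutes {..<m} \<and> \<not> evenperm p}"
  have t: "t permutes {..<m}" "permutation t" "\<not> evenperm t" "t \<circ> t = id"
    using kl by (auto simp: t_def permutes_swap_id permutation_swap_id evenperm_swap)
  have perm: "permutation p" if "p permutes {..<m}" for p
    using that by (intro permutes_imp_permutation) auto
  have gc: "g p \<in> carrier R" for p unfolding g_def by (rule standard_term_closed[OF r])
  have tt: "t \<circ> (t \<circ> p) = p" for p using t(4) by (simp add: o_assoc)
  have img: "?O = (\<circ>) t ` ?E"
  proof (intro equalityI subsetI)
    fix p assume p: "p \<in> ?O"
    then have "t \<circ> p \<in> ?E" using t(1) permutes_compose[of p "{..<m}" t] evenperm_comp[OF t(2) perm[of p]] t(3) by simp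
    then show "p \<in> (\<circ>) t ` ?E" using tt[of p] by (intro image_eqI[of _ _ "t \<circ> p"]) simp_all
  next
    fix p assume "p \<in> (\<circ>) t ` ?E"
    then obtain p' where p': "p = t \<circ> p'" "p' permutes {..<m}" "evenperm p'" by auto
    then show "p \<in> ?O" using t(1) permutes_compose[of p' "{..<m}" t] evenperm_comp[OF t(2) perm[of p']] t(3) by simp
  qed
  have "\<rho> \<circ> t = \<rho>" using kl by (auto simp: t_def fun_eq_iff transpose_def)
  then have gt: "g (t \<circ> p) = \<ominus> g p" if p: "p permutes {..<m}" for p
  proof -
    have "sign (t \<circ> p) = - sign p" using evenperm_comp[OF t(2) perm[OF p]] t(3) by (simp add: sign_def)
    moreover have "\<rho> \<circ> (t \<circ> p) = \<rho> \<circ> p" using \<open>\<rho> \<circ> t = \<rho>\<close> by (simp add: o_assoc)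
    ultimately show ?thesis
      unfolding g_def using r by (simp add: add.int_pow_neg eval_word_closed Pi_iff)
  qed
  have fin: "finite ?E" "finite ?O" by (rule finite_subset[OF _ finite_permutations[of "{..<m}"]]; auto)+
  have "standard_polynomial m \<rho> = (\<Oplus>p\<in>?E \<union> ?O. g p)"
    unfolding standard_polynomial_def g_def by (rule arg_cong[of _ _ "finsum R _"]) auto
  also have "\<dots> = (\<Oplus>p\<in>?E. g p) \<oplus> (\<Oplus>p\<in>?O. g p)"
    by (rule finsum_Un_disjoint) (use fin gc in auto)
  also have "(\<Oplus>p\<in>?O. g p) = (\<Oplus>p\<in>?E. g (t \<circ> p))"
    unfolding img
  proof (rule finsum_reindex)
    show "inj_on ((\<circ>) t) ?E" using tt by (intro inj_on_inverseI[of _ "(\<circ>) t"])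
  qed (use gc in auto)
  also have "(\<Oplus>p\<in>?E. g p) \<oplus> (\<Oplus>p\<in>?E. g (t \<circ> p)) = (\<Oplus>p\<in>?E. g p \<oplus> g (t \<circ> p))"
    by (rule finsum_addf[symmetric]) (use gc in auto)
  also have "\<dots> = \<zero>" by (rule add.finprod_one_eqI) (auto simp: gt gc r_neg)
  finally show ?thesis .
qed

lemma combine_single:
  assumes "length Ks = length Vs" "set Ks \<subseteq> carrier R" "set Vs \<subseteq> carrier R" "k < length Vs"
    and "\<And>i. \<lbrakk>i < length Vs; i \<noteq> k\<rbrakk> \<Longrightarrow> Vs ! i = \<zero>"
  shows "combine Ks Vs = Ks ! k \<otimes> Vs ! k"
  using assms
proof (induction Ks Vs arbitrary: k rule: list_induct2)
  case (Cons a Ks v Vs)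
  show ?case
  proof (cases k)
    case 0
    have "Vs = replicate (length Vs) \<zero>"
      by (rule nth_equalityI) (use Cons.prems(4)[of "Suc i" for i] 0 in auto)
    moreover have "combine Ks (replicate j \<zero>) = \<zero>" if "set Ks \<subseteq> carrier R" for j
      using that by (induction Ks arbitrary: j; case_tac j) auto
    ultimately have "combine Ks Vs = \<zero>" using Cons.prems by (metis set_subset_Cons subset_trans)
    then show ?thesis using 0 Cons.prems by simp
  next
    case (Suc k')
    have "v = \<zero>" using Cons.prems(4)[of 0] Suc by simp
    moreover have "combine Ks Vs = Ks ! k' \<otimes> Vs ! k'"
      by (rule Cons.IH) (use Cons.prems Cons.prems(4)[of "Suc i" for i] Suc in auto)
    moreover have "Ks ! k' \<in> carrier R" "Vs ! k' \<in> carrier R"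
      using Cons.prems Suc Cons.hyps by (auto intro!: subsetD[OF _ nth_mem])
    ultimately show ?thesis using Suc Cons.prems by simp
  qed
qed simp

end

lemma (in division_ring) standard_identity:
  assumes dim: "dimension N C (carrier R)" and r: "\<rho> \<in> UNIV \<rightarrow> carrier R"
  shows "standard_polynomial (Suc N) \<rho> = \<zero>"
proof -
  let ?Us = "map \<rho> [0..<Suc N]"
  have Us: "set ?Us \<subseteq> carrier R" using r by auto
  have "dependent C ?Us"
    using independent_length_le_dimension[OF center_subfield dim _ Us] by auto
  then obtain Ks where Ks: "length Ks = length ?Us" "combine Ks ?Us = \<zero>" "set Ks \<subseteq> C" "set Ks \<noteq> {\<zero>}"
    by (rule dependent_imp_non_trivial_combine[OF center_subfield Us])
  have "\<exists>k<Suc N. Ks ! k \<noteq> \<zero>"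
  proof (rule ccontr)
    assume "\<not> ?thesis"
    then have "set Ks \<subseteq> {\<zero>}" "set Ks \<noteq> {}" using Ks(1) by (auto simp: in_set_conv_nth)
    then show False using Ks(4) subset_singletonD by metis
  qed
  then obtain k where k: "k < Suc N" "Ks ! k \<noteq> \<zero>" by blast
  define L where "L x = standard_polynomial (Suc N) (\<rho>(k := x))" for x
  have Lc: "L x \<in> carrier R" if "x \<in> carrier R" for x
    unfolding L_def using r that by (intro standard_polynomial_closed) (auto simp: Pi_iff)
  have L_mult: "L (z \<otimes> x) = z \<otimes> L x" if "z \<in> C" "x \<in> carrier R" for z x
    unfolding L_def by (rule standard_polynomial_mult[OF r k(1) that])
  have L0: "L \<zero> = \<zero>" using L_mult[of \<zero> \<zero>] Lc[of \<zero>] subringE(2)[OF center_subring] by simp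
  have L_combine: "L (combine Ls Vs) = combine Ls (map L Vs)" if "set Ls \<subseteq> C" "set Vs \<subseteq> carrier R" for Ls Vs
    using that
  proof (induction Ls Vs rule: combine.induct)
    case (1 l Ls v Vs)
    have "combine Ls Vs \<in> carrier R" "l \<otimes> v \<in> carrier R"
      using 1 C_closed by (auto intro!: combine_in_carrier)
    then have "L (combine (l # Ls) (v # Vs)) = L (l \<otimes> v) \<oplus> L (combine Ls Vs)"
      unfolding L_def combine.simps by (intro standard_polynomial_add[OF r k(1)])
    then show ?case using 1 L_mult by simp
  qed (auto simp: L0)
  have "\<zero> = combine Ks (map L ?Us)" using L_combine[OF Ks(3) Us] Ks(2) L0 by simp
  also have "\<dots> = Ks ! k \<otimes> map L ?Us ! k"
  proof (rule combine_single)
    fix i assume "i < length (map L ?Us)" "i \<noteq> k"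
    then show "map L ?Us ! i = \<zero>" unfolding L_def using r k
      by (simp del: upt_Suc) (rule standard_polynomial_alternating[of _ k _ i], auto simp: Pi_iff)
  qed (use Ks k r Lc C_closed in \<open>auto simp: Pi_iff\<close>)
  also have "map L ?Us ! k = standard_polynomial (Suc N) \<rho>" using k by (simp add: L_def del: upt_Suc)
  finally have "Ks ! k \<otimes> standard_polynomial (Suc N) \<rho> = \<zero>" ..
  moreover have "Ks ! k \<in> carrier R" using Ks k C_closed by (metis length_map length_upt minus_nat.diff_0 nth_mem subsetD)
  ultimately show ?thesis using no_zero_div standard_polynomial_closed[OF r] k(2) by blast
qed

lemma alg_hom_standard_polynomial:
  assumes A: "nc_algebra K A" and B: "nc_algebra K B" and h: "h \<in> alg_hom K A B" and r: "\<rho> \<in> UNIV \<rightarrow> carrier A"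
  shows "h (ring.standard_polynomial A m \<rho>) = ring.standard_polynomial B m (h \<circ> \<rho>)"
proof -
  interpret A: nc_algebra K A by fact
  interpret B: nc_algebra K B by fact
  have w: "h (eval_word A \<rho>' w) = eval_word B (h \<circ> \<rho>') w" if "\<rho>' \<in> UNIV \<rightarrow> carrier A" for \<rho>' w
  proof (induction w)
    case Nil
    then show ?case by (simp add: eval_word_def alg_hom_one[OF h])
  next
    case (Cons i w)
    have "h (\<rho>' i \<otimes>\<^bsub>A\<^esub> eval_word A \<rho>' w) = h (\<rho>' i) \<otimes>\<^bsub>B\<^esub> h (eval_word A \<rho>' w)"
      using that by (intro alg_hom_mult[OF h] A.eval_word_closed) auto
    then show ?case using Cons by (simp add: eval_word_def)
  qed
  have "h \<in> hom (add_monoid A) (add_monoid B)"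
    by (intro homI) (simp_all add: alg_hom_closed[OF h] alg_hom_add[OF h])
  from hom_int_pow[OF this _ A.a_group B.a_group]
  have pow: "h ([n] \<cdot>\<^bsub>A\<^esub> x) = [n] \<cdot>\<^bsub>B\<^esub> h x" if "x \<in> carrier A" for n :: int and x
    using that by (simp add: add_pow_def)
  have "h (A.standard_polynomial m \<rho>) = (\<Oplus>\<^bsub>B\<^esub>p\<in>{p. p permutes {..<m}}. h ([sign p] \<cdot>\<^bsub>A\<^esub> eval_word A (\<rho> \<circ> p) [0..<m]))"
    unfolding A.standard_polynomial_def
    by (rule alg_hom_finsum[OF A B h]) (auto simp: finite_permutations intro!: A.standard_term_closed[OF r])
  also have "\<dots> = B.standard_polynomial m (h \<circ> \<rho>)"
    unfolding B.standard_polynomial_def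
  proof (rule B.finsum_cong')
    fix p :: "nat \<Rightarrow> nat"
    have rp: "\<rho> \<circ> p \<in> UNIV \<rightarrow> carrier A" using r by auto
    show "h ([sign p] \<cdot>\<^bsub>A\<^esub> eval_word A (\<rho> \<circ> p) [0..<m]) = [sign p] \<cdot>\<^bsub>B\<^esub> eval_word B (h \<circ> \<rho> \<circ> p) [0..<m]"
      using A.eval_word_closed[OF rp] by (simp add: pow w[OF rp] o_assoc)
  next
    have "h \<circ> \<rho> \<in> UNIV \<rightarrow> carrier B" using r alg_hom_closed[OF h] by (auto simp: Pi_iff)
    then show "(\<lambda>p. [sign p] \<cdot>\<^bsub>B\<^esub> eval_word B (h \<circ> \<rho> \<circ> p) [0..<m]) \<in> {p. p permutes {..<m}} \<rightarrow> carrier B"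
      by (intro Pi_I[of "{p. p permutes {..<m}}"] B.standard_term_closed)
  qed simp
  finally show ?thesis .
qed

text \<open>The standard polynomial in the encoding by coefficients: the word listing the values of
  \<open>p\<close> has coefficient \<open>sign p\<close>. Different permutations give different
  words, all words have length \<open>m\<close>, and the identity permutation has coefficient one,
  so the polynomial is monic.\<close>

lemma (in ring) PI_ringI:
  assumes id: "\<And>\<rho>. \<rho> \<in> UNIV \<rightarrow> carrier R \<Longrightarrow> standard_polynomial m \<rho> = \<zero>"
  shows "PI_ring R"
proof -
  let ?P = "{p. p permutes {..<m}}"
  define c where "c p = map p [0..<m]" for p :: "nat \<Rightarrow> nat"
  have inj: "inj_on c ?P"
  proof (rule inj_onI)
    fix p p' assume p: "p \<in> ?P" "p' \<in> ?P" "c p = c p'"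
    show "p = p'"
    proof
      fix i
      show "p i = p' i"
      proof (cases "i < m")
        case True
        then show ?thesis using p(3) by (auto simp: c_def)
      next
        case False
        then show ?thesis using p(1,2) permutes_not_in[of p "{..<m}" i] permutes_not_in[of p' "{..<m}" i] by simp
      qed
    qed
  qed
  define f where "f w = (if w \<in> c ` ?P then sign (inv_into ?P c w) else 0)" for w
  have f: "f (c p) = sign p" if "p \<in> ?P" for p using that inj by (simp add: f_def)
  have supp: "{w. f w \<noteq> 0} = c ` ?P" by (auto simp: f_def)
  have "f (c id) = 1" using f[of id] by (simp add: permutes_id)
  moreover have "length v \<le> length (c id)" if "f v \<noteq> 0" for v
  proof -
    have "v \<in> c ` ?P" using that supp by blast
    then show ?thesis by (auto simp: c_def)
  qed
  moreover have "(\<Oplus>w\<in>{w. f w \<noteq> 0}. [f w] \<cdot> eval_word R \<rho> w) = \<zero>" if r: "\<rho> \<in> UNIV \<rightarrow> carrier R" for \<rho>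
  proof -
    have "(\<Oplus>w\<in>c ` ?P. [f w] \<cdot> eval_word R \<rho> w) = (\<Oplus>p\<in>?P. [f (c p)] \<cdot> eval_word R \<rho> (c p))"
      by (rule finsum_reindex[OF _ inj]) (use eval_word_closed[OF r] in auto)
    also have "\<dots> = standard_polynomial m \<rho>"
      unfolding standard_polynomial_def
      by (rule finsum_cong') (use f r in \<open>auto simp: c_def eval_word_map intro!: standard_term_closed[OF r]\<close>)
    finally show ?thesis unfolding supp id[OF r] .
  qed
  ultimately show ?thesis unfolding PI_ring_def
    using ring_axioms finite_imageI[OF finite_permutations[of "{..<m}"], of c]
    by (intro conjI exI[of _ f] exI[of _ "c id"]) (auto simp: supp)
qed

section \<open>The PI degree\<close>

context right_ore_domain
begin

abbreviation emb where "emb a \<equiv> frc a \<one>"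

lemma emb_mult: "\<lbrakk>a \<in> carrier A; b \<in> carrier A\<rbrakk> \<Longrightarrow> emb (a \<otimes> b) = emb a \<otimes>\<^bsub>Q\<^esub> emb b"
  using Q_mult[of a \<one> b \<one>] by simp

lemma emb_add: "\<lbrakk>a \<in> carrier A; b \<in> carrier A\<rbrakk> \<Longrightarrow> emb (a \<oplus> b) = emb a \<oplus>\<^bsub>Q\<^esub> emb b"
  by (simp add: Q_add)

lemma emb_hom: "emb \<in> alg_hom K A Q"
  by (rule alg_homI) (simp_all add: emb_mult emb_add Q_one Q_smult)

lemma emb_inj: "inj_on emb (carrier A)"
proof (rule inj_onI)
  fix a b assume ab: "a \<in> carrier A" "b \<in> carrier A" "emb a = emb b"
  have "a \<otimes> \<one> = b \<otimes> \<one>" by (rule frac_eqD[OF ab(3)]) (use ab in auto)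
  then show "a = b" using ab by simp
qed

text \<open>Reduces a statement about all fractions to one about the embedded ring and inverses, so
  that a span closed under products and inverses is everything.\<close>

lemma frac_emb:
  assumes "a \<in> carrier A" "s \<in> nz" shows "frc a s = emb a \<otimes>\<^bsub>Q\<^esub> inv\<^bsub>Q\<^esub> (emb s)"
proof -
  interpret D: division_ring Q by (rule division_ring_Q)
  have c: "emb s \<in> carrier Q" "frc \<one> s \<in> carrier Q" using assms by auto
  have u: "emb s \<in> Units Q" using assms by (intro D.nonzero_unit) (auto simp: frac_zero_iff)
  have "inv\<^bsub>Q\<^esub> (emb s) \<otimes>\<^bsub>Q\<^esub> (emb s \<otimes>\<^bsub>Q\<^esub> frc \<one> s) = frc \<one> s"
    using u c by (simp add: D.m_assoc[symmetric])
  then have "inv\<^bsub>Q\<^esub> (emb s) = frc \<one> s" using Q_inverse[of s \<one>] assms u by simp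
  then show ?thesis using Q_mult[of a \<one> \<one> s] assms by simp
qed

text \<open>For a fraction with denominator \<open>s\<close> the element \<open>x\<close> is
  rewritten as the fraction of \<open>s \<otimes> x\<close> over \<open>s\<close>, after which both
  products are computed without further cofactors.\<close>

lemma emb_center:
  assumes "x \<in> ring_center A" shows "emb x \<in> ring_center Q"
proof -
  have x: "x \<in> carrier A" and xa: "\<And>a. a \<in> carrier A \<Longrightarrow> x \<otimes> a = a \<otimes> x"
    using assms by (auto simp: ring_center_def)
  have "emb x \<otimes>\<^bsub>Q\<^esub> y = y \<otimes>\<^bsub>Q\<^esub> emb x" if y: "y \<in> carrier Q" for y
  proof -
    obtain a s where as: "y = frc a s" "a \<in> carrier A" "s \<in> nz" by (rule Q_E[OF y])
    have s: "s \<in> carrier A" using as by simp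
    have "emb x = frc (s \<otimes> x) s" using frac_scale[of x \<one> s] as(3) x xa[OF s] by simp
    then have "y \<otimes>\<^bsub>Q\<^esub> emb x = frc (x \<otimes> a) s" using Q_mult[of a s x s] as x xa by simp
    moreover have "emb x \<otimes>\<^bsub>Q\<^esub> y = frc (x \<otimes> a) s" using Q_mult[of x \<one> a s] as x by simp
    ultimately show ?thesis by simp
  qed
  then show ?thesis using x by (simp add: ring_center_def)
qed

end

lemma sum_pairs:
  fixes f :: "nat \<Rightarrow> int"
  shows "(\<Sum>t\<in>{1..2 * n}. f t) = (\<Sum>j\<in>{1..n}. f (2 * j - 1) + f (2 * j))"
  by (induction n) (simp_all add: sum.nat_ivl_Suc')

section \<open>The single parameter case at a root of unity\<close>

locale single_weyl_torus = K: field K for K :: "('k, 'm) ring_scheme" +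
  fixes n r :: nat and q :: 'k
  assumes primitive: "primitive_root_of_unity K r q" and q1: "q \<noteq> \<one>\<^bsub>K\<^esub>"
begin

lemma q_unit: "q \<in> carrier K" "q \<noteq> \<zero>\<^bsub>K\<^esub>" and r: "r > 0" and q_r: "q [^]\<^bsub>K\<^esub> r = \<one>\<^bsub>K\<^esub>"
  and q_min: "\<lbrakk>0 < j; j < r\<rbrakk> \<Longrightarrow> q [^]\<^bsub>K\<^esub> j \<noteq> \<one>\<^bsub>K\<^esub>"
proof -
  show "q \<in> carrier K" "r > 0" "q [^]\<^bsub>K\<^esub> r = \<one>\<^bsub>K\<^esub>" "\<lbrakk>0 < j; j < r\<rbrakk> \<Longrightarrow> q [^]\<^bsub>K\<^esub> j \<noteq> \<one>\<^bsub>K\<^esub>"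
    using primitive unfolding primitive_root_of_unity_def by auto
  then show "q \<noteq> \<zero>\<^bsub>K\<^esub>" by (auto simp: K.nat_pow_zero)
qed

sublocale weyl_torus K n "\<lambda>_. q" "\<lambda>_ _. \<one>\<^bsub>K\<^esub>"
  by unfold_locales (use q_unit q1 in \<open>auto simp: mult_antisymmetric_def\<close>)

sublocale D: division_ring "ring_of_fractions T"
  by (rule T.division_ring_Q)

lemma unit_pow_dvd: "int r dvd z \<Longrightarrow> unit_pow K q z = \<one>\<^bsub>K\<^esub>"
proof -
  assume "int r dvd z"
  then obtain w where "z = int r * w" by (rule dvdE)
  moreover have "unit_pow K q (int r) = \<one>\<^bsub>K\<^esub>"
    using q_unit q_r by (simp add: int_pow_int K.units_of_pow K.field_Units)
  ultimately show ?thesis by (simp add: K.unit_pow_mult q_unit)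
qed

text \<open>Division with remainder: a power of \<open>q\<close> equal to one has a remainder
  exponent below \<open>r\<close> with the same property, which minimality forces to be
  zero.\<close>

lemma unit_pow_eq_iff: "unit_pow K q y = unit_pow K q z \<longleftrightarrow> int r dvd y - z"
proof -
  have one: "unit_pow K q z = \<one>\<^bsub>K\<^esub> \<Longrightarrow> int r dvd z" for z
  proof (rule ccontr)
    assume z: "unit_pow K q z = \<one>\<^bsub>K\<^esub>" "\<not> int r dvd z"
    define m where "m = nat (z mod int r)"
    have "0 \<le> z mod int r" "z mod int r < int r" "z mod int r \<noteq> 0"
      using r z(2) by (simp_all add: dvd_eq_mod_eq_0)
    then have m: "int m = z mod int r" "0 < m" "m < r" unfolding m_def by linarith+
    have "unit_pow K q z = unit_pow K q (int r * (z div int r)) \<otimes>\<^bsub>K\<^esub> unit_pow K q (int m)"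
      unfolding K.unit_pow_add[OF q_unit, symmetric] m(1) by simp
    also have "\<dots> = q [^]\<^bsub>K\<^esub> m"
      using q_unit by (simp add: unit_pow_dvd int_pow_int K.units_of_pow K.field_Units)
    finally show False using z(1) q_min[OF m(2,3)] by simp
  qed
  have e: "unit_pow K q y = unit_pow K q (y - z) \<otimes>\<^bsub>K\<^esub> unit_pow K q z"
    unfolding K.unit_pow_add[OF q_unit, symmetric] by simp
  have c: "unit_pow K q (y - z) \<in> carrier K" "unit_pow K q z \<in> carrier K" "unit_pow K q z \<noteq> \<zero>\<^bsub>K\<^esub>"
    using K.unit_pow_closed[OF q_unit] by auto
  show ?thesis
  proof
    assume "unit_pow K q y = unit_pow K q z"
    then have "unit_pow K q (y - z) \<otimes>\<^bsub>K\<^esub> unit_pow K q z = \<one>\<^bsub>K\<^esub> \<otimes>\<^bsub>K\<^esub> unit_pow K q z" using e c by simp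
    then have "unit_pow K q (y - z) = \<one>\<^bsub>K\<^esub>" using c K.m_rcancel by blast
    then show "int r dvd y - z" by (rule one)
  next
    assume "int r dvd y - z"
    then show "unit_pow K q y = unit_pow K q z" using e c by (simp add: unit_pow_dvd)
  qed
qed

text \<open>The matrix of exponents to base \<open>q\<close>. It turns the commutation scalars into
  integer linear algebra modulo \<open>r\<close>.\<close>

definition log_matrix :: "nat \<Rightarrow> nat \<Rightarrow> int"
  where "log_matrix s t = (let i = (s + 1) div 2; j = (t + 1) div 2 in
    if odd s then (if even t \<and> i \<le> j then - 1 else 0)
    else if odd t then (if j \<le> i then 1 else 0)
    else if j < i then - 1 else if i < j then 1 else 0)"

lemma weyl_matrix_log: "weyl_matrix K (\<lambda>_. q) (\<lambda>_ _. \<one>\<^bsub>K\<^esub>) s t = unit_pow K q (log_matrix s t)"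
proof -
  have u: "q \<in> Units K" using q_unit by (simp add: K.field_Units)
  then show ?thesis
    by (auto simp: weyl_matrix_def weyl_block_def log_matrix_def Let_def K.unit_pow_minus K.unit_pow_1 q_unit units_of_one)
qed

text \<open>The hypothesis is phrased to cover divisibility of all entries in either argument; in
  each case every factor is a power of \<open>q\<close> with an exponent divisible by
  \<open>r\<close>.\<close>

lemma cc_dvd:
  assumes "\<And>i. int r dvd Poly_Mapping.lookup a i \<or> (\<forall>j. int r dvd Poly_Mapping.lookup b j)"
  shows "cc a b = \<one>\<^bsub>K\<^esub>"
  unfolding torus_cocycle_def
proof (rule K.finprod_one_eqI)
  fix p assume "p \<in> pairs"
  then obtain i j where p: "p = (i, j)" by blast
  have "int r dvd Poly_Mapping.lookup a i * Poly_Mapping.lookup b j" using assms[of i] by auto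
  then show "(case p of (i, j) \<Rightarrow> unit_pow K (weyl_matrix K (\<lambda>_. q) (\<lambda>_ _. \<one>\<^bsub>K\<^esub>) i j)
      (Poly_Mapping.lookup a i * Poly_Mapping.lookup b j)) = \<one>\<^bsub>K\<^esub>"
    by (simp add: p weyl_matrix_log q_unit unit_pow_dvd flip: K.unit_pow_mult)
qed

lemma central_monomial:
  assumes b: "b \<in> exponents (2 * n)" "\<And>i. int r dvd Poly_Mapping.lookup b i" and s: "s \<in> carrier K"
  shows "kmono K s b \<in> ring_center T"
proof -
  have c: "kmono K s b \<in> carrier T" using b s by (simp add: mono_closed)
  have "kmono K s b \<otimes>\<^bsub>T\<^esub> f = f \<otimes>\<^bsub>T\<^esub> kmono K s b" if "f \<in> carrier T" for f
    using that
  proof (induction rule: carrier_induct)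
    case zero
    then show ?case using c by simp
  next
    case (add g t a)
    have "kmono K s b \<otimes>\<^bsub>T\<^esub> kmono K t a = kmono K t a \<otimes>\<^bsub>T\<^esub> kmono K s b"
      using add b s by (simp add: mono_mult cc_dvd K.m_comm add.commute)
    then show ?case using add c by (simp add: mono_closed l_distr r_distr)
  qed
  then show ?thesis using c by (simp add: ring_center_def)
qed

abbreviation box where "box \<equiv> exponent_box (2 * n) 0 (int r)"

lemma box_reduce:
  assumes a: "a \<in> exponents (2 * n)"
  obtains a' b where "a' \<in> box" "b \<in> exponents (2 * n)" "\<And>i. int r dvd Poly_Mapping.lookup b i" "a = b + a'"
proof -
  define a' where "a' = Poly_Mapping.map (\<lambda>z. z mod int r) a"
  have l: "Poly_Mapping.lookup a' i = Poly_Mapping.lookup a i mod int r" for i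
    by (simp add: a'_def map.rep_eq when_def)
  have "a' \<in> box" using a r by (simp add: exponent_box_def exponents_iff l)
  moreover have "a - a' \<in> exponents (2 * n)" using a by (simp add: exponents_iff l lookup_minus)
  moreover have "int r dvd Poly_Mapping.lookup (a - a') i" for i by (simp add: l lookup_minus)
  ultimately show ?thesis by (rule that) simp
qed

text \<open>The logarithm to base \<open>q\<close> of the eigenvalue of \<open>Z s\<close> on the
  monomial with exponent \<open>a\<close>; it is additive in \<open>a\<close>.\<close>

definition weight :: "nat \<Rightarrow> (nat \<Rightarrow>\<^sub>0 int) \<Rightarrow> int"
  where "weight s a = (\<Sum>t\<in>{1..2 * n}. log_matrix s t * Poly_Mapping.lookup a t)"

text \<open>Eigenvalues multiply when monomials do and are inverted with them, so the claim spreads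
  from the generators, where it is the matrix entry, to the whole exponent group.\<close>

lemma qc_weight:
  assumes s: "s \<in> {1..2 * n}" and a: "a \<in> exponents (2 * n)"
  shows "qc (unit_pow K q (weight s a)) (Z s) (zmon a)"
proof -
  have "a \<in> exponents (2 * n) \<and> qc (unit_pow K q (weight s a)) (Z s) (zmon a)"
    using a
  proof (rule exponents_generated)
    have "weight s 0 = 0" by (simp add: weight_def)
    then have "unit_pow K q (weight s 0) = \<one>\<^bsub>K\<^esub>" by (simp only: K.unit_pow_0)
    then show "0 \<in> exponents (2 * n) \<and> qc (unit_pow K q (weight s 0)) (Z s) (zmon 0)"
      using qc_one(1)[OF Z_closed[OF s]] H_zero by (simp add: T_one)
  next
    fix a b
    assume a: "a \<in> exponents (2 * n) \<and> qc (unit_pow K q (weight s a)) (Z s) (zmon a)"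
      and b: "b \<in> exponents (2 * n) \<and> qc (unit_pow K q (weight s b)) (Z s) (zmon b)"
    have "weight s (a + b) = weight s a + weight s b"
      by (simp add: weight_def lookup_add distrib_left sum.distrib)
    then show "a + b \<in> exponents (2 * n) \<and> qc (unit_pow K q (weight s (a + b))) (Z s) (zmon (a + b))"
      using a b qc_smult[OF qc_mult_right, of "unit_pow K q (weight s a)" "Z s" "zmon a" "unit_pow K q (weight s b)" "zmon b" "inv\<^bsub>K\<^esub> (cc a b)"]
      by (simp add: H_add zmon_add K.unit_pow_add q_unit K.field_Units)
  next
    fix a
    assume a: "a \<in> exponents (2 * n) \<and> qc (unit_pow K q (weight s a)) (Z s) (zmon a)"
    have u: "unit_pow K q (weight s a) \<noteq> \<zero>\<^bsub>K\<^esub>" using K.unit_pow_closed[OF q_unit] by simp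
    have "cc a (- a) \<in> Units K" by (simp add: K.field_Units)
    then have cu: "cc a (- a) \<otimes>\<^bsub>K\<^esub> inv\<^bsub>K\<^esub> (cc a (- a)) = \<one>\<^bsub>K\<^esub>" "inv\<^bsub>K\<^esub> (cc a (- a)) \<in> carrier K" by simp_all
    have m: "- a \<in> exponents (2 * n)" using a H_minus by blast
    have zu: "zmon a \<in> Units T" using a zmon_Units by blast
    have zc: "zmon a \<in> carrier T" "zmon (- a) \<in> carrier T" using a m by (simp_all add: mono_closed)
    have "zmon a \<otimes>\<^bsub>T\<^esub> zmon (- a) = cc a (- a) \<odot>\<^bsub>T\<^esub> \<one>\<^bsub>T\<^esub>" using a m by (simp add: zmon_mult T_one)
    then have "inv\<^bsub>T\<^esub> (zmon a) \<otimes>\<^bsub>T\<^esub> (zmon a \<otimes>\<^bsub>T\<^esub> zmon (- a)) = cc a (- a) \<odot>\<^bsub>T\<^esub> inv\<^bsub>T\<^esub> (zmon a)"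
      using zu by (simp add: smult_mult_right)
    then have e: "zmon (- a) = cc a (- a) \<odot>\<^bsub>T\<^esub> inv\<^bsub>T\<^esub> (zmon a)" using zu zc by (simp add: m_assoc[symmetric])
    have "weight s (- a) = - weight s a" by (simp add: weight_def sum_negf)
    then show "- a \<in> exponents (2 * n) \<and> qc (unit_pow K q (weight s (- a))) (Z s) (zmon (- a))"
      unfolding e using m a qc_smult[OF qc_inv_right[OF _ u zu], of "Z s" "cc a (- a)"]
      by (simp add: K.unit_pow_minus q_unit)
  next
    fix t assume t: "t \<in> {1..2 * n}"
    have "weight s (ee t) = log_matrix s t"
      using t by (simp add: weight_def lookup_single when_def if_distrib[of "times _"] cong: if_cong)
    then show "ee t \<in> exponents (2 * n) \<and> qc (unit_pow K q (weight s (ee t))) (Z s) (Z t)"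
      using Z_qc[OF s t refl] ee_in[OF t] by (simp add: weyl_matrix_log)
  qed
  then show ?thesis by blast
qed

text \<open>The differences of consecutive weights for odd \<open>s\<close> give the even coordinates, and then the weights
  for even \<open>s\<close> give the odd ones.\<close>

lemma weights_separate:
  assumes ab: "a \<in> box" "b \<in> box" and w: "\<And>s. s \<in> {1..2 * n} \<Longrightarrow> int r dvd weight s a - weight s b"
  shows "a = b"
proof -
  define d where "d t = Poly_Mapping.lookup a t - Poly_Mapping.lookup b t" for t
  have F: "weight s a - weight s b = (\<Sum>j\<in>{1..n}. log_matrix s (2 * j - 1) * d (2 * j - 1) + log_matrix s (2 * j) * d (2 * j))" for s
    unfolding weight_def d_def sum_pairs sum_subtractf[symmetric] by (rule sum.cong) (simp_all add: algebra_simps)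
  define G where "G i = (\<Sum>j\<in>{1..n}. if i \<le> j then - d (2 * j) else 0)" for i
  have G: "int r dvd G i" if "i \<ge> 1" for i
  proof (cases "i \<le> n")
    case True
    have "weight (2 * i - 1) a - weight (2 * i - 1) b = G i"
      unfolding F G_def by (rule sum.cong) (use that True in \<open>auto simp: log_matrix_def\<close>)
    moreover have "2 * i - 1 \<in> {1..2 * n}" using that True by auto
    ultimately show ?thesis using w[of "2 * i - 1"] by simp
  next
    case False
    then show ?thesis by (simp add: G_def)
  qed
  have even: "int r dvd d (2 * i)" if i: "i \<in> {1..n}" for i
  proof -
    have "G i - G (i + 1) = (\<Sum>j\<in>{1..n}. if j = i then - d (2 * j) else 0)"
      unfolding G_def sum_subtractf[symmetric] by (rule sum.cong) auto
    also have "\<dots> = - d (2 * i)" using i by simp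
    finally show ?thesis using dvd_diff[OF G[of i] G[of "i + 1"]] i by simp
  qed
  \<comment> \<open>The contribution of the odd coordinates to the weight for \<open>2 * i\<close>;
    the contribution of the even ones is already known to be divisible by \<open>r\<close>.\<close>
  define H where "H i = (\<Sum>j\<in>{1..n}. if j \<le> i then d (2 * j - 1) else 0)" for i
  have H: "int r dvd H i" if "i \<le> n" for i
  proof (cases "i = 0")
    case False
    have "weight (2 * i) a - weight (2 * i) b = H i + (\<Sum>j\<in>{1..n}. (if j < i then - 1 else if i < j then 1 else 0) * d (2 * j))"
      unfolding F H_def sum.distrib[symmetric] by (rule sum.cong) (use that False in \<open>auto simp: log_matrix_def\<close>)
    moreover have "int r dvd (\<Sum>j\<in>{1..n}. (if j < i then - 1 else if i < j then 1 else 0) * d (2 * j))"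
      by (intro dvd_sum dvd_mult even)
    moreover have "int r dvd weight (2 * i) a - weight (2 * i) b" by (rule w) (use that False in auto)
    ultimately show ?thesis by (simp add: dvd_add_left_iff)
  qed (simp add: H_def)
  have odd: "int r dvd d (2 * i - 1)" if i: "i \<in> {1..n}" for i
  proof -
    have "H i - H (i - 1) = (\<Sum>j\<in>{1..n}. if j = i then d (2 * j - 1) else 0)"
      unfolding H_def sum_subtractf[symmetric] by (rule sum.cong) (use i in auto)
    also have "\<dots> = d (2 * i - 1)" using i by simp
    finally have "H i - H (i - 1) = d (2 * i - 1)" .
    moreover have "int r dvd H i - H (i - 1)" by (intro dvd_diff H) (use i in auto)
    ultimately show ?thesis by simp
  qed
  have "Poly_Mapping.lookup a t = Poly_Mapping.lookup b t" for t
  proof (cases "t \<in> {1..2 * n}")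
    case True
    have "int r dvd d t"
    proof (cases "odd t")
      case True
      then obtain i where "t = 2 * i + 1" by (rule oddE)
      then show ?thesis using odd[of "i + 1"] \<open>t \<in> _\<close> by simp
    next
      case False
      then obtain i where "t = 2 * i" by blast
      then show ?thesis using even[of i] \<open>t \<in> _\<close> by simp
    qed
    \<comment> \<open>Entries of vectors in the box are their own remainders modulo
      \<open>r\<close>, so congruence becomes equality.\<close>
    then have "Poly_Mapping.lookup a t mod int r = Poly_Mapping.lookup b t mod int r"
      unfolding d_def by (simp add: mod_eq_dvd_iff)
    then show ?thesis using ab True by (simp add: exponent_box_def)
  next
    case False
    then show ?thesis using ab by (simp add: exponent_box_def exponents_iff)
  qed
  then show ?thesis by (rule poly_mapping_eqI)
qed

text \<open>The monomials with exponents in the box are independent because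
  \<open>weights_separate\<close> finds, for any two of them, a generator with distinct central
  eigenvalues. They span the embedded torus because every monomial is a central one times one from
  the box. Finite dimension extends this to inverses and hence to all fractions.\<close>

lemma dimension_center: "D.dimension ((r ^ n) ^ 2) (ring_center T.Q) (carrier T.Q)"
proof -
  define e where "e a = T.emb (zmon a)" for a
  obtain Es where Es: "set Es = box" "distinct Es"
    using finite_distinct_list[OF finite_exponent_box[of "2 * n" 0 "int r"]] by blast
  have exp: "a \<in> exponents (2 * n)" if "a \<in> box" for a using that by (simp add: exponent_box_def)
  have zc: "zmon a \<in> carrier T" if "a \<in> exponents (2 * n)" for a using that by (simp add: mono_closed)
  have ec: "e a \<in> carrier T.Q" if "a \<in> box" for a
    unfolding e_def using zc[OF exp[OF that]] by (intro T.frac_in_Q) auto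
  have e_inj: "inj_on e box"
  proof (rule inj_onI)
    fix a b assume ab: "a \<in> box" "b \<in> box" "e a = e b"
    have "zmon a = zmon b" using inj_onD[OF T.emb_inj] ab zc exp unfolding e_def by blast
    then have "zmon a a = zmon b a" by simp
    then show "a = b" by (simp add: kmono_apply split: if_splits)
  qed
  let ?Us = "map e Es"
  have ind: "D.independent D.C ?Us"
  proof (rule D.eigenvectors_independent)
    show "set ?Us \<subseteq> carrier T.Q - {\<zero>\<^bsub>T.Q\<^esub>}"
      using ec Es zc exp zmon_nonzero by (auto simp: e_def T.frac_zero_iff)
    show "distinct ?Us" using Es e_inj by (simp add: distinct_map)
    fix u v assume uv: "u \<in> set ?Us" "v \<in> set ?Us" "u \<noteq> v"
    then obtain a b where ab: "a \<in> box" "b \<in> box" "u = e a" "v = e b" "a \<noteq> b" using Es by auto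
    then obtain s where s: "s \<in> {1..2 * n}" "\<not> int r dvd weight s a - weight s b" using weights_separate by blast
    define k where "k c = unit_pow K q (weight s c)" for c
    have kc: "k c \<in> carrier K" for c unfolding k_def using K.unit_pow_closed[OF q_unit] by blast
    \<comment> \<open>The eigenvalue has to be a function of the basis element, so the exponent is
      recovered through the inverse of \<open>e\<close>; it enters as a scalar multiple of one,
      which is central.\<close>
    define \<chi> where "\<chi> w = T.emb (kmono K (k (inv_into box e w)) 0)" for w
    have \<chi>_e: "\<chi> (e c) = T.emb (kmono K (k c) 0)" if "c \<in> box" for c
      using inv_into_f_f[OF e_inj that] by (simp add: \<chi>_def)
    have cen: "\<chi> (e c) \<in> D.C" if "c \<in> box" for c
      unfolding \<chi>_e[OF that] by (intro T.emb_center central_monomial kc) (auto simp: H_zero)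
    have eig: "T.emb (Z s) \<otimes>\<^bsub>T.Q\<^esub> e c = \<chi> (e c) \<otimes>\<^bsub>T.Q\<^esub> (e c \<otimes>\<^bsub>T.Q\<^esub> T.emb (Z s))" if c: "c \<in> box" for c
    proof -
      have m: "kmono K (k c) 0 \<in> carrier T" using kc H_zero by (simp add: mono_closed)
      have zz: "Z s \<in> carrier T" "zmon c \<in> carrier T" using Z_closed[OF s(1)] zc[OF exp[OF c]] by auto
      have "Z s \<otimes>\<^bsub>T\<^esub> zmon c = k c \<odot>\<^bsub>T\<^esub> (zmon c \<otimes>\<^bsub>T\<^esub> Z s)"
        using qc_weight[OF s(1) exp[OF c]] by (simp add: qc_def k_def)
      also have "\<dots> = kmono K (k c) 0 \<otimes>\<^bsub>T\<^esub> (zmon c \<otimes>\<^bsub>T\<^esub> Z s)"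
      proof -
        have "kmono K (k c) 0 = k c \<odot>\<^bsub>T\<^esub> \<one>\<^bsub>T\<^esub>" using kc[of c] by (simp add: T_one smult_mono)
        then show ?thesis using kc[of c] zz by (simp add: smult_mult_left)
      qed
      finally show ?thesis
        using m zz unfolding e_def[of c] \<chi>_e[OF c, unfolded e_def] by (simp flip: T.emb_mult)
    qed
    have "\<chi> u \<noteq> \<chi> v"
    proof
      assume "\<chi> u = \<chi> v"
      then have "T.emb (kmono K (k a) 0) = T.emb (kmono K (k b) 0)"
        unfolding ab(3,4) \<chi>_e[OF ab(1)] \<chi>_e[OF ab(2)] .
      then have "kmono K (k a) (0 :: nat \<Rightarrow>\<^sub>0 int) = kmono K (k b) 0"
        by (rule inj_onD[OF T.emb_inj]) (use kc H_zero in \<open>simp_all add: mono_closed\<close>)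
      then have "kmono K (k a) 0 (0 :: nat \<Rightarrow>\<^sub>0 int) = kmono K (k b) (0 :: nat \<Rightarrow>\<^sub>0 int) 0" by (rule fun_cong)
      then have "k a = k b" by (simp add: kmono_apply)
      then show False using s(2) unit_pow_eq_iff by (simp add: k_def)
    qed
    moreover have "T.emb (Z s) \<in> carrier T.Q" "T.emb (Z s) \<noteq> \<zero>\<^bsub>T.Q\<^esub>"
      using Z_closed[OF s(1)] zmon_nonzero by (auto simp: T.frac_zero_iff)
    ultimately show "\<exists>y \<chi>. y \<in> carrier T.Q \<and> y \<noteq> \<zero>\<^bsub>T.Q\<^esub> \<and>
        (\<forall>w\<in>set ?Us. \<chi> w \<in> D.C \<and> y \<otimes>\<^bsub>T.Q\<^esub> w = \<chi> w \<otimes>\<^bsub>T.Q\<^esub> (w \<otimes>\<^bsub>T.Q\<^esub> y)) \<and> \<chi> u \<noteq> \<chi> v"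
      using cen eig Es by (intro exI[of _ "T.emb (Z s)"] exI[of _ \<chi>]) auto
  qed
  let ?S = "D.Span D.C ?Us"
  note sub = D.span_carrier[OF ind]
  note S = D.Span_subgroup_props[OF D.center_subfield sub] D.Span_smult_closed[OF D.center_subfield sub]
  have embS: "T.emb f \<in> ?S" if "f \<in> carrier T" for f
    using that
  proof (induction rule: carrier_induct)
    case zero
    then show ?case using S by (simp flip: T.Q_zero)
  next
    case (add g s a)
    obtain a' b where ab: "a' \<in> box" "b \<in> exponents (2 * n)" "\<And>i. int r dvd Poly_Mapping.lookup b i" "a = b + a'"
      by (rule box_reduce[OF add(3)]) blast
    have "kmono K s a = kmono K s b \<otimes>\<^bsub>T\<^esub> zmon a'"
      using ab exp[OF ab(1)] add(2) by (simp add: mono_mult cc_dvd)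
    then have "T.emb (kmono K s a) = T.emb (kmono K s b) \<otimes>\<^bsub>T.Q\<^esub> e a'"
      using ab(2) exp[OF ab(1)] add(2) by (simp add: e_def T.emb_mult mono_closed)
    moreover have "T.emb (kmono K s b) \<in> D.C" by (intro T.emb_center central_monomial ab add)
    moreover have "e a' \<in> ?S"
      by (rule subsetD[OF D.Span_base_incl[OF D.center_subfield sub]]) (use ab(1) Es in simp)
    ultimately have "T.emb (kmono K s a) \<in> ?S" using S by simp
    then show ?case using add S by (simp add: T.emb_add mono_closed)
  qed
  have closed: "u \<otimes>\<^bsub>T.Q\<^esub> v \<in> ?S" if uv: "u \<in> set ?Us" "v \<in> set ?Us" for u v
  proof -
    obtain a b where ab: "u = e a" "v = e b" "a \<in> box" "b \<in> box" using uv Es(1) by auto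
    have "u \<otimes>\<^bsub>T.Q\<^esub> v = T.emb (zmon a \<otimes>\<^bsub>T\<^esub> zmon b)"
      unfolding ab(1,2) e_def by (rule T.emb_mult[symmetric]) (use ab zc exp in auto)
    also have "\<dots> \<in> ?S" by (intro embS m_closed zc exp ab)
    finally show ?thesis .
  qed
  have "?S = carrier T.Q"
  proof (intro equalityI subsetI)
    fix x assume "x \<in> ?S" then show "x \<in> carrier T.Q" using S by blast
  next
    fix x assume x: "x \<in> carrier T.Q"
    obtain f g where fg: "x = T.frc f g" "f \<in> carrier T" "g \<in> T.nz" by (rule T.Q_E[OF x])
    have g: "T.emb g \<in> ?S" "T.emb g \<noteq> \<zero>\<^bsub>T.Q\<^esub>" using embS fg(3) by (auto simp: T.frac_zero_iff)
    \<comment> \<open>The span is finite dimensional and closed under products, so it contains the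
      inverses of its nonzero elements.\<close>
    have "inv\<^bsub>T.Q\<^esub> (T.emb g) \<in> ?S"
    proof (rule D.span_inverse[OF ind g])
      show "\<one>\<^bsub>T.Q\<^esub> \<in> ?S" unfolding T.Q_one by (rule embS) simp
      fix u assume "u \<in> set ?Us"
      then show "T.emb g \<otimes>\<^bsub>T.Q\<^esub> u \<in> ?S"
        using D.span_mult[OF ind closed g(1)] D.Span_base_incl[OF D.center_subfield sub] by blast
    qed
    then show "x \<in> ?S"
      unfolding fg(1) T.frac_emb[OF fg(2,3)] by (intro D.span_mult[OF ind closed] embS fg)
  qed
  moreover have "length ?Us = (r ^ n) ^ 2"
    using card_exponent_box[of "2 * n" 0 "int r"] distinct_card[OF Es(2)] Es(1)
    by (simp add: power_mult[symmetric] mult.commute)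
  ultimately show ?thesis using D.dimension_independent[OF ind] by simp
qed

text \<open>The Weyl algebra is a domain, hence prime. The standard identity holds in the fractions
  of the torus and is pulled back along the embedding; the dimension over the centre is carried over
  by the isomorphism of the fraction rings, which matches their centres.\<close>

theorem prime_PI_degree:
  "prime_ring (qweyl_single K n q) \<and> PI_ring (qweyl_single K n q) \<and> PIdeg (qweyl_single K n q) = r ^ n"
proof -
  let ?A = "qweyl_single K n q"
  obtain \<psi> where "localizing_embedding K ?A T \<psi>" using qweyl_localizing unfolding qweyl_single_def by blast
  then interpret A: localizing_embedding K ?A T \<psi> .
  interpret F: division_ring "ring_of_fractions ?A" by (rule A.R.division_ring_Q)
  have "prime_ring ?A"
    unfolding prime_ring_def
  proof (intro conjI ballI impI A.R.ring_axioms A.R.one_not_zero')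
    fix a b assume ab: "a \<in> carrier ?A" "b \<in> carrier ?A" "\<forall>r\<in>carrier ?A. a \<otimes>\<^bsub>?A\<^esub> r \<otimes>\<^bsub>?A\<^esub> b = \<zero>\<^bsub>?A\<^esub>"
    then have "a \<otimes>\<^bsub>?A\<^esub> b = \<zero>\<^bsub>?A\<^esub>" using A.R.r_one[OF ab(1)] A.R.one_closed by metis
    then show "a = \<zero>\<^bsub>?A\<^esub> \<or> b = \<zero>\<^bsub>?A\<^esub>" using A.R.no_zero_div ab by blast
  qed
  moreover have "PI_ring ?A"
  proof (rule A.R.PI_ringI)
    fix \<rho> :: "nat \<Rightarrow> 'k tower" assume r: "\<rho> \<in> UNIV \<rightarrow> carrier ?A"
    let ?h = "\<lambda>a. T.emb (\<psi> a)"
    have h: "?h \<in> alg_hom K ?A T.Q" by (rule alg_hom_compose[OF A.hom T.emb_hom])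
    have "?h (A.R.standard_polynomial (Suc ((r ^ n) ^ 2)) \<rho>) = D.standard_polynomial (Suc ((r ^ n) ^ 2)) (?h \<circ> \<rho>)"
      by (rule alg_hom_standard_polynomial[OF A.R.nc_algebra_axioms T.nc_algebra_Q h r])
    also have "\<dots> = \<zero>\<^bsub>T.Q\<^esub>"
      by (rule D.standard_identity[OF dimension_center]) (use r alg_hom_closed[OF h] in \<open>auto simp: Pi_iff\<close>)
    finally have "\<psi> (A.R.standard_polynomial (Suc ((r ^ n) ^ 2)) \<rho>) = \<zero>\<^bsub>T\<^esub>"
      using A.R.standard_polynomial_closed[OF r] by (simp add: T.frac_zero_iff A.h)
    then show "A.R.standard_polynomial (Suc ((r ^ n) ^ 2)) \<rho> = \<zero>\<^bsub>?A\<^esub>"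
      using A.f_zero A.R.standard_polynomial_closed[OF r] by blast
  qed
  moreover have "PIdeg ?A = r ^ n"
  proof -
    define g where "g = inv_into (carrier A.R.Q) A.frac_map"
    have g: "g \<in> alg_iso K T.Q A.R.Q" unfolding g_def by (rule alg_iso_inv[OF A.frac_map_iso A.R.nc_algebra_Q])
    then have gh: "g \<in> alg_hom K T.Q A.R.Q" and bij: "bij_betw g (carrier T.Q) (carrier A.R.Q)" by (auto simp: alg_iso_iff)
    note im = bij_betw_imp_surj_on[OF bij] and inj = bij_betw_imp_inj_on[OF bij]
    interpret g: ring_hom_ring T.Q A.R.Q g
      by (rule ring_hom_ringI2) (use gh D.ring_axioms F.ring_axioms in \<open>auto simp: alg_hom_def\<close>)
    have "g ` D.C = F.C"
    proof (intro equalityI subsetI)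
      fix y assume "y \<in> g ` D.C"
      then obtain x where x: "y = g x" "x \<in> D.C" by blast
      have "y \<otimes>\<^bsub>A.R.Q\<^esub> z = z \<otimes>\<^bsub>A.R.Q\<^esub> y" if z: "z \<in> carrier A.R.Q" for z
      proof -
        obtain w where w: "w \<in> carrier T.Q" "z = g w" using z im by blast
        show ?thesis
          unfolding x(1) w(2) alg_hom_mult[OF gh D.C_closed[OF x(2)] w(1), symmetric]
            alg_hom_mult[OF gh w(1) D.C_closed[OF x(2)], symmetric] D.C_comm[OF x(2) w(1)] ..
      qed
      then show "y \<in> F.C" using D.C_closed[OF x(2)] x(1) alg_hom_closed[OF gh] by (simp add: ring_center_def)
    next
      fix y assume y: "y \<in> F.C"
      then obtain x where x: "x \<in> carrier T.Q" "y = g x" using F.C_closed im by blast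
      have "x \<otimes>\<^bsub>T.Q\<^esub> z = z \<otimes>\<^bsub>T.Q\<^esub> x" if z: "z \<in> carrier T.Q" for z
      proof (rule inj_onD[OF inj])
        show "g (x \<otimes>\<^bsub>T.Q\<^esub> z) = g (z \<otimes>\<^bsub>T.Q\<^esub> x)"
          unfolding alg_hom_mult[OF gh x(1) z] alg_hom_mult[OF gh z x(1)] x(2)[symmetric]
          by (rule F.C_comm[OF y alg_hom_closed[OF gh z]])
      qed (use x z in auto)
      then show "y \<in> g ` D.C" using x by (auto simp: ring_center_def)
    qed
    moreover have "F.dimension ((r ^ n) ^ 2) (g ` D.C) (g ` carrier T.Q)"
      by (rule g.inj_hom_dimension[OF D.center_subfield F.one_neq_zero inj dimension_center])
    ultimately have dim: "F.dimension ((r ^ n) ^ 2) F.C (carrier A.R.Q)" unfolding im by simp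
    \<comment> \<open>Uniqueness for the \<open>THE\<close> in \<open>PIdeg\<close>: the dimension
      is unique, and a natural number is determined by its square.\<close>
    have "d = r ^ n" if "F.dimension (d ^ 2) F.C (carrier A.R.Q)" for d
      using F.dimension_is_inj[OF F.center_subfield that dim] by (simp add: power2_eq_iff_nonneg)
    then show ?thesis unfolding PIdeg_def Let_def by (intro the_equality dim)
  qed
  ultimately show ?thesis by blast
qed

end

theorem mainTheorem8:
  fixes K :: "('k, 'm) ring_scheme" and n :: nat
  assumes "field K" and "n \<ge> 1"
  shows "(\<forall>q \<gamma>. (\<forall>i\<in>{1..n}. q i \<in> carrier K - {\<zero>\<^bsub>K\<^esub>} \<and> q i \<noteq> \<one>\<^bsub>K\<^esub>) \<longrightarrow>
             mult_antisymmetric K n \<gamma> \<longrightarrow>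
             alg_isomorphic K (ring_of_fractions (qweyl K n q \<gamma>))
                              (ring_of_fractions (qaffine K (2 * n) (weyl_matrix K q \<gamma>)))) \<and>
         (\<forall>q r. q \<noteq> \<one>\<^bsub>K\<^esub> \<longrightarrow> primitive_root_of_unity K r q \<longrightarrow>
             prime_ring (qweyl_single K n q) \<and> PI_ring (qweyl_single K n q) \<and>
             PIdeg (qweyl_single K n q) = r ^ n)"
proof (intro conjI allI impI)
  fix q \<gamma> assume "\<forall>i\<in>{1..n}. q i \<in> carrier K - {\<zero>\<^bsub>K\<^esub>} \<and> q i \<noteq> \<one>\<^bsub>K\<^esub>" "mult_antisymmetric K n \<gamma>"
  then interpret weyl_torus K n q \<gamma>
    by (intro weyl_torus.intro weyl_torus_axioms.intro assms(1)) blast+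
  show "alg_isomorphic K (ring_of_fractions (qweyl K n q \<gamma>))
      (ring_of_fractions (qaffine K (2 * n) (weyl_matrix K q \<gamma>)))"
    by (rule fractions_isomorphic)
next
  fix q r assume "q \<noteq> \<one>\<^bsub>K\<^esub>" "primitive_root_of_unity K r q"
  then interpret single_weyl_torus K n r q
    by (intro single_weyl_torus.intro single_weyl_torus_axioms.intro assms(1))
  show "prime_ring (qweyl_single K n q)" "PI_ring (qweyl_single K n q)" "PIdeg (qweyl_single K n q) = r ^ n"
    using prime_PI_degree by blast+
qed

end
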